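(* Let $L$ be a homogeneous Lévy basis on $\mathcal B_b(\mathbb R^d)$ and let $g\in L^1(\mathbb R^d,ds)\cap\mathcal L_{\Phi_0}$ have non-vanishing Fourier transform. Define $X_u=\int_{\mathbb R^d}g(u-s)L(ds)$, $u\in\mathbb R^d$. Then for every $m\in\{0,1,2,\dots\}$, $\mathcal L(X)\in\mathbb L_m(\mathbb R^{\mathbb R^d})$ if and only if $\mathcal L(L)\in\mathbb L_m(\mathbb R^{\mathcal B_b(\mathbb R^d)})$.
   Context: $\mathcal B_b(\mathbb R^d)$ is the $\delta$-ring of bounded Borel sets. A Lévy basis on it is an independently scattered, a.s. countably additive family $\{L(A)\}$ of ID random variables with $\log\mathbb Ee^{i\theta L(A)}=\int_A\psi(\theta,s)c(ds)$, $\psi(\theta,s)=i\gamma(s)\theta-\frac12b^2(s)\theta^2+\int[e^{i\theta x}-1-i\theta\tau_1(x)]\rho(s,dx)$, $\tau_1(x)=x/(1\vee|x|)$. It is homogeneous if $\gamma,b,\rho$ do not depend on $s$ and $c$ is proportional to Lebesgue measure. $\mathcal L_{\Phi_0}$ is the space of $L$-integrable functions: $\{f:\int\Phi_0(|f(s)|,s)c(ds)<\infty\}$ with $\Phi_0(r,s)=\sup_{|c|\le1}|\gamma cr+\int[\tau_1(xcr)-cr\tau_1(x)]\rho(dx)|+b^2r^2+\int[\mathbf 1_{\{|xr|>1\}}+|xr|^2\mathbf 1_{\{|xr|\le1\}}]\rho(dx)$. Urbanik classes: $\mu\in\mathbb L_0(\mathbb R^k)$ (selfdecomposable) if for each $q>1$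 there is ID $\mu_q$ with $\hat\mu(\theta)=\hat\mu(q^{-1}\theta)\hat\mu_q(\theta)$, and $\mu\in\mathbb L_m$ if also each $\mu_q\in\mathbb L_{m-1}$; the law of a field indexed by $I$ is in $\mathbb L_m(\mathbb R^I)$ iff all its finite-dimensional distributions are in $\mathbb L_m$. *)

theory Defs
  imports "HOL-Probability.Probability"
begin

section \<open>Bounded Borel sets of R^d\<close>

definition bdd_borel :: "'a::euclidean_space set set" where
  "bdd_borel = {A. A \<in> sets borel \<and> bounded A}"

section \<open>Levy-Khintchine ingredients (homogeneous case)\<close>

definition tau1 :: "real \<Rightarrow> real" where
  "tau1 x = x / max 1 \<bar>x\<bar>"

definition levy_measure :: "real measure \<Rightarrow> bool" where
  "levy_measure \<rho> \<longleftrightarrow> sets \<rho> = sets borel \<and> emeasure \<rho> {0} = 0 \<and>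
     (\<integral>\<^sup>+ x. ennreal (min 1 (x\<^sup>2)) \<partial>\<rho>) < \<infinity>"

definition lk_exponent :: "real \<Rightarrow> real \<Rightarrow> real measure \<Rightarrow> real \<Rightarrow> complex" where
  "lk_exponent \<gamma> b \<rho> \<theta> =
     \<i> * complex_of_real (\<gamma> * \<theta>) - complex_of_real (b\<^sup>2 * \<theta>\<^sup>2 / 2) +
     (CLINT x|\<rho>. iexp (\<theta> * x) - 1 - \<i> * complex_of_real (\<theta> * tau1 x))"

section \<open>Homogeneous Levy basis on the bounded Borel sets\<close>

text \<open>c = kappa * Lebesgue measure, kappa > 0.\<close>

definition hom_levy_basis ::
  "'w measure \<Rightarrow> ('a::euclidean_space set \<Rightarrow> 'w \<Rightarrow> real) \<Rightarrow> real \<Rightarrow> real \<Rightarrow> real measure \<Rightarrow> real \<Rightarrow> bool" where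
  "hom_levy_basis M L \<gamma> b \<rho> \<kappa> \<longleftrightarrow>
     prob_space M \<and> levy_measure \<rho> \<and> \<kappa> > 0 \<and>
     (\<forall>A\<in>bdd_borel. L A \<in> borel_measurable M) \<and>
     \<comment> \<open>independently scattered\<close>
     (\<forall>F. finite F \<longrightarrow> F \<subseteq> bdd_borel \<longrightarrow> disjoint F \<longrightarrow>
        prob_space.indep_vars M (\<lambda>_. borel) L F) \<and>
     \<comment> \<open>almost surely countably additive\<close>
     (\<forall>A :: nat \<Rightarrow> 'a set. range A \<subseteq> bdd_borel \<longrightarrow> disjoint_family A \<longrightarrow>
        (\<Union>n. A n) \<in> bdd_borel \<longrightarrow>
        (AE \<omega> in M. (\<lambda>n. L (A n) \<omega>) sums L (\<Union>n. A n) \<omega>)) \<and>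
     \<comment> \<open>law of L(A): log E exp(i theta L(A)) = int_A psi(theta) c(ds)\<close>
     (\<forall>A\<in>bdd_borel. \<forall>\<theta>. char (distr M borel (L A)) \<theta> =
        exp (complex_of_real (\<kappa> * measure lborel A) * lk_exponent \<gamma> b \<rho> \<theta>))"

section \<open>The function Phi_0 and the space L_{Phi_0}\<close>

definition Phi0 :: "real \<Rightarrow> real \<Rightarrow> real measure \<Rightarrow> real \<Rightarrow> ennreal" where
  "Phi0 \<gamma> b \<rho> r =
     (\<Squnion>c\<in>{-1..1::real}. ennreal \<bar>\<gamma> * c * r + (\<integral>x. (tau1 (x * c * r) - c * r * tau1 x) \<partial>\<rho>)\<bar>)
     + ennreal (b\<^sup>2 * r\<^sup>2)
     + (\<integral>\<^sup>+ x. ennreal (indicator {x. \<bar>x * r\<bar> > 1} x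
                      + (x * r)\<^sup>2 * indicator {x. \<bar>x * r\<bar> \<le> 1} x) \<partial>\<rho>)"

definition in_L_Phi0 ::
  "real \<Rightarrow> real \<Rightarrow> real measure \<Rightarrow> real \<Rightarrow> ('a::euclidean_space \<Rightarrow> real) \<Rightarrow> bool" where
  "in_L_Phi0 \<gamma> b \<rho> \<kappa> f \<longleftrightarrow>
     ennreal \<kappa> * (\<integral>\<^sup>+ s. Phi0 \<gamma> b \<rho> \<bar>f s\<bar> \<partial>(lborel :: 'a measure)) < \<infinity>"

section \<open>Fourier transform\<close>

definition fourier_transform :: "('a::euclidean_space \<Rightarrow> real) \<Rightarrow> 'a \<Rightarrow> complex" where
  "fourier_transform g \<xi> = (CLINT s|lborel. complex_of_real (g s) * iexp (- (\<xi> \<bullet> s)))"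

section \<open>Stochastic integral w.r.t. a Levy basis (Rajput--Rosinski)\<close>

definition tendsto_in_prob ::
  "'w measure \<Rightarrow> (nat \<Rightarrow> 'w \<Rightarrow> real) \<Rightarrow> ('w \<Rightarrow> real) \<Rightarrow> bool" where
  "tendsto_in_prob M Y Z \<longleftrightarrow> Z \<in> borel_measurable M \<and>
     (\<forall>\<epsilon>>0. (\<lambda>n. measure M {\<omega>\<in>space M. \<epsilon> < \<bar>Y n \<omega> - Z \<omega>\<bar>}) \<longlonglongrightarrow> 0)"

text \<open>Simple function number n: sum over the finite disjoint family P n of bounded Borel
  sets of a n A * indicator A. Its integral over B is sum of a n A * L(B inter A).\<close>

definition stoch_integral ::
  "'w measure \<Rightarrow> ('a::euclidean_space set \<Rightarrow> 'w \<Rightarrow> real) \<Rightarrow> ('a \<Rightarrow> real) \<Rightarrow> ('w \<Rightarrow> real) \<Rightarrow> bool" where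
  "stoch_integral M L f Y \<longleftrightarrow>
     (\<exists>(P :: nat \<Rightarrow> 'a set set) (a :: nat \<Rightarrow> 'a set \<Rightarrow> real).
        (\<forall>n. finite (P n) \<and> P n \<subseteq> bdd_borel \<and> disjoint (P n)) \<and>
        (AE s in lborel. (\<lambda>n. \<Sum>A\<in>P n. a n A * indicator A s) \<longlonglongrightarrow> f s) \<and>
        (\<forall>B\<in>sets borel. \<exists>Z. tendsto_in_prob M (\<lambda>n \<omega>. \<Sum>A\<in>P n. a n A * L (B \<inter> A) \<omega>) Z) \<and>
        tendsto_in_prob M (\<lambda>n \<omega>. \<Sum>A\<in>P n. a n A * L A \<omega>) Y)"

section \<open>Infinitely divisible laws and Urbanik classes on R^J (J finite)\<close>

definition prob_on :: "'i set \<Rightarrow> ('i \<Rightarrow> real) measure \<Rightarrow> bool" where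
  "prob_on J \<mu> \<longleftrightarrow> prob_space \<mu> \<and> sets \<mu> = sets (Pi\<^sub>M J (\<lambda>_. borel))"

definition charf :: "'i set \<Rightarrow> ('i \<Rightarrow> real) measure \<Rightarrow> ('i \<Rightarrow> real) \<Rightarrow> complex" where
  "charf J \<mu> \<theta> = (CLINT x|\<mu>. iexp (\<Sum>j\<in>J. \<theta> j * x j))"

text \<open>mu is ID iff for each n there is nu with mu = nu^{*n}, i.e. hat mu = (hat nu)^n.\<close>

definition inf_div :: "'i set \<Rightarrow> ('i \<Rightarrow> real) measure \<Rightarrow> bool" where
  "inf_div J \<mu> \<longleftrightarrow> prob_on J \<mu> \<and>
     (\<forall>n::nat. n > 0 \<longrightarrow> (\<exists>\<nu>. prob_on J \<nu> \<and> (\<forall>\<theta>. charf J \<mu> \<theta> = (charf J \<nu> \<theta>) ^ n)))"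

fun urbanik :: "nat \<Rightarrow> 'i set \<Rightarrow> ('i \<Rightarrow> real) measure \<Rightarrow> bool" where
  "urbanik 0 J \<mu> \<longleftrightarrow> prob_on J \<mu> \<and>
     (\<forall>q::real. q > 1 \<longrightarrow> (\<exists>\<mu>q. inf_div J \<mu>q \<and>
        (\<forall>\<theta>. charf J \<mu> \<theta> = charf J \<mu> (\<lambda>j. \<theta> j / q) * charf J \<mu>q \<theta>)))"
| "urbanik (Suc m) J \<mu> \<longleftrightarrow> prob_on J \<mu> \<and>
     (\<forall>q::real. q > 1 \<longrightarrow> (\<exists>\<mu>q. inf_div J \<mu>q \<and> urbanik m J \<mu>q \<and>
        (\<forall>\<theta>. charf J \<mu> \<theta> = charf J \<mu> (\<lambda>j. \<theta> j / q) * charf J \<mu>q \<theta>)))"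

text \<open>Law of a random field (Y_i), i in I, is in L_m(R^I) iff all finite-dimensional
  distributions are in L_m.\<close>

definition fidi :: "'w measure \<Rightarrow> ('i \<Rightarrow> 'w \<Rightarrow> real) \<Rightarrow> 'i set \<Rightarrow> ('i \<Rightarrow> real) measure" where
  "fidi M Y J = distr M (Pi\<^sub>M J (\<lambda>_. borel)) (\<lambda>\<omega>. restrict (\<lambda>i. Y i \<omega>) J)"

definition law_in_urbanik :: "nat \<Rightarrow> 'w measure \<Rightarrow> 'i set \<Rightarrow> ('i \<Rightarrow> 'w \<Rightarrow> real) \<Rightarrow> bool" where
  "law_in_urbanik m M I Y \<longleftrightarrow> (\<forall>J. finite J \<longrightarrow> J \<subseteq> I \<longrightarrow> urbanik m J (fidi M Y J))"

end

(*
  Let psi be the Levy-Khintchine exponent of the basis. The finite-dimensional laws of both L and X have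
  characteristic function exp (kappa * int psi (sum_j theta_j f_j(s)) ds), with f_j = 1_{A_j} for L and
  f_j = g (u_j - .) for X. A law exp Psi belongs to L_m iff the iterated dilation differences
  theta |-> Psi theta - Psi (theta / q) of its exponent are exponents of infinitely divisible laws, and these
  differences commute with the integral over s. Hence both conditions follow from the corresponding condition
  on the one-dimensional exponent psi, and L returns psi by evaluation on a single cube.

  To recover psi from X, let phi be a dilation difference of psi, with a signed jump measure mu1 - mu2. An
  infinitely divisible exponent is conditionally positive definite. Test this on 1 - cos (z X_0) times a
  nonnegative trigonometric polynomial in a linear combination of the X_u, whose kernel sum_u w_u g (u - s)
  is chosen to converge to the constant int g, which is the Fourier transform at 0 and therefore nonzero. In
  the limit the s-variable decouples and (int (1 - cos (z g(-s) x)) ds) (mu1 - mu2)(dx) >= 0 away from 0, so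
  mu1 - mu2 is a nonnegative measure and phi is an infinitely divisible exponent.
*)
theory Submission
  imports Defs
begin

section \<open>Characteristic functions on finite products\<close>

text \<open>The step from X to the exponent shapes the proof. The jump measure of the field is the
  image of ds \<mu>(dx) under (s, x) |-> (g (u - s) x)_u, so s and x are entangled; and \<mu> is
  signed, because a dilation difference of an exponent need not be infinitely divisible a priori.
  The factor 1 - cos (z g(-s) x) is the trace of a second difference of the exponent. It cancels the
  drift, reduces the Gaussian part to a multiple of the value of the test function at 0, and makes
  ds \<mu>(dx) a finite measure, so that bounded convergence applies to all limits of test functions
  and of linear forms. As the Gaussian term sees only the point 0, the resulting inequality between
  integrals passes to sets avoiding 0. What remains is a weight in x, which must be finite and
  positive off 0 before it can be divided out. Infinite divisibility itself is handled through
  \<open>id_exponent\<close>, a class closed under sums, nonnegative multiples and, by the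
  continuity theorem, limits; this is why Levy's theorem on finite products is developed before
  anything else.\<close>

lemma charf_distr:
  assumes [measurable]: "f \<in> measurable M (Pi\<^sub>M J (\<lambda>_. borel))"
  shows "charf J (distr M (Pi\<^sub>M J (\<lambda>_. borel)) f) \<theta> = (CLINT x|M. iexp (\<Sum>j\<in>J. \<theta> j * f x j))"
  unfolding charf_def by (subst integral_distr) auto

lemma prob_on_distr:
  assumes "prob_space M" "f \<in> measurable M (Pi\<^sub>M J (\<lambda>_. borel))"
  shows "prob_on J (distr M (Pi\<^sub>M J (\<lambda>_. borel)) f)"
  using assms by (auto simp: prob_on_def intro: prob_space.prob_space_distr)

lemma prob_on_measurable_cong:
  assumes "prob_on J \<mu>"
  shows "measurable \<mu> N = measurable (Pi\<^sub>M J (\<lambda>_. borel)) N"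
  using assms by (auto simp: prob_on_def intro!: measurable_cong_sets)

lemma measurable_iexp_prob_on:
  assumes "prob_on J \<mu>"
  shows "(\<lambda>x. iexp (\<Sum>j\<in>J. \<theta> j * x j)) \<in> borel_measurable \<mu>"
  unfolding prob_on_measurable_cong[OF assms] by measurable

lemma integrable_iexp_prob_on:
  assumes "prob_on J \<mu>"
  shows "complex_integrable \<mu> (\<lambda>x. iexp (\<Sum>j\<in>J. \<theta> j * x j))"
proof -
  interpret prob_space \<mu> using assms by (simp add: prob_on_def)
  show ?thesis
    by (rule integrable_const_bound[where B=1, OF _ measurable_iexp_prob_on[OF assms]]) simp
qed

lemma charf_zero:
  assumes "prob_on J \<mu>" shows "charf J \<mu> (\<lambda>_. 0) = 1"
proof -
  interpret prob_space \<mu> using assms by (simp add: prob_on_def)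
  show ?thesis by (simp add: charf_def prob_space)
qed

lemma norm_charf_le_1:
  assumes "prob_on J \<mu>" shows "norm (charf J \<mu> \<theta>) \<le> 1"
proof -
  interpret prob_space \<mu> using assms by (simp add: prob_on_def)
  have "norm (charf J \<mu> \<theta>) \<le> (LINT x|\<mu>. norm (iexp (\<Sum>j\<in>J. \<theta> j * x j)))"
    unfolding charf_def by (rule integral_norm_bound)
  also have "\<dots> = 1" by (simp add: prob_space)
  finally show ?thesis .
qed

text \<open>Dominated convergence with bound 1. Rays are where continuity is used: to follow a root
  of unity from 0, and to get measurability on a coordinate axis.\<close>

lemma charf_continuous_along:
  assumes \<mu>: "prob_on J \<mu>"
  shows "continuous_on UNIV (\<lambda>s::real. charf J \<mu> (\<lambda>j. s * \<theta> j))"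
  unfolding continuous_on_sequentially
proof (intro allI ballI impI)
  interpret prob_space \<mu> using assms by (simp add: prob_on_def)
  fix x :: "nat \<Rightarrow> real" and a assume "(\<forall>n. x n \<in> UNIV) \<and> x \<longlonglongrightarrow> a"
  then have x: "x \<longlonglongrightarrow> a" by simp
  show "((\<lambda>s. charf J \<mu> (\<lambda>j. s * \<theta> j)) \<circ> x) \<longlonglongrightarrow> charf J \<mu> (\<lambda>j. a * \<theta> j)"
    unfolding charf_def comp_def
  proof (rule integral_dominated_convergence[where w="\<lambda>_. 1"])
    show "AE y in \<mu>. (\<lambda>i. iexp (\<Sum>j\<in>J. x i * \<theta> j * y j)) \<longlonglongrightarrow> iexp (\<Sum>j\<in>J. a * \<theta> j * y j)"
      by (intro AE_I2 tendsto_intros x)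
  qed (auto intro!: measurable_iexp_prob_on[OF \<mu>] simp del: of_real_sum of_real_mult)
qed

text \<open>The law of the sum of two independent vectors; Fubini splits the exponential.\<close>

lemma charf_convolution:
  assumes \<mu>: "prob_on J \<mu>" and \<nu>: "prob_on J \<nu>"
  shows "\<exists>\<pi>. prob_on J \<pi> \<and> (\<forall>\<theta>. charf J \<pi> \<theta> = charf J \<mu> \<theta> * charf J \<nu> \<theta>)"
proof -
  interpret A: prob_space \<mu> using \<mu> by (simp add: prob_on_def)
  interpret B: prob_space \<nu> using \<nu> by (simp add: prob_on_def)
  interpret pair_prob_space \<mu> \<nu> ..
  have s1[measurable_cong]: "sets \<mu> = sets (Pi\<^sub>M J (\<lambda>_. borel))" using \<mu> by (simp add: prob_on_def)
  have s2[measurable_cong]: "sets \<nu> = sets (Pi\<^sub>M J (\<lambda>_. borel))" using \<nu> by (simp add: prob_on_def)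
  let ?f = "\<lambda>(x, y). \<lambda>j\<in>J. x j + y j :: real"
  have f[measurable]: "?f \<in> measurable (\<mu> \<Otimes>\<^sub>M \<nu>) (Pi\<^sub>M J (\<lambda>_. borel))" by measurable
  let ?\<pi> = "distr (\<mu> \<Otimes>\<^sub>M \<nu>) (Pi\<^sub>M J (\<lambda>_. borel)) ?f"
  have "charf J ?\<pi> \<theta> = charf J \<mu> \<theta> * charf J \<nu> \<theta>" for \<theta>
  proof -
    have "charf J ?\<pi> \<theta> = (CLINT p|(\<mu> \<Otimes>\<^sub>M \<nu>). iexp (\<Sum>j\<in>J. \<theta> j * ?f p j))"
      by (rule charf_distr[OF f])
    also have "\<dots> = (CLINT p|(\<mu> \<Otimes>\<^sub>M \<nu>). iexp (\<Sum>j\<in>J. \<theta> j * fst p j) * iexp (\<Sum>j\<in>J. \<theta> j * snd p j))"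
      by (intro Bochner_Integration.integral_cong)
         (auto simp: split_beta sum.distrib[symmetric] exp_add[symmetric] distrib_left[symmetric]
            simp flip: of_real_add intro!: sum.cong)
    also have "\<dots> = (CLINT x|\<mu>. CLINT y|\<nu>. iexp (\<Sum>j\<in>J. \<theta> j * x j) * iexp (\<Sum>j\<in>J. \<theta> j * y j))"
    proof (subst integral_fst'[symmetric])
      show "complex_integrable (\<mu> \<Otimes>\<^sub>M \<nu>) (\<lambda>p. iexp (\<Sum>j\<in>J. \<theta> j * fst p j) * iexp (\<Sum>j\<in>J. \<theta> j * snd p j))"
        by (rule integrable_const_bound[where B=1]) (auto simp: norm_mult)
    qed simp
    also have "\<dots> = charf J \<mu> \<theta> * charf J \<nu> \<theta>"
      by (simp add: charf_def)
    finally show ?thesis .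
  qed
  moreover have "prob_on J ?\<pi>"
    by (rule prob_on_distr) (auto intro: prob_space_axioms)
  ultimately show ?thesis by blast
qed

text \<open>Since exp (1/2) \<ge> 3/2. This is the least value of the tail functional 1 - exp (- y^2
  / 2) on |y| \<ge> 1, up to rounding down to 1/3.\<close>

lemma exp_gaussian_le: "1 / 3 \<le> 1 - exp (- (1/2::real))"
proof -
  have "1 + 1/2 \<le> exp (1/2::real)" by (rule exp_ge_add_one_self)
  then show ?thesis by (simp add: exp_minus field_simps)
qed

text \<open>Fubini against a standard normal \<xi>, whose transform is known. It plays the role of
  the usual averaging over an interval and gives an exact identity.\<close>

lemma charf_axis_gaussian:
  assumes \<mu>: "prob_on J \<mu>" and J: "finite J" "j \<in> J"
  shows "(LINT x|\<mu>. 1 - exp (- (\<delta> * x j)\<^sup>2 / 2)) =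
    (LINT \<xi>|std_normal_distribution. 1 - Re (charf J \<mu> (\<lambda>i. if i = j then \<delta> * \<xi> else 0)))"
proof -
  interpret A: prob_space \<mu> using \<mu> by (simp add: prob_on_def)
  interpret B: real_distribution std_normal_distribution by (rule real_dist_normal_dist)
  interpret pair_prob_space \<mu> std_normal_distribution ..
  have s1[measurable_cong]: "sets \<mu> = sets (Pi\<^sub>M J (\<lambda>_. borel))" using \<mu> by (simp add: prob_on_def)
  note [measurable] = J
  have eq: "(\<Sum>i\<in>J. (if i = j then c else 0) * x i) = c * x j" for c and x :: "'a \<Rightarrow> real"
    using J by (simp add: if_distrib[of "\<lambda>a. a * _"] sum.delta cong: if_cong)
  have p1: "B.prob UNIV = 1" using B.prob_space by simp
  have e0: "(CLINT x|\<mu>. CLINT \<xi>|std_normal_distribution. 1 - iexp (\<delta> * \<xi> * x j)) =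
     (CLINT \<xi>|std_normal_distribution. CLINT x|\<mu>. 1 - iexp (\<delta> * \<xi> * x j))"
  proof (rule Fubini_integral[symmetric])
    show "complex_integrable (\<mu> \<Otimes>\<^sub>M std_normal_distribution) (\<lambda>(x, y). 1 - iexp (\<delta> * y * x j))"
      by (rule integrable_const_bound[where B=2])
         (auto intro!: order_trans[OF norm_triangle_ineq4] AE_I2)
  qed
  have e1: "(CLINT \<xi>|std_normal_distribution. 1 - iexp (\<delta> * \<xi> * x j)) = of_real (1 - exp (- (\<delta> * x j)\<^sup>2 / 2))" for x
  proof -
    have "(CLINT \<xi>|std_normal_distribution. 1 - iexp (\<delta> * \<xi> * x j)) =
       1 - char std_normal_distribution (\<delta> * x j)"
      unfolding char_def
      by (subst Bochner_Integration.integral_diff)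
         (auto intro!: B.integrable_const_bound[where B=1] simp: p1 ac_simps)
    then show ?thesis by (simp add: char_std_normal_distribution)
  qed
  have e2: "(CLINT x|\<mu>. 1 - iexp (\<delta> * \<xi> * x j)) = 1 - charf J \<mu> (\<lambda>i. if i = j then \<delta> * \<xi> else 0)" for \<xi>
    unfolding charf_def eq
    by (subst Bochner_Integration.integral_diff)
       (auto intro!: A.integrable_const_bound[where B=1] simp: A.prob_space)
  have *: "of_real (LINT x|\<mu>. 1 - exp (- (\<delta> * x j)\<^sup>2 / 2)) =
    (CLINT \<xi>|std_normal_distribution. 1 - charf J \<mu> (\<lambda>i. if i = j then \<delta> * \<xi> else 0))"
    using e0 unfolding e1 e2 integral_complex_of_real .
  \<comment> \<open>Measurability in \<xi> is inherited from continuity along the j-th axis, seen as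
    a ray.\<close>
  have "continuous_on UNIV (\<lambda>s. charf J \<mu> (\<lambda>i. s * (if i = j then \<delta> else 0)))"
    by (rule charf_continuous_along[OF \<mu>])
  then have "(\<lambda>s. charf J \<mu> (\<lambda>i. s * (if i = j then \<delta> else 0))) \<in> borel_measurable borel"
    by (rule borel_measurable_continuous_onI)
  also have "(\<lambda>s. charf J \<mu> (\<lambda>i. s * (if i = j then \<delta> else 0))) = (\<lambda>s. charf J \<mu> (\<lambda>i. if i = j then \<delta> * s else 0))"
    by (intro ext arg_cong2[where f="charf J"] refl) auto
  finally have [measurable]: "(\<lambda>s. charf J \<mu> (\<lambda>i. if i = j then \<delta> * s else 0)) \<in> borel_measurable borel" .
  have "Re (CLINT \<xi>|std_normal_distribution. 1 - charf J \<mu> (\<lambda>i. if i = j then \<delta> * \<xi> else 0)) =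
    (LINT \<xi>|std_normal_distribution. Re (1 - charf J \<mu> (\<lambda>i. if i = j then \<delta> * \<xi> else 0)))"
  proof (rule integral_Re[symmetric], rule B.integrable_const_bound[where B=2])
    show "AE \<xi> in std_normal_distribution. cmod (1 - charf J \<mu> (\<lambda>i. if i = j then \<delta> * \<xi> else 0)) \<le> 2"
    proof (rule AE_I2)
      fix \<xi>
      have "norm (charf J \<mu> (\<lambda>i. if i = j then \<delta> * \<xi> else 0)) \<le> 1" by (rule norm_charf_le_1[OF \<mu>])
      then show "cmod (1 - charf J \<mu> (\<lambda>i. if i = j then \<delta> * \<xi> else 0)) \<le> 2"
        by (intro order_trans[OF norm_triangle_ineq4]) auto
    qed
  qed measurable
  with arg_cong[OF *, of Re] show ?thesis by simp
qed

text \<open>The mass of |x j| \<ge> 1 / \<delta> is at most three times the Gaussian average of 1 -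
  Re of the characteristic function. For fixed \<delta> this average converges in n, and its limit
  is small for small \<delta> by continuity of \<phi> at 0.\<close>

lemma charf_limit_tight:
  assumes \<mu>: "\<And>n. prob_on J (\<mu> n)" and J: "finite J" "j \<in> J"
    and lim: "\<And>\<theta>. (\<lambda>n. charf J (\<mu> n) \<theta>) \<longlonglongrightarrow> \<phi> \<theta>"
    and cont: "isCont (\<lambda>s::real. \<phi> (\<lambda>i. if i = j then s else 0)) 0"
    and "0 < \<epsilon>"
  shows "\<exists>K>0. \<forall>\<^sub>F n in sequentially. measure (\<mu> n) {x\<in>space (\<mu> n). K \<le> \<bar>x j\<bar>} \<le> \<epsilon>"
proof -
  interpret B: real_distribution std_normal_distribution by (rule real_dist_normal_dist)
  define c where "c n \<delta> \<xi> = charf J (\<mu> n) (\<lambda>i. if i = j then \<delta> * \<xi> else 0)" for n and \<delta> \<xi> :: real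
  define d where "d \<delta> \<xi> = \<phi> (\<lambda>i. if i = j then \<delta> * \<xi> else 0)" for \<delta> \<xi> :: real
  have cm[measurable]: "c n \<delta> \<in> borel_measurable borel" for n \<delta>
  proof -
    have "continuous_on UNIV (\<lambda>s. charf J (\<mu> n) (\<lambda>i. s * (if i = j then \<delta> else 0)))"
      by (rule charf_continuous_along[OF \<mu>])
    then have "(\<lambda>s. charf J (\<mu> n) (\<lambda>i. s * (if i = j then \<delta> else 0))) \<in> borel_measurable borel"
      by (rule borel_measurable_continuous_onI)
    also have "(\<lambda>s. charf J (\<mu> n) (\<lambda>i. s * (if i = j then \<delta> else 0))) = c n \<delta>"
      unfolding c_def by (intro ext arg_cong2[where f="charf J"] refl) auto
    finally show ?thesis .
  qed
  have cd: "(\<lambda>n. c n \<delta> \<xi>) \<longlonglongrightarrow> d \<delta> \<xi>" for \<delta> \<xi> unfolding c_def d_def by (rule lim)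
  have dm[measurable]: "d \<delta> \<in> borel_measurable borel" for \<delta>
    by (rule borel_measurable_LIMSEQ_metric[OF _ cd]) measurable
  have c1: "norm (c n \<delta> \<xi>) \<le> 1" for n \<delta> \<xi> unfolding c_def by (rule norm_charf_le_1[OF \<mu>])
  have d1: "norm (d \<delta> \<xi>) \<le> 1" for \<delta> \<xi>
    by (rule Lim_bounded[OF tendsto_norm[OF cd]]) (auto intro: c1)
  have "\<phi> (\<lambda>_. 0) = 1"
    using lim[of "\<lambda>_. 0"] by (simp add: charf_zero[OF \<mu>] LIMSEQ_const_iff)
  then have \<phi>0: "\<phi> (\<lambda>i. if i = j then 0 else 0) = 1" by simp
  have lim1: "(\<lambda>n. LINT \<xi>|std_normal_distribution. 1 - Re (c n \<delta> \<xi>)) \<longlonglongrightarrow>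
     (LINT \<xi>|std_normal_distribution. 1 - Re (d \<delta> \<xi>))" for \<delta>
  proof (rule integral_dominated_convergence[where w="\<lambda>_. 2"])
    show "AE x in std_normal_distribution. norm (1 - Re (c i \<delta> x)) \<le> 2" for i
    proof (rule AE_I2)
      fix \<xi> show "norm (1 - Re (c i \<delta> \<xi>)) \<le> 2"
        using abs_Re_le_cmod[of "c i \<delta> \<xi>"] c1[of i \<delta> \<xi>] by (auto simp: abs_le_iff)
    qed
  qed (auto intro!: tendsto_intros cd)
  have lim2: "(\<lambda>n. LINT \<xi>|std_normal_distribution. 1 - Re (d (1 / Suc n) \<xi>)) \<longlonglongrightarrow>
     (LINT \<xi>|std_normal_distribution. 0)"
  proof (rule integral_dominated_convergence[where w="\<lambda>_. 2"])
    show "AE x in std_normal_distribution. norm (1 - Re (d (1 / Suc n) x)) \<le> 2" for n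
    proof (rule AE_I2)
      fix \<xi> show "norm (1 - Re (d (1 / Suc n) \<xi>)) \<le> 2"
        using abs_Re_le_cmod[of "d (1 / Suc n) \<xi>"] d1[of "1 / Suc n" \<xi>] by (auto simp: abs_le_iff)
    qed
    show "AE \<xi> in std_normal_distribution. (\<lambda>n. 1 - Re (d (1 / Suc n) \<xi>)) \<longlonglongrightarrow> 0"
    proof (rule AE_I2)
      fix \<xi> :: real
      have "(\<lambda>n. 1 / Suc n * \<xi>) \<longlonglongrightarrow> 0 * \<xi>"
        by (intro tendsto_intros LIMSEQ_Suc lim_1_over_n)
      then have "(\<lambda>n. 1 / Suc n * \<xi>) \<longlonglongrightarrow> 0" by simp
      from isCont_tendsto_compose[OF cont this] have "(\<lambda>n. d (1 / Suc n) \<xi>) \<longlonglongrightarrow> 1"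
        unfolding d_def \<phi>0 by simp
      then have "(\<lambda>n. 1 - Re (d (1 / Suc n) \<xi>)) \<longlonglongrightarrow> 1 - Re 1" by (intro tendsto_intros)
      then show "(\<lambda>n. 1 - Re (d (1 / Suc n) \<xi>)) \<longlonglongrightarrow> 0" by simp
    qed
  qed auto
  \<comment> \<open>The 3 matches the lower bound 1/3 of the tail functional where |\<delta> x j|
    \<ge> 1.\<close>
  have "0 < \<epsilon> / 3" using \<open>0 < \<epsilon>\<close> by simp
  from order_tendstoD(2)[OF lim2[simplified], OF this] obtain m where
    m: "(LINT \<xi>|std_normal_distribution. 1 - Re (d (1 / Suc m) \<xi>)) < \<epsilon> / 3"
    unfolding eventually_sequentially by auto
  define \<delta> where "\<delta> = 1 / Suc m"
  have "\<delta> > 0" by (simp add: \<delta>_def)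
  have "\<forall>\<^sub>F n in sequentially. (LINT \<xi>|std_normal_distribution. 1 - Re (c n \<delta> \<xi>)) < \<epsilon> / 3"
    by (rule order_tendstoD(2)[OF lim1]) (use m in \<open>simp add: \<delta>_def\<close>)
  then have "\<forall>\<^sub>F n in sequentially. measure (\<mu> n) {x\<in>space (\<mu> n). 1 / \<delta> \<le> \<bar>x j\<bar>} \<le> \<epsilon>"
  proof eventually_elim
    case (elim n)
    interpret A: prob_space "\<mu> n" using \<mu> by (simp add: prob_on_def)
    have s1[measurable_cong]: "sets (\<mu> n) = sets (Pi\<^sub>M J (\<lambda>_. borel))" using \<mu> by (simp add: prob_on_def)
    note [measurable] = J
    have "1 / 3 * measure (\<mu> n) {x\<in>space (\<mu> n). 1 / \<delta> \<le> \<bar>x j\<bar>} =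
      (LINT x|\<mu> n. 1 / 3 * indicator {x\<in>space (\<mu> n). 1 / \<delta> \<le> \<bar>x j\<bar>} x)"
      by simp
    also have "\<dots> \<le> (LINT x|\<mu> n. 1 - exp (- (\<delta> * x j)\<^sup>2 / 2))"
    proof (rule integral_mono)
      show "integrable (\<mu> n) (\<lambda>x. 1 - exp (- (\<delta> * x j)\<^sup>2 / 2))"
        by (rule A.integrable_const_bound[where B=1]) auto
      show "integrable (\<mu> n) (\<lambda>x. 1 / 3 * indicat_real {x \<in> space (\<mu> n). 1 / \<delta> \<le> \<bar>x j\<bar>} x)"
        by (rule A.integrable_const_bound[where B=1]) (auto split: split_indicator)
      fix x
      show "1 / 3 * indicat_real {x \<in> space (\<mu> n). 1 / \<delta> \<le> \<bar>x j\<bar>} x \<le> 1 - exp (- (\<delta> * x j)\<^sup>2 / 2)"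
      proof (cases "1 / \<delta> \<le> \<bar>x j\<bar>")
        case True
        then have "1 \<le> \<bar>\<delta> * x j\<bar>" using \<open>\<delta> > 0\<close> by (simp add: abs_mult field_simps)
        then have "1 \<le> (\<delta> * x j)\<^sup>2" by (simp add: abs_le_square_iff[of 1, simplified])
        then have "exp (- (\<delta> * x j)\<^sup>2 / 2) \<le> exp (- (1/2::real))" by simp
        with exp_gaussian_le have "1 / 3 \<le> 1 - exp (- (\<delta> * x j)\<^sup>2 / 2)" by linarith
        then show ?thesis by (auto split: split_indicator)
      qed (simp split: split_indicator)
    qed
    also have "\<dots> < \<epsilon> / 3"
      unfolding charf_axis_gaussian[OF \<mu> J] using elim by (simp add: c_def)
    finally show ?case by simp
  qed
  then show ?thesis using \<open>\<delta> > 0\<close> by (intro exI[of _ "1 / \<delta>"]) auto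
qed

section \<open>Levy's continuity theorem\<close>

text \<open>A sequence of numbers in \<open>[0, 1)\<close> is coded by a point of the Cantor set (\<open>cantor_code\<close> applied to the
  interleaved binary digits), and \<open>cantor_coordinate k\<close> recovers the \<open>k\<close>-th number. Decoding is continuous on
  the whole line, so limit theorems for laws on the line carry over to laws on a finite product.\<close>
definition binary_digit :: "nat \<Rightarrow> real \<Rightarrow> real" where
  "binary_digit i y = of_int (\<lfloor>2 ^ Suc i * y\<rfloor> mod 2)"

lemma binary_digit_01: "binary_digit i y \<in> {0, 1}"
  unfolding binary_digit_def using pos_mod_bound[of 2 "\<lfloor>2 ^ Suc i * y\<rfloor>"] pos_mod_sign[of 2 "\<lfloor>2 ^ Suc i * y\<rfloor>"]
  by (smt (verit, best) insert_iff of_int_0 of_int_1)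

lemma measurable_binary_digit [measurable]: "binary_digit i \<in> borel_measurable borel"
  unfolding binary_digit_def by measurable

text \<open>The partial sums are the dyadic truncations floor (2^n y) / 2^n: halving floor (2^(n+1)
  y) leaves the digit n as remainder.\<close>

lemma binary_digit_sums:
  assumes "0 \<le> y" "y < 1"
  shows "(\<lambda>i. binary_digit i y * (1/2) ^ Suc i) sums y"
proof -
  have part: "(\<Sum>i<n. binary_digit i y * (1/2) ^ Suc i) = of_int \<lfloor>2 ^ n * y\<rfloor> / 2 ^ n" for n
  proof (induction n)
    case 0
    have "\<lfloor>y\<rfloor> = 0" using assms by (simp add: floor_eq_iff)
    then show ?case by simp
  next
    case (Suc n)
    have "\<lfloor>2 ^ Suc n * y\<rfloor> div 2 = \<lfloor>2 ^ n * y\<rfloor>"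
      using floor_divide_real_eq_div[of 2 "2 ^ Suc n * y"] by simp
    then have "\<lfloor>2 ^ Suc n * y\<rfloor> = 2 * \<lfloor>2 ^ n * y\<rfloor> + \<lfloor>2 ^ Suc n * y\<rfloor> mod 2"
      by presburger
    then have "of_int \<lfloor>2 ^ Suc n * y\<rfloor> = 2 * real_of_int \<lfloor>2 ^ n * y\<rfloor> + binary_digit n y"
      unfolding binary_digit_def by (metis of_int_add of_int_mult of_int_numeral)
    then show ?case using Suc by (simp add: field_simps)
  qed
  have "(\<lambda>n. of_int \<lfloor>2 ^ n * y\<rfloor> / 2 ^ n) \<longlonglongrightarrow> y"
  proof (rule tendsto_sandwich[where h="\<lambda>_. y" and f="\<lambda>n. y - (1/2) ^ n"])
    show "\<forall>\<^sub>F n in sequentially. y - (1 / 2) ^ n \<le> of_int \<lfloor>2 ^ n * y\<rfloor> / 2 ^ n"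
    proof (rule always_eventually, rule allI)
      fix n
      have "2 ^ n * y - 1 \<le> of_int \<lfloor>2 ^ n * y\<rfloor>" by linarith
      then have "(2 ^ n * y - 1) / 2 ^ n \<le> of_int \<lfloor>2 ^ n * y\<rfloor> / 2 ^ n"
        by (rule divide_right_mono) simp
      then show "y - (1 / 2) ^ n \<le> of_int \<lfloor>2 ^ n * y\<rfloor> / 2 ^ n"
        by (simp add: diff_divide_distrib power_one_over)
    qed
    show "\<forall>\<^sub>F n in sequentially. of_int \<lfloor>2 ^ n * y\<rfloor> / 2 ^ n \<le> y"
      by (rule always_eventually) (simp add: field_simps)
    have "(\<lambda>n. y - (1 / 2) ^ n) \<longlonglongrightarrow> y - 0"
      by (intro tendsto_intros LIMSEQ_power_zero) auto
    then show "(\<lambda>n. y - (1 / 2) ^ n) \<longlonglongrightarrow> y" by simp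
  qed auto
  then show ?thesis unfolding sums_def part .
qed

definition cantor_code :: "(nat \<Rightarrow> real) \<Rightarrow> real" where
  "cantor_code \<delta> = (\<Sum>n. 2 * \<delta> n / 3 ^ Suc n)"

text \<open>A code with first digit 0 lies in [0, 1/3], one with first digit 1 in [2/3, 1]. Clamping
  3 s - 1 reads off the digit there and interpolates over the gap, which makes decoding continuous
  on the whole line.\<close>

definition cantor_digit :: "real \<Rightarrow> real" where
  "cantor_digit s = max 0 (min 1 (3 * s - 1))"

text \<open>On codes this deletes the leading ternary digit, which is twice the binary one.\<close>

definition cantor_shift :: "real \<Rightarrow> real" where
  "cantor_shift s = 3 * s - 2 * cantor_digit s"

lemma cantor_code_summable:
  assumes "\<And>n. \<delta> n \<in> {0, 1::real}"
  shows "summable (\<lambda>n. 2 * \<delta> n / 3 ^ Suc n)"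
proof (rule summable_comparison_test')
  show "summable (\<lambda>n. 2 / 3 * (1 / 3 :: real) ^ n)" by (intro summable_mult summable_geometric) auto
  show "norm (2 * \<delta> n / 3 ^ Suc n) \<le> 2 / 3 * (1 / 3) ^ n" for n
    using assms[of n] by (auto simp: power_one_over field_simps)
qed

lemma cantor_code_bounds:
  assumes "\<And>n. \<delta> n \<in> {0, 1::real}"
  shows "0 \<le> cantor_code \<delta>" "cantor_code \<delta> \<le> 1"
proof -
  show "0 \<le> cantor_code \<delta>"
    unfolding cantor_code_def
    by (rule suminf_nonneg[OF cantor_code_summable[OF assms]]) (use assms in \<open>metis divide_nonneg_pos empty_iff insert_iff mult_nonneg_nonneg order_refl zero_le_numeral zero_le_one zero_less_numeral zero_less_power\<close>)
  have "(\<lambda>n. 2 / 3 * (1 / 3 :: real) ^ n) sums (2 / 3 * (1 / (1 - 1 / 3)))"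
    by (intro sums_mult geometric_sums) auto
  then have s: "(\<lambda>n. 2 / 3 * (1 / 3 :: real) ^ n) sums 1" by simp
  have "cantor_code \<delta> \<le> (\<Sum>n. 2 / 3 * (1 / 3) ^ n)"
    unfolding cantor_code_def
  proof (rule suminf_le[OF _ cantor_code_summable[OF assms] sums_summable[OF s]])
    show "2 * \<delta> n / 3 ^ Suc n \<le> 2 / 3 * (1 / 3) ^ n" for n
      using assms[of n] by (auto simp: power_one_over field_simps)
  qed
  then show "cantor_code \<delta> \<le> 1" using sums_unique[OF s] by simp
qed

lemma cantor_code_Suc:
  assumes "\<And>n. \<delta> n \<in> {0, 1::real}"
  shows "cantor_code \<delta> = (2 * \<delta> 0 + cantor_code (\<lambda>n. \<delta> (Suc n))) / 3"
proof -
  have "cantor_code \<delta> = 2 * \<delta> 0 / 3 + (\<Sum>n. 2 * \<delta> (Suc n) / 3 ^ Suc (Suc n))"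
    using suminf_split_head[OF cantor_code_summable[of \<delta>, OF assms]] unfolding cantor_code_def by simp
  also have "(\<Sum>n. 2 * \<delta> (Suc n) / 3 ^ Suc (Suc n)) = (\<Sum>n. 2 * \<delta> (Suc n) / 3 ^ Suc n / 3)"
    by (simp add: field_simps)
  also have "\<dots> = cantor_code (\<lambda>n. \<delta> (Suc n)) / 3"
    unfolding cantor_code_def
    by (rule suminf_divide) (rule cantor_code_summable, rule assms)
  finally show ?thesis by (simp add: field_simps)
qed

lemma cantor_digit_code:
  assumes "\<And>n. \<delta> n \<in> {0, 1::real}"
  shows "cantor_digit (cantor_code \<delta>) = \<delta> 0"
proof -
  have "0 \<le> cantor_code (\<lambda>n. \<delta> (Suc n))" "cantor_code (\<lambda>n. \<delta> (Suc n)) \<le> 1"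
    by (rule cantor_code_bounds, rule assms)+
  moreover have "\<delta> 0 = 0 \<or> \<delta> 0 = 1" using assms[of 0] by simp
  ultimately show ?thesis
    unfolding cantor_digit_def cantor_code_Suc[of \<delta>, OF assms] by (elim disjE) simp_all
qed

lemma cantor_shift_code:
  assumes "\<And>n. \<delta> n \<in> {0, 1::real}"
  shows "cantor_shift (cantor_code \<delta>) = cantor_code (\<lambda>n. \<delta> (Suc n))"
  unfolding cantor_shift_def cantor_digit_code[OF assms] by (subst cantor_code_Suc[OF assms]) (simp add: field_simps)

lemma cantor_digit_shift_code:
  assumes "\<And>n. \<delta> n \<in> {0, 1::real}"
  shows "cantor_digit ((cantor_shift ^^ m) (cantor_code \<delta>)) = \<delta> m"
proof -
  have "(cantor_shift ^^ m) (cantor_code \<delta>) = cantor_code (\<lambda>n. \<delta> (n + m))"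
  proof (induction m)
    case (Suc m)
    have "(cantor_shift ^^ Suc m) (cantor_code \<delta>) = cantor_shift (cantor_code (\<lambda>n. \<delta> (n + m)))"
      using Suc by simp
    also have "\<dots> = cantor_code (\<lambda>n. \<delta> (Suc n + m))"
      by (rule cantor_shift_code) (rule assms)
    finally show ?case by simp
  qed simp
  moreover have "cantor_digit (cantor_code (\<lambda>n. \<delta> (n + m))) = \<delta> (0 + m)"
    by (rule cantor_digit_code) (rule assms)
  ultimately show ?thesis by simp
qed

definition cantor_coordinate :: "nat \<Rightarrow> real \<Rightarrow> real" where
  "cantor_coordinate k s = (\<Sum>i. cantor_digit ((cantor_shift ^^ prod_encode (i, k)) s) * (1/2) ^ Suc i)"

text \<open>A uniform limit of continuous functions, by the Weierstrass test with bounds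
  2^-(i+1).\<close>

lemma continuous_cantor_coordinate: "continuous_on UNIV (cantor_coordinate k)"
proof -
  have d: "continuous_on UNIV cantor_digit" unfolding cantor_digit_def by (intro continuous_intros)
  have s: "continuous_on UNIV cantor_shift"
    unfolding cantor_shift_def by (intro continuous_intros d)
  have sn: "continuous_on UNIV (cantor_shift ^^ n)" for n
  proof (induction n)
    case (Suc n)
    then have "continuous_on UNIV (cantor_shift \<circ> (cantor_shift ^^ n))"
      by (rule continuous_on_compose) (rule continuous_on_subset[OF s], simp)
    then show ?case by simp
  qed auto
  have dn: "continuous_on UNIV (\<lambda>x. cantor_digit ((cantor_shift ^^ n) x))" for n
    using continuous_on_compose[OF sn continuous_on_subset[OF d]] by (simp add: comp_def)
  have "uniform_limit UNIV (\<lambda>n s. \<Sum>i<n. cantor_digit ((cantor_shift ^^ prod_encode (i, k)) s) * (1/2) ^ Suc i)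
     (\<lambda>s. \<Sum>i. cantor_digit ((cantor_shift ^^ prod_encode (i, k)) s) * (1/2) ^ Suc i) sequentially"
  proof (rule Weierstrass_m_test)
    show "norm (cantor_digit ((cantor_shift ^^ prod_encode (n, k)) x) * (1/2) ^ Suc n) \<le> (1/2) ^ Suc n" for n x
      by (auto simp: cantor_digit_def abs_mult)
    show "summable (\<lambda>n. (1/2::real) ^ Suc n)" by (subst summable_Suc_iff) (auto intro: summable_geometric)
  qed
  then show ?thesis
    unfolding cantor_coordinate_def
    by (rule uniform_limit_theorem[rotated]) (auto intro!: always_eventually continuous_intros dn)
qed

lemma cantor_coordinate_01: "cantor_coordinate k s \<in> {0..1}"
proof -
  have g: "(\<lambda>n. (1/2::real) ^ Suc n) sums 1" by (rule power_half_series)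
  have sm: "summable (\<lambda>i. cantor_digit ((cantor_shift ^^ prod_encode (i, k)) s) * (1/2) ^ Suc i)"
    by (rule summable_comparison_test'[OF sums_summable[OF g]]) (auto simp: cantor_digit_def abs_mult)
  have "0 \<le> cantor_coordinate k s"
    unfolding cantor_coordinate_def by (rule suminf_nonneg[OF sm]) (auto simp: cantor_digit_def)
  moreover have "cantor_coordinate k s \<le> (\<Sum>i. (1/2) ^ Suc i)"
    unfolding cantor_coordinate_def
    by (rule suminf_le[OF _ sm sums_summable[OF g]]) (auto simp: cantor_digit_def)
  ultimately show ?thesis using sums_unique[OF g] by simp
qed

lemma cantor_coordinate_code:
  assumes "\<And>i. 0 \<le> y i \<and> y i < 1"
  shows "cantor_coordinate k (cantor_code (\<lambda>n. binary_digit (fst (prod_decode n)) (y (snd (prod_decode n))))) = y k"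
proof -
  let ?\<delta> = "\<lambda>n. binary_digit (fst (prod_decode n)) (y (snd (prod_decode n)))"
  have "cantor_digit ((cantor_shift ^^ prod_encode (i, k)) (cantor_code ?\<delta>)) = binary_digit i (y k)" for i
    using cantor_digit_shift_code[of ?\<delta> "prod_encode (i, k)", OF binary_digit_01] by (simp only: prod_encode_inverse fst_conv snd_conv)
  then show ?thesis
    unfolding cantor_coordinate_def using sums_unique[OF binary_digit_sums[of "y k"], symmetric] assms[of k]
    by simp
qed

text \<open>The coded laws converge weakly along a subsequence by Helly's selection theorem; Skorohod's theorem
  realises this by almost sure convergence, which survives decoding. Tightness keeps the decoded limit in
  \<open>(0, 1)\<close>, where the arctangent can be inverted.\<close>
theorem charf_limit_exists:
  assumes \<mu>: "\<And>n. prob_on J (\<mu> n)" and J: "finite J"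
    and lim: "\<And>\<theta>. (\<lambda>n. charf J (\<mu> n) \<theta>) \<longlonglongrightarrow> \<phi> \<theta>"
    and cont: "\<And>j. j \<in> J \<Longrightarrow> isCont (\<lambda>s::real. \<phi> (\<lambda>i. if i = j then s else 0)) 0"
  shows "\<exists>\<nu>. prob_on J \<nu> \<and> (\<forall>\<theta>. charf J \<nu> \<theta> = \<phi> \<theta>)"
proof -
  \<comment> \<open>The arctangent compresses each coordinate into (0, 1). The value 0 is a dummy
    for empty J, the only case in which \<open>from_nat_into J k\<close> falls outside J.\<close>
  define y where "y x k = (if from_nat_into J k \<in> J then 1 / 2 + arctan (x (from_nat_into J k)) / pi else 0)"
    for x :: "'a \<Rightarrow> real" and k
  have y01: "0 \<le> y x k \<and> y x k < 1" for x k
    using arctan_lbound[of "x (from_nat_into J k)"] arctan_ubound[of "x (from_nat_into J k)"]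
    by (auto simp: y_def field_simps)
  have [measurable]: "(\<lambda>x. y x k) \<in> borel_measurable (Pi\<^sub>M J (\<lambda>_. borel))" for k
    unfolding y_def by (cases "from_nat_into J k \<in> J") (auto intro!: measurable_compose[OF _ borel_measurable_arctan])
  define code where "code x = cantor_code (\<lambda>n. binary_digit (fst (prod_decode n)) (y x (snd (prod_decode n))))" for x
  have [measurable]: "code \<in> borel_measurable (Pi\<^sub>M J (\<lambda>_. borel))"
    unfolding code_def cantor_code_def by measurable
  have code01: "0 \<le> code x" "code x \<le> 1" for x
    unfolding code_def by (rule cantor_code_bounds, rule binary_digit_01)+
  define idx where "idx = to_nat_on J"
  define h where "h j = cantor_coordinate (idx j)" for j
  have hcont: "isCont (h j) s" for j s
    using continuous_cantor_coordinate[of "idx j"] by (simp add: h_def continuous_on_eq_continuous_at)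
  have [measurable]: "h j \<in> borel_measurable borel" for j
    unfolding h_def by (rule borel_measurable_continuous_onI[OF continuous_cantor_coordinate])
  have h01: "0 \<le> h j s" "h j s \<le> 1" for j s
    using cantor_coordinate_01[of "idx j" s] by (auto simp: h_def)
  have hcode: "h j (code x) = 1 / 2 + arctan (x j) / pi" if "j \<in> J" for j x
  proof -
    have "from_nat_into J (idx j) = j" unfolding idx_def using that J by (simp add: countable_finite)
    then have "y x (idx j) = 1 / 2 + arctan (x j) / pi" using that by (simp add: y_def)
    then show ?thesis unfolding h_def code_def using cantor_coordinate_code[of "y x" "idx j"] y01 by simp
  qed
  \<comment> \<open>The tangent of pi (t - 1/2), which undoes the compression. As a quotient it is
    Borel on the whole line, and it is continuous wherever the cosine is nonzero.\<close>
  define tn where "tn t = sin (pi * (t - 1 / 2)) / cos (pi * (t - 1 / 2))" for t :: real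
  have [measurable]: "tn \<in> borel_measurable borel" unfolding tn_def by measurable
  have tncode: "tn (h j (code x)) = x j" if "j \<in> J" for j x
  proof -
    have "tn (h j (code x)) = tan (arctan (x j))"
      unfolding tn_def tan_def hcode[OF that] by simp
    then show ?thesis by (simp add: tan_arctan)
  qed
  define N where "N n = distr (\<mu> n) borel code" for n
  have sets\<mu>[measurable_cong]: "sets (\<mu> n) = sets (Pi\<^sub>M J (\<lambda>_. borel))" for n using \<mu> by (simp add: prob_on_def)
  have ps\<mu>: "prob_space (\<mu> n)" for n using \<mu> by (simp add: prob_on_def)
  have Nreal: "real_distribution (N n)" for n
    unfolding N_def by (rule prob_space.real_distribution_distr[OF ps\<mu>]) measurable
  \<comment> \<open>All codes lie in [0, 1], so the coded laws are tight for free; tightness of the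
    original laws enters only in \<open>inner\<close>.\<close>
  have "tight N"
    unfolding tight_def
  proof (intro conjI allI impI Nreal)
    fix \<epsilon> :: real assume "0 < \<epsilon>"
    have "measure (N n) {-1<..1} = 1" for n
    proof -
      interpret prob_space "\<mu> n" by (rule ps\<mu>)
      have "code -` {-1<..1} \<inter> space (\<mu> n) = space (\<mu> n)" using less_le_trans[of "-1" 0, OF _ code01(1)] code01(2) by auto
      then show ?thesis unfolding N_def by (subst measure_distr) (auto simp: prob_space)
    qed
    then show "\<exists>a b. a < b \<and> (\<forall>n. 1 - \<epsilon> < measure (N n) {a<..b})"
      using \<open>0 < \<epsilon>\<close> by (intro exI[of _ "-1"] exI[of _ 1]) auto
  qed
  from tight_imp_convergent_subsubsequence[OF this strict_mono_id] obtain r \<nu> where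
    r: "strict_mono (r :: nat \<Rightarrow> nat)" and "real_distribution \<nu>" "weak_conv_m (N \<circ> id \<circ> r) \<nu>" by blast
  then have "real_distribution ((N \<circ> r) n)" "weak_conv_m (N \<circ> r) \<nu>" for n by (auto simp: Nreal)
  from Skorohod[OF this(1) \<open>real_distribution \<nu>\<close> this(2)]
  obtain \<Omega> :: "real measure" and Ys :: "nat \<Rightarrow> real \<Rightarrow> real" and Y where
    "prob_space \<Omega>" and Ys[measurable]: "\<And>n. Ys n \<in> borel_measurable \<Omega>"
    and dYs: "\<And>n. distr \<Omega> borel (Ys n) = N (r n)" and Y: "Y \<in> measurable \<Omega> lborel"
    and YsY: "\<And>w. w \<in> space \<Omega> \<Longrightarrow> (\<lambda>n. Ys n w) \<longlonglongrightarrow> Y w"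
    by (simp add: comp_def) blast
  interpret prob_space \<Omega> by fact
  have [measurable]: "Y \<in> borel_measurable \<Omega>" using Y by simp
  have transfer: "(LINT w|\<Omega>. F (Ys n w)) = (LINT x|\<mu> (r n). F (code x))"
    if [measurable]: "F \<in> borel_measurable borel" for F :: "real \<Rightarrow> 'b :: {banach, second_countable_topology}" and n
  proof -
    have "(LINT w|\<Omega>. F (Ys n w)) = (LINT s|distr \<Omega> borel (Ys n). F s)" by (simp add: integral_distr)
    also have "\<dots> = (LINT x|\<mu> (r n). F (code x))" unfolding dYs N_def by (simp add: integral_distr)
    finally show ?thesis .
  qed
  have hlim: "(\<lambda>n. h j (Ys n w)) \<longlonglongrightarrow> h j (Y w)" if "w \<in> space \<Omega>" for j w
    by (rule isCont_tendsto_compose[OF hcont YsY[OF that]])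
  have inner: "AE w in \<Omega>. 0 < h j (Y w) \<and> h j (Y w) < 1" if j: "j \<in> J" for j
  proof -
    let ?A = "{w \<in> space \<Omega>. \<not> (0 < h j (Y w) \<and> h j (Y w) < 1)}"
    have A[measurable]: "?A \<in> sets \<Omega>" by measurable
    have "measure \<Omega> ?A \<le> \<epsilon>" if "0 < \<epsilon>" for \<epsilon>
    proof -
      from charf_limit_tight[OF \<mu> J j lim cont[OF j] that] obtain K where
        K: "0 < K" "\<forall>\<^sub>F n in sequentially. measure (\<mu> n) {x\<in>space (\<mu> n). K \<le> \<bar>x j\<bar>} \<le> \<epsilon>" by blast
      \<comment> \<open>\<open>a\<close> is the distance from the endpoints of the compressed image
        of [-K, K]. The continuous weight \<open>q\<close> equals 1 at 0 and 1 and vanishes on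
        [a, 1 - a], so its integral is bounded by the tail beyond K.\<close>
      define a where "a = 1 / 2 - arctan K / pi"
      have a: "0 < a" using arctan_ubound[of K] by (simp add: a_def field_simps)
      define q where "q t = max 0 (1 - min t (1 - t) / a)" for t
      have qcont: "isCont q t" for t unfolding q_def using a by (intro continuous_intros) auto
      have [measurable]: "q \<in> borel_measurable borel" unfolding q_def by measurable
      have q1: "0 \<le> q t \<and> q t \<le> 1" if "0 \<le> t" "t \<le> 1" for t using that a by (auto simp: q_def)
      have "(\<lambda>n. LINT w|\<Omega>. q (h j (Ys n w))) \<longlonglongrightarrow> (LINT w|\<Omega>. q (h j (Y w)))"
        by (rule integral_dominated_convergence[where w="\<lambda>_. 1"])
           (auto intro!: AE_I2 isCont_tendsto_compose[OF qcont] hlim simp: q1 h01)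
      moreover have "\<forall>\<^sub>F n in sequentially. (LINT w|\<Omega>. q (h j (Ys n w))) \<le> \<epsilon>"
        using filterlim_subseq[OF r, unfolded filterlim_iff, rule_format, OF K(2)]
      proof eventually_elim
        case (elim n)
        interpret M: prob_space "\<mu> (r n)" by (rule ps\<mu>)
        note [measurable] = j
        have "(LINT w|\<Omega>. q (h j (Ys n w))) = (LINT x|\<mu> (r n). q (h j (code x)))"
          by (rule transfer) measurable
        also have "\<dots> \<le> (LINT x|\<mu> (r n). indicator {x\<in>space (\<mu> (r n)). K \<le> \<bar>x j\<bar>} x)"
        proof (rule integral_mono)
          show "integrable (\<mu> (r n)) (\<lambda>x. q (h j (code x)))"
            by (rule M.integrable_const_bound[where B=1]) (auto simp: q1 h01)
          fix x assume x: "x \<in> space (\<mu> (r n))"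
          show "q (h j (code x)) \<le> indicator {x\<in>space (\<mu> (r n)). K \<le> \<bar>x j\<bar>} x"
          proof (cases "K \<le> \<bar>x j\<bar>")
            case True then show ?thesis using x q1 h01 by simp
          next
            case False
            then have "-K \<le> x j" "x j \<le> K" by auto
            then have "arctan (x j) \<le> arctan K" "- arctan K \<le> arctan (x j)"
              using arctan_le_iff[of "-K" "x j"] by (auto simp: arctan_le_iff arctan_minus)
            then have "arctan (x j) / pi \<le> arctan K / pi" "- (arctan K / pi) \<le> arctan (x j) / pi"
              by (auto simp: divide_right_mono field_simps)
            then have "a \<le> min (h j (code x)) (1 - h j (code x))"
              unfolding hcode[OF j] a_def by auto
            then have "1 \<le> min (h j (code x)) (1 - h j (code x)) / a" using a by (simp add: field_simps)
            then show ?thesis by (simp add: q_def)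
          qed
        qed (auto intro!: M.integrable_const_bound[where B=1])
        also have "\<dots> = measure (\<mu> (r n)) {x\<in>space (\<mu> (r n)). K \<le> \<bar>x j\<bar>}"
          by simp
        finally show ?case using elim by simp
      qed
      ultimately have "(LINT w|\<Omega>. q (h j (Y w))) \<le> \<epsilon>"
        by (rule tendsto_upperbound) auto
      moreover have "(LINT w|\<Omega>. indicator ?A w) \<le> (LINT w|\<Omega>. q (h j (Y w)))"
      proof (rule integral_mono)
        show "integrable \<Omega> (\<lambda>w. q (h j (Y w)))"
          by (rule integrable_const_bound[where B=1]) (auto simp: q1 h01)
        show "integrable \<Omega> (indicat_real ?A)"
          by (rule integrable_const_bound[where B=1]) (auto split: split_indicator)
        fix w
        show "indicator ?A w \<le> q (h j (Y w))"
          using h01[of j "Y w"] q1[of "h j (Y w)"] by (auto simp: q_def not_less split: split_indicator)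
      qed
      ultimately show ?thesis by simp
    qed
    then have "measure \<Omega> ?A \<le> 0" by (rule field_le_epsilon) simp
    then have "prob ?A = 0" by (simp add: measure_le_0_iff)
    then show ?thesis
      by (subst AE_iff_measurable[OF A refl]) (simp add: emeasure_eq_measure)
  qed
  define X where "X w = (\<lambda>j\<in>J. tn (h j (Y w)))" for w
  have X[measurable]: "X \<in> measurable \<Omega> (Pi\<^sub>M J (\<lambda>_. borel))"
    unfolding X_def by measurable
  have "charf J (distr \<Omega> (Pi\<^sub>M J (\<lambda>_. borel)) X) \<theta> = \<phi> \<theta>" for \<theta>
  proof -
    have "(\<lambda>n. CLINT w|\<Omega>. iexp (\<Sum>j\<in>J. \<theta> j * tn (h j (Ys n w)))) \<longlonglongrightarrow>
       (CLINT w|\<Omega>. iexp (\<Sum>j\<in>J. \<theta> j * tn (h j (Y w))))"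
    proof (rule integral_dominated_convergence[where w="\<lambda>_. 1"])
      have "AE w in \<Omega>. \<forall>j\<in>J. 0 < h j (Y w) \<and> h j (Y w) < 1"
        using inner J by (simp add: AE_finite_all)
      with AE_space show "AE w in \<Omega>. (\<lambda>n. iexp (\<Sum>j\<in>J. \<theta> j * tn (h j (Ys n w)))) \<longlonglongrightarrow> iexp (\<Sum>j\<in>J. \<theta> j * tn (h j (Y w)))"
      proof eventually_elim
        case (elim w)
        have "isCont tn (h j (Y w))" if "j \<in> J" for j
        proof -
          have "0 < cos (pi * (h j (Y w) - 1 / 2))"
            using elim(2)[rule_format, OF that]
            by (intro cos_gt_zero_pi) (auto simp: field_simps)
          then show ?thesis unfolding tn_def by (intro continuous_intros) auto
        qed
        then show ?case
          by (intro tendsto_intros isCont_tendsto_compose[of _ tn] hlim elim(1))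
      qed
    qed (simp_all del: of_real_sum of_real_mult)
    also have "(\<lambda>n. CLINT w|\<Omega>. iexp (\<Sum>j\<in>J. \<theta> j * tn (h j (Ys n w)))) = (\<lambda>n. charf J (\<mu> (r n)) \<theta>)"
    proof
      fix n
      have "(CLINT w|\<Omega>. iexp (\<Sum>j\<in>J. \<theta> j * tn (h j (Ys n w)))) =
        (CLINT x|\<mu> (r n). iexp (\<Sum>j\<in>J. \<theta> j * tn (h j (code x))))"
        by (rule transfer) measurable
      also have "\<dots> = charf J (\<mu> (r n)) \<theta>"
        unfolding charf_def by (simp add: tncode cong: sum.cong)
      finally show "(CLINT w|\<Omega>. iexp (\<Sum>j\<in>J. \<theta> j * tn (h j (Ys n w)))) = charf J (\<mu> (r n)) \<theta>" .
    qed
    finally have "(\<lambda>n. charf J (\<mu> (r n)) \<theta>) \<longlonglongrightarrow> (CLINT w|\<Omega>. iexp (\<Sum>j\<in>J. \<theta> j * tn (h j (Y w))))" .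
    moreover have "(\<lambda>n. charf J (\<mu> (r n)) \<theta>) \<longlonglongrightarrow> \<phi> \<theta>"
      using LIMSEQ_subseq_LIMSEQ[OF lim r] by (simp add: comp_def)
    ultimately have "(CLINT w|\<Omega>. iexp (\<Sum>j\<in>J. \<theta> j * tn (h j (Y w)))) = \<phi> \<theta>"
      by (rule LIMSEQ_unique)
    then show ?thesis
      unfolding charf_distr[OF X] by (simp add: X_def cong: sum.cong)
  qed
  moreover have "prob_on J (distr \<Omega> (Pi\<^sub>M J (\<lambda>_. borel)) X)"
    by (rule prob_on_distr[OF prob_space_axioms X])
  ultimately show ?thesis by blast
qed

section \<open>Exponents of infinitely divisible laws and Urbanik classes\<close>

text \<open>The whole convolution semigroup is demanded instead of n-th roots: this form passes at
  once to sums, multiples and limits, whereas roots must first be matched up to roots of unity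
  (\<open>charf_root_unique\<close>).\<close>

definition id_exponent :: "'i set \<Rightarrow> (('i \<Rightarrow> real) \<Rightarrow> complex) \<Rightarrow> bool" where
  "id_exponent J \<Psi> \<longleftrightarrow>
     (\<forall>t>0. \<exists>\<nu>. prob_on J \<nu> \<and> (\<forall>\<theta>. charf J \<nu> \<theta> = exp (complex_of_real t * \<Psi> \<theta>)))"

text \<open>Continuity along rays covers both uses: at 0 on the axes for the continuity theorem, and
  along the ray through \<theta> for the branch of an n-th root.\<close>

definition ray_continuous :: "(('i \<Rightarrow> real) \<Rightarrow> complex) \<Rightarrow> bool" where
  "ray_continuous \<Psi> \<longleftrightarrow> (\<forall>\<theta>. continuous_on UNIV (\<lambda>s::real. \<Psi> (\<lambda>j. s * \<theta> j)))"

definition dilation_diff :: "real \<Rightarrow> (('i \<Rightarrow> real) \<Rightarrow> complex) \<Rightarrow> ('i \<Rightarrow> real) \<Rightarrow> complex" where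
  "dilation_diff q \<Psi> \<theta> = \<Psi> \<theta> - \<Psi> (\<lambda>j. \<theta> j / q)"

fun urbanik_exponent :: "nat \<Rightarrow> 'i set \<Rightarrow> (('i \<Rightarrow> real) \<Rightarrow> complex) \<Rightarrow> bool" where
  "urbanik_exponent 0 J \<Psi> \<longleftrightarrow> (\<forall>q>1. id_exponent J (dilation_diff q \<Psi>))"
| "urbanik_exponent (Suc m) J \<Psi> \<longleftrightarrow>
     (\<forall>q>1. id_exponent J (dilation_diff q \<Psi>) \<and> urbanik_exponent m J (dilation_diff q \<Psi>))"

lemma ray_continuous_axis:
  assumes "ray_continuous \<Psi>"
  shows "isCont (\<lambda>s::real. \<Psi> (\<lambda>i. if i = j then s else 0)) s"
proof -
  have "continuous_on UNIV (\<lambda>s::real. \<Psi> (\<lambda>i. s * (if i = j then 1 else 0)))"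
    by (rule assms[unfolded ray_continuous_def, rule_format])
  moreover have "(\<lambda>s::real. \<Psi> (\<lambda>i. s * (if i = j then 1 else 0))) = (\<lambda>s. \<Psi> (\<lambda>i. if i = j then s else 0))"
    by (intro ext arg_cong[where f=\<Psi>]) auto
  ultimately show ?thesis by (simp add: continuous_on_eq_continuous_at)
qed

lemma ray_continuous_dilation_diff:
  assumes "ray_continuous \<Psi>" shows "ray_continuous (dilation_diff q \<Psi>)"
  unfolding ray_continuous_def
proof
  fix \<theta> :: "'a \<Rightarrow> real"
  have "continuous_on UNIV (\<lambda>s::real. \<Psi> (\<lambda>j. s * (\<theta> j / q)))" "continuous_on UNIV (\<lambda>s::real. \<Psi> (\<lambda>j. s * \<theta> j))"
    by (rule assms[unfolded ray_continuous_def, rule_format])+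
  then show "continuous_on UNIV (\<lambda>s::real. dilation_diff q \<Psi> (\<lambda>j. s * \<theta> j))"
    unfolding dilation_diff_def by (auto intro!: continuous_intros)
qed

lemma prob_on_point_mass: "\<exists>\<nu>. prob_on J \<nu> \<and> (\<forall>\<theta>. charf J \<nu> \<theta> = iexp (\<Sum>j\<in>J. \<theta> j * a j))"
proof -
  let ?P = "return borel (0::real)"
  interpret prob_space ?P by (rule prob_space_return) simp
  have m: "(\<lambda>_. \<lambda>j\<in>J. a j) \<in> measurable ?P (Pi\<^sub>M J (\<lambda>_. borel))" by measurable
  have "charf J (distr ?P (Pi\<^sub>M J (\<lambda>_. borel)) (\<lambda>_. \<lambda>j\<in>J. a j)) \<theta> = iexp (\<Sum>j\<in>J. \<theta> j * a j)" for \<theta>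
    unfolding charf_distr[OF m] using prob_space by (simp cong: sum.cong)
  with prob_on_distr[OF prob_space_axioms m] show ?thesis by blast
qed

lemma id_exponent_zero: "id_exponent J (\<lambda>_. 0)"
  unfolding id_exponent_def using prob_on_point_mass[of J "\<lambda>_. 0"] by simp

lemma id_exponent_add:
  assumes "id_exponent J \<Psi>" "id_exponent J \<Phi>"
  shows "id_exponent J (\<lambda>\<theta>. \<Psi> \<theta> + \<Phi> \<theta>)"
  unfolding id_exponent_def
proof (intro allI impI)
  fix t :: real assume "0 < t"
  with assms obtain \<mu> \<nu> where *: "prob_on J \<mu>" "\<And>\<theta>. charf J \<mu> \<theta> = exp (complex_of_real t * \<Psi> \<theta>)"
    "prob_on J \<nu>" "\<And>\<theta>. charf J \<nu> \<theta> = exp (complex_of_real t * \<Phi> \<theta>)"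
    unfolding id_exponent_def by metis
  from charf_convolution[OF *(1,3)]
  show "\<exists>\<nu>. prob_on J \<nu> \<and> (\<forall>\<theta>. charf J \<nu> \<theta> = exp (complex_of_real t * (\<Psi> \<theta> + \<Phi> \<theta>)))"
    by (simp add: * exp_add distrib_left)
qed

lemma id_exponent_scale:
  assumes "id_exponent J \<Psi>" "0 \<le> c"
  shows "id_exponent J (\<lambda>\<theta>. complex_of_real c * \<Psi> \<theta>)"
proof (cases "c = 0")
  case True then show ?thesis by (simp add: id_exponent_zero)
next
  case False
  then have c: "0 < c" using assms by simp
  show ?thesis
    unfolding id_exponent_def
  proof (intro allI impI)
    fix t :: real assume "0 < t"
    with c have "0 < t * c" by simp
    then show "\<exists>\<nu>. prob_on J \<nu> \<and> (\<forall>\<theta>. charf J \<nu> \<theta> = exp (complex_of_real t * (complex_of_real c * \<Psi> \<theta>)))"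
      using assms(1) unfolding id_exponent_def by (metis mult.assoc of_real_mult)
  qed
qed

lemma id_exponent_sum:
  assumes "finite K" "\<And>k. k \<in> K \<Longrightarrow> id_exponent J (\<Psi> k)"
  shows "id_exponent J (\<lambda>\<theta>. \<Sum>k\<in>K. \<Psi> k \<theta>)"
  using assms by (induction K rule: finite_induct) (auto intro: id_exponent_zero id_exponent_add)

text \<open>For each t, the laws with transforms exp (t \<Psi> n) fall under the continuity
  theorem.\<close>

lemma id_exponent_limit:
  assumes "finite J" "\<And>n::nat. id_exponent J (\<Psi> n)" "\<And>\<theta>. (\<lambda>n. \<Psi> n \<theta>) \<longlonglongrightarrow> \<Phi> \<theta>" "ray_continuous \<Phi>"
  shows "id_exponent J \<Phi>"
  unfolding id_exponent_def
proof (intro allI impI)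
  fix t :: real assume "0 < t"
  then have "\<exists>\<nu>. prob_on J \<nu> \<and> (\<forall>\<theta>. charf J \<nu> \<theta> = exp (complex_of_real t * \<Psi> n \<theta>))" for n
    using assms(2)[of n] unfolding id_exponent_def by blast
  then obtain \<mu> where \<mu>: "\<And>n. prob_on J (\<mu> n)"
    "\<And>n \<theta>. charf J (\<mu> n) \<theta> = exp (complex_of_real t * \<Psi> n \<theta>)"
    by metis
  show "\<exists>\<nu>. prob_on J \<nu> \<and> (\<forall>\<theta>. charf J \<nu> \<theta> = exp (complex_of_real t * \<Phi> \<theta>))"
  proof (rule charf_limit_exists[OF \<mu>(1) assms(1)])
    show "(\<lambda>n. charf J (\<mu> n) \<theta>) \<longlonglongrightarrow> exp (complex_of_real t * \<Phi> \<theta>)" for \<theta>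
      unfolding \<mu>(2) by (intro tendsto_intros assms)
    show "isCont (\<lambda>s. exp (complex_of_real t * \<Phi> (\<lambda>i. if i = j then s else 0))) 0" for j
      by (intro continuous_intros ray_continuous_axis[OF assms(4)])
  qed
qed

lemma charf_power:
  assumes "prob_on J \<nu>"
  shows "\<exists>\<pi>. prob_on J \<pi> \<and> (\<forall>\<theta>. charf J \<pi> \<theta> = charf J \<nu> \<theta> ^ k)"
proof (induction k)
  case 0
  show ?case using prob_on_point_mass[of J "\<lambda>_. 0"] by simp
next
  case (Suc k)
  then obtain \<pi> where "prob_on J \<pi>" "\<forall>\<theta>. charf J \<pi> \<theta> = charf J \<nu> \<theta> ^ k" by blast
  with charf_convolution[OF assms this(1)] show ?case by simp
qed

text \<open>Along the ray through \<theta> the quotient of the two sides is continuous with values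
  in the finite set of n-th roots of unity. Hence it is constant, and it equals 1 at 0.\<close>

lemma charf_root_unique:
  assumes \<nu>: "prob_on J \<nu>" and n: "0 < n" and root: "\<And>\<theta>. charf J \<nu> \<theta> ^ n = exp (\<Psi> \<theta>)"
    and \<Psi>: "ray_continuous \<Psi>" "\<Psi> (\<lambda>_. 0) = 0"
  shows "charf J \<nu> \<theta> = exp (\<Psi> \<theta> / of_nat n)"
proof -
  define f where "f s = charf J \<nu> (\<lambda>j. s * \<theta> j) / exp (\<Psi> (\<lambda>j. s * \<theta> j) / of_nat n)" for s :: real
  have "continuous_on UNIV f"
    unfolding f_def using \<Psi>(1) n unfolding ray_continuous_def
    by (intro continuous_intros charf_continuous_along[OF \<nu>]) auto
  moreover have root1: "f s ^ n = 1" for s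
    unfolding f_def using n by (simp add: power_divide root exp_of_nat_mult[symmetric])
  then have "f ` UNIV \<subseteq> {z. z ^ n = 1}" by auto
  moreover have "finite {z::complex. z ^ n = 1}" using n by (intro finite_roots_unity) simp
  ultimately have "f constant_on UNIV"
    using connected_UNIV by (metis continuous_finite_range_constant finite_subset)
  then have "f 1 = f 0" unfolding constant_on_def by auto
  also have "f 0 = 1" by (simp add: f_def charf_zero[OF \<nu>] \<Psi>(2))
  finally show ?thesis by (simp add: f_def)
qed

text \<open>Powers of roots realise all rational times; an arbitrary t is a limit of rationals, and
  the continuity theorem supplies the limit law.\<close>

lemma id_exponent_of_inf_div:
  assumes "finite J" "inf_div J \<mu>" "\<And>\<theta>. charf J \<mu> \<theta> = exp (\<Psi> \<theta>)"
    and \<Psi>: "ray_continuous \<Psi>" "\<Psi> (\<lambda>_. 0) = 0"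
  shows "id_exponent J \<Psi>"
  unfolding id_exponent_def
proof (intro allI impI)
  fix t :: real assume t: "0 < t"
  \<comment> \<open>The least numerator with \<open>k n\<close> / (n + 1) \<ge> t, so the error is
    at most 1 / (n + 1).\<close>
  define k where "k n = nat \<lceil>t * Suc n\<rceil>" for n
  have "\<exists>\<pi>. prob_on J \<pi> \<and> (\<forall>\<theta>. charf J \<pi> \<theta> = exp (complex_of_real (k n / Suc n) * \<Psi> \<theta>))" for n
  proof -
    from assms(2) obtain \<nu> where \<nu>: "prob_on J \<nu>" "\<And>\<theta>. charf J \<mu> \<theta> = charf J \<nu> \<theta> ^ Suc n"
      unfolding inf_div_def by (metis zero_less_Suc)
    have "charf J \<nu> \<theta> ^ Suc n = exp (\<Psi> \<theta>)" for \<theta> using \<nu>(2) assms(3) by metis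
    from charf_root_unique[OF \<nu>(1) _ this \<Psi>]
    have "charf J \<nu> \<theta> = exp (\<Psi> \<theta> / of_nat (Suc n))" for \<theta> by simp
    with charf_power[OF \<nu>(1), of "k n"] show ?thesis
      by (simp add: exp_of_nat_mult[symmetric])
  qed
  then obtain \<pi> where \<pi>: "\<And>n. prob_on J (\<pi> n)"
    "\<And>n \<theta>. charf J (\<pi> n) \<theta> = exp (complex_of_real (k n / Suc n) * \<Psi> \<theta>)" by metis
  have lim: "(\<lambda>n. k n / Suc n) \<longlonglongrightarrow> t"
  proof (rule tendsto_sandwich[where f="\<lambda>_. t" and h="\<lambda>n. t + 1 / Suc n"])
    have k: "t * Suc n \<le> k n" "k n \<le> t * Suc n + 1" for n
    proof -
      have "0 \<le> t * Suc n" using t by (intro mult_nonneg_nonneg) auto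
      then have "real (k n) = of_int \<lceil>t * Suc n\<rceil>" unfolding k_def by (intro of_nat_nat) linarith
      then show "t * Suc n \<le> k n" "k n \<le> t * Suc n + 1" by linarith+
    qed
    show "\<forall>\<^sub>F n in sequentially. t \<le> k n / Suc n"
      using k by (intro always_eventually allI) (simp add: field_simps del: of_nat_Suc)
    show "\<forall>\<^sub>F n in sequentially. k n / Suc n \<le> t + 1 / Suc n"
      using k by (intro always_eventually allI) (simp add: field_simps del: of_nat_Suc)
    have "(\<lambda>n. t + 1 / Suc n) \<longlonglongrightarrow> t + 0"
      by (intro tendsto_intros LIMSEQ_Suc lim_1_over_n)
    then show "(\<lambda>n. t + 1 / Suc n) \<longlonglongrightarrow> t" by simp
  qed simp
  show "\<exists>\<nu>. prob_on J \<nu> \<and> (\<forall>\<theta>. charf J \<nu> \<theta> = exp (complex_of_real t * \<Psi> \<theta>))"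
  proof (rule charf_limit_exists[OF \<pi>(1) assms(1)])
    show "(\<lambda>n. charf J (\<pi> n) \<theta>) \<longlonglongrightarrow> exp (complex_of_real t * \<Psi> \<theta>)" for \<theta>
      unfolding \<pi>(2) by (intro tendsto_intros lim)
    show "isCont (\<lambda>s. exp (complex_of_real t * \<Psi> (\<lambda>i. if i = j then s else 0))) 0" for j
      by (intro continuous_intros ray_continuous_axis[OF \<Psi>(1)])
  qed
qed

lemma inf_div_of_id_exponent:
  assumes "id_exponent J \<Psi>"
  shows "\<exists>\<mu>. inf_div J \<mu> \<and> (\<forall>\<theta>. charf J \<mu> \<theta> = exp (\<Psi> \<theta>))"
proof -
  from assms obtain \<mu> where \<mu>: "prob_on J \<mu>" "\<And>\<theta>. charf J \<mu> \<theta> = exp (\<Psi> \<theta>)"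
    unfolding id_exponent_def by (metis mult_1 of_real_1 zero_less_one)
  have "\<exists>\<nu>. prob_on J \<nu> \<and> (\<forall>\<theta>. charf J \<mu> \<theta> = charf J \<nu> \<theta> ^ n)" if "0 < n" for n :: nat
  proof -
    from assms that obtain \<nu> where \<nu>: "prob_on J \<nu>" "\<And>\<theta>. charf J \<nu> \<theta> = exp (complex_of_real (1 / n) * \<Psi> \<theta>)"
      unfolding id_exponent_def by (meson divide_pos_pos of_nat_0_less_iff zero_less_one)
    have "charf J \<mu> \<theta> = charf J \<nu> \<theta> ^ n" for \<theta>
      unfolding \<mu> \<nu> using that by (simp add: exp_of_nat_mult[symmetric])
    with \<nu>(1) show ?thesis by blast
  qed
  with \<mu> show ?thesis unfolding inf_div_def by blast
qed

text \<open>A transform of the form exp never vanishes, so the factor is forced to be the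
  quotient.\<close>

lemma charf_dilation_factor_iff:
  assumes "\<And>\<theta>. charf J \<mu> \<theta> = exp (\<Psi> \<theta>)"
  shows "(\<forall>\<theta>. charf J \<mu> \<theta> = charf J \<mu> (\<lambda>j. \<theta> j / q) * charf J \<nu> \<theta>) \<longleftrightarrow>
    (\<forall>\<theta>. charf J \<nu> \<theta> = exp (dilation_diff q \<Psi> \<theta>))"
proof -
  have "a = b * c \<longleftrightarrow> c = a / b" if "b \<noteq> 0" for a b c :: complex
    using that by (metis nonzero_mult_div_cancel_left times_divide_eq_right)
  then show ?thesis unfolding assms dilation_diff_def exp_diff by simp
qed

text \<open>The transform of the factor is determined, so the existential over laws becomes a
  condition on \<open>dilation_diff q \<Psi>\<close>. That function is again ray continuous and 0 at
  0, which lets the induction continue with it.\<close>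

lemma urbanik_iff_exponent:
  assumes "finite J" "prob_on J \<mu>" "\<And>\<theta>. charf J \<mu> \<theta> = exp (\<Psi> \<theta>)"
    and "ray_continuous \<Psi>" "\<Psi> (\<lambda>_. 0) = 0"
  shows "urbanik m J \<mu> \<longleftrightarrow> urbanik_exponent m J \<Psi>"
  using assms(2-)
proof (induction m arbitrary: \<mu> \<Psi>)
  case (0 \<mu> \<Psi>)
  have zero: "dilation_diff q \<Psi> (\<lambda>_. 0) = 0" for q using 0(4) by (simp add: dilation_diff_def)
  note rc = ray_continuous_dilation_diff[OF 0(3)]
  have "(\<exists>\<nu>. inf_div J \<nu> \<and> (\<forall>\<theta>. charf J \<nu> \<theta> = exp (dilation_diff q \<Psi> \<theta>))) \<longleftrightarrow>
    id_exponent J (dilation_diff q \<Psi>)" for q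
    using id_exponent_of_inf_div[OF assms(1) _ _ rc zero] inf_div_of_id_exponent by metis
  then show ?case using 0(1) by (simp add: charf_dilation_factor_iff[OF 0(2)])
next
  case (Suc m \<mu> \<Psi>)
  have zero: "dilation_diff q \<Psi> (\<lambda>_. 0) = 0" for q using Suc(5) by (simp add: dilation_diff_def)
  note rc = ray_continuous_dilation_diff[OF Suc(4)]
  have IH: "urbanik m J \<nu> \<longleftrightarrow> urbanik_exponent m J (dilation_diff q \<Psi>)"
    if "inf_div J \<nu>" "\<forall>\<theta>. charf J \<nu> \<theta> = exp (dilation_diff q \<Psi> \<theta>)" for \<nu> q
    using that by (intro Suc.IH rc zero) (auto simp: inf_div_def)
  have "(\<exists>\<nu>. inf_div J \<nu> \<and> urbanik m J \<nu> \<and> (\<forall>\<theta>. charf J \<nu> \<theta> = exp (dilation_diff q \<Psi> \<theta>))) \<longleftrightarrow>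
    id_exponent J (dilation_diff q \<Psi>) \<and> urbanik_exponent m J (dilation_diff q \<Psi>)" (is "?L = ?R") for q
  proof
    assume ?L
    then obtain \<nu> where "inf_div J \<nu>" "urbanik m J \<nu>" "\<forall>\<theta>. charf J \<nu> \<theta> = exp (dilation_diff q \<Psi> \<theta>)" by blast
    then show ?R using id_exponent_of_inf_div[OF assms(1) _ _ rc zero] IH by blast
  next
    assume R: ?R
    then obtain \<nu> where "inf_div J \<nu>" "\<forall>\<theta>. charf J \<nu> \<theta> = exp (dilation_diff q \<Psi> \<theta>)"
      using inf_div_of_id_exponent by blast
    then show ?L using R IH by blast
  qed
  then show ?case using Suc(2) by (simp add: charf_dilation_factor_iff[OF Suc(3)])
qed

section \<open>Levy-Khintchine exponents are infinitely divisible\<close>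

text \<open>A one-point index set makes the theory on finite products available on the line.\<close>

abbreviation id_exponent1 :: "(real \<Rightarrow> complex) \<Rightarrow> bool" where
  "id_exponent1 \<phi> \<equiv> id_exponent {()} (\<lambda>\<theta>. \<phi> (\<theta> ()))"

lemma ray_continuous1:
  assumes "continuous_on UNIV \<phi>" shows "ray_continuous (\<lambda>\<theta>. \<phi> (\<theta> a))"
  unfolding ray_continuous_def
  by (intro allI continuous_on_compose2[OF assms] continuous_intros) auto

lemma charf_of_real_distribution:
  assumes "real_distribution \<nu>"
  shows "\<exists>\<mu>. prob_on {()} \<mu> \<and> (\<forall>\<theta>. charf {()} \<mu> \<theta> = char \<nu> (\<theta> ()))"
proof -
  interpret real_distribution \<nu> by fact
  have m: "(\<lambda>x. \<lambda>_\<in>{()}. x) \<in> measurable \<nu> (Pi\<^sub>M {()} (\<lambda>_. borel))" by measurable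
  have "charf {()} (distr \<nu> (Pi\<^sub>M {()} (\<lambda>_. borel)) (\<lambda>x. \<lambda>_\<in>{()}. x)) \<theta> = char \<nu> (\<theta> ())" for \<theta>
    unfolding charf_distr[OF m] char_def by simp
  with prob_on_distr[OF prob_space_axioms m] show ?thesis by blast
qed

lemma id_exponent1I:
  assumes "\<And>t. 0 < t \<Longrightarrow> \<exists>\<nu>. real_distribution \<nu> \<and> (\<forall>\<theta>. char \<nu> \<theta> = exp (complex_of_real t * \<phi> \<theta>))"
  shows "id_exponent1 \<phi>"
  unfolding id_exponent_def
proof (intro allI impI)
  fix t :: real assume "0 < t"
  from assms[OF this] obtain \<nu> where \<nu>: "real_distribution \<nu>" "\<forall>\<theta>. char \<nu> \<theta> = exp (complex_of_real t * \<phi> \<theta>)" by blast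
  from charf_of_real_distribution[OF \<nu>(1)] \<nu>(2)
  show "\<exists>\<nu>. prob_on {()} \<nu> \<and> (\<forall>\<theta>. charf {()} \<nu> \<theta> = exp (complex_of_real t * \<phi> (\<theta> ())))" by simp
qed

text \<open>The law of the vector (y j * x) over j, where x has exponent \<phi>. It is the
  contribution of one level set of a simple kernel in \<open>id_exponent_field\<close>.\<close>

lemma id_exponent_linear_image:
  assumes "id_exponent {a} (\<lambda>\<theta>. \<phi> (\<theta> a))"
  shows "id_exponent J (\<lambda>\<theta>. \<phi> (\<Sum>j\<in>J. \<theta> j * y j))"
  unfolding id_exponent_def
proof (intro allI impI)
  fix t :: real assume "0 < t"
  with assms obtain \<nu> where \<nu>: "prob_on {a} \<nu>" "\<And>\<theta>. charf {a} \<nu> \<theta> = exp (complex_of_real t * \<phi> (\<theta> a))"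
    unfolding id_exponent_def by metis
  interpret prob_space \<nu> using \<nu>(1) by (simp add: prob_on_def)
  have [measurable_cong]: "sets \<nu> = sets (Pi\<^sub>M {a} (\<lambda>_. borel))" using \<nu>(1) by (simp add: prob_on_def)
  have m: "(\<lambda>x. \<lambda>j\<in>J. y j * x a) \<in> measurable \<nu> (Pi\<^sub>M J (\<lambda>_. borel))" by measurable
  have "charf J (distr \<nu> (Pi\<^sub>M J (\<lambda>_. borel)) (\<lambda>x. \<lambda>j\<in>J. y j * x a)) \<theta> =
      exp (complex_of_real t * \<phi> (\<Sum>j\<in>J. \<theta> j * y j))" for \<theta>
  proof -
    have "charf J (distr \<nu> (Pi\<^sub>M J (\<lambda>_. borel)) (\<lambda>x. \<lambda>j\<in>J. y j * x a)) \<theta> =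
      (CLINT x|\<nu>. iexp (\<Sum>j\<in>J. \<theta> j * (\<lambda>j\<in>J. y j * x a) j))"
      by (rule charf_distr[OF m])
    also have "\<dots> = charf {a} \<nu> (\<lambda>_. \<Sum>j\<in>J. \<theta> j * y j)"
      unfolding charf_def
      by (intro Bochner_Integration.integral_cong refl arg_cong[where f=iexp])
         (simp add: sum_distrib_right mult.assoc cong: sum.cong)
    finally show ?thesis unfolding \<nu>(2) .
  qed
  with prob_on_distr[OF prob_space_axioms m]
  show "\<exists>\<nu>. prob_on J \<nu> \<and> (\<forall>\<theta>. charf J \<nu> \<theta> = exp (complex_of_real t * \<phi> (\<Sum>j\<in>J. \<theta> j * y j)))" by blast
qed

lemma id_exponent1_drift: "id_exponent1 (\<lambda>\<theta>. \<i> * complex_of_real (\<gamma> * \<theta>))"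
  unfolding id_exponent_def
proof (intro allI impI)
  fix t :: real
  show "\<exists>\<nu>. prob_on {()} \<nu> \<and> (\<forall>\<theta>. charf {()} \<nu> \<theta> = exp (complex_of_real t * (\<i> * complex_of_real (\<gamma> * \<theta> ()))))"
    using prob_on_point_mass[of "{()}" "\<lambda>_. t * \<gamma>"] by (simp add: mult_ac)
qed

lemma id_exponent1_gaussian:
  assumes "0 \<le> \<beta>" shows "id_exponent1 (\<lambda>\<theta>. - complex_of_real (\<beta> * \<theta>\<^sup>2 / 2))"
proof (rule id_exponent1I)
  fix t :: real assume t: "0 < t"
  interpret real_distribution std_normal_distribution by (rule real_dist_normal_dist)
  let ?\<nu> = "distr std_normal_distribution borel (\<lambda>x. sqrt (t * \<beta>) * x)"
  have "char ?\<nu> \<theta> = exp (complex_of_real t * - complex_of_real (\<beta> * \<theta>\<^sup>2 / 2))" for \<theta>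
  proof -
    have "char ?\<nu> \<theta> = char std_normal_distribution (sqrt (t * \<beta>) * \<theta>)"
      unfolding char_def by (subst integral_distr) (auto simp: mult_ac)
    also have "\<dots> = complex_of_real (exp (- (t * (\<beta> * \<theta>\<^sup>2 / 2))))"
      using t assms by (simp add: char_std_normal_distribution power_mult_distrib)
    finally show ?thesis by (simp add: exp_of_real[symmetric])
  qed
  moreover have "real_distribution ?\<nu>" by (rule real_distribution_distr) simp
  ultimately show "\<exists>\<nu>. real_distribution \<nu> \<and>
      (\<forall>\<theta>. char \<nu> \<theta> = exp (complex_of_real t * - complex_of_real (\<beta> * \<theta>\<^sup>2 / 2)))" by blast
qed

text \<open>Both 1 + w / n and exp (w / n) lie in the unit disc, the latter since Re w \<le> 0.
  There n-th powers have Lipschitz constant n, and the two numbers differ by O(1 / n^2).\<close>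

lemma tendsto_power_exp:
  fixes w :: complex
  assumes "Re w \<le> 0" "\<And>n. N \<le> n \<Longrightarrow> norm (1 + w / of_nat n) \<le> 1"
  shows "(\<lambda>n. (1 + w / of_nat n) ^ n) \<longlonglongrightarrow> exp w"
proof -
  have bound: "norm ((1 + w / of_nat n) ^ n - exp w) \<le> exp (norm w) * (norm w)\<^sup>2 * (1 / n)" if n: "n \<ge> max 1 N" for n :: nat
  proof -
    have n0: "0 < n" using n by simp
    have "norm ((1 + w / of_nat n) ^ n - exp (w / of_nat n) ^ n) \<le> n * norm (1 + w / of_nat n - exp (w / of_nat n))"
      using assms n by (intro norm_power_diff) (auto simp: divide_nonpos_nonneg)
    also have "norm (1 + w / of_nat n - exp (w / of_nat n)) = norm (exp (w / of_nat n) - (\<Sum>k\<le>1. (w / of_nat n) ^ k / fact k))"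
      by (simp add: norm_minus_commute)
    also have "\<dots> \<le> exp \<bar>Re (w / of_nat n)\<bar> * (norm (w / of_nat n)) ^ Suc 1 / fact 1"
      by (rule Taylor_exp)
    also have "\<dots> \<le> exp (norm w) * (norm (w / of_nat n)) ^ Suc 1 / fact 1"
    proof -
      have "\<bar>Re (w / of_nat n)\<bar> \<le> norm (w / of_nat n)" by (rule abs_Re_le_cmod)
      also have "\<dots> \<le> norm w" using n0 by (simp add: norm_divide divide_le_eq mult_left_mono[of 1 n "norm w", simplified])
      finally show ?thesis by (simp add: mult_right_mono)
    qed
    finally have "norm ((1 + w / of_nat n) ^ n - exp (w / of_nat n) ^ n) \<le>
      n * (exp (norm w) * (norm (w / of_nat n)) ^ Suc 1 / fact 1)"
      using n0 by simp
    also have "\<dots> = exp (norm w) * (norm w)\<^sup>2 * (1 / n)"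
      using n0 by (simp add: norm_divide power2_eq_square field_simps)
    finally show ?thesis using n0 by (simp add: exp_of_nat_mult[symmetric])
  qed
  have "(\<lambda>n. exp (norm w) * (norm w)\<^sup>2 * (1 / real n)) \<longlonglongrightarrow> exp (norm w) * (norm w)\<^sup>2 * 0"
    by (intro tendsto_intros lim_1_over_n)
  then have z: "(\<lambda>n. exp (norm w) * (norm w)\<^sup>2 * (1 / real n)) \<longlonglongrightarrow> 0" by simp
  have "(\<lambda>n. (1 + w / of_nat n) ^ n - exp w) \<longlonglongrightarrow> 0"
    by (rule Lim_null_comparison[OF _ z])
       (use bound in \<open>auto simp: eventually_sequentially intro!: exI[of _ "max 1 N"]\<close>)
  then show ?thesis by (simp add: LIM_zero_iff)
qed

text \<open>Poisson limit theorem. A variable that has law S with probability l / n and is 0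
  otherwise has transform 1 + l (char S - 1) / n; n independent copies are added and n tends to
  infinity.\<close>

lemma id_exponent1_compound_poisson:
  assumes S: "real_distribution S" and "0 \<le> c"
  shows "id_exponent1 (\<lambda>\<theta>. complex_of_real c * (char S \<theta> - 1))"
  unfolding id_exponent_def
proof (intro allI impI)
  fix t :: real assume "0 < t"
  interpret real_distribution S by fact
  have pS: "measure S UNIV = 1" using prob_space by simp
  define l where "l = t * c"
  have l: "0 \<le> l" using \<open>0 < t\<close> \<open>0 \<le> c\<close> by (simp add: l_def)
  \<comment> \<open>From n = N on, l / n is a probability; the sequence of laws below starts
    there.\<close>
  obtain N :: nat where N: "max 1 l \<le> N" using real_arch_simple by blast
  have step: "\<exists>\<mu>. prob_on {()} \<mu> \<and> (\<forall>\<theta>. charf {()} \<mu> \<theta> = 1 + complex_of_real l * (char S (\<theta> ()) - 1) / of_nat n)"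
    if n: "N \<le> n" for n
  proof -
    define p where "p = l / n"
    have n0: "0 < n" "l \<le> n" using n N by auto
    have p: "0 \<le> p" "p \<le> 1" using l n0 by (auto simp: p_def)
    let ?B = "measure_pmf (bernoulli_pmf p)"
    interpret B: prob_space ?B by (rule prob_space_measure_pmf)
    interpret pair_prob_space ?B S ..
    let ?f = "\<lambda>(b, x). if b then x else (0::real)"
    have f[measurable]: "?f \<in> borel_measurable (?B \<Otimes>\<^sub>M S)"
    proof -
      have [measurable]: "Measurable.pred (?B \<Otimes>\<^sub>M S) fst"
        by (rule measurable_compose[OF measurable_fst]) simp
      show ?thesis unfolding split_beta by measurable
    qed
    let ?\<nu> = "distr (?B \<Otimes>\<^sub>M S) borel ?f"
    have "char ?\<nu> \<theta> = 1 + complex_of_real l * (char S \<theta> - 1) / of_nat n" for \<theta>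
    proof -
      have "char ?\<nu> \<theta> = (CLINT z|(?B \<Otimes>\<^sub>M S). iexp (\<theta> * ?f z))"
        unfolding char_def by (subst integral_distr) auto
      also have "\<dots> = (CLINT b|?B. CLINT x|S. iexp (\<theta> * ?f (b, x)))"
        by (rule integral_fst'[symmetric]) (rule integrable_const_bound[where B=1]; simp)
      also have "\<dots> = complex_of_real p * char S \<theta> + complex_of_real (1 - p)"
        using p pS by (simp add: integral_measure_pmf[of UNIV] UNIV_bool char_def scaleR_conv_of_real space_eq_univ)
      finally have "char ?\<nu> \<theta> = 1 + complex_of_real p * (char S \<theta> - 1)" by (simp add: algebra_simps)
      then show ?thesis by (simp add: p_def)
    qed
    moreover have "real_distribution ?\<nu>" by (rule real_distribution_distr[OF f])
    ultimately show ?thesis using charf_of_real_distribution by metis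
  qed
  define w where "w \<theta> = complex_of_real l * (char S (\<theta> ()) - 1)" for \<theta> :: "unit \<Rightarrow> real"
  have "\<exists>\<pi>. prob_on {()} \<pi> \<and> (\<forall>\<theta>. charf {()} \<pi> \<theta> = (1 + w \<theta> / of_nat (n + N)) ^ (n + N))" for n
  proof -
    from step[of "n + N"] obtain \<mu> where \<mu>: "prob_on {()} \<mu>" "\<And>\<theta>. charf {()} \<mu> \<theta> = 1 + w \<theta> / of_nat (n + N)"
      unfolding w_def by auto
    from charf_power[OF \<mu>(1), of "n + N"] show ?thesis unfolding \<mu>(2) .
  qed
  then obtain \<pi> where \<pi>: "\<And>n. prob_on {()} (\<pi> n)"
    "\<And>n \<theta>. charf {()} (\<pi> n) \<theta> = (1 + w \<theta> / of_nat (n + N)) ^ (n + N)" by metis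
  have "\<exists>\<nu>. prob_on {()} \<nu> \<and> (\<forall>\<theta>. charf {()} \<nu> \<theta> = exp (w \<theta>))"
  proof (rule charf_limit_exists[OF \<pi>(1)])
    fix \<theta>
    have "Re (char S (\<theta> ())) \<le> 1" using complex_Re_le_cmod[of "char S (\<theta> ())"] cmod_char_le_1[of "\<theta> ()"] by linarith
    then have "Re (w \<theta>) \<le> 0" using l by (simp add: w_def mult_nonneg_nonpos)
    moreover have "norm (1 + w \<theta> / of_nat n) \<le> 1" if n: "N \<le> n" for n
      using step[OF n] norm_charf_le_1 unfolding w_def by metis
    ultimately have "(\<lambda>n. (1 + w \<theta> / of_nat n) ^ n) \<longlonglongrightarrow> exp (w \<theta>)" by (rule tendsto_power_exp)
    from LIMSEQ_ignore_initial_segment[OF this, of N]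
    show "(\<lambda>n. charf {()} (\<pi> n) \<theta>) \<longlonglongrightarrow> exp (w \<theta>)" unfolding \<pi>(2) .
  next
    show "isCont (\<lambda>s. exp (w (\<lambda>i. if i = j then s else 0))) 0" if "j \<in> {()}" for j
      using isCont_char[of 0] by (simp add: w_def)
  qed simp
  then show "\<exists>\<nu>. prob_on {()} \<nu> \<and>
     (\<forall>\<theta>. charf {()} \<nu> \<theta> = exp (complex_of_real t * (complex_of_real c * (char S (\<theta> ()) - 1))))"
    by (simp add: w_def l_def mult.assoc)
qed

text \<open>Normalising the measure gives the jump law of a compound Poisson exponent whose
  intensity is the total mass. Total mass 0 admits no normalisation and is treated apart.\<close>

lemma id_exponent1_finite_measure:
  assumes "finite_measure \<sigma>" and sets[measurable_cong]: "sets \<sigma> = sets borel"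
  shows "id_exponent1 (\<lambda>\<theta>. CLINT x|\<sigma>. iexp (\<theta> * x) - 1)"
proof -
  interpret finite_measure \<sigma> by fact
  have sp: "space \<sigma> = UNIV" using sets_eq_imp_space_eq[OF sets] by simp
  let ?c = "measure \<sigma> UNIV"
  have i: "complex_integrable \<sigma> (\<lambda>x. iexp (\<theta> * x))" for \<theta>
    by (rule integrable_const_bound[where B=1]) auto
  have eq: "(CLINT x|\<sigma>. iexp (\<theta> * x) - 1) = (CLINT x|\<sigma>. iexp (\<theta> * x)) - complex_of_real ?c" for \<theta>
    using i[of \<theta>] by (simp add: sp scaleR_conv_of_real)
  show ?thesis
  proof (cases "?c = 0")
    case True
    then have "emeasure \<sigma> (space \<sigma>) = 0" by (simp add: emeasure_eq_measure sp)
    then have "AE x in \<sigma>. False" by (subst AE_iff_measurable[OF _ refl]) auto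
    then have "(CLINT x|\<sigma>. iexp (\<theta> * x) - 1) = 0" for \<theta>
      by (intro integral_eq_zero_AE) auto
    then show ?thesis by (simp add: id_exponent_zero)
  next
    case False
    then have c: "0 < ?c" using measure_nonneg[of \<sigma> UNIV] by linarith
    let ?S = "density \<sigma> (\<lambda>_. ennreal (1 / ?c))"
    have "emeasure ?S (space ?S) = 1"
      using c by (simp add: emeasure_density sp nn_integral_cmult emeasure_eq_measure ennreal_mult[symmetric] del: ennreal_1)
    then interpret S: prob_space ?S by (rule prob_spaceI)
    have S: "real_distribution ?S" by standard (auto simp: sets)
    have "char ?S \<theta> = (1 / ?c) *\<^sub>R (CLINT x|\<sigma>. iexp (\<theta> * x))" for \<theta>
      unfolding char_def using c by (subst integral_density) auto
    then have "(CLINT x|\<sigma>. iexp (\<theta> * x) - 1) = complex_of_real ?c * (char ?S \<theta> - 1)" for \<theta>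
      unfolding eq using c by (simp add: scaleR_conv_of_real field_simps)
    then show ?thesis using id_exponent1_compound_poisson[OF S measure_nonneg[of \<sigma> UNIV]] by simp
  qed
qed

section \<open>The jump part of the Levy-Khintchine exponent\<close>

definition levy_jump :: "real measure \<Rightarrow> real \<Rightarrow> complex" where
  "levy_jump \<rho> \<theta> = (CLINT x|\<rho>. iexp (\<theta> * x) - 1 - \<i> * complex_of_real (\<theta> * tau1 x))"

lemma measurable_tau1 [measurable]: "tau1 \<in> borel_measurable borel"
  unfolding tau1_def by measurable

lemma tau1_eq: "\<bar>x\<bar> \<le> 1 \<Longrightarrow> tau1 x = x" by (simp add: tau1_def max_absorb1)

lemma abs_tau1_le_1: "\<bar>tau1 x\<bar> \<le> 1"
  by (auto simp: tau1_def max_def)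

text \<open>Second-order Taylor expansion for |x| \<le> 1, where \<open>tau1 x\<close> = x, and the
  trivial bound 2 + |\<theta>| beyond; one constant covers both.\<close>

lemma norm_levy_integrand_le:
  "norm (iexp (\<theta> * x) - 1 - \<i> * complex_of_real (\<theta> * tau1 x)) \<le> (2 + \<bar>\<theta>\<bar> + \<theta>\<^sup>2) * min 1 (x\<^sup>2)"
proof (cases "\<bar>x\<bar> \<le> 1")
  case True
  have "norm (iexp (\<theta> * x) - (\<Sum>k\<le>1. (\<i> * complex_of_real (\<theta> * x)) ^ k / fact k)) \<le> \<bar>\<theta> * x\<bar> ^ Suc 1 / fact (Suc 1)"
    by (rule iexp_approx1)
  then have "norm (iexp (\<theta> * x) - 1 - \<i> * complex_of_real (\<theta> * tau1 x)) \<le> \<theta>\<^sup>2 * x\<^sup>2 / 2"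
    by (simp add: tau1_eq[OF True] power2_eq_square abs_mult[symmetric] diff_diff_eq mult_ac)
  also have "\<dots> \<le> (2 + \<bar>\<theta>\<bar> + \<theta>\<^sup>2) * x\<^sup>2"
    by (simp add: distrib_right)
  also have "x\<^sup>2 = min 1 (x\<^sup>2)" using True by (simp add: abs_square_le_1 min_absorb2)
  finally show ?thesis .
next
  case False
  have "norm (iexp (\<theta> * x) - 1 - \<i> * complex_of_real (\<theta> * tau1 x)) \<le> norm (iexp (\<theta> * x)) + 1 + \<bar>\<theta> * tau1 x\<bar>"
    by (intro order_trans[OF norm_triangle_ineq4] add_mono) (auto simp: norm_mult)
  also have "\<dots> \<le> 2 + \<bar>\<theta>\<bar>" using mult_left_mono[OF abs_tau1_le_1[of x], of "\<bar>\<theta>\<bar>"] by (simp add: abs_mult)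
  also have "\<dots> \<le> 2 + \<bar>\<theta>\<bar> + \<theta>\<^sup>2" by simp
  finally have *: "norm (iexp (\<theta> * x) - 1 - \<i> * complex_of_real (\<theta> * tau1 x)) \<le> 2 + \<bar>\<theta>\<bar> + \<theta>\<^sup>2" .
  have "min 1 (x\<^sup>2) = 1" using False abs_le_square_iff[of 1 x] by (simp add: min_absorb1)
  with * show ?thesis by (simp only: mult_1_right)
qed

lemma levy_measure_integrable:
  assumes "levy_measure \<rho>"
  shows "integrable \<rho> (\<lambda>x. min 1 (x\<^sup>2))"
proof -
  have [measurable_cong]: "sets \<rho> = sets borel" using assms by (simp add: levy_measure_def)
  show ?thesis using assms by (intro integrableI_bounded) (auto simp: levy_measure_def)
qed

lemma levy_measure_integrableI:
  fixes f :: "real \<Rightarrow> 'b :: {banach, second_countable_topology}"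
  assumes "levy_measure \<rho>" and [measurable]: "f \<in> borel_measurable borel"
    and "\<And>x. norm (f x) \<le> B * min 1 (x\<^sup>2)"
  shows "integrable \<rho> f"
proof -
  have [measurable_cong]: "sets \<rho> = sets borel" using assms by (simp add: levy_measure_def)
  show ?thesis
    by (rule Bochner_Integration.integrable_bound[OF integrable_mult_right[OF levy_measure_integrable[OF assms(1)], of B]])
       (auto intro!: AE_I2 order_trans[OF assms(3) abs_ge_self])
qed

lemma integrable_levy_integrand:
  assumes "levy_measure \<rho>"
  shows "complex_integrable \<rho> (\<lambda>x. iexp (\<theta> * x) - 1 - \<i> * complex_of_real (\<theta> * tau1 x))"
  by (rule levy_measure_integrableI[OF assms _ norm_levy_integrand_le]) measurable

lemma continuous_levy_jump:
  assumes "levy_measure \<rho>" shows "continuous_on UNIV (levy_jump \<rho>)"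
  unfolding continuous_on_sequentially
proof (intro allI ballI impI)
  have [measurable_cong]: "sets \<rho> = sets borel" using assms by (simp add: levy_measure_def)
  fix x :: "nat \<Rightarrow> real" and a assume "(\<forall>n. x n \<in> UNIV) \<and> x \<longlonglongrightarrow> a"
  then have x: "x \<longlonglongrightarrow> a" by simp
  then obtain K where K: "\<And>n. \<bar>x n\<bar> \<le> K"
    using convergent_imp_Bseq[OF convergentI[OF x]] by (auto simp: Bseq_def)
  show "(levy_jump \<rho> \<circ> x) \<longlonglongrightarrow> levy_jump \<rho> a"
    unfolding levy_jump_def comp_def
  proof (rule integral_dominated_convergence[where w="\<lambda>y. (2 + K + K\<^sup>2) * min 1 (y\<^sup>2)"])
    show "AE y in \<rho>. (\<lambda>i. iexp (x i * y) - 1 - \<i> * complex_of_real (x i * tau1 y)) \<longlonglongrightarrow>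
       iexp (a * y) - 1 - \<i> * complex_of_real (a * tau1 y)"
      by (intro AE_I2 tendsto_intros x)
    show "AE y in \<rho>. cmod (iexp (x i * y) - 1 - \<i> * complex_of_real (x i * tau1 y)) \<le> (2 + K + K\<^sup>2) * min 1 (y\<^sup>2)" for i
    proof (rule AE_I2, rule order_trans[OF norm_levy_integrand_le], rule mult_right_mono)
      have "(x i)\<^sup>2 \<le> K\<^sup>2" using K[of i] power_mono[of "\<bar>x i\<bar>" K 2] by simp
      then show "2 + \<bar>x i\<bar> + (x i)\<^sup>2 \<le> 2 + K + K\<^sup>2" using K[of i] by simp
    qed simp
  qed (use levy_measure_integrable[OF assms] in auto)
qed

text \<open>Jumps of size at most 1 / (n + 1) are cut off. What remains is a finite measure whose
  compensator is an explicit drift, and dominated convergence removes the cut because \<rho> has no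
  mass at 0.\<close>

lemma id_exponent1_levy_jump:
  assumes \<rho>: "levy_measure \<rho>" shows "id_exponent1 (levy_jump \<rho>)"
proof -
  have [measurable_cong]: "sets \<rho> = sets borel" using \<rho> by (simp add: levy_measure_def)
  have \<rho>0: "AE x in \<rho>. x \<noteq> 0"
  proof (rule AE_I[of _ _ "{0}"])
    show "emeasure \<rho> {0} = 0" using \<rho> by (simp add: levy_measure_def)
  qed auto
  define A where "A n = {x::real. 1 / real (Suc n) < \<bar>x\<bar>}" for n
  have [measurable]: "A n \<in> sets borel" for n unfolding A_def by measurable
  have A: "indicator (A n) x \<le> (real (Suc n))\<^sup>2 * min 1 (x\<^sup>2)" for n x
  proof (cases "x \<in> A n")
    case True
    then have "1 \<le> real (Suc n) * \<bar>x\<bar>" by (simp add: A_def field_simps del: of_nat_Suc)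
    then have "1 \<le> (real (Suc n) * \<bar>x\<bar>)\<^sup>2" by simp
    then have "1 \<le> (real (Suc n))\<^sup>2 * x\<^sup>2" by (simp add: power_mult_distrib)
    then show ?thesis using True by (simp add: min_def)
  qed (simp)
  define \<sigma> where "\<sigma> n = density \<rho> (indicator (A n))" for n
  have iA: "integrable \<rho> (indicat_real (A n))" for n
    by (rule levy_measure_integrableI[OF \<rho>, where B="(real (Suc n))\<^sup>2"]) (use A in \<open>auto simp del: of_nat_Suc\<close>)
  have fin: "finite_measure (\<sigma> n)" for n
  proof
    have "emeasure (\<sigma> n) (space (\<sigma> n)) = (\<integral>\<^sup>+x. ennreal (indicat_real (A n) x) \<partial>\<rho>)"
      unfolding \<sigma>_def by (simp add: emeasure_density ennreal_indicator cong: nn_integral_cong)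
    then show "emeasure (\<sigma> n) (space (\<sigma> n)) \<noteq> \<infinity>"
      using integrableD(2)[OF iA[of n]] by (simp add: nn_integral_eq_integral[OF iA])
  qed
  define d where "d n = - (LINT x|\<rho>. indicator (A n) x * tau1 x)" for n
  have iT: "integrable \<rho> (\<lambda>x. indicator (A n) x * tau1 x)" for n
    by (rule Bochner_Integration.integrable_bound[OF iA[of n]]) (use abs_tau1_le_1 in \<open>auto split: split_indicator\<close>)
  let ?h = "\<lambda>\<theta> x. iexp (\<theta> * x) - 1 - \<i> * complex_of_real (\<theta> * tau1 x)"
  have iE: "complex_integrable \<rho> (\<lambda>x. indicator (A n) x *\<^sub>R (iexp (\<theta> * x) - 1))" for n \<theta>
  proof (rule Bochner_Integration.integrable_bound[OF integrable_mult_right[OF iA[of n], of 2]])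
    have "norm (iexp (\<theta> * x) - 1) \<le> 2" for x
      by (rule order_trans[OF norm_triangle_ineq4]) simp
    then show "AE x in \<rho>. cmod (indicat_real (A n) x *\<^sub>R (iexp (\<theta> * x) - 1)) \<le> norm (2 * indicat_real (A n) x)"
      by (auto split: split_indicator)
  qed auto
  have eq: "(CLINT x|\<sigma> n. iexp (\<theta> * x) - 1) + \<i> * complex_of_real (d n * \<theta>) =
    (CLINT x|\<rho>. indicator (A n) x *\<^sub>R ?h \<theta> x)" for n \<theta>
  proof -
    have "(CLINT x|\<rho>. indicator (A n) x *\<^sub>R ?h \<theta> x) =
      (CLINT x|\<rho>. indicator (A n) x *\<^sub>R (iexp (\<theta> * x) - 1) - \<i> * \<theta> * complex_of_real (indicator (A n) x * tau1 x))"
      by (intro Bochner_Integration.integral_cong) (auto split: split_indicator)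
    also have "\<dots> = (CLINT x|\<rho>. indicator (A n) x *\<^sub>R (iexp (\<theta> * x) - 1)) -
      (CLINT x|\<rho>. \<i> * \<theta> * complex_of_real (indicator (A n) x * tau1 x))"
      using iT[of n] by (intro Bochner_Integration.integral_diff iE integrable_mult_right integrable_of_real)
    also have "(CLINT x|\<rho>. \<i> * \<theta> * complex_of_real (indicator (A n) x * tau1 x)) = - \<i> * complex_of_real (d n * \<theta>)"
      by (simp only: integral_mult_right_zero integral_complex_of_real) (simp add: d_def)
    also have "(CLINT x|\<rho>. indicator (A n) x *\<^sub>R (iexp (\<theta> * x) - 1)) = (CLINT x|\<sigma> n. iexp (\<theta> * x) - 1)"
      unfolding \<sigma>_def ennreal_indicator[symmetric] by (rule integral_density[symmetric]) auto
    finally show ?thesis by simp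
  qed
  show ?thesis
  proof (rule id_exponent_limit)
    show "id_exponent1 (\<lambda>\<theta>. (CLINT x|\<sigma> n. iexp (\<theta> * x) - 1) + \<i> * complex_of_real (d n * \<theta>))" for n
      by (intro id_exponent_add id_exponent1_drift id_exponent1_finite_measure[OF fin])
         (use \<rho> in \<open>simp add: \<sigma>_def levy_measure_def\<close>)
    show "ray_continuous (\<lambda>\<theta>. levy_jump \<rho> (\<theta> ()))"
      by (rule ray_continuous1[OF continuous_levy_jump[OF \<rho>]])
    fix \<theta> :: "unit \<Rightarrow> real"
    show "(\<lambda>n. (CLINT x|\<sigma> n. iexp (\<theta> () * x) - 1) + \<i> * complex_of_real (d n * \<theta> ())) \<longlonglongrightarrow> levy_jump \<rho> (\<theta> ())"
      unfolding eq levy_jump_def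
    proof (rule integral_dominated_convergence[where w="\<lambda>x. (2 + \<bar>\<theta> ()\<bar> + (\<theta> ())\<^sup>2) * min 1 (x\<^sup>2)"])
      show "AE x in \<rho>. (\<lambda>n. indicator (A n) x *\<^sub>R ?h (\<theta> ()) x) \<longlonglongrightarrow> ?h (\<theta> ()) x"
        using \<rho>0
      proof eventually_elim
        case (elim x)
        then obtain m where m: "1 / real (Suc m) < \<bar>x\<bar>" using nat_approx_posE[of "\<bar>x\<bar>"] by auto
        have "x \<in> A n" if "m \<le> n" for n
        proof -
          have "1 / real (Suc n) \<le> 1 / real (Suc m)" using that by (simp add: frac_le)
          then show ?thesis using m by (simp add: A_def)
        qed
        then show ?case
          by (intro tendsto_eventually) (auto simp: eventually_sequentially intro!: exI[of _ m])
      qed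
      show "AE x in \<rho>. cmod (indicator (A n) x *\<^sub>R ?h (\<theta> ()) x) \<le> (2 + \<bar>\<theta> ()\<bar> + (\<theta> ())\<^sup>2) * min 1 (x\<^sup>2)" for n
        using norm_levy_integrand_le by (auto split: split_indicator)
    qed (use levy_measure_integrable[OF \<rho>] in auto)
  qed simp
qed

lemma id_exponent1_levy_khintchine:
  assumes "levy_measure \<rho>" "0 \<le> \<beta>"
  shows "id_exponent1 (\<lambda>\<theta>. \<i> * complex_of_real (\<gamma> * \<theta>) - complex_of_real (\<beta> * \<theta>\<^sup>2 / 2) + levy_jump \<rho> \<theta>)"
  using id_exponent_add[OF id_exponent_add[OF id_exponent1_drift id_exponent1_gaussian[OF assms(2)]]
      id_exponent1_levy_jump[OF assms(1)]]
  by simp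

lemma lk_exponent_eq:
  "lk_exponent \<gamma> b \<rho> \<theta> =
     \<i> * complex_of_real (\<gamma> * \<theta>) - complex_of_real (b\<^sup>2 * \<theta>\<^sup>2 / 2) + levy_jump \<rho> \<theta>"
  by (simp add: lk_exponent_def levy_jump_def)

lemma min_one_square_mono: "\<bar>x\<bar> \<le> \<bar>y\<bar> \<Longrightarrow> min 1 (x\<^sup>2) \<le> min 1 (y\<^sup>2)" for x y :: real
  by (simp add: abs_le_square_iff min_le_iff_disj)

lemma min_one_square_add: "min 1 ((a + b)\<^sup>2) \<le> 2 * min 1 (a\<^sup>2) + 2 * min 1 (b\<^sup>2)" for a b :: real
proof -
  have "(a + b)\<^sup>2 \<le> 2 * a\<^sup>2 + 2 * b\<^sup>2" using zero_le_power2[of "a - b"] by (simp add: power2_eq_square algebra_simps)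
  moreover have "min 1 A \<le> 2 * min 1 a + 2 * min 1 b" if "A \<le> 2 * a + 2 * b" "0 \<le> a" "0 \<le> b" for A a b :: real
    using that by (auto simp: min_def)
  ultimately show ?thesis by simp
qed

lemma min_one_square_scale: "min 1 ((x * r)\<^sup>2) \<le> (1 + r\<^sup>2) * min 1 (x\<^sup>2)" for x r :: real
proof (cases "x\<^sup>2 \<le> 1")
  case True
  have "(x * r)\<^sup>2 \<le> (1 + r\<^sup>2) * x\<^sup>2" by (simp add: power_mult_distrib algebra_simps)
  then show ?thesis using True by (simp add: min_absorb2 min_le_iff_disj)
next
  case False
  then have "min 1 (x\<^sup>2) = 1" by simp
  then show ?thesis using min.cobounded1[of 1 "(x * r)\<^sup>2"] by (simp add: add_increasing2 min.coboundedI1)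
qed

text \<open>\<open>tau1\<close> is additive when |a| + |b| \<le> 1. Otherwise the defect is at most
  3, and 1 is bounded through \<open>min_one_square_add\<close>, which has the factor 2; hence
  6.\<close>

lemma tau1_add_le: "\<bar>tau1 (a + b) - tau1 a - tau1 b\<bar> \<le> 6 * min 1 (a\<^sup>2) + 6 * min 1 (b\<^sup>2)"
proof (cases "\<bar>a\<bar> + \<bar>b\<bar> \<le> 1")
  case True
  then have "\<bar>a\<bar> \<le> 1" "\<bar>b\<bar> \<le> 1" "\<bar>a + b\<bar> \<le> 1" by linarith+
  then show ?thesis by (simp add: tau1_eq)
next
  case False
  have "\<bar>tau1 (a + b) - tau1 a - tau1 b\<bar> \<le> 3"
    using abs_tau1_le_1[of "a + b"] abs_tau1_le_1[of a] abs_tau1_le_1[of b] by linarith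
  moreover have "1 \<le> (\<bar>a\<bar> + \<bar>b\<bar>)\<^sup>2" using False by simp
  then have "min 1 ((\<bar>a\<bar> + \<bar>b\<bar>)\<^sup>2) = 1" by simp
  ultimately show ?thesis using min_one_square_add[of "\<bar>a\<bar>" "\<bar>b\<bar>"] by simp
qed

text \<open>The defect vanishes unless |x| or |x r| exceeds 1, and in these cases (1 + r^2) min 1
  (x^2) is at least 1.\<close>

lemma tau1_scale_le: "\<bar>tau1 (x * r) - r * tau1 x\<bar> \<le> (1 + \<bar>r\<bar>) * (1 + r\<^sup>2) * min 1 (x\<^sup>2)"
proof -
  have le: "\<bar>tau1 (x * r) - r * tau1 x\<bar> \<le> 1 + \<bar>r\<bar>"
  proof -
    have "\<bar>r * tau1 x\<bar> \<le> \<bar>r\<bar>" using mult_left_mono[OF abs_tau1_le_1[of x], of "\<bar>r\<bar>"] by (simp add: abs_mult)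
    then show ?thesis using abs_tau1_le_1[of "x * r"] by linarith
  qed
  consider "\<bar>x\<bar> \<le> 1" "\<bar>x * r\<bar> \<le> 1" | "1 < \<bar>x\<bar>" | "\<bar>x\<bar> \<le> 1" "1 < \<bar>x * r\<bar>" by linarith
  then have "tau1 (x * r) - r * tau1 x = 0 \<or> 1 \<le> (1 + r\<^sup>2) * min 1 (x\<^sup>2)"
  proof cases
    case 1 then show ?thesis by (simp add: tau1_eq)
  next
    case 2
    then have "1 \<le> x\<^sup>2" using abs_le_square_iff[of 1 x] by simp
    then show ?thesis by (simp add: min_absorb1)
  next
    case 3
    then have "x\<^sup>2 \<le> 1" "1 \<le> (x * r)\<^sup>2" using abs_le_square_iff[of x 1] abs_le_square_iff[of 1 "x * r"] by simp_all
    then have "1 \<le> r\<^sup>2 * min 1 (x\<^sup>2)" by (simp add: min_absorb2 power_mult_distrib mult.commute)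
    then show ?thesis by (simp add: distrib_right add_increasing)
  qed
  then show ?thesis
  proof
    assume *: "1 \<le> (1 + r\<^sup>2) * min 1 (x\<^sup>2)"
    have "1 + \<bar>r\<bar> \<le> (1 + \<bar>r\<bar>) * ((1 + r\<^sup>2) * min 1 (x\<^sup>2))"
      using mult_left_mono[OF *, of "1 + \<bar>r\<bar>"] by simp
    then show ?thesis using le by (simp add: mult.assoc)
  qed simp
qed

section \<open>The function Phi_0\<close>

text \<open>The drift of r times a variable with drift \<gamma> and jump measure \<rho>, once its
  jumps x r are compensated by \<open>tau1 (x * r)\<close>.\<close>

definition comp_drift :: "real \<Rightarrow> real measure \<Rightarrow> real \<Rightarrow> real" where
  "comp_drift \<gamma> \<rho> r = \<gamma> * r + (\<integral>x. (tau1 (x * r) - r * tau1 x) \<partial>\<rho>)"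

lemma Phi0_eq:
  "Phi0 \<gamma> b \<rho> r = (\<Squnion>c\<in>{-1..1}. ennreal \<bar>comp_drift \<gamma> \<rho> (c * r)\<bar>) + ennreal (b\<^sup>2 * r\<^sup>2)
     + (\<integral>\<^sup>+x. ennreal (min 1 ((x * r)\<^sup>2)) \<partial>\<rho>)"
proof -
  have "indicator {x. \<bar>x * r\<bar> > 1} x + (x * r)\<^sup>2 * indicator {x. \<bar>x * r\<bar> \<le> 1} x = min 1 ((x * r)\<^sup>2)" for x
    using abs_le_square_iff[of 1 "x * r"] abs_le_square_iff[of "x * r" 1]
    by (auto simp: min_def split: split_indicator)
  then show ?thesis by (simp add: Phi0_def comp_drift_def mult.assoc)
qed

locale levy_triplet =
  fixes \<gamma> b :: real and \<rho> :: "real measure"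
  assumes levy: "levy_measure \<rho>"
begin

abbreviation "\<Phi> \<equiv> Phi0 \<gamma> b \<rho>"
abbreviation "U \<equiv> comp_drift \<gamma> \<rho>"
abbreviation "V r \<equiv> \<integral>\<^sup>+x. ennreal (min 1 ((x * r)\<^sup>2)) \<partial>\<rho>"

lemma sets_rho [measurable_cong]: "sets \<rho> = sets borel"
  using levy by (simp add: levy_measure_def)

lemma integrable_tau1_scale: "integrable \<rho> (\<lambda>x. tau1 (x * r) - r * tau1 x)"
  by (rule levy_measure_integrableI[OF levy, where B="(1 + \<bar>r\<bar>) * (1 + r\<^sup>2)"]) (use tau1_scale_le in auto)

lemma integrable_min_one_square: "integrable \<rho> (\<lambda>x. min 1 ((x * r)\<^sup>2))"
  by (rule levy_measure_integrableI[OF levy, where B="1 + r\<^sup>2"]) (use min_one_square_scale in auto)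

lemma V_eq: "V r = ennreal (LINT x|\<rho>. min 1 ((x * r)\<^sup>2))"
  by (rule nn_integral_eq_integral[OF integrable_min_one_square]) simp

lemma V_finite: "V r < \<infinity>"
  by (simp add: V_eq)

lemma abs_U_le: "\<bar>U r\<bar> \<le> \<bar>\<gamma>\<bar> * \<bar>r\<bar> + (1 + \<bar>r\<bar>) * (1 + r\<^sup>2) * (LINT x|\<rho>. min 1 (x\<^sup>2))"
proof -
  have "\<bar>LINT x|\<rho>. tau1 (x * r) - r * tau1 x\<bar> \<le> (LINT x|\<rho>. \<bar>tau1 (x * r) - r * tau1 x\<bar>)"
    by (rule integral_abs_bound)
  also have "\<dots> \<le> (LINT x|\<rho>. (1 + \<bar>r\<bar>) * (1 + r\<^sup>2) * min 1 (x\<^sup>2))"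
    using integrable_tau1_scale levy_measure_integrable[OF levy] tau1_scale_le
    by (intro integral_mono) auto
  finally show ?thesis
    unfolding comp_drift_def by (simp add: abs_mult[symmetric])
qed

lemma SUP_U_finite: "(\<Squnion>c\<in>{-1..1}. ennreal \<bar>U (c * r)\<bar>) < \<infinity>"
proof -
  let ?I = "LINT x|\<rho>. min 1 (x\<^sup>2)"
  have I: "0 \<le> ?I" by (rule integral_nonneg_AE) simp
  have "\<bar>U (c * r)\<bar> \<le> \<bar>\<gamma>\<bar> * \<bar>r\<bar> + (1 + \<bar>r\<bar>) * (1 + r\<^sup>2) * ?I" if "c \<in> {-1..1}" for c
  proof -
    have c: "\<bar>c * r\<bar> \<le> \<bar>r\<bar>" using that by (simp add: abs_mult abs_le_iff mult_left_le_one_le)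
    then have c2: "(c * r)\<^sup>2 \<le> r\<^sup>2" by (simp only: abs_le_square_iff)
    have "\<bar>U (c * r)\<bar> \<le> \<bar>\<gamma>\<bar> * \<bar>c * r\<bar> + (1 + \<bar>c * r\<bar>) * (1 + (c * r)\<^sup>2) * ?I" by (rule abs_U_le)
    also have "\<dots> \<le> \<bar>\<gamma>\<bar> * \<bar>r\<bar> + (1 + \<bar>r\<bar>) * (1 + r\<^sup>2) * ?I"
      using c c2 I by (intro add_mono mult_mono) auto
    finally show ?thesis .
  qed
  then have "(\<Squnion>c\<in>{-1..1}. ennreal \<bar>U (c * r)\<bar>) \<le> ennreal (\<bar>\<gamma>\<bar> * \<bar>r\<bar> + (1 + \<bar>r\<bar>) * (1 + r\<^sup>2) * ?I)"
    by (intro SUP_least ennreal_leI)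
  then show ?thesis by (rule le_less_trans) simp
qed

lemma Phi0_finite: "\<Phi> r < \<infinity>"
  unfolding Phi0_eq using SUP_U_finite[of r] V_finite[of r] by (simp add: ennreal_add_eq_top less_top)

lemma Phi0_0: "\<Phi> 0 = 0"
  unfolding Phi0_eq by (simp add: comp_drift_def tau1_def)

lemma U_le_SUP: "\<bar>r\<bar> \<le> r' \<Longrightarrow> ennreal \<bar>U r\<bar> \<le> (\<Squnion>c\<in>{-1..1}. ennreal \<bar>U (c * r')\<bar>)"
proof (rule SUP_upper2[of "if r' = 0 then 0 else r / r'"])
  assume "\<bar>r\<bar> \<le> r'"
  then show "(if r' = 0 then 0 else r / r') \<in> {-1..1}" by (auto simp: field_simps abs_le_iff)
  show "ennreal \<bar>U r\<bar> \<le> ennreal \<bar>U ((if r' = 0 then 0 else r / r') * r')\<bar>" using \<open>\<bar>r\<bar> \<le> r'\<close> by auto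
qed

lemma V_mono: "\<bar>r\<bar> \<le> \<bar>r'\<bar> \<Longrightarrow> V r \<le> V r'"
  by (intro nn_integral_mono ennreal_leI min_one_square_mono) (simp add: abs_mult mult_left_mono)

lemma Phi0_mono:
  assumes "0 \<le> r" "r \<le> r'" shows "\<Phi> r \<le> \<Phi> r'"
  unfolding Phi0_eq
proof (intro add_mono V_mono SUP_least)
  fix c :: real assume "c \<in> {-1..1}"
  then have "\<bar>c * r\<bar> \<le> r" using assms by (simp add: abs_mult abs_le_iff mult_left_le_one_le)
  then show "ennreal \<bar>U (c * r)\<bar> \<le> (\<Squnion>c\<in>{-1..1}. ennreal \<bar>U (c * r')\<bar>)" using assms by (intro U_le_SUP) simp
qed (use assms in \<open>auto intro!: ennreal_leI mult_left_mono power_mono\<close>)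

text \<open>The supremum in \<open>Phi0\<close> runs over an uncountable set; measurability comes
  from monotonicity on the nonnegative half-line.\<close>

lemma measurable_Phi0_abs [measurable]: "(\<lambda>r. \<Phi> \<bar>r\<bar>) \<in> borel_measurable borel"
proof -
  define F where "F r = enn2real (\<Phi> (max 0 r))" for r
  have "mono F"
    unfolding F_def by (intro monoI enn2real_mono Phi0_mono) (use Phi0_finite in auto)
  then have [measurable]: "F \<in> borel_measurable borel" by (rule borel_measurable_mono)
  have "\<Phi> \<bar>r\<bar> = ennreal (F \<bar>r\<bar>)" for r
    unfolding F_def using Phi0_finite[of "\<bar>r\<bar>"] by (simp add: max_absorb2)
  then show ?thesis by simp
qed

text \<open>The defect of additivity of \<open>U\<close> is the integral of the defect of additivity
  of \<open>tau1\<close>.\<close>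

lemma U_add: "\<bar>U (r + s)\<bar> \<le> \<bar>U r\<bar> + \<bar>U s\<bar> + 6 * (LINT x|\<rho>. min 1 ((x * r)\<^sup>2)) + 6 * (LINT x|\<rho>. min 1 ((x * s)\<^sup>2))"
proof -
  let ?d = "\<lambda>x. tau1 (x * (r + s)) - tau1 (x * r) - tau1 (x * s)"
  have d: "?d = (\<lambda>x. (tau1 (x * (r + s)) - (r + s) * tau1 x) - (tau1 (x * r) - r * tau1 x) - (tau1 (x * s) - s * tau1 x))"
    by (simp add: fun_eq_iff algebra_simps)
  have di: "integrable \<rho> ?d"
    unfolding d by (intro Bochner_Integration.integrable_diff integrable_tau1_scale)
  have "(LINT x|\<rho>. ?d x) = U (r + s) - U r - U s"
    unfolding d comp_drift_def
    by (simp add: integrable_tau1_scale) (simp add: algebra_simps)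
  moreover have "\<bar>LINT x|\<rho>. ?d x\<bar> \<le> (LINT x|\<rho>. 6 * min 1 ((x * r)\<^sup>2) + 6 * min 1 ((x * s)\<^sup>2))"
  proof (rule order_trans[OF integral_abs_bound integral_mono])
    show "\<bar>?d x\<bar> \<le> 6 * min 1 ((x * r)\<^sup>2) + 6 * min 1 ((x * s)\<^sup>2)" for x
      using tau1_add_le[of "x * r" "x * s"] by (simp add: distrib_left)
  qed (intro integrable_abs di Bochner_Integration.integrable_add integrable_mult_right integrable_min_one_square)+
  moreover have "(LINT x|\<rho>. 6 * min 1 ((x * r)\<^sup>2) + 6 * min 1 ((x * s)\<^sup>2)) =
     6 * (LINT x|\<rho>. min 1 ((x * r)\<^sup>2)) + 6 * (LINT x|\<rho>. min 1 ((x * s)\<^sup>2))"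
    using integrable_min_one_square by simp
  ultimately show ?thesis by linarith
qed

text \<open>The 8 collects, in front of \<open>V\<close>, the 6 from the drift and the 2 from the
  jump term itself.\<close>

lemma Phi0_add:
  assumes "0 \<le> r" "0 \<le> s"
  shows "\<Phi> (r + s) \<le> 8 * (\<Phi> r + \<Phi> s)"
proof -
  let ?S = "\<lambda>r. \<Squnion>c\<in>{-1..1}. ennreal \<bar>U (c * r)\<bar>"
  let ?B = "\<lambda>r. ennreal (b\<^sup>2 * r\<^sup>2)"
  have S: "?S (r + s) \<le> ?S r + ?S s + 6 * V r + 6 * V s"
  proof (rule SUP_least)
    fix c :: real assume c: "c \<in> {-1..1}"
    have cr: "\<bar>c * r\<bar> \<le> r" "\<bar>c * s\<bar> \<le> s" using c assms by (simp_all add: abs_mult abs_le_iff mult_left_le_one_le)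
    have I: "0 \<le> (LINT x|\<rho>. min 1 ((x * r)\<^sup>2))" for r by (rule integral_nonneg_AE) simp
    have "ennreal \<bar>U (c * (r + s))\<bar> \<le> ennreal (\<bar>U (c * r)\<bar> + \<bar>U (c * s)\<bar> +
        6 * (LINT x|\<rho>. min 1 ((x * (c * r))\<^sup>2)) + 6 * (LINT x|\<rho>. min 1 ((x * (c * s))\<^sup>2)))"
      using U_add[of "c * r" "c * s"] by (intro ennreal_leI) (simp add: distrib_left)
    also have "\<dots> = ennreal \<bar>U (c * r)\<bar> + ennreal \<bar>U (c * s)\<bar> + 6 * V (c * r) + 6 * V (c * s)"
      using I by (simp add: V_eq ennreal_plus ennreal_mult'' ennreal_mult)
    also have "\<dots> \<le> ?S r + ?S s + 6 * V r + 6 * V s"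
      using cr c assms by (intro add_mono mult_left_mono V_mono SUP_upper) auto
    finally show "ennreal \<bar>U (c * (r + s))\<bar> \<le> ?S r + ?S s + 6 * V r + 6 * V s" .
  qed
  have V: "V (r + s) \<le> 2 * V r + 2 * V s"
  proof -
    have "V (r + s) \<le> (\<integral>\<^sup>+x. 2 * ennreal (min 1 ((x * r)\<^sup>2)) + 2 * ennreal (min 1 ((x * s)\<^sup>2)) \<partial>\<rho>)"
    proof (rule nn_integral_mono)
      fix x
      have "ennreal (min 1 ((x * (r + s))\<^sup>2)) \<le> ennreal (2 * min 1 ((x * r)\<^sup>2) + 2 * min 1 ((x * s)\<^sup>2))"
        using min_one_square_add[of "x * r" "x * s"] by (intro ennreal_leI) (simp add: distrib_left)
      then show "ennreal (min 1 ((x * (r + s))\<^sup>2)) \<le> 2 * ennreal (min 1 ((x * r)\<^sup>2)) + 2 * ennreal (min 1 ((x * s)\<^sup>2))"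
        by (simp add: ennreal_plus ennreal_mult)
    qed
    then show ?thesis by (simp add: nn_integral_add nn_integral_cmult)
  qed
  have B: "?B (r + s) \<le> 2 * ?B r + 2 * ?B s"
  proof -
    have "(r + s)\<^sup>2 \<le> 2 * r\<^sup>2 + 2 * s\<^sup>2" using zero_le_power2[of "r - s"] by (simp add: power2_eq_square algebra_simps)
    then have "b\<^sup>2 * (r + s)\<^sup>2 \<le> b\<^sup>2 * (2 * r\<^sup>2 + 2 * s\<^sup>2)" by (rule mult_left_mono) simp
    then have "?B (r + s) \<le> ennreal (2 * (b\<^sup>2 * r\<^sup>2) + 2 * (b\<^sup>2 * s\<^sup>2))" by (intro ennreal_leI) (simp add: algebra_simps)
    then show ?thesis by (simp add: ennreal_plus ennreal_mult)
  qed
  have "\<Phi> (r + s) \<le> (?S r + ?S s + 6 * V r + 6 * V s) + (2 * ?B r + 2 * ?B s) + (2 * V r + 2 * V s)"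
    unfolding Phi0_eq by (intro add_mono S V B)
  also have "\<dots> = (1 * ?S r + 2 * ?B r + 8 * V r) + (1 * ?S s + 2 * ?B s + 8 * V s)"
  proof -
    have "6 * v + 2 * v = 8 * v" for v :: ennreal
      by (simp flip: distrib_right)
    then show ?thesis by (simp add: add_ac flip: \<open>\<And>v. 6 * v + 2 * v = 8 * v\<close>)
  qed
  also have "\<dots> \<le> (8 * ?S r + 8 * ?B r + 8 * V r) + (8 * ?S s + 8 * ?B s + 8 * V s)"
    by (intro add_mono mult_right_mono) simp_all
  also have "\<dots> = 8 * (\<Phi> r + \<Phi> s)" unfolding Phi0_eq by (simp add: distrib_left)
  finally show ?thesis .
qed

text \<open>Integer factors by iterating \<open>Phi0_add\<close>, all others by
  monotonicity.\<close>

lemma Phi0_scale: "\<exists>C<\<infinity>. \<forall>r\<ge>0. \<Phi> (c * r) \<le> C * \<Phi> r" if "0 \<le> c"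
proof -
  have n: "\<exists>C<\<infinity>. \<forall>r\<ge>0. \<Phi> (real n * r) \<le> C * \<Phi> r" for n
  proof (induction n)
    case 0 then show ?case by (intro exI[of _ 0]) (simp add: Phi0_0)
  next
    case (Suc n)
    then obtain C where C: "C < \<infinity>" "\<And>r. 0 \<le> r \<Longrightarrow> \<Phi> (real n * r) \<le> C * \<Phi> r" by blast
    have "\<Phi> (real (Suc n) * r) \<le> 8 * (1 + C) * \<Phi> r" if "0 \<le> r" for r
    proof -
      have "\<Phi> (real (Suc n) * r) = \<Phi> (r + real n * r)" by (simp add: distrib_right)
      also have "\<dots> \<le> 8 * (\<Phi> r + \<Phi> (real n * r))" using that by (intro Phi0_add) auto
      also have "\<dots> \<le> 8 * (\<Phi> r + C * \<Phi> r)" using C(2)[OF that] by (intro mult_left_mono add_left_mono) auto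
      also have "\<dots> = 8 * (1 + C) * \<Phi> r" by (simp add: distrib_left distrib_right mult.assoc)
      finally show ?thesis .
    qed
    moreover have "8 * (1 + C) < \<infinity>" using C(1) by (simp add: ennreal_mult_less_top)
    ultimately show ?case by blast
  qed
  obtain m :: nat where m: "c \<le> m" using real_arch_simple by blast
  from n[of m] obtain C where C: "C < \<infinity>" "\<And>r. 0 \<le> r \<Longrightarrow> \<Phi> (real m * r) \<le> C * \<Phi> r" by blast
  have "\<Phi> (c * r) \<le> C * \<Phi> r" if "0 \<le> r" for r
    using Phi0_mono[of "c * r" "m * r"] C(2)[OF that] m that \<open>0 \<le> c\<close> by (auto intro: mult_right_mono order_trans)
  with C(1) show ?thesis by blast
qed

text \<open>Linear combinations of integrable kernels are integrable. The absolute values stay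
  inside the sum so that it can serve as a dominating radius.\<close>

lemma nn_integral_Phi0_sum_finite:
  fixes f :: "'i \<Rightarrow> 'x \<Rightarrow> real"
  assumes "finite J" "\<And>j. j \<in> J \<Longrightarrow> f j \<in> borel_measurable N"
    and "\<And>j. j \<in> J \<Longrightarrow> (\<integral>\<^sup>+s. \<Phi> \<bar>f j s\<bar> \<partial>N) < \<infinity>" and "\<And>j. j \<in> J \<Longrightarrow> 0 \<le> c j"
  shows "(\<integral>\<^sup>+s. \<Phi> (\<Sum>j\<in>J. c j * \<bar>f j s\<bar>) \<partial>N) < \<infinity>"
  using assms
proof (induction J rule: finite_induct)
  case empty
  then show ?case by (simp add: Phi0_0)
next
  case (insert j J)
  have [measurable]: "f i \<in> borel_measurable N" if "i \<in> insert j J" for i using insert.prems that by blast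
  from Phi0_scale[of "c j"] insert.prems obtain C where
    C: "C < \<infinity>" "\<And>r. 0 \<le> r \<Longrightarrow> \<Phi> (c j * r) \<le> C * \<Phi> r" by blast
  let ?g = "\<lambda>s. \<Sum>i\<in>J. c i * \<bar>f i s\<bar>"
  have g0: "0 \<le> ?g s" for s using insert.prems by (intro sum_nonneg) auto
  have "(\<lambda>s. \<Phi> \<bar>?g s\<bar>) \<in> borel_measurable N" by measurable
  then have [measurable]: "(\<lambda>s. \<Phi> (?g s)) \<in> borel_measurable N" by (simp add: g0)
  have "(\<integral>\<^sup>+s. \<Phi> (\<Sum>i\<in>insert j J. c i * \<bar>f i s\<bar>) \<partial>N) \<le> (\<integral>\<^sup>+s. 8 * (C * \<Phi> \<bar>f j s\<bar> + \<Phi> (?g s)) \<partial>N)"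
  proof (rule nn_integral_mono)
    fix s
    have "\<Phi> (\<Sum>i\<in>insert j J. c i * \<bar>f i s\<bar>) = \<Phi> (c j * \<bar>f j s\<bar> + ?g s)" using insert.hyps by simp
    also have "\<dots> \<le> 8 * (\<Phi> (c j * \<bar>f j s\<bar>) + \<Phi> (?g s))"
      using g0 insert.prems by (intro Phi0_add) auto
    also have "\<dots> \<le> 8 * (C * \<Phi> \<bar>f j s\<bar> + \<Phi> (?g s))"
      using C(2)[of "\<bar>f j s\<bar>"] by (intro mult_left_mono add_right_mono) auto
    finally show "\<Phi> (\<Sum>i\<in>insert j J. c i * \<bar>f i s\<bar>) \<le> 8 * (C * \<Phi> \<bar>f j s\<bar> + \<Phi> (?g s))" .
  qed
  also have "\<dots> = 8 * (C * (\<integral>\<^sup>+s. \<Phi> \<bar>f j s\<bar> \<partial>N) + (\<integral>\<^sup>+s. \<Phi> (?g s) \<partial>N))"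
    by (simp add: nn_integral_cmult nn_integral_add)
  also have "\<dots> < \<infinity>"
    using C(1) insert by (simp add: ennreal_mult_less_top)
  finally show ?case .
qed

text \<open>The class contains the exponent of the basis and is closed under dilation differences,
  so every exponent met in the induction over m can be integrated along the field.\<close>

definition Phi0_bounded :: "(real \<Rightarrow> complex) \<Rightarrow> bool" where
  "Phi0_bounded \<phi> \<longleftrightarrow> continuous_on UNIV \<phi> \<and>
     (\<exists>C<\<infinity>. \<forall>r. ennreal (norm (\<phi> r)) \<le> C * \<Phi> \<bar>r\<bar>)"

lemma Phi0_bounded_0: "Phi0_bounded \<phi> \<Longrightarrow> \<phi> 0 = 0"
  unfolding Phi0_bounded_def using Phi0_0 by (metis abs_zero ennreal_eq_0_iff le_zero_eq mult_zero_right norm_le_zero_iff)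

lemma continuous_lk_exponent: "continuous_on UNIV (lk_exponent \<gamma> b \<rho>)"
  unfolding lk_exponent_eq[abs_def] by (intro continuous_intros continuous_levy_jump levy) auto

text \<open>Compensating with \<open>tau1 (x * r)\<close> in place of r \<open>tau1 x\<close> turns
  the drift into \<open>U r\<close>, and the remaining terms are then bounded by the parts of
  \<Phi>. The 4 is 2 + |\<theta>| + \<theta>^2 at \<theta> = 1.\<close>

lemma Phi0_bounded_lk_exponent: "Phi0_bounded (lk_exponent \<gamma> b \<rho>)"
  unfolding Phi0_bounded_def
proof (intro conjI exI allI continuous_lk_exponent)
  show "(4::ennreal) < \<infinity>" by simp
  fix r
  let ?I = "LINT x|\<rho>. min 1 ((x * \<bar>r\<bar>)\<^sup>2)"
  let ?e = "\<lambda>x. iexp (x * r) - 1 - \<i> * complex_of_real (tau1 (x * r))"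
  have I0: "0 \<le> ?I" by (rule integral_nonneg_AE) simp
  have e: "norm (?e x) \<le> 4 * min 1 ((x * \<bar>r\<bar>)\<^sup>2)" for x
    using norm_levy_integrand_le[of 1 "x * r"] by (simp add: power_mult_distrib)
  have ie: "complex_integrable \<rho> ?e"
    by (rule Bochner_Integration.integrable_bound[OF integrable_mult_right[OF integrable_min_one_square, of 4 "\<bar>r\<bar>"]])
       (use e in auto)
  have it: "complex_integrable \<rho> (\<lambda>x. \<i> * complex_of_real (tau1 (x * r) - r * tau1 x))"
    by (intro integrable_mult_right integrable_of_real integrable_tau1_scale)
  have "levy_jump \<rho> r = (CLINT x|\<rho>. ?e x + \<i> * complex_of_real (tau1 (x * r) - r * tau1 x))"
    unfolding levy_jump_def by (intro Bochner_Integration.integral_cong) (auto simp: algebra_simps)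
  also have "\<dots> = (CLINT x|\<rho>. ?e x) + \<i> * complex_of_real (LINT x|\<rho>. tau1 (x * r) - r * tau1 x)"
    by (subst Bochner_Integration.integral_add[OF ie it])
       (simp only: integral_mult_right_zero integral_complex_of_real)
  finally have eq: "lk_exponent \<gamma> b \<rho> r = \<i> * complex_of_real (U r) - complex_of_real (b\<^sup>2 * r\<^sup>2 / 2) + (CLINT x|\<rho>. ?e x)"
    unfolding lk_exponent_eq comp_drift_def by (simp add: algebra_simps)
  have "norm (CLINT x|\<rho>. ?e x) \<le> (LINT x|\<rho>. norm (?e x))" by (rule integral_norm_bound)
  also have "\<dots> \<le> (LINT x|\<rho>. 4 * min 1 ((x * \<bar>r\<bar>)\<^sup>2))"
    using ie integrable_min_one_square e by (intro integral_mono) auto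
  finally have "norm (CLINT x|\<rho>. ?e x) \<le> 4 * ?I" using integrable_min_one_square by simp
  then have "norm (lk_exponent \<gamma> b \<rho> r) \<le> \<bar>U r\<bar> + b\<^sup>2 * r\<^sup>2 / 2 + 4 * ?I"
    unfolding eq by (intro norm_triangle_le norm_triangle_le_diff add_mono) (auto simp: norm_mult norm_divide norm_power)
  also have "\<dots> \<le> \<bar>U r\<bar> + b\<^sup>2 * r\<^sup>2 + 4 * ?I" by simp
  finally have "ennreal (norm (lk_exponent \<gamma> b \<rho> r)) \<le> ennreal (\<bar>U r\<bar> + b\<^sup>2 * r\<^sup>2 + 4 * ?I)" by (rule ennreal_leI)
  also have "\<dots> = ennreal \<bar>U r\<bar> + ennreal (b\<^sup>2 * \<bar>r\<bar>\<^sup>2) + 4 * V \<bar>r\<bar>"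
    using I0 by (simp add: V_eq ennreal_plus ennreal_mult)
  also have "\<dots> \<le> 4 * (\<Squnion>c\<in>{-1..1}. ennreal \<bar>U (c * \<bar>r\<bar>)\<bar>) + 4 * ennreal (b\<^sup>2 * \<bar>r\<bar>\<^sup>2) + 4 * V \<bar>r\<bar>"
  proof (intro add_mono)
    have m: "x \<le> 4 * x" for x :: ennreal using mult_right_mono[of 1 4 x] by simp
    show "ennreal \<bar>U r\<bar> \<le> 4 * (\<Squnion>c\<in>{-1..1}. ennreal \<bar>U (c * \<bar>r\<bar>)\<bar>)"
      using U_le_SUP[of r "\<bar>r\<bar>"] m by (metis order_refl order_trans)
    show "ennreal (b\<^sup>2 * \<bar>r\<bar>\<^sup>2) \<le> 4 * ennreal (b\<^sup>2 * \<bar>r\<bar>\<^sup>2)" by (rule m)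
  qed simp
  also have "\<dots> = 4 * \<Phi> \<bar>r\<bar>" unfolding Phi0_eq by (simp add: distrib_left)
  finally show "ennreal (norm (lk_exponent \<gamma> b \<rho> r)) \<le> 4 * \<Phi> \<bar>r\<bar>" .
qed

lemma Phi0_bounded_dilation_diff:
  assumes "Phi0_bounded \<phi>" "1 < q"
  shows "Phi0_bounded (\<lambda>r. \<phi> r - \<phi> (r / q))"
proof -
  from assms(1) obtain C where C: "continuous_on UNIV \<phi>" "C < \<infinity>" "\<And>r. ennreal (norm (\<phi> r)) \<le> C * \<Phi> \<bar>r\<bar>"
    unfolding Phi0_bounded_def by blast
  have "ennreal (norm (\<phi> r - \<phi> (r / q))) \<le> (C + C) * \<Phi> \<bar>r\<bar>" for r
  proof -
    have "\<bar>r / q\<bar> \<le> \<bar>r\<bar>" using assms(2) by (simp add: divide_le_eq mult_left_mono[of 1 q "\<bar>r\<bar>", simplified])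
    then have m: "\<Phi> \<bar>r / q\<bar> \<le> \<Phi> \<bar>r\<bar>" by (intro Phi0_mono) auto
    have "ennreal (norm (\<phi> r - \<phi> (r / q))) \<le> ennreal (norm (\<phi> r) + norm (\<phi> (r / q)))"
      by (intro ennreal_leI norm_triangle_ineq4)
    also have "\<dots> = ennreal (norm (\<phi> r)) + ennreal (norm (\<phi> (r / q)))" by (simp add: ennreal_plus)
    also have "\<dots> \<le> C * \<Phi> \<bar>r\<bar> + C * \<Phi> \<bar>r\<bar>"
      using C(3)[of r] order_trans[OF C(3)[of "r / q"] mult_left_mono[OF m, of C]] by (intro add_mono) auto
    finally show ?thesis by (simp add: distrib_right)
  qed
  moreover have "C + C < \<infinity>" using C(2) by simp
  moreover have "continuous_on UNIV (\<lambda>r. \<phi> r - \<phi> (r / q))"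
    using assms(2) by (intro continuous_intros C(1) continuous_on_compose2[OF C(1)]) auto
  ultimately show ?thesis unfolding Phi0_bounded_def by blast
qed

end

section \<open>Exponents of the fields\<close>

definition field_exponent ::
  "real \<Rightarrow> 'i set \<Rightarrow> ('i \<Rightarrow> 'a::euclidean_space \<Rightarrow> real) \<Rightarrow> (real \<Rightarrow> complex) \<Rightarrow> ('i \<Rightarrow> real) \<Rightarrow> complex" where
  "field_exponent \<kappa> J f \<phi> \<theta> = complex_of_real \<kappa> * (CLINT s|lborel. \<phi> (\<Sum>j\<in>J. \<theta> j * f j s))"

context levy_triplet
begin

definition Phi0_integrable :: "('a::euclidean_space \<Rightarrow> real) \<Rightarrow> bool" where
  "Phi0_integrable f \<longleftrightarrow> f \<in> borel_measurable lborel \<and> (\<integral>\<^sup>+s. \<Phi> \<bar>f s\<bar> \<partial>lborel) < \<infinity>"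

lemma Phi0_bounded_measurable: "Phi0_bounded \<phi> \<Longrightarrow> \<phi> \<in> borel_measurable borel"
  unfolding Phi0_bounded_def by (auto intro: borel_measurable_continuous_onI)

text \<open>Monotonicity of \<Phi> lets one function of s dominate \<phi> on all arguments up to the
  radius at once. This serves limits along rays, with the radius scaled by a bound of the sequence,
  and limits of simple kernels, with factor 2.\<close>

lemma field_dominator:
  fixes f :: "'i \<Rightarrow> 'a::euclidean_space \<Rightarrow> real"
  assumes "finite J" and f: "\<And>j. j \<in> J \<Longrightarrow> Phi0_integrable (f j)" and \<phi>: "Phi0_bounded \<phi>"
    and c: "\<And>j. j \<in> J \<Longrightarrow> 0 \<le> c j"
  obtains w where "integrable lborel w" "\<And>s r. \<bar>r\<bar> \<le> (\<Sum>j\<in>J. c j * \<bar>f j s\<bar>) \<Longrightarrow> norm (\<phi> r) \<le> w s"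
proof -
  from \<phi> obtain C where C: "C < \<infinity>" "\<And>r. ennreal (norm (\<phi> r)) \<le> C * \<Phi> \<bar>r\<bar>"
    unfolding Phi0_bounded_def by blast
  have [measurable]: "f j \<in> borel_measurable borel" if "j \<in> J" for j
    using f[OF that] by (simp add: Phi0_integrable_def)
  define R where "R s = (\<Sum>j\<in>J. c j * \<bar>f j s\<bar>)" for s
  have R0: "0 \<le> R s" for s unfolding R_def using c by (intro sum_nonneg) auto
  have [measurable]: "R \<in> borel_measurable borel" unfolding R_def by measurable
  have "(\<lambda>s. \<Phi> \<bar>R s\<bar>) \<in> borel_measurable borel" by measurable
  then have [measurable]: "(\<lambda>s. \<Phi> (R s)) \<in> borel_measurable borel" by (simp add: R0)
  define w where "w s = enn2real (C * \<Phi> (R s))" for s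
  have fin: "C * \<Phi> (R s) < \<infinity>" for s using C(1) Phi0_finite by (simp add: ennreal_mult_less_top)
  then have w: "ennreal (w s) = C * \<Phi> (R s)" for s unfolding w_def by simp
  have "(\<integral>\<^sup>+s. \<Phi> (R s) \<partial>lborel) < \<infinity>"
    unfolding R_def using assms f by (intro nn_integral_Phi0_sum_finite) (auto simp: Phi0_integrable_def)
  moreover have "(\<integral>\<^sup>+s. ennreal (norm (w s)) \<partial>lborel) = (\<integral>\<^sup>+s. C * \<Phi> (R s) \<partial>lborel)"
    by (intro nn_integral_cong) (simp add: w[symmetric], simp add: w_def)
  ultimately have "(\<integral>\<^sup>+s. ennreal (norm (w s)) \<partial>lborel) < \<infinity>"
    using C(1) by (simp add: nn_integral_cmult ennreal_mult_less_top)
  moreover have "w \<in> borel_measurable lborel" unfolding w_def by measurable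
  ultimately have "integrable lborel w" by (intro integrableI_bounded)
  moreover have "norm (\<phi> r) \<le> w s" if "\<bar>r\<bar> \<le> (\<Sum>j\<in>J. c j * \<bar>f j s\<bar>)" for s r
  proof -
    have "ennreal (norm (\<phi> r)) \<le> C * \<Phi> \<bar>r\<bar>" by (rule C(2))
    also have "\<dots> \<le> C * \<Phi> (R s)" using that by (intro mult_left_mono Phi0_mono) (auto simp: R_def)
    also have "\<dots> = ennreal (w s)" by (simp add: w)
    finally show ?thesis by (simp add: w_def)
  qed
  ultimately show ?thesis by (rule that)
qed

lemma abs_sum_mult_le: "\<bar>\<Sum>j\<in>J. \<theta> j * y j\<bar> \<le> (\<Sum>j\<in>J. \<bar>\<theta> j\<bar> * \<bar>y j\<bar>)" for \<theta> y :: "'i \<Rightarrow> real"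
  by (rule order_trans[OF sum_abs]) (simp add: abs_mult)

lemma integrable_field:
  fixes f :: "'i \<Rightarrow> 'a::euclidean_space \<Rightarrow> real"
  assumes "finite J" and f: "\<And>j. j \<in> J \<Longrightarrow> Phi0_integrable (f j)" and \<phi>: "Phi0_bounded \<phi>"
  shows "complex_integrable lborel (\<lambda>s. \<phi> (\<Sum>j\<in>J. \<theta> j * f j s))"
proof -
  have [measurable]: "f j \<in> borel_measurable borel" if "j \<in> J" for j
    using f[OF that] by (simp add: Phi0_integrable_def)
  note [measurable] = Phi0_bounded_measurable[OF \<phi>]
  obtain w where w: "integrable lborel w" "\<And>s r. \<bar>r\<bar> \<le> (\<Sum>j\<in>J. \<bar>\<theta> j\<bar> * \<bar>f j s\<bar>) \<Longrightarrow> norm (\<phi> r) \<le> w s"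
    using field_dominator[where f=f and c="\<lambda>j. \<bar>\<theta> j\<bar>", OF assms] by auto
  show ?thesis
    by (rule Bochner_Integration.integrable_bound[OF w(1)])
       (auto intro!: AE_I2 order_trans[OF w(2)[OF abs_sum_mult_le] abs_ge_self])
qed

lemma ray_continuous_field_exponent:
  fixes f :: "'i \<Rightarrow> 'a::euclidean_space \<Rightarrow> real"
  assumes "finite J" and f: "\<And>j. j \<in> J \<Longrightarrow> Phi0_integrable (f j)" and \<phi>: "Phi0_bounded \<phi>"
  shows "ray_continuous (field_exponent \<kappa> J f \<phi>)"
  unfolding ray_continuous_def
proof (intro allI continuous_on_sequentially[THEN iffD2] ballI impI)
  have [measurable]: "f j \<in> borel_measurable borel" if "j \<in> J" for j
    using f[OF that] by (simp add: Phi0_integrable_def)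
  note [measurable] = Phi0_bounded_measurable[OF \<phi>]
  fix \<theta> :: "'i \<Rightarrow> real" and x :: "nat \<Rightarrow> real" and a
  assume "(\<forall>n. x n \<in> UNIV) \<and> x \<longlonglongrightarrow> a"
  then have x: "x \<longlonglongrightarrow> a" by simp
  then obtain K where K: "0 < K" "\<And>n. \<bar>x n\<bar> \<le> K"
    using convergent_imp_Bseq[OF convergentI[OF x]] by (auto simp: Bseq_def)
  obtain w where w: "integrable lborel w" "\<And>s r. \<bar>r\<bar> \<le> (\<Sum>j\<in>J. K * \<bar>\<theta> j\<bar> * \<bar>f j s\<bar>) \<Longrightarrow> norm (\<phi> r) \<le> w s"
    using field_dominator[where f=f and c="\<lambda>j. K * \<bar>\<theta> j\<bar>", OF assms] K(1) by auto
  have c: "isCont \<phi> r" for r using \<phi> by (simp add: Phi0_bounded_def continuous_on_eq_continuous_at)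
  show "((\<lambda>s. field_exponent \<kappa> J f \<phi> (\<lambda>j. s * \<theta> j)) \<circ> x) \<longlonglongrightarrow> field_exponent \<kappa> J f \<phi> (\<lambda>j. a * \<theta> j)"
    unfolding field_exponent_def comp_def
  proof (intro tendsto_mult tendsto_const integral_dominated_convergence[OF _ _ w(1)])
    show "AE s in lborel. (\<lambda>i. \<phi> (\<Sum>j\<in>J. x i * \<theta> j * f j s)) \<longlonglongrightarrow> \<phi> (\<Sum>j\<in>J. a * \<theta> j * f j s)"
      by (intro AE_I2 isCont_tendsto_compose[OF c] tendsto_intros x)
    show "AE s in lborel. norm (\<phi> (\<Sum>j\<in>J. x i * \<theta> j * f j s)) \<le> w s" for i
    proof (rule AE_I2, rule w(2), rule order_trans[OF abs_sum_mult_le], rule sum_mono)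
      fix s j
      show "\<bar>x i * \<theta> j\<bar> * \<bar>f j s\<bar> \<le> K * \<bar>\<theta> j\<bar> * \<bar>f j s\<bar>"
        using K(2)[of i] by (simp add: abs_mult mult_right_mono)
    qed
  qed measurable
qed

lemma field_exponent_zero:
  assumes "Phi0_bounded \<phi>" shows "field_exponent \<kappa> J f \<phi> (\<lambda>_. 0) = 0"
  by (simp add: field_exponent_def Phi0_bounded_0[OF assms])

lemma dilation_diff_field_exponent:
  fixes f :: "'i \<Rightarrow> 'a::euclidean_space \<Rightarrow> real"
  assumes "finite J" and f: "\<And>j. j \<in> J \<Longrightarrow> Phi0_integrable (f j)" and \<phi>: "Phi0_bounded \<phi>"
  shows "dilation_diff q (field_exponent \<kappa> J f \<phi>) = field_exponent \<kappa> J f (\<lambda>r. \<phi> r - \<phi> (r / q))"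
proof
  fix \<theta>
  have "(\<Sum>j\<in>J. \<theta> j * f j s) / q = (\<Sum>j\<in>J. \<theta> j / q * f j s)" for s
    by (simp add: sum_divide_distrib)
  then show "dilation_diff q (field_exponent \<kappa> J f \<phi>) \<theta> = field_exponent \<kappa> J f (\<lambda>r. \<phi> r - \<phi> (r / q)) \<theta>"
    using Bochner_Integration.integral_diff[OF integrable_field[where f=f and \<theta>=\<theta>, OF assms]
        integrable_field[where f=f and \<theta>="\<lambda>j. \<theta> j / q", OF assms]]
    unfolding dilation_diff_def field_exponent_def by (simp only: right_diff_distrib)
qed

text \<open>For simple kernels the exponent is a finite nonnegative combination of exponents of
  linear images. General kernels follow by dominated convergence and closure under limits.\<close>

lemma id_exponent_field:
  fixes f :: "'i \<Rightarrow> 'a::euclidean_space \<Rightarrow> real"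
  assumes J: "finite J" and f: "\<And>j. j \<in> J \<Longrightarrow> Phi0_integrable (f j)" and \<phi>: "Phi0_bounded \<phi>"
    and id: "id_exponent1 \<phi>" and \<kappa>: "0 \<le> \<kappa>"
  shows "id_exponent J (field_exponent \<kappa> J f \<phi>)"
proof -
  have fm[measurable]: "f j \<in> borel_measurable borel" if "j \<in> J" for j
    using f[OF that] by (simp add: Phi0_integrable_def)
  note [measurable] = Phi0_bounded_measurable[OF \<phi>]
  have c: "isCont \<phi> r" for r using \<phi> by (simp add: Phi0_bounded_def continuous_on_eq_continuous_at)
  \<comment> \<open>Approximation measured from the base point 0 gives the bound 2 |f|, so one
    dominating function serves all i.\<close>
  have "\<exists>F. (\<forall>i. simple_function lborel (F i)) \<and> (\<forall>s. (\<lambda>i. F i s) \<longlonglongrightarrow> f j s) \<and>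
    (\<forall>i s. \<bar>F i s\<bar> \<le> 2 * \<bar>f j s\<bar>)" if "j \<in> J" for j
    using borel_measurable_implies_sequence_metric[of "f j" lborel 0] fm[OF that] by (simp add: dist_real_def)
  then obtain F where F: "\<And>i j. j \<in> J \<Longrightarrow> simple_function lborel (F j i)"
    "\<And>j s. j \<in> J \<Longrightarrow> (\<lambda>i. F j i s) \<longlonglongrightarrow> f j s"
    "\<And>i j s. j \<in> J \<Longrightarrow> \<bar>F j i s\<bar> \<le> 2 * \<bar>f j s\<bar>"
    by metis
  have Fm[measurable]: "F j i \<in> borel_measurable borel" if "j \<in> J" for i j
    using F(1)[OF that, of i] by (auto dest: borel_measurable_simple_function)
  have wex: "\<exists>w. integrable lborel w \<and> (\<forall>i s. norm (\<phi> (\<Sum>j\<in>J. \<theta> j * F j i s)) \<le> w s)" for \<theta>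
  proof -
    obtain w where w: "integrable lborel w" "\<And>s r. \<bar>r\<bar> \<le> (\<Sum>j\<in>J. 2 * \<bar>\<theta> j\<bar> * \<bar>f j s\<bar>) \<Longrightarrow> norm (\<phi> r) \<le> w s"
      using field_dominator[where f=f and c="\<lambda>j. 2 * \<bar>\<theta> j\<bar>", OF J f \<phi>] by auto
    have "norm (\<phi> (\<Sum>j\<in>J. \<theta> j * F j i s)) \<le> w s" for i s
    proof (rule w(2), rule order_trans[OF abs_sum_mult_le], rule sum_mono)
      fix j assume "j \<in> J"
      from mult_left_mono[OF F(3)[OF this], of "\<bar>\<theta> j\<bar>" i s]
      show "\<bar>\<theta> j\<bar> * \<bar>F j i s\<bar> \<le> 2 * \<bar>\<theta> j\<bar> * \<bar>f j s\<bar>" by simp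
    qed
    with w(1) show ?thesis by blast
  qed
  show ?thesis
  proof (rule id_exponent_limit[OF J])
    show "ray_continuous (field_exponent \<kappa> J f \<phi>)" by (rule ray_continuous_field_exponent[OF J f \<phi>])
    show "(\<lambda>i. field_exponent \<kappa> J (\<lambda>j. F j i) \<phi> \<theta>) \<longlonglongrightarrow> field_exponent \<kappa> J f \<phi> \<theta>" for \<theta>
    proof -
      from wex[of \<theta>] obtain w where w: "integrable lborel w" "\<And>i s. norm (\<phi> (\<Sum>j\<in>J. \<theta> j * F j i s)) \<le> w s" by blast
      show ?thesis
        unfolding field_exponent_def
        by (intro tendsto_mult tendsto_const integral_dominated_convergence[OF _ _ w(1)])
           (auto intro!: AE_I2 isCont_tendsto_compose[OF c] tendsto_intros F(2) w(2))
    qed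
    show "id_exponent J (field_exponent \<kappa> J (\<lambda>j. F j i) \<phi>)" for i
    proof -
      \<comment> \<open>The simple functions are joined into one vector-valued function with finite
        range \<open>W\<close>; the exponent is constant on its level sets
        \<open>A v\<close>.\<close>
      define G where "G s = (\<lambda>j\<in>J. F j i s)" for s
      define W where "W = range G"
      have "W \<subseteq> (\<Pi>\<^sub>E j\<in>J. F j i ` UNIV)" unfolding W_def G_def by auto
      moreover have "finite (\<Pi>\<^sub>E j\<in>J. F j i ` UNIV)"
        using F(1) J by (intro finite_PiE) (auto simp: simple_function_def)
      ultimately have finW: "finite W" by (rule finite_subset)
      define A where "A v = {s. G s = v}" for v
      have A_sets[measurable]: "A v \<in> sets borel" for v
      proof (cases "v \<in> W")
        case True
        then have "A v = {s\<in>space borel. \<forall>j\<in>J. F j i s = v j}"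
          unfolding A_def W_def G_def by (auto simp: fun_eq_iff restrict_def) 
        also have "\<dots> \<in> sets borel" using J by measurable
        finally show ?thesis .
      next
        case False
        then have "A v = {}" by (auto simp: A_def W_def)
        then show ?thesis by simp
      qed
      have eq: "field_exponent \<kappa> J (\<lambda>j. F j i) \<phi> \<theta> =
        (\<Sum>v\<in>W. complex_of_real (\<kappa> * measure lborel (A v)) * \<phi> (\<Sum>j\<in>J. \<theta> j * v j))" for \<theta>
      proof -
        let ?p = "\<lambda>v. \<phi> (\<Sum>j\<in>J. \<theta> j * v j)"
        from wex[of \<theta>] obtain w where w: "integrable lborel w" "\<And>i s. norm (\<phi> (\<Sum>j\<in>J. \<theta> j * F j i s)) \<le> w s" by blast
        have G: "\<phi> (\<Sum>j\<in>J. \<theta> j * F j i s) = ?p (G s)" for s by (simp add: G_def cong: sum.cong)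
        have int: "complex_integrable lborel (\<lambda>s. indicator (A v) s *\<^sub>R ?p v)" for v
        proof (rule Bochner_Integration.integrable_bound[OF w(1)])
          show "AE s in lborel. norm (indicator (A v) s *\<^sub>R ?p v) \<le> norm (w s)"
          proof (rule AE_I2)
            fix s
            have "norm (?p (G s)) \<le> w s" using w(2)[of i s] by (simp add: G)
            then show "norm (indicator (A v) s *\<^sub>R ?p v) \<le> norm (w s)"
              by (auto simp: A_def split: split_indicator)
          qed
        qed measurable
        \<comment> \<open>A level set of infinite volume has \<open>measure\<close> 0 by default.
          This is harmless: integrability forces the value \<open>?p v\<close> to be 0
          there.\<close>
        have one: "(CLINT s|lborel. indicator (A v) s *\<^sub>R ?p v) = measure lborel (A v) *\<^sub>R ?p v" for v
        proof (cases "?p v = 0")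
          case False
          have "integrable lborel (\<lambda>s. norm (indicator (A v) s *\<^sub>R ?p v) / norm (?p v))"
            by (intro integrable_divide integrable_norm int)
          then have "integrable lborel (indicat_real (A v))" using False by (simp add: indicator_def[abs_def] if_distrib cong: if_cong)
          then show ?thesis by (subst integral_scaleR_left) auto
        qed simp
        have "(CLINT s|lborel. \<phi> (\<Sum>j\<in>J. \<theta> j * F j i s)) = (CLINT s|lborel. \<Sum>v\<in>W. indicator (A v) s *\<^sub>R ?p v)"
        proof (rule Bochner_Integration.integral_cong[OF refl])
          fix s
          have "(\<Sum>v\<in>W. indicator (A v) s *\<^sub>R ?p v) = (\<Sum>v\<in>W. if v = G s then ?p v else 0)"
            by (rule sum.cong) (auto simp: A_def split: split_indicator)
          also have "\<dots> = ?p (G s)" using finW by (simp add: W_def)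
          finally show "\<phi> (\<Sum>j\<in>J. \<theta> j * F j i s) = (\<Sum>v\<in>W. indicator (A v) s *\<^sub>R ?p v)" by (simp add: G)
        qed
        also have "\<dots> = (\<Sum>v\<in>W. measure lborel (A v) *\<^sub>R ?p v)"
          by (subst Bochner_Integration.integral_sum[OF int]) (simp only: one)
        finally show ?thesis
          unfolding field_exponent_def by (simp add: sum_distrib_left scaleR_conv_of_real mult.assoc)
      qed
      show ?thesis
        unfolding eq[abs_def]
        by (intro id_exponent_sum[OF finW] id_exponent_scale id_exponent_linear_image[OF id] mult_nonneg_nonneg \<kappa> measure_nonneg)
    qed
  qed
qed

text \<open>Dilation differences commute with the integral over s and stay in
  \<open>Phi0_bounded\<close>, so the condition is transported level by level.\<close>

lemma urbanik_exponent_field: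
  fixes f :: "'i \<Rightarrow> 'a::euclidean_space \<Rightarrow> real"
  assumes J: "finite J" and f: "\<And>j. j \<in> J \<Longrightarrow> Phi0_integrable (f j)" and \<kappa>: "0 \<le> \<kappa>"
    and \<phi>: "Phi0_bounded \<phi>" and ue: "urbanik_exponent m {()} (\<lambda>\<theta>. \<phi> (\<theta> ()))"
  shows "urbanik_exponent m J (field_exponent \<kappa> J f \<phi>)"
  using \<phi> ue
proof (induction m arbitrary: \<phi>)
  case (0 \<phi>)
  then show ?case
    by (auto simp: dilation_diff_field_exponent[OF J f 0(1)] dilation_diff_def[of _ "\<lambda>\<theta>. \<phi> (\<theta> ())", abs_def]
      intro!: id_exponent_field[OF J f] Phi0_bounded_dilation_diff \<kappa>)
next
  case (Suc m \<phi>)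
  then show ?case
    by (auto simp: dilation_diff_field_exponent[OF J f Suc(2)] dilation_diff_def[of _ "\<lambda>\<theta>. \<phi> (\<theta> ())", abs_def]
      intro!: id_exponent_field[OF J f] Phi0_bounded_dilation_diff \<kappa>)
qed

end

section \<open>Stochastic integrals\<close>

text \<open>The simple functions that define a stochastic integral converge only almost everywhere, so dominated
  convergence is not available for their exponents. Convergence over every measurable set replaces it, by a
  gliding hump: along a sparse subsequence the \<open>h (n i)\<close> live essentially on disjoint sets \<open>A i\<close>. Over the union
  of the \<open>A i\<close> with \<open>i\<close> even the exponentials tend to 1 for odd \<open>i\<close>, hence for all \<open>i\<close>, and for even \<open>i\<close> they
  are asymptotically those over the whole space.\<close>
lemma exp_integral_tendsto_1:
  fixes h :: "nat \<Rightarrow> 'x \<Rightarrow> complex"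
  assumes "sigma_finite_measure N" and h: "\<And>n. complex_integrable N (h n)"
    and lim: "AE x in N. (\<lambda>n. h n x) \<longlonglongrightarrow> 0"
    and conv: "\<And>B. B \<in> sets N \<Longrightarrow> convergent (\<lambda>n. exp (CLINT x|N. indicator B x *\<^sub>R h n x))"
  shows "(\<lambda>n. exp (CLINT x|N. h n x)) \<longlonglongrightarrow> 1"
proof -
  interpret sigma_finite_measure N by fact
  have [measurable]: "h n \<in> borel_measurable N" for n using h by auto
  \<comment> \<open>A strictly positive integrable function turns pointwise convergence to 0 into
    domination on the increasing sets \<open>E m\<close>, which exhaust the space up to a null
    set.\<close>
  obtain w0 where w0: "w0 \<in> borel_measurable N" "integral\<^sup>N N w0 \<noteq> \<infinity>" "\<And>x. x \<in> space N \<Longrightarrow> 0 < w0 x \<and> w0 x < \<infinity>"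
    using Ex_finite_integrable_function by blast
  note [measurable] = w0(1)
  define w where "w x = enn2real (w0 x)" for x
  have [measurable]: "w \<in> borel_measurable N" unfolding w_def by measurable
  have wpos: "0 < w x" if "x \<in> space N" for x
    using w0(3)[OF that] by (simp add: w_def enn2real_positive_iff)
  have wi: "integrable N w"
  proof (rule integrableI_bounded)
    have "(\<integral>\<^sup>+x. ennreal (norm (w x)) \<partial>N) = integral\<^sup>N N w0"
      using w0(3) by (intro nn_integral_cong) (simp add: w_def)
    then show "(\<integral>\<^sup>+x. ennreal (norm (w x)) \<partial>N) < \<infinity>" using w0(2) by (simp add: less_top)
  qed measurable
  define E where "E m = {x\<in>space N. \<forall>n\<ge>m. norm (h n x) \<le> w x}" for m
  have E_sets[measurable]: "E m \<in> sets N" for m unfolding E_def by measurable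
  have E_mono: "E m \<subseteq> E m'" if "m \<le> m'" for m m' using that unfolding E_def by auto
  have E_cover: "AE x in N. \<exists>m. x \<in> E m"
    using lim AE_space
  proof eventually_elim
    case (elim x)
    have "\<forall>\<^sub>F n in sequentially. norm (h n x) < w x"
      using order_tendstoD(2)[OF tendsto_norm_zero[OF elim(1)] wpos[OF elim(2)]] .
    then show ?case using elim(2) by (force simp: E_def eventually_sequentially)
  qed
  define I where "I n B = (LINT x|N. indicator B x * norm (h n x))" for n B
  have iI: "integrable N (\<lambda>x. indicator B x * norm (h n x))" if [measurable]: "B \<in> sets N" for n B
    by (rule Bochner_Integration.integrable_bound[OF h[of n]]) (auto split: split_indicator)
  have I_bound: "norm (CLINT x|N. indicator B x *\<^sub>R h n x) \<le> I n B" for n B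
    unfolding I_def by (rule order_trans[OF integral_norm_bound]) simp
  have I_mono: "I n B \<le> I n C" if "B \<subseteq> C" "B \<in> sets N" "C \<in> sets N" for n B C
    unfolding I_def using that by (intro integral_mono iI) (auto split: split_indicator)
  have I_near: "(\<lambda>n. I n (E m)) \<longlonglongrightarrow> 0" for m
  proof (rule LIMSEQ_offset[where k=m])
    have "(\<lambda>n. I (n + m) (E m)) \<longlonglongrightarrow> (LINT x|N. 0)"
      unfolding I_def
    proof (rule integral_dominated_convergence[OF _ _ wi])
      show "AE x in N. (\<lambda>n. indicator (E m) x * norm (h (n + m) x)) \<longlonglongrightarrow> 0"
        using lim
      proof eventually_elim
        case (elim x)
        from tendsto_norm_zero[OF LIMSEQ_ignore_initial_segment[OF elim, of m]]
        show ?case by (intro tendsto_mult_right_zero)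
      qed
      show "AE x in N. norm (indicator (E m) x * norm (h (n + m) x)) \<le> w x" for n
        using wpos by (intro AE_I2) (auto simp: E_def less_imp_le split: split_indicator)
    qed measurable
    then show "(\<lambda>n. I (n + m) (E m)) \<longlonglongrightarrow> 0" by simp
  qed
  have I_far: "(\<lambda>m. I n (space N - E m)) \<longlonglongrightarrow> 0" for n
  proof -
    have "(\<lambda>m. I n (space N - E m)) \<longlonglongrightarrow> (LINT x|N. 0)"
      unfolding I_def
    proof (rule integral_dominated_convergence[OF _ _ integrable_norm[OF h[of n]]])
      show "AE x in N. (\<lambda>m. indicator (space N - E m) x * norm (h n x)) \<longlonglongrightarrow> 0"
        using E_cover
      proof eventually_elim
        case (elim x)
        then obtain m where m: "x \<in> E m" by blast
        have "indicator (space N - E k) x * norm (h n x) = 0" if "m \<le> k" for k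
          using E_mono[OF that] m by auto
        then show ?case by (intro tendsto_eventually) (auto simp: eventually_sequentially intro!: exI[of _ m])
      qed
    qed (auto split: split_indicator)
    then show ?thesis by simp
  qed
  define \<delta> where "\<delta> i = 1 / real (Suc i)" for i
  have \<delta>: "0 < \<delta> i" for i by (simp add: \<delta>_def)
  \<comment> \<open>A pair is (m, n). Given m, n is taken so large that \<open>h n\<close> is small
    on \<open>E m\<close>; the next m is taken so large that this \<open>h n\<close> is small off
    the new \<open>E m\<close>. Thus \<open>h n\<close> lives on the difference of consecutive
    sets.\<close>
  have "\<exists>p. \<forall>i. I (snd (p i)) (E (fst (p i))) < \<delta> i \<and>
     (fst (p i) < fst (p (Suc i)) \<and> snd (p i) < snd (p (Suc i)) \<and> I (snd (p i)) (space N - E (fst (p (Suc i)))) < \<delta> i)"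
  proof (rule dependent_nat_choice)
    from order_tendstoD(2)[OF I_near[of 0] \<delta>[of 0]]
    show "\<exists>p. I (snd p) (E (fst p)) < \<delta> 0" by (force simp: eventually_sequentially)
  next
    fix p :: "nat \<times> nat" and i assume "I (snd p) (E (fst p)) < \<delta> i"
    from eventually_conj[OF order_tendstoD(2)[OF I_far[of "snd p"] \<delta>[of i]] eventually_gt_at_top[of "fst p"]]
    obtain m where m: "I (snd p) (space N - E m) < \<delta> i" "fst p < m" by (force simp: eventually_sequentially)
    from eventually_conj[OF order_tendstoD(2)[OF I_near[of m] \<delta>[of "Suc i"]] eventually_gt_at_top[of "snd p"]]
    obtain n where n: "I n (E m) < \<delta> (Suc i)" "snd p < n" by (force simp: eventually_sequentially)
    show "\<exists>p'. I (snd p') (E (fst p')) < \<delta> (Suc i) \<and>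
      fst p < fst p' \<and> snd p < snd p' \<and> I (snd p) (space N - E (fst p')) < \<delta> i"
      using m n by (intro exI[of _ "(m, n)"]) simp
  qed
  then obtain p where p: "\<And>i. I (snd (p i)) (E (fst (p i))) < \<delta> i" "\<And>i. fst (p i) < fst (p (Suc i))"
    "\<And>i. snd (p i) < snd (p (Suc i))" "\<And>i. I (snd (p i)) (space N - E (fst (p (Suc i)))) < \<delta> i"
    by blast
  define m where "m i = fst (p i)" for i
  define n where "n i = snd (p i)" for i
  have m: "strict_mono m" and n: "strict_mono n" unfolding m_def n_def by (auto intro!: strict_mono_Suc_iff[THEN iffD2] p)
  define A where "A i = E (m (Suc i)) - E (m i)" for i
  have [measurable]: "A i \<in> sets N" for i unfolding A_def by measurable
  have A_disj: "A i \<inter> A j = {}" if "i < j" for i j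
  proof -
    have "m (Suc i) \<le> m j" using that m by (simp add: strict_mono_less_eq)
    from E_mono[OF this] show ?thesis by (auto simp: A_def)
  qed
  have I_compl: "I (n i) (space N - A i) \<le> 2 * \<delta> i" for i
  proof -
    have "I (n i) (space N - A i) \<le> (LINT x|N. indicator (E (m i)) x * norm (h (n i) x) + indicator (space N - E (m (Suc i))) x * norm (h (n i) x))"
      unfolding I_def
      by (intro integral_mono Bochner_Integration.integrable_add iI) (auto simp: A_def split: split_indicator)
    also have "\<dots> = I (n i) (E (m i)) + I (n i) (space N - E (m (Suc i)))"
      unfolding I_def by (intro Bochner_Integration.integral_add iI) auto
    also have "\<dots> \<le> 2 * \<delta> i" using p(1)[of i] p(4)[of i] by (simp add: m_def n_def)
    finally show ?thesis .
  qed
  define B where "B = (\<Union>k. A (2 * k))"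
  have B[measurable]: "B \<in> sets N" unfolding B_def by measurable
  have B_odd: "B \<subseteq> space N - A (2 * k + 1)" for k
  proof
    fix x assume "x \<in> B"
    then obtain l where l: "x \<in> A (2 * l)" unfolding B_def by blast
    have "x \<in> space N" using l sets.sets_into_space[of "A (2 * l)" N] by auto
    moreover have "2 * l < 2 * k + 1 \<or> 2 * k + 1 < 2 * l" by arith
    then have "x \<notin> A (2 * k + 1)" using A_disj l by blast
    ultimately show "x \<in> space N - A (2 * k + 1)" by blast
  qed
  have n_even: "strict_mono (\<lambda>k. n (2 * k))" and n_odd: "strict_mono (\<lambda>k. n (2 * k + 1))"
    using n by (auto simp: strict_mono_def)
  have \<delta>0: "(\<lambda>k. 2 * \<delta> (r k)) \<longlonglongrightarrow> 0" if "strict_mono r" for r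
  proof -
    have "\<delta> \<longlonglongrightarrow> 0" unfolding \<delta>_def using LIMSEQ_Suc[OF lim_1_over_n] by simp
    from LIMSEQ_subseq_LIMSEQ[OF this that] have "(\<lambda>k. 2 * \<delta> (r k)) \<longlonglongrightarrow> 2 * 0" by (intro tendsto_intros) (simp add: comp_def)
    then show ?thesis by simp
  qed
  have "(\<lambda>k. CLINT x|N. indicator B x *\<^sub>R h (n (2 * k + 1)) x) \<longlonglongrightarrow> 0"
  proof (rule Lim_null_comparison[OF always_eventually \<delta>0])
    show "\<forall>k. norm (CLINT x|N. indicator B x *\<^sub>R h (n (2 * k + 1)) x) \<le> 2 * \<delta> (2 * k + 1)"
    proof
      fix k
      have "I (n (2 * k + 1)) B \<le> I (n (2 * k + 1)) (space N - A (2 * k + 1))"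
        by (rule I_mono[OF B_odd]) auto
      with I_bound[of B "n (2 * k + 1)"] I_compl[of "2 * k + 1"]
      show "norm (CLINT x|N. indicator B x *\<^sub>R h (n (2 * k + 1)) x) \<le> 2 * \<delta> (2 * k + 1)" by linarith
    qed
    show "strict_mono (\<lambda>k. 2 * k + 1 :: nat)" by (simp add: strict_mono_def)
  qed
  then have odd: "(\<lambda>k. exp (CLINT x|N. indicator B x *\<^sub>R h (n (2 * k + 1)) x)) \<longlonglongrightarrow> exp 0" by (rule tendsto_exp)
  have "(\<lambda>k. CLINT x|N. indicator (space N - B) x *\<^sub>R h (n (2 * k)) x) \<longlonglongrightarrow> 0"
  proof (rule Lim_null_comparison[OF always_eventually \<delta>0])
    show "\<forall>k. norm (CLINT x|N. indicator (space N - B) x *\<^sub>R h (n (2 * k)) x) \<le> 2 * \<delta> (2 * k)"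
    proof
      fix k
      have "I (n (2 * k)) (space N - B) \<le> I (n (2 * k)) (space N - A (2 * k))"
        by (rule I_mono) (auto simp: B_def)
      with I_bound[of "space N - B" "n (2 * k)"] I_compl[of "2 * k"]
      show "norm (CLINT x|N. indicator (space N - B) x *\<^sub>R h (n (2 * k)) x) \<le> 2 * \<delta> (2 * k)" by linarith
    qed
    show "strict_mono (\<lambda>k. 2 * k :: nat)" by (simp add: strict_mono_def)
  qed
  then have even: "(\<lambda>k. exp (CLINT x|N. indicator (space N - B) x *\<^sub>R h (n (2 * k)) x)) \<longlonglongrightarrow> exp 0" by (rule tendsto_exp)
  from conv[OF B] obtain z where z: "(\<lambda>n. exp (CLINT x|N. indicator B x *\<^sub>R h n x)) \<longlonglongrightarrow> z" unfolding convergent_def by blast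
  have "z = 1"
    using LIMSEQ_unique[OF LIMSEQ_subseq_LIMSEQ[OF z n_odd, unfolded comp_def] odd] by simp
  have "(CLINT x|N. indicator (space N) x *\<^sub>R h n x) = (CLINT x|N. h n x)" for n
    by (intro Bochner_Integration.integral_cong) auto
  with conv[OF sets.top] obtain c where c: "(\<lambda>n. exp (CLINT x|N. h n x)) \<longlonglongrightarrow> c"
    unfolding convergent_def by auto
  have split: "exp (CLINT x|N. h n x) = exp (CLINT x|N. indicator B x *\<^sub>R h n x) * exp (CLINT x|N. indicator (space N - B) x *\<^sub>R h n x)" for n
  proof -
    have "(CLINT x|N. h n x) = (CLINT x|N. indicator B x *\<^sub>R h n x + indicator (space N - B) x *\<^sub>R h n x)"
      by (intro Bochner_Integration.integral_cong) (auto split: split_indicator)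
    also have "\<dots> = (CLINT x|N. indicator B x *\<^sub>R h n x) + (CLINT x|N. indicator (space N - B) x *\<^sub>R h n x)"
      by (intro Bochner_Integration.integral_add integrable_mult_indicator h) auto
    finally show ?thesis by (simp add: exp_add)
  qed
  have "(\<lambda>k. exp (CLINT x|N. h (n (2 * k)) x)) \<longlonglongrightarrow> z * exp 0"
    unfolding split using LIMSEQ_subseq_LIMSEQ[OF z n_even, unfolded comp_def] even by (rule tendsto_mult)
  from LIMSEQ_unique[OF LIMSEQ_subseq_LIMSEQ[OF c n_even, unfolded comp_def] this] have "c = 1" using \<open>z = 1\<close> by simp
  with c show ?thesis by simp
qed

section \<open>Convergence in probability and characteristic functions\<close>

lemma norm_iexp_diff_le: "norm (iexp a - iexp b) \<le> min 2 \<bar>a - b\<bar>"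
proof -
  have "norm (iexp a - iexp b) \<le> 2" by (rule order_trans[OF norm_triangle_ineq4]) simp
  moreover have "norm (iexp (a - b) - 1) \<le> \<bar>a - b\<bar>"
    using iexp_approx1[of "a - b" 0] by simp
  moreover have "iexp a - iexp b = iexp b * (iexp (a - b) - 1)"
    by (simp add: right_diff_distrib exp_add[symmetric])
  then have "norm (iexp a - iexp b) = norm (iexp (a - b) - 1)" by (simp only: norm_mult norm_exp_i_times mult_1)
  ultimately show ?thesis by simp
qed

text \<open>Off an event of small probability the variables differ by at most \<epsilon>; on that
  event the truncation at 2 bounds the integrand.\<close>

lemma (in prob_space) tendsto_in_prob_truncated:
  assumes "tendsto_in_prob M Y Z" and [measurable]: "\<And>n. Y n \<in> borel_measurable M" and c: "0 \<le> c"
  shows "(\<lambda>n. expectation (\<lambda>\<omega>. min 2 (c * \<bar>Y n \<omega> - Z \<omega>\<bar>))) \<longlonglongrightarrow> 0"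
proof (rule LIMSEQ_I)
  have [measurable]: "Z \<in> borel_measurable M" using assms(1) by (simp add: tendsto_in_prob_def)
  fix e :: real assume e: "0 < e"
  \<comment> \<open>Chosen for c \<epsilon> \<le> e / 2; the + 1 in the denominator admits c =
    0.\<close>
  define \<epsilon> where "\<epsilon> = e / (2 * (c + 1))"
  have \<epsilon>: "0 < \<epsilon>" "c * \<epsilon> \<le> e / 2" using e c by (auto simp: \<epsilon>_def field_simps)
  let ?A = "\<lambda>n. {\<omega>\<in>space M. \<epsilon> < \<bar>Y n \<omega> - Z \<omega>\<bar>}"
  have "(\<lambda>n. prob (?A n)) \<longlonglongrightarrow> 0" using assms(1) \<epsilon>(1) by (simp add: tendsto_in_prob_def)
  from order_tendstoD(2)[OF this, of "e / 4"] e
  obtain n0 where n0: "\<And>n. n \<ge> n0 \<Longrightarrow> prob (?A n) < e / 4" by (auto simp: eventually_sequentially)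
  have "norm (expectation (\<lambda>\<omega>. min 2 (c * \<bar>Y n \<omega> - Z \<omega>\<bar>)) - 0) < e" if "n \<ge> n0" for n
  proof -
    have "expectation (\<lambda>\<omega>. min 2 (c * \<bar>Y n \<omega> - Z \<omega>\<bar>)) \<le> expectation (\<lambda>\<omega>. e / 2 + 2 * indicator (?A n) \<omega>)"
    proof (rule integral_mono)
      show "integrable M (\<lambda>\<omega>. min 2 (c * \<bar>Y n \<omega> - Z \<omega>\<bar>))"
        by (rule integrable_const_bound[where B=2]) (use c in auto)
      show "integrable M (\<lambda>\<omega>. e / 2 + 2 * indicat_real (?A n) \<omega>)"
        by (intro Bochner_Integration.integrable_add integrable_mult_right) (auto simp: less_top[symmetric])
      fix \<omega> assume "\<omega> \<in> space M"
      then show "min 2 (c * \<bar>Y n \<omega> - Z \<omega>\<bar>) \<le> e / 2 + 2 * indicat_real (?A n) \<omega>"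
        using mult_left_mono[of "\<bar>Y n \<omega> - Z \<omega>\<bar>" \<epsilon> c] \<epsilon>(2) c e
        by (cases "\<epsilon> < \<bar>Y n \<omega> - Z \<omega>\<bar>") auto
    qed
    also have "\<dots> = e / 2 + 2 * prob (?A n)" by (simp add: prob_space less_top[symmetric])
    also have "\<dots> < e" using n0[OF that] by simp
    finally have "expectation (\<lambda>\<omega>. min 2 (c * \<bar>Y n \<omega> - Z \<omega>\<bar>)) < e" .
    moreover have "0 \<le> expectation (\<lambda>\<omega>. min 2 (c * \<bar>Y n \<omega> - Z \<omega>\<bar>))"
      by (rule integral_nonneg_AE) (use c in auto)
    ultimately show ?thesis by simp
  qed
  then show "\<exists>n0. \<forall>n\<ge>n0. norm (expectation (\<lambda>\<omega>. min 2 (c * \<bar>Y n \<omega> - Z \<omega>\<bar>)) - 0) < e" by blast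
qed

lemma (in prob_space) tendsto_in_prob_charf:
  assumes "finite J" and Y: "\<And>j. j \<in> J \<Longrightarrow> tendsto_in_prob M (Y j) (Z j)"
    and Ym: "\<And>j n. j \<in> J \<Longrightarrow> Y j n \<in> borel_measurable M"
  shows "(\<lambda>n. CLINT \<omega>|M. iexp (\<Sum>j\<in>J. \<theta> j * Y j n \<omega>)) \<longlonglongrightarrow> (CLINT \<omega>|M. iexp (\<Sum>j\<in>J. \<theta> j * Z j \<omega>))"
proof (rule LIM_zero_cancel)
  note [measurable] = Ym
  have [measurable]: "Z j \<in> borel_measurable M" if "j \<in> J" for j using Y[OF that] by (simp add: tendsto_in_prob_def)
  have iY: "complex_integrable M (\<lambda>\<omega>. iexp (\<Sum>j\<in>J. \<theta> j * Y j n \<omega>))" for n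
    by (rule integrable_const_bound[where B=1]) (simp, measurable)
  have iZ: "complex_integrable M (\<lambda>\<omega>. iexp (\<Sum>j\<in>J. \<theta> j * Z j \<omega>))"
    by (rule integrable_const_bound[where B=1]) (simp, measurable)
  let ?m = "\<lambda>j n \<omega>. min 2 (\<bar>\<theta> j\<bar> * \<bar>Y j n \<omega> - Z j \<omega>\<bar>)"
  have im: "integrable M (?m j n)" if [simp]: "j \<in> J" for j n
    by (rule integrable_const_bound[where B=2]) auto
  have "(\<lambda>n. \<Sum>j\<in>J. expectation (?m j n)) \<longlonglongrightarrow> (\<Sum>j\<in>J. 0)"
    by (intro tendsto_sum tendsto_in_prob_truncated Y) auto
  then have z: "(\<lambda>n. \<Sum>j\<in>J. expectation (?m j n)) \<longlonglongrightarrow> 0" by simp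
  show "(\<lambda>n. (CLINT \<omega>|M. iexp (\<Sum>j\<in>J. \<theta> j * Y j n \<omega>)) - (CLINT \<omega>|M. iexp (\<Sum>j\<in>J. \<theta> j * Z j \<omega>))) \<longlonglongrightarrow> 0"
  proof (rule Lim_null_comparison[OF always_eventually z], rule allI)
    fix n
    have "norm ((CLINT \<omega>|M. iexp (\<Sum>j\<in>J. \<theta> j * Y j n \<omega>)) - (CLINT \<omega>|M. iexp (\<Sum>j\<in>J. \<theta> j * Z j \<omega>))) =
      norm (CLINT \<omega>|M. iexp (\<Sum>j\<in>J. \<theta> j * Y j n \<omega>) - iexp (\<Sum>j\<in>J. \<theta> j * Z j \<omega>))"
      by (subst Bochner_Integration.integral_diff[OF iY iZ]) simp
    also have "\<dots> \<le> expectation (\<lambda>\<omega>. norm (iexp (\<Sum>j\<in>J. \<theta> j * Y j n \<omega>) - iexp (\<Sum>j\<in>J. \<theta> j * Z j \<omega>)))"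
      by (rule integral_norm_bound)
    also have "\<dots> \<le> expectation (\<lambda>\<omega>. \<Sum>j\<in>J. ?m j n \<omega>)"
    proof (rule integral_mono)
      show "integrable M (\<lambda>\<omega>. norm (iexp (\<Sum>j\<in>J. \<theta> j * Y j n \<omega>) - iexp (\<Sum>j\<in>J. \<theta> j * Z j \<omega>)))"
        by (intro integrable_norm Bochner_Integration.integrable_diff iY iZ)
      show "integrable M (\<lambda>\<omega>. \<Sum>j\<in>J. ?m j n \<omega>)" by (intro Bochner_Integration.integrable_sum im)
      fix \<omega>
      \<comment> \<open>Truncation at 2 is subadditive, which reduces a linear combination to its
        single terms.\<close>
      have sub: "min 2 (\<Sum>j\<in>J. d j) \<le> (\<Sum>j\<in>J. min 2 (d j))" if "\<And>j. 0 \<le> d j" for d :: "_ \<Rightarrow> real"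
        using assms(1)
      proof (induction J rule: finite_induct)
        case (insert j K)
        have "min 2 (d j + (\<Sum>j\<in>K. d j)) \<le> min 2 (d j) + min 2 (\<Sum>j\<in>K. d j)"
          using that[of j] sum_nonneg[of K d, OF that] by (auto simp: min_def simp del: sum_nonneg)
        then show ?case using insert by simp
      qed simp
      have "\<bar>(\<Sum>j\<in>J. \<theta> j * Y j n \<omega>) - (\<Sum>j\<in>J. \<theta> j * Z j \<omega>)\<bar> \<le> (\<Sum>j\<in>J. \<bar>\<theta> j\<bar> * \<bar>Y j n \<omega> - Z j \<omega>\<bar>)"
        unfolding sum_subtractf[symmetric] right_diff_distrib[symmetric]
        by (rule order_trans[OF sum_abs]) (simp add: abs_mult)
      then have "min 2 \<bar>(\<Sum>j\<in>J. \<theta> j * Y j n \<omega>) - (\<Sum>j\<in>J. \<theta> j * Z j \<omega>)\<bar> \<le> (\<Sum>j\<in>J. ?m j n \<omega>)"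
        using sub[of "\<lambda>j. \<bar>\<theta> j\<bar> * \<bar>Y j n \<omega> - Z j \<omega>\<bar>"] by simp
      with norm_iexp_diff_le show "norm (iexp (\<Sum>j\<in>J. \<theta> j * Y j n \<omega>) - iexp (\<Sum>j\<in>J. \<theta> j * Z j \<omega>)) \<le> (\<Sum>j\<in>J. ?m j n \<omega>)"
        by (rule order_trans)
    qed
    also have "\<dots> = (\<Sum>j\<in>J. expectation (?m j n))" by (intro Bochner_Integration.integral_sum im)
    finally show "norm ((CLINT \<omega>|M. iexp (\<Sum>j\<in>J. \<theta> j * Y j n \<omega>)) - (CLINT \<omega>|M. iexp (\<Sum>j\<in>J. \<theta> j * Z j \<omega>)))
      \<le> (\<Sum>j\<in>J. expectation (?m j n))" .
  qed
qed

section \<open>Bounded Borel sets and their common refinement\<close>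

lemma bdd_borel_simps [simp, intro]:
  "{} \<in> bdd_borel"
  "A \<in> bdd_borel \<Longrightarrow> B \<in> bdd_borel \<Longrightarrow> A \<union> B \<in> bdd_borel"
  "A \<in> bdd_borel \<Longrightarrow> B \<in> sets borel \<Longrightarrow> A - B \<in> bdd_borel"
  "A \<in> bdd_borel \<Longrightarrow> B \<in> sets borel \<Longrightarrow> B \<inter> A \<in> bdd_borel"
  for A B :: "'a::euclidean_space set"
  by (auto simp: bdd_borel_def intro: bounded_diff bounded_Int)

lemma bdd_borel_sets: "A \<in> bdd_borel \<Longrightarrow> A \<in> sets borel"
  by (simp add: bdd_borel_def)

lemma bdd_borel_Union: "finite F \<Longrightarrow> F \<subseteq> bdd_borel \<Longrightarrow> \<Union>F \<in> bdd_borel"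
  by (induction F rule: finite_induct) simp_all

lemma bdd_borel_emeasure_finite: "A \<in> bdd_borel \<Longrightarrow> emeasure lborel A < \<infinity>"
  using emeasure_bounded_finite by (auto simp: bdd_borel_def)

text \<open>The atoms of the algebra generated by the sets, indexed by nonempty subsets of I: x
  belongs to the atom of {i. x \<in> A i} and to no other. The empty subset is left out because its
  atom is unbounded.\<close>

lemma disjoint_refinement:
  fixes A :: "'k \<Rightarrow> 'a::euclidean_space set"
  assumes "finite I" "\<And>k. k \<in> I \<Longrightarrow> A k \<in> bdd_borel"
  shows "\<exists>F. finite F \<and> F \<subseteq> bdd_borel \<and> disjoint F \<and> (\<forall>k\<in>I. A k = \<Union>{C\<in>F. C \<subseteq> A k})"
proof -
  define atom where "atom S = (\<Inter>k\<in>S. A k) - (\<Union>k\<in>I - S. A k)" for S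
  define F where "F = atom ` (Pow I - {{}})"
  have at_self: "x \<in> atom {i\<in>I. x \<in> A i}" for x unfolding atom_def by auto
  have at_eq: "S = {i\<in>I. x \<in> A i}" if "x \<in> atom S" "S \<subseteq> I" for x S using that unfolding atom_def by auto
  have "finite F" unfolding F_def using assms(1) by simp
  moreover have "F \<subseteq> bdd_borel"
  proof -
    have "atom S \<in> bdd_borel" if "S \<subseteq> I" "S \<noteq> {}" for S
    proof -
      from that obtain k where k: "k \<in> S" "k \<in> I" by auto
      have fS: "finite S" using that assms(1) finite_subset by blast
      have b: "A i \<in> sets borel" if "i \<in> I" for i using assms(2)[OF that] by (rule bdd_borel_sets)
      have "(\<Inter>k\<in>S. A k) \<in> sets borel" using fS \<open>S \<noteq> {}\<close> \<open>S \<subseteq> I\<close> b by (intro sets.finite_INT) auto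
      moreover have "(\<Union>k\<in>I - S. A k) \<in> sets borel" using assms(1) b by (intro sets.finite_UN) auto
      moreover have "atom S \<subseteq> A k" using k by (auto simp: atom_def)
      moreover have "bounded (A k)" using assms(2)[OF k(2)] by (simp add: bdd_borel_def)
      ultimately show ?thesis
        using bounded_subset[of "A k" "atom S"] by (simp add: atom_def bdd_borel_def)
    qed
    then show ?thesis unfolding F_def by auto
  qed
  moreover have "disjoint F"
  proof (rule disjointI)
    fix C D assume "C \<in> F" "D \<in> F" "C \<noteq> D"
    then obtain S T where "C = atom S" "D = atom T" "S \<subseteq> I" "T \<subseteq> I" unfolding F_def by auto
    note ST = this
    show "C \<inter> D = {}"
    proof (rule equals0I)
      fix x assume x: "x \<in> C \<inter> D"
      then have "S = {i\<in>I. x \<in> A i}" "T = {i\<in>I. x \<in> A i}" using ST by (auto intro!: at_eq)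
      then show False using ST \<open>C \<noteq> D\<close> by simp
    qed
  qed
  moreover have "A k = \<Union>{C\<in>F. C \<subseteq> A k}" if k: "k \<in> I" for k
  proof
    show "A k \<subseteq> \<Union>{C\<in>F. C \<subseteq> A k}"
    proof
      fix x assume x: "x \<in> A k"
      let ?S = "{i\<in>I. x \<in> A i}"
      have "k \<in> ?S" using x k by simp
      then have "atom ?S \<subseteq> A k" "atom ?S \<in> F" unfolding atom_def F_def by blast+
      then show "x \<in> \<Union>{C\<in>F. C \<subseteq> A k}" using at_self[of x] by blast
    qed
  qed blast
  ultimately show ?thesis by blast
qed

section \<open>Finite-dimensional laws of the basis and of the field\<close>

locale levy_basis = levy_triplet \<gamma> b \<rho> + prob_space M
  for \<gamma> b and \<rho> and M :: "'w measure" and L :: "'a::euclidean_space set \<Rightarrow> 'w \<Rightarrow> real" and \<kappa> :: real +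
  assumes basis: "hom_levy_basis M L \<gamma> b \<rho> \<kappa>"
begin

abbreviation "\<psi> \<equiv> lk_exponent \<gamma> b \<rho>"

lemma kappa_pos: "0 < \<kappa>" using basis by (simp add: hom_levy_basis_def)

lemma measurable_L [measurable]: "A \<in> bdd_borel \<Longrightarrow> L A \<in> borel_measurable M"
  using basis by (simp add: hom_levy_basis_def)

lemma L_countably_additive:
  fixes A :: "nat \<Rightarrow> 'a set"
  assumes "range A \<subseteq> bdd_borel" "disjoint_family A" "(\<Union>n. A n) \<in> bdd_borel"
  shows "AE \<omega> in M. (\<lambda>n. L (A n) \<omega>) sums L (\<Union>n. A n) \<omega>"
  using basis assms by (simp add: hom_levy_basis_def)

lemma char_L:
  assumes "A \<in> bdd_borel"
  shows "char (distr M borel (L A)) \<theta> = exp (complex_of_real (\<kappa> * measure lborel A) * \<psi> \<theta>)"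
  using basis assms by (simp add: hom_levy_basis_def)

text \<open>Additivity for a sequence of empty sets gives a convergent series with constant terms,
  which must be 0.\<close>

lemma L_empty: "AE \<omega> in M. L {} \<omega> = 0"
proof -
  have "AE \<omega> in M. (\<lambda>n. L ((\<lambda>_::nat. {}) n) \<omega>) sums L (\<Union>n. (\<lambda>_::nat. {}) n) \<omega>"
    by (rule L_countably_additive) (auto simp: disjoint_family_on_def)
  then show ?thesis
  proof eventually_elim
    case (elim \<omega>)
    from summable_LIMSEQ_zero[OF sums_summable[OF elim]] show ?case by (simp add: LIMSEQ_const_iff)
  qed
qed

text \<open>Countable additivity for A, B, followed by empty sets, which contribute 0 almost
  surely.\<close>

lemma L_Un:
  assumes A: "A \<in> bdd_borel" "B \<in> bdd_borel" "A \<inter> B = {}"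
  shows "AE \<omega> in M. L (A \<union> B) \<omega> = L A \<omega> + L B \<omega>"
proof -
  let ?A = "\<lambda>n::nat. if n = 0 then A else if n = 1 then B else {}"
  have U: "(\<Union>n. ?A n) = A \<union> B"
  proof
    show "(\<Union>n. ?A n) \<subseteq> A \<union> B" by (auto split: if_splits)
    have "?A 0 \<subseteq> (\<Union>n. ?A n)" "?A 1 \<subseteq> (\<Union>n. ?A n)" by blast+
    then show "A \<union> B \<subseteq> (\<Union>n. ?A n)" by simp
  qed
  have "AE \<omega> in M. (\<lambda>n. L (?A n) \<omega>) sums L (\<Union>n. ?A n) \<omega>"
    using A by (intro L_countably_additive) (auto simp: U disjoint_family_on_def)
  with L_empty show ?thesis
  proof eventually_elim
    case (elim \<omega>)
    have "(\<lambda>n. L (?A n) \<omega>) sums (\<Sum>n\<in>{0, 1}. L (?A n) \<omega>)"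
      using elim(1) by (intro sums_finite) auto
    with elim(2) show ?case unfolding U using sums_unique2 by fastforce
  qed
qed

lemma L_Union:
  assumes "finite F" "F \<subseteq> bdd_borel" "disjoint F"
  shows "AE \<omega> in M. L (\<Union>F) \<omega> = (\<Sum>C\<in>F. L C \<omega>)"
  using assms
proof (induction F rule: finite_induct)
  case empty
  then show ?case using L_empty by simp
next
  case (insert C F)
  have d: "disjoint F" using insert.prems by (simp add: disjoint_def)
  have "C \<inter> \<Union>F = {}" using insert.prems insert.hyps by (auto simp: disjoint_def)
  with insert.prems insert.hyps have "AE \<omega> in M. L (C \<union> \<Union>F) \<omega> = L C \<omega> + L (\<Union>F) \<omega>"
    by (intro L_Un bdd_borel_Union) auto
  moreover have "AE \<omega> in M. L (\<Union>F) \<omega> = (\<Sum>C\<in>F. L C \<omega>)" using insert d by auto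
  ultimately show ?case
  proof eventually_elim
    case (elim \<omega>)
    then show ?case using insert.hyps by simp
  qed
qed

lemma Phi0_integrable_indicator:
  assumes "A \<in> bdd_borel" shows "Phi0_integrable (indicator A :: 'a \<Rightarrow> real)"
proof -
  have [measurable]: "A \<in> sets borel" using assms by (rule bdd_borel_sets)
  have "(\<integral>\<^sup>+s. \<Phi> \<bar>indicator A s :: real\<bar> \<partial>lborel) = (\<integral>\<^sup>+s. \<Phi> 1 * indicator A s \<partial>lborel)"
    by (intro nn_integral_cong) (simp add: Phi0_0 split: split_indicator)
  also have "\<dots> = \<Phi> 1 * emeasure lborel A" by (simp add: nn_integral_cmult_indicator)
  also have "\<dots> < \<infinity>" using Phi0_finite[of 1] bdd_borel_emeasure_finite[OF assms] by (simp add: ennreal_mult_less_top)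
  finally show ?thesis unfolding Phi0_integrable_def by simp
qed

text \<open>The sets may overlap, so the sum is rewritten over a disjoint refinement, where
  independence and the law of \<open>L\<close> on each cell apply. Outside all cells the kernel is 0
  and so is \<psi>.\<close>

lemma charf_simple_integral:
  fixes A :: "'k \<Rightarrow> 'a set"
  assumes I: "finite I" "\<And>k. k \<in> I \<Longrightarrow> A k \<in> bdd_borel"
  shows "(CLINT \<omega>|M. iexp (\<Sum>k\<in>I. a k * L (A k) \<omega>)) =
    exp (field_exponent \<kappa> I (\<lambda>k. indicator (A k)) \<psi> a)"
proof -
  have "\<exists>F. finite F \<and> F \<subseteq> bdd_borel \<and> disjoint F \<and> (\<forall>k\<in>I. A k = \<Union>{C\<in>F. C \<subseteq> A k})"
    by (rule disjoint_refinement[OF I(1)]) (rule I(2))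
  then obtain F where F: "finite F" "F \<subseteq> bdd_borel" "disjoint F"
    and F': "\<forall>k\<in>I. A k = \<Union>{C\<in>F. C \<subseteq> A k}" by (elim exE conjE) (rule that)
  define y where "y C = (\<Sum>k\<in>I. if C \<subseteq> A k then a k else 0)" for C
  have Fb[measurable]: "C \<in> sets borel" if "C \<in> F" for C using F(2) that bdd_borel_sets by blast
  have FL[measurable]: "L C \<in> borel_measurable M" if "C \<in> F" for C using F(2) that measurable_L by blast
  have "AE \<omega> in M. \<forall>k\<in>I. L (A k) \<omega> = (\<Sum>C\<in>{C\<in>F. C \<subseteq> A k}. L C \<omega>)"
  proof (rule AE_finite_allI[OF I(1)])
    fix k assume k: "k \<in> I"
    have "AE \<omega> in M. L (\<Union>{C\<in>F. C \<subseteq> A k}) \<omega> = (\<Sum>C\<in>{C\<in>F. C \<subseteq> A k}. L C \<omega>)"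
      using F(1-3) by (intro L_Union) (auto simp: disjoint_def)
    then show "AE \<omega> in M. L (A k) \<omega> = (\<Sum>C\<in>{C\<in>F. C \<subseteq> A k}. L C \<omega>)" using bspec[OF F' k] by simp
  qed
  then have AE: "AE \<omega> in M. (\<Sum>k\<in>I. a k * L (A k) \<omega>) = (\<Sum>C\<in>F. y C * L C \<omega>)"
  proof eventually_elim
    case (elim \<omega>)
    have "(\<Sum>k\<in>I. a k * L (A k) \<omega>) = (\<Sum>k\<in>I. \<Sum>C\<in>F. (if C \<subseteq> A k then a k else 0) * L C \<omega>)"
    proof (rule sum.cong[OF refl])
      fix k assume k: "k \<in> I"
      have "a k * L (A k) \<omega> = (\<Sum>C\<in>{C\<in>F. C \<subseteq> A k}. a k * L C \<omega>)"
        using elim k by (simp add: sum_distrib_left)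
      also have "\<dots> = (\<Sum>C\<in>F. (if C \<subseteq> A k then a k else 0) * L C \<omega>)"
        using F(1) by (subst sum.inter_filter) (auto intro!: sum.cong)
      finally show "a k * L (A k) \<omega> = (\<Sum>C\<in>F. (if C \<subseteq> A k then a k else 0) * L C \<omega>)" .
    qed
    also have "\<dots> = (\<Sum>C\<in>F. y C * L C \<omega>)"
      unfolding y_def sum_distrib_right by (rule sum.swap)
    finally show ?case .
  qed
  have "(CLINT \<omega>|M. iexp (\<Sum>k\<in>I. a k * L (A k) \<omega>)) = (CLINT \<omega>|M. iexp (\<Sum>C\<in>F. y C * L C \<omega>))"
  proof (rule integral_cong_AE)
    show "(\<lambda>\<omega>. iexp (\<Sum>k\<in>I. a k * L (A k) \<omega>)) \<in> borel_measurable M" using I(2) by measurable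
    show "(\<lambda>\<omega>. iexp (\<Sum>C\<in>F. y C * L C \<omega>)) \<in> borel_measurable M" by measurable
    show "AE \<omega> in M. iexp (\<Sum>k\<in>I. a k * L (A k) \<omega>) = iexp (\<Sum>C\<in>F. y C * L C \<omega>)" using AE by eventually_elim simp
  qed
  also have "\<dots> = char (distr M borel (\<lambda>\<omega>. \<Sum>C\<in>F. y C * L C \<omega>)) 1"
    unfolding char_def by (subst integral_distr) (auto simp del: of_real_sum)
  also have "\<dots> = (\<Prod>C\<in>F. char (distr M borel (\<lambda>\<omega>. y C * L C \<omega>)) 1)"
  proof (rule char_distr_sum)
    have "indep_vars (\<lambda>_. borel) L F" using basis F(1-3) by (simp add: hom_levy_basis_def)
    from indep_vars_compose2[OF this, of "\<lambda>C x. y C * x" "\<lambda>_. borel"]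
    show "indep_vars (\<lambda>i. borel) (\<lambda>C \<omega>. y C * L C \<omega>) F" by simp
  qed
  also have "\<dots> = (\<Prod>C\<in>F. exp (complex_of_real (\<kappa> * measure lborel C) * \<psi> (y C)))"
  proof (rule prod.cong[OF refl])
    fix C assume C: "C \<in> F"
    have "char (distr M borel (\<lambda>\<omega>. y C * L C \<omega>)) 1 = char (distr M borel (L C)) (y C)"
      unfolding char_def using C by (subst (1 2) integral_distr) auto
    also have "\<dots> = exp (complex_of_real (\<kappa> * measure lborel C) * \<psi> (y C))"
      using C F(2) by (intro char_L) blast
    finally show "char (distr M borel (\<lambda>\<omega>. y C * L C \<omega>)) 1 = exp (complex_of_real (\<kappa> * measure lborel C) * \<psi> (y C))" .
  qed
  also have "\<dots> = exp (\<Sum>C\<in>F. complex_of_real (\<kappa> * measure lborel C) * \<psi> (y C))"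
    using F(1) by (simp add: exp_sum)
  also have "(\<Sum>C\<in>F. complex_of_real (\<kappa> * measure lborel C) * \<psi> (y C)) = field_exponent \<kappa> I (\<lambda>k. indicator (A k)) \<psi> a"
  proof -
    have pt: "\<psi> (\<Sum>k\<in>I. a k * indicator (A k) s) = (\<Sum>C\<in>F. indicator C s *\<^sub>R \<psi> (y C))" for s
    proof (cases "s \<in> \<Union>F")
      case True
      then obtain D where D: "D \<in> F" "s \<in> D" by blast
      have DC: "s \<in> C \<longleftrightarrow> C = D" if "C \<in> F" for C using F(3) D that by (auto simp: disjoint_def)
      have "(\<Sum>k\<in>I. a k * indicator (A k) s) = y D"
        unfolding y_def
      proof (rule sum.cong[OF refl])
        fix k assume k: "k \<in> I"
        have "s \<in> A k \<longleftrightarrow> D \<subseteq> A k"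
        proof
          assume "s \<in> A k"
          then have "s \<in> \<Union>{C\<in>F. C \<subseteq> A k}" using bspec[OF F' k] by simp
          then obtain C where "C \<in> F" "C \<subseteq> A k" "s \<in> C" by auto
          then show "D \<subseteq> A k" using DC by simp
        qed (use D in blast)
        then show "a k * indicator (A k) s = (if D \<subseteq> A k then a k else 0)" by simp
      qed
      moreover have "(\<Sum>C\<in>F. indicator C s *\<^sub>R \<psi> (y C)) = (\<Sum>C\<in>F. if C = D then \<psi> (y C) else 0)"
        using DC by (intro sum.cong) auto
      ultimately show ?thesis using F(1) D(1) by simp
    next
      case False
      then have "s \<notin> A k" if "k \<in> I" for k using bspec[OF F' that] by blast
      then have "(\<Sum>k\<in>I. a k * indicator (A k) s) = 0" by (intro sum.neutral) auto
      moreover have "(\<Sum>C\<in>F. indicator C s *\<^sub>R \<psi> (y C)) = 0" using False by (intro sum.neutral) auto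
      ultimately show ?thesis using Phi0_bounded_0[OF Phi0_bounded_lk_exponent] by simp
    qed
    have int: "integrable lborel (indicat_real C)" if "C \<in> F" for C
      using that F(2) bdd_borel_emeasure_finite[of C] by (intro integrable_real_indicator) auto
    have "(CLINT s|lborel. \<Sum>C\<in>F. indicator C s *\<^sub>R \<psi> (y C)) = (\<Sum>C\<in>F. CLINT s|lborel. indicator C s *\<^sub>R \<psi> (y C))"
      by (intro Bochner_Integration.integral_sum integrable_scaleR_left int)
    also have "\<dots> = (\<Sum>C\<in>F. measure lborel C *\<^sub>R \<psi> (y C))"
      by (intro sum.cong refl, subst integral_scaleR_left[OF int]) auto
    finally show ?thesis
      unfolding field_exponent_def pt by (simp add: sum_distrib_left scaleR_conv_of_real mult.assoc)
  qed
  finally show ?thesis .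
qed

lemma charf_fidi_L:
  assumes "finite J" "J \<subseteq> bdd_borel"
  shows "prob_on J (fidi M L J)" "charf J (fidi M L J) \<theta> = exp (field_exponent \<kappa> J indicator \<psi> \<theta>)"
proof -
  have m: "(\<lambda>\<omega>. restrict (\<lambda>i. L i \<omega>) J) \<in> measurable M (Pi\<^sub>M J (\<lambda>_. borel))"
    using assms(2) by (intro measurable_restrict) auto
  show "prob_on J (fidi M L J)" unfolding fidi_def by (rule prob_on_distr[OF prob_space_axioms m])
  have "charf J (fidi M L J) \<theta> = (CLINT \<omega>|M. iexp (\<Sum>k\<in>J. \<theta> k * L k \<omega>))"
    unfolding fidi_def charf_distr[OF m] by (simp cong: sum.cong)
  also have "\<dots> = exp (field_exponent \<kappa> J indicator \<psi> \<theta>)"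
    using charf_simple_integral[OF assms(1), of "\<lambda>k. k" \<theta>] assms(2) by auto
  finally show "charf J (fidi M L J) \<theta> = exp (field_exponent \<kappa> J indicator \<psi> \<theta>)" .
qed

text \<open>For simple kernels this is \<open>charf_simple_integral\<close>. The side of the
  variables passes to the limit by convergence in probability, the side of the exponents by
  \<open>exp_integral_tendsto_1\<close>.\<close>

lemma charf_stoch_integral:
  fixes X :: "'i \<Rightarrow> 'w \<Rightarrow> real"
  assumes J: "finite J" and X: "\<And>j. j \<in> J \<Longrightarrow> stoch_integral M L (f j) (X j)"
    and f: "\<And>j. j \<in> J \<Longrightarrow> Phi0_integrable (f j)"
  shows "(CLINT \<omega>|M. iexp (\<Sum>j\<in>J. \<theta> j * X j \<omega>)) = exp (field_exponent \<kappa> J f \<psi> \<theta>)"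
proof -
  define Q where "Q j P a \<longleftrightarrow> (\<forall>n. finite (P n) \<and> P n \<subseteq> bdd_borel \<and> disjoint (P n)) \<and>
    (AE s in lborel. (\<lambda>n::nat. \<Sum>A\<in>P n. a n A * indicator A s) \<longlonglongrightarrow> f j s) \<and>
    (\<forall>B\<in>sets borel. \<exists>Z. tendsto_in_prob M (\<lambda>n \<omega>. \<Sum>A\<in>P n. a n A * L (B \<inter> A) \<omega>) Z) \<and>
    tendsto_in_prob M (\<lambda>n \<omega>. \<Sum>A\<in>P n. a n A * L A \<omega>) (X j)" for j P a
  have "\<forall>j\<in>J. \<exists>P a. Q j P a"
    using X unfolding stoch_integral_def Q_def by simp
  then obtain P a where PQ: "\<And>j. j \<in> J \<Longrightarrow> Q j (P j) (a j)" by metis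
  note q = PQ[unfolded Q_def]
  have P: "finite (P j n)" "P j n \<subseteq> bdd_borel" if "j \<in> J" for j n
    using q[OF that] by simp_all
  have lim: "AE s in lborel. (\<lambda>n::nat. \<Sum>A\<in>P j n. a j n A * indicator A s) \<longlonglongrightarrow> f j s" if "j \<in> J" for j
    by (rule q[OF that, THEN conjunct2, THEN conjunct1])
  have Z: "\<exists>Z. tendsto_in_prob M (\<lambda>n \<omega>. \<Sum>A\<in>P j n. a j n A * L (B \<inter> A) \<omega>) Z" if "j \<in> J" "B \<in> sets borel" for j B
    using q[OF that(1), THEN conjunct2, THEN conjunct2, THEN conjunct1] that(2) by (rule bspec)
  have XJ: "tendsto_in_prob M (\<lambda>n \<omega>. \<Sum>A\<in>P j n. a j n A * L A \<omega>) (X j)" if "j \<in> J" for j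
    by (rule q[OF that, THEN conjunct2, THEN conjunct2, THEN conjunct2])
  \<comment> \<open>The disjoint union of the partitions for all j lets a single family of sets
    carry the linear combination; sets belonging to different j may overlap.\<close>
  define K where "K n = Sigma J (\<lambda>j. P j n)" for n
  have K: "finite (K n)" for n unfolding K_def using J P(1) by blast
  have Kb: "snd k \<in> bdd_borel" if "k \<in> K n" for k n
    using that subsetD[OF P(2)] unfolding K_def by auto
  define c where "c n k = \<theta> (fst k) * a (fst k) n (snd k)" for n k
  define F where "F s = (\<Sum>j\<in>J. \<theta> j * f j s)" for s
  define Fn where "Fn n s = (\<Sum>k\<in>K n. c n k * indicator (snd k) s)" for n and s :: 'a
  have double: "(\<Sum>k\<in>K n. c n k * h (snd k)) = (\<Sum>j\<in>J. \<theta> j * (\<Sum>A\<in>P j n. a j n A * h A))" for n and h :: "'a set \<Rightarrow> real"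
  proof -
    have "(\<Sum>k\<in>K n. c n k * h (snd k)) = (\<Sum>(j, A)\<in>Sigma J (\<lambda>j. P j n). \<theta> j * a j n A * h A)"
      unfolding K_def c_def by (intro sum.cong) auto
    also have "\<dots> = (\<Sum>j\<in>J. \<Sum>A\<in>P j n. \<theta> j * a j n A * h A)"
      using J P(1) by (intro sum.Sigma[symmetric]) auto
    finally show ?thesis by (simp add: sum_distrib_left mult.assoc)
  qed
  note \<psi>b = Phi0_bounded_lk_exponent
  have \<psi>0: "\<psi> 0 = 0" by (rule Phi0_bounded_0[OF \<psi>b])
  have \<psi>c: "isCont \<psi> r" for r using continuous_lk_exponent by (simp add: continuous_on_eq_continuous_at)
  have ind: "Phi0_integrable (indicator (snd k) :: 'a \<Rightarrow> real)" if "k \<in> K n" for k n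
    by (rule Phi0_integrable_indicator[OF Kb[OF that]])
  have iFn: "complex_integrable lborel (\<lambda>s. \<psi> (Fn n s))" for n
    unfolding Fn_def by (rule integrable_field[OF K ind \<psi>b])
  have iF: "complex_integrable lborel (\<lambda>s. \<psi> (F s))"
    unfolding F_def by (rule integrable_field[OF J f \<psi>b])
  have FnF: "AE s in lborel. (\<lambda>n. Fn n s) \<longlonglongrightarrow> F s"
  proof -
    have "AE s in lborel. \<forall>j\<in>J. (\<lambda>n::nat. \<Sum>A\<in>P j n. a j n A * indicator A s) \<longlonglongrightarrow> f j s"
      using lim by (intro AE_finite_allI[OF J])
    then show ?thesis
    proof eventually_elim
      case (elim s)
      then show ?case unfolding Fn_def F_def double[of _ "\<lambda>A. indicator A s"] by (intro tendsto_intros) auto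
    qed
  qed
  have simple: "(CLINT \<omega>|M. iexp (\<Sum>j\<in>J. \<theta> j * (\<Sum>A\<in>P j n. a j n A * L (B \<inter> A) \<omega>))) =
     exp (complex_of_real \<kappa> * (CLINT s|lborel. indicator B s *\<^sub>R \<psi> (Fn n s)))" if B: "B \<in> sets borel" for B n
  proof -
    have "(CLINT \<omega>|M. iexp (\<Sum>j\<in>J. \<theta> j * (\<Sum>A\<in>P j n. a j n A * L (B \<inter> A) \<omega>))) =
      (CLINT \<omega>|M. iexp (\<Sum>k\<in>K n. c n k * L (B \<inter> snd k) \<omega>))"
      using double[of n "\<lambda>A. L (B \<inter> A) \<omega>" for \<omega>] by simp
    also have "\<dots> = exp (field_exponent \<kappa> (K n) (\<lambda>k. indicator (B \<inter> snd k)) \<psi> (c n))"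
      using B Kb by (intro charf_simple_integral K) auto
    finally have e: "(CLINT \<omega>|M. iexp (\<Sum>j\<in>J. \<theta> j * (\<Sum>A\<in>P j n. a j n A * L (B \<inter> A) \<omega>))) =
      exp (field_exponent \<kappa> (K n) (\<lambda>k. indicator (B \<inter> snd k)) \<psi> (c n))" .
    have pt: "\<psi> (\<Sum>k\<in>K n. c n k * indicator (B \<inter> snd k) s) = indicator B s *\<^sub>R \<psi> (Fn n s)" for s
      by (cases "s \<in> B") (simp_all add: Fn_def \<psi>0 indicator_inter_arith)
    have "field_exponent \<kappa> (K n) (\<lambda>k. indicator (B \<inter> snd k)) \<psi> (c n) =
      complex_of_real \<kappa> * (CLINT s|lborel. indicator B s *\<^sub>R \<psi> (Fn n s))"
      unfolding field_exponent_def pt by simp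
    then show ?thesis unfolding e by simp
  qed
  have YM: "(\<lambda>\<omega>. \<Sum>A\<in>P j n. a j n A * L (B \<inter> A) \<omega>) \<in> borel_measurable M" if "j \<in> J" "B \<in> sets borel" for j n B
    using P(2)[OF that(1)] that(2) by (intro borel_measurable_sum borel_measurable_times measurable_L) auto
  have conv: "convergent (\<lambda>n. exp (complex_of_real \<kappa> * (CLINT s|lborel. indicator B s *\<^sub>R \<psi> (Fn n s))))"
    if B: "B \<in> sets borel" for B
  proof -
    have "\<forall>j\<in>J. \<exists>Z. tendsto_in_prob M (\<lambda>n \<omega>. \<Sum>A\<in>P j n. a j n A * L (B \<inter> A) \<omega>) Z"
      using Z B by simp
    from bchoice[OF this] obtain ZB where
      "\<forall>j\<in>J. tendsto_in_prob M (\<lambda>n \<omega>. \<Sum>A\<in>P j n. a j n A * L (B \<inter> A) \<omega>) (ZB j)" ..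
    then have ZB: "tendsto_in_prob M (\<lambda>n \<omega>. \<Sum>A\<in>P j n. a j n A * L (B \<inter> A) \<omega>) (ZB j)" if "j \<in> J" for j
      using that by (rule bspec)
    have "(\<lambda>n. CLINT \<omega>|M. iexp (\<Sum>j\<in>J. \<theta> j * (\<Sum>A\<in>P j n. a j n A * L (B \<inter> A) \<omega>)))
       \<longlonglongrightarrow> (CLINT \<omega>|M. iexp (\<Sum>j\<in>J. \<theta> j * ZB j \<omega>))"
      by (rule tendsto_in_prob_charf[OF J ZB YM[OF _ B]])
    then show ?thesis unfolding simple[OF B] by (rule convergentI)
  qed
  have toX: "(\<lambda>n. exp (complex_of_real \<kappa> * (CLINT s|lborel. \<psi> (Fn n s)))) \<longlonglongrightarrow> (CLINT \<omega>|M. iexp (\<Sum>j\<in>J. \<theta> j * X j \<omega>))"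
  proof -
    have "(\<lambda>n. CLINT \<omega>|M. iexp (\<Sum>j\<in>J. \<theta> j * (\<Sum>A\<in>P j n. a j n A * L A \<omega>)))
       \<longlonglongrightarrow> (CLINT \<omega>|M. iexp (\<Sum>j\<in>J. \<theta> j * X j \<omega>))"
      by (rule tendsto_in_prob_charf[OF J XJ]) (use YM[of _ UNIV] in simp_all)
    moreover have "(CLINT \<omega>|M. iexp (\<Sum>j\<in>J. \<theta> j * (\<Sum>A\<in>P j n. a j n A * L A \<omega>))) =
      exp (complex_of_real \<kappa> * (CLINT s|lborel. \<psi> (Fn n s)))" for n
      using simple[of UNIV n] by (simp del: of_real_sum of_real_mult)
    ultimately show ?thesis by simp
  qed
  \<comment> \<open>Subtracting the limit kernel reduces the claim to functions tending to 0 almost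
    everywhere. Convergence of the integrals over every Borel set B gives that of the exponentials,
    after division by a fixed nonzero factor.\<close>
  define h where "h n s = complex_of_real \<kappa> * (\<psi> (Fn n s) - \<psi> (F s))" for n s
  have "(\<lambda>n. exp (CLINT s|lborel. h n s)) \<longlonglongrightarrow> 1"
  proof (rule exp_integral_tendsto_1)
    show "sigma_finite_measure (lborel :: 'a measure)" by standard
    show "complex_integrable lborel (h n)" for n
      unfolding h_def by (intro integrable_mult_right Bochner_Integration.integrable_diff iFn iF)
    show "AE s in lborel. (\<lambda>n. h n s) \<longlonglongrightarrow> 0"
      using FnF
    proof eventually_elim
      case (elim s)
      have "(\<lambda>n. h n s) \<longlonglongrightarrow> complex_of_real \<kappa> * (\<psi> (F s) - \<psi> (F s))"
        unfolding h_def by (intro tendsto_intros isCont_tendsto_compose[OF \<psi>c elim])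
      then show ?case by simp
    qed
    fix B :: "'a set" assume "B \<in> sets lborel"
    then have B[measurable]: "B \<in> sets borel" by simp
    have "exp (CLINT s|lborel. indicator B s *\<^sub>R h n s) =
      exp (complex_of_real \<kappa> * (CLINT s|lborel. indicator B s *\<^sub>R \<psi> (Fn n s))) /
      exp (complex_of_real \<kappa> * (CLINT s|lborel. indicator B s *\<^sub>R \<psi> (F s)))" for n
    proof -
      have "(CLINT s|lborel. indicator B s *\<^sub>R h n s) =
        (CLINT s|lborel. complex_of_real \<kappa> * (indicator B s *\<^sub>R \<psi> (Fn n s) - indicator B s *\<^sub>R \<psi> (F s)))"
        by (intro Bochner_Integration.integral_cong refl) (simp add: h_def scaleR_conv_of_real algebra_simps)
      also have "\<dots> = complex_of_real \<kappa> * ((CLINT s|lborel. indicator B s *\<^sub>R \<psi> (Fn n s)) - (CLINT s|lborel. indicator B s *\<^sub>R \<psi> (F s)))"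
        by (simp only: integral_mult_right_zero, subst Bochner_Integration.integral_diff)
           (auto intro!: integrable_mult_indicator iFn iF)
      finally show ?thesis by (simp add: right_diff_distrib exp_diff)
    qed
    note e = this
    from conv[OF B] obtain l where
      "(\<lambda>n. exp (complex_of_real \<kappa> * (CLINT s|lborel. indicator B s *\<^sub>R \<psi> (Fn n s)))) \<longlonglongrightarrow> l"
      unfolding convergent_def by blast
    from convergentI[OF tendsto_divide[OF this tendsto_const]]
    show "convergent (\<lambda>n. exp (CLINT s|lborel. indicator B s *\<^sub>R h n s))" unfolding e by simp
  qed
  also have "(\<lambda>n. exp (CLINT s|lborel. h n s)) =
    (\<lambda>n. exp (complex_of_real \<kappa> * (CLINT s|lborel. \<psi> (Fn n s))) / exp (complex_of_real \<kappa> * (CLINT s|lborel. \<psi> (F s))))"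
    unfolding h_def by (simp add: iFn iF right_diff_distrib exp_diff)
  finally have "(\<lambda>n. exp (complex_of_real \<kappa> * (CLINT s|lborel. \<psi> (Fn n s))) / exp (complex_of_real \<kappa> * (CLINT s|lborel. \<psi> (F s)))) \<longlonglongrightarrow> 1" .
  from LIMSEQ_unique[OF this tendsto_divide[OF toX tendsto_const]]
  have "1 = (CLINT \<omega>|M. iexp (\<Sum>j\<in>J. \<theta> j * X j \<omega>)) / exp (complex_of_real \<kappa> * (CLINT s|lborel. \<psi> (F s)))" by simp
  then show ?thesis unfolding field_exponent_def F_def by (simp add: field_simps)
qed

lemma charf_fidi_stoch_integral:
  fixes X :: "'i \<Rightarrow> 'w \<Rightarrow> real"
  assumes J: "finite J" and X: "\<And>j. j \<in> J \<Longrightarrow> stoch_integral M L (f j) (X j)"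
    and f: "\<And>j. j \<in> J \<Longrightarrow> Phi0_integrable (f j)"
  shows "prob_on J (fidi M X J)" "charf J (fidi M X J) \<theta> = exp (field_exponent \<kappa> J f \<psi> \<theta>)"
proof -
  have "X j \<in> borel_measurable M" if "j \<in> J" for j
    using X[OF that] by (auto simp: stoch_integral_def tendsto_in_prob_def)
  then have m: "(\<lambda>\<omega>. restrict (\<lambda>i. X i \<omega>) J) \<in> measurable M (Pi\<^sub>M J (\<lambda>_. borel))"
    by (intro measurable_restrict) auto
  show "prob_on J (fidi M X J)" unfolding fidi_def by (rule prob_on_distr[OF prob_space_axioms m])
  have "charf J (fidi M X J) \<theta> = (CLINT \<omega>|M. iexp (\<Sum>j\<in>J. \<theta> j * X j \<omega>))"
    unfolding fidi_def charf_distr[OF m] by (simp cong: sum.cong)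
  also have "\<dots> = exp (field_exponent \<kappa> J f \<psi> \<theta>)"
    using J X f by (rule charf_stoch_integral)
  finally show "charf J (fidi M X J) \<theta> = exp (field_exponent \<kappa> J f \<psi> \<theta>)" .
qed

text \<open>Common form of both conditions: the kernels are indicators for the basis and translates
  of the reflected g for the field.\<close>

lemma law_in_urbanik_iff:
  fixes X :: "'i \<Rightarrow> 'w \<Rightarrow> real"
  assumes "\<And>J. finite J \<Longrightarrow> J \<subseteq> T \<Longrightarrow> prob_on J (fidi M X J)"
    and "\<And>J \<theta>. finite J \<Longrightarrow> J \<subseteq> T \<Longrightarrow> charf J (fidi M X J) \<theta> = exp (field_exponent \<kappa> J f \<psi> \<theta>)"
    and "\<And>j. j \<in> T \<Longrightarrow> Phi0_integrable (f j)"
  shows "law_in_urbanik m M T X \<longleftrightarrow>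
    (\<forall>J. finite J \<longrightarrow> J \<subseteq> T \<longrightarrow> urbanik_exponent m J (field_exponent \<kappa> J f \<psi>))"
proof -
  have "urbanik m J (fidi M X J) \<longleftrightarrow> urbanik_exponent m J (field_exponent \<kappa> J f \<psi>)"
    if J: "finite J" "J \<subseteq> T" for J
  proof (rule urbanik_iff_exponent[OF J(1) assms(1)[OF J] assms(2)[OF J]])
    show "ray_continuous (field_exponent \<kappa> J f \<psi>)"
      using J assms(3) by (intro ray_continuous_field_exponent Phi0_bounded_lk_exponent) auto
    show "field_exponent \<kappa> J f \<psi> (\<lambda>_. 0) = 0" by (rule field_exponent_zero[OF Phi0_bounded_lk_exponent])
  qed
  then show ?thesis unfolding law_in_urbanik_def by blast
qed

end

section \<open>Combinations of translates and trigonometric polynomials\<close>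

lemma lborel_integrable_reflect:
  fixes f :: "'a::euclidean_space \<Rightarrow> 'b::{banach, second_countable_topology}"
  shows "integrable lborel (\<lambda>s. f (u - s)) \<longleftrightarrow> integrable lborel f"
    and "(LINT s|lborel. f (u - s)) = (LINT s|lborel. f s)"
proof -
  have eq: "(lborel :: 'a measure) = distr lborel borel (\<lambda>s. u - s)"
    by (subst lborel_affine[of "-1" u]) (auto simp: density_1 one_ennreal_def[symmetric])
  show "(LINT s|lborel. f (u - s)) = (LINT s|lborel. f s)"
  proof (cases "f \<in> borel_measurable borel")
    case True
    then show ?thesis by (subst (2) eq) (simp add: integral_distr)
  next
    \<comment> \<open>For a non-measurable f neither side is integrable, and both integrals have the
      default value 0.\<close>
    case False
    have "(\<lambda>s. f (u - s)) \<notin> borel_measurable lborel"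
    proof
      assume "(\<lambda>s. f (u - s)) \<in> borel_measurable lborel"
      then have "(\<lambda>s. f (u - (u - s))) \<in> borel_measurable borel"
        by (intro measurable_compose[of "\<lambda>s. u - s" borel borel "\<lambda>s. f (u - s)"]) simp_all
      then show False using False by simp
    qed
    then have "\<not> integrable lborel (\<lambda>s. f (u - s))" using borel_measurable_integrable by blast
    moreover have "\<not> integrable lborel f" using False borel_measurable_integrable[of lborel f] by auto
    ultimately show ?thesis by (simp add: not_integrable_integral_eq)
  qed
  show "integrable lborel (\<lambda>s. f (u - s)) \<longleftrightarrow> integrable lborel f"
  proof
    assume f: "integrable lborel f"
    have m: "f \<in> borel_measurable borel" using borel_measurable_integrable[OF f] by simp
    have "integrable (distr lborel borel (\<lambda>s. u - s)) f" using f eq by simp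
    then show "integrable lborel (\<lambda>s. f (u - s))"
      by (subst (asm) integrable_distr_eq) (simp_all add: m)
  next
    assume f: "integrable lborel (\<lambda>s. f (u - s))"
    have m: "(\<lambda>s. f (u - s)) \<in> borel_measurable borel" using borel_measurable_integrable[OF f] by simp
    have "integrable (distr lborel borel (\<lambda>s. u - s)) (\<lambda>s. f (u - s))" using f eq by simp
    then have "integrable lborel (\<lambda>s. f (u - (u - s)))"
      by (subst (asm) integrable_distr_eq) (simp_all add: m)
    then show "integrable lborel f" by simp
  qed
qed

section \<open>Continuity of translations in L1\<close>

definition L1_translation_continuous :: "('a::euclidean_space \<Rightarrow> real) \<Rightarrow> bool" where
  "L1_translation_continuous f \<longleftrightarrow> integrable lborel f \<and>
     (\<forall>(x::nat \<Rightarrow> 'a) u. x \<longlonglongrightarrow> u \<longrightarrow> (\<lambda>n. LINT s|lborel. \<bar>f (x n - s) - f (u - s)\<bar>) \<longlonglongrightarrow> 0)"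

text \<open>Three-epsilon argument: by invariance of Lebesgue measure the approximation error is the
  same at every translate.\<close>

lemma L1_translation_continuous_approx:
  fixes f :: "'a::euclidean_space \<Rightarrow> real"
  assumes f: "integrable lborel f"
    and approx: "\<And>e. 0 < e \<Longrightarrow> \<exists>h. L1_translation_continuous h \<and> (LINT s|lborel. \<bar>f s - h s\<bar>) < e"
  shows "L1_translation_continuous f"
  unfolding L1_translation_continuous_def
proof (intro conjI f allI impI LIMSEQ_I)
  fix x :: "nat \<Rightarrow> 'a" and u and e :: real assume x: "x \<longlonglongrightarrow> u" and e: "0 < e"
  from approx[of "e / 3"] e obtain h where h: "L1_translation_continuous h" "(LINT s|lborel. \<bar>f s - h s\<bar>) < e / 3" by auto
  have hi: "integrable lborel h" using h(1) by (simp add: L1_translation_continuous_def)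
  have "(\<lambda>n. LINT s|lborel. \<bar>h (x n - s) - h (u - s)\<bar>) \<longlonglongrightarrow> 0" using h(1) x by (simp add: L1_translation_continuous_def)
  from order_tendstoD(2)[OF this, of "e / 3"] e obtain N where
    N: "\<And>n. N \<le> n \<Longrightarrow> (LINT s|lborel. \<bar>h (x n - s) - h (u - s)\<bar>) < e / 3" by (auto simp: eventually_sequentially)
  note i = lborel_integrable_reflect(1)[THEN iffD2]
  have "norm ((LINT s|lborel. \<bar>f (x n - s) - f (u - s)\<bar>) - 0) < e" if "N \<le> n" for n
  proof -
    have "(LINT s|lborel. \<bar>f (x n - s) - f (u - s)\<bar>) \<le>
      (LINT s|lborel. \<bar>f (x n - s) - h (x n - s)\<bar> + \<bar>h (x n - s) - h (u - s)\<bar> + \<bar>f (u - s) - h (u - s)\<bar>)"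
      by (intro integral_mono integrable_abs Bochner_Integration.integrable_add Bochner_Integration.integrable_diff
          i[OF f] i[OF hi]) linarith
    also have "\<dots> = (LINT s|lborel. \<bar>f (x n - s) - h (x n - s)\<bar>) + (LINT s|lborel. \<bar>h (x n - s) - h (u - s)\<bar>)
       + (LINT s|lborel. \<bar>f (u - s) - h (u - s)\<bar>)"
      by (simp add: i[OF f] i[OF hi])
    also have "\<dots> < e"
      using lborel_integrable_reflect(2)[of "\<lambda>s. \<bar>f s - h s\<bar>" "x n"] lborel_integrable_reflect(2)[of "\<lambda>s. \<bar>f s - h s\<bar>" u]
        h(2) N[OF that] by simp
    finally show ?thesis by (simp add: integral_nonneg_AE)
  qed
  then show "\<exists>N. \<forall>n\<ge>N. norm ((LINT s|lborel. \<bar>f (x n - s) - f (u - s)\<bar>) - 0) < e" by blast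
qed

text \<open>Only membership is stable for an open set: u - s \<in> U persists along
  \<open>x n\<close>. This controls the positive part of the difference of indicators; the negative
  part has the same integral, because translates have equal volume. Hence the factor 2.\<close>

lemma L1_translation_continuous_open:
  fixes U :: "'a::euclidean_space set"
  assumes U: "open U" "emeasure lborel U < \<infinity>"
  shows "L1_translation_continuous (indicator U)"
  unfolding L1_translation_continuous_def
proof (intro conjI allI impI)
  have [measurable]: "U \<in> sets borel" using U by simp
  show i: "integrable lborel (indicat_real U)" using U by (intro integrable_real_indicator) auto
  note j = lborel_integrable_reflect(1)[THEN iffD2, OF i]
  fix x :: "nat \<Rightarrow> 'a" and u assume x: "x \<longlonglongrightarrow> u"
  let ?p = "\<lambda>n s. max 0 (indicat_real U (u - s) - indicat_real U (x n - s))"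
  have "(\<lambda>n. LINT s|lborel. ?p n s) \<longlonglongrightarrow> (LINT s|(lborel :: 'a measure). (0::real))"
  proof (rule integral_dominated_convergence[OF _ _ j[of u]])
    show "AE s in lborel. (\<lambda>n. ?p n s) \<longlonglongrightarrow> 0"
    proof (rule AE_I2, rule tendsto_eventually)
      fix s
      show "\<forall>\<^sub>F n in sequentially. ?p n s = 0"
      proof (cases "u - s \<in> U")
        case True
        have "(\<lambda>n. x n - s) \<longlonglongrightarrow> u - s" by (intro tendsto_intros x)
        from topological_tendstoD[OF this U(1) True] show ?thesis by eventually_elim (simp add: True)
      qed simp
    qed
  qed (auto split: split_indicator)
  then have "(\<lambda>n. 2 * (LINT s|lborel. ?p n s)) \<longlonglongrightarrow> 2 * 0" by (intro tendsto_intros) simp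
  also have "(\<lambda>n. 2 * (LINT s|lborel. ?p n s)) = (\<lambda>n. LINT s|lborel. \<bar>indicat_real U (x n - s) - indicat_real U (u - s)\<bar>)"
  proof
    fix n
    have p: "integrable lborel (?p n)"
      by (rule Bochner_Integration.integrable_bound[OF j[of u]]) (auto split: split_indicator)
    have "(LINT s|lborel. \<bar>indicat_real U (x n - s) - indicat_real U (u - s)\<bar>) =
      (LINT s|lborel. 2 * ?p n s + (indicat_real U (x n - s) - indicat_real U (u - s)))"
      by (intro Bochner_Integration.integral_cong) (auto split: split_indicator)
    also have "\<dots> = 2 * (LINT s|lborel. ?p n s) + ((LINT s|lborel. indicat_real U (x n - s)) - (LINT s|lborel. indicat_real U (u - s)))"
      using p j[of u] j[of "x n"] by simp
    also have "(LINT s|lborel. indicat_real U (x n - s)) = (LINT s|lborel. indicat_real U (u - s))"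
      unfolding lborel_integrable_reflect(2) ..
    finally show "2 * (LINT s|lborel. ?p n s) = (LINT s|lborel. \<bar>indicat_real U (x n - s) - indicat_real U (u - s)\<bar>)" by simp
  qed
  finally show "(\<lambda>n. LINT s|lborel. \<bar>indicat_real U (x n - s) - indicat_real U (u - s)\<bar>) \<longlonglongrightarrow> 0" by simp
qed

text \<open>Outer regularity encloses A in an open set of nearly the same volume.\<close>

lemma L1_translation_continuous_indicator:
  fixes A :: "'a::euclidean_space set"
  assumes A[measurable]: "A \<in> sets borel" and fin: "emeasure lborel A < \<infinity>"
  shows "L1_translation_continuous (indicator A)"
proof (rule L1_translation_continuous_approx)
  show i: "integrable lborel (indicat_real A)" using fin by (intro integrable_real_indicator) auto
  fix e :: real assume e: "0 < e"
  have "A \<in> sets lebesgue" using A by (simp add: sets_completionI_sets)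
  then obtain U where U: "open U" "A \<subseteq> U" "U - A \<in> lmeasurable" "emeasure lebesgue (U - A) < ennreal e"
    using e by (rule sets_lebesgue_outer_open)
  have [measurable]: "U \<in> sets borel" using U(1) by simp
  have "U - A \<in> sets lborel" by simp
  then have d: "emeasure lborel (U - A) < ennreal e" using U(4) by simp
  then have d': "emeasure lborel (U - A) < \<infinity>" by (rule order.strict_trans) simp
  have "emeasure lborel U = emeasure lborel (A \<union> (U - A))" using U(2) by (simp add: Un_absorb1)
  also have "\<dots> \<le> emeasure lborel A + emeasure lborel (U - A)" by (rule emeasure_subadditive) auto
  also have "\<dots> < \<infinity>" using fin d' by simp
  finally have Ufin: "emeasure lborel U < \<infinity>" .
  have "(LINT s|lborel. \<bar>indicat_real A s - indicat_real U s\<bar>) = (LINT s|lborel. indicat_real (U - A) s)"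
    using U(2) by (intro Bochner_Integration.integral_cong) (auto split: split_indicator)
  also have "\<dots> < e" using d e by (cases "emeasure lborel (U - A)") (auto simp: measure_def ennreal_less_iff)
  finally show "\<exists>h. L1_translation_continuous h \<and> (LINT s|lborel. \<bar>indicat_real A s - h s\<bar>) < e"
    using L1_translation_continuous_open[OF U(1) Ufin] by blast
qed

lemma L1_translation_continuous_integrable:
  fixes f :: "'a::euclidean_space \<Rightarrow> real"
  assumes "integrable lborel f" shows "L1_translation_continuous f"
  using assms
proof (induction rule: integrable_induct)
  case (base A c)
  then have A: "L1_translation_continuous (indicator A)" by (intro L1_translation_continuous_indicator) auto
  show ?case
    unfolding L1_translation_continuous_def
  proof (intro conjI allI impI)
    show "integrable lborel (\<lambda>s. indicat_real A s *\<^sub>R c)" using A by (simp add: L1_translation_continuous_def)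
    fix x :: "nat \<Rightarrow> 'a" and u assume "x \<longlonglongrightarrow> u"
    with A have "(\<lambda>n. LINT s|lborel. \<bar>indicator A (x n - s) - indicator A (u - s) :: real\<bar>) \<longlonglongrightarrow> 0"
      by (simp add: L1_translation_continuous_def)
    then have "(\<lambda>n. (LINT s|lborel. \<bar>indicator A (x n - s) - indicator A (u - s) :: real\<bar>) * \<bar>c\<bar>) \<longlonglongrightarrow> 0 * \<bar>c\<bar>"
      by (intro tendsto_intros)
    then show "(\<lambda>n. LINT s|lborel. \<bar>indicat_real A (x n - s) *\<^sub>R c - indicat_real A (u - s) *\<^sub>R c\<bar>) \<longlonglongrightarrow> 0"
      by (simp add: left_diff_distrib[symmetric] abs_mult)
  qed
next
  case (add f g)
  note fg = add(3,4)[unfolded L1_translation_continuous_def]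
  show ?case
    unfolding L1_translation_continuous_def
  proof (intro conjI allI impI)
    show "integrable lborel (\<lambda>s. f s + g s)" using add by simp
    fix x :: "nat \<Rightarrow> 'a" and u assume x: "x \<longlonglongrightarrow> u"
    note i = lborel_integrable_reflect(1)[THEN iffD2]
    have z: "(\<lambda>n. (LINT s|lborel. \<bar>f (x n - s) - f (u - s)\<bar>) + (LINT s|lborel. \<bar>g (x n - s) - g (u - s)\<bar>)) \<longlonglongrightarrow> 0"
      using fg x by (intro tendsto_add_zero) auto
    show "(\<lambda>n. LINT s|lborel. \<bar>f (x n - s) + g (x n - s) - (f (u - s) + g (u - s))\<bar>) \<longlonglongrightarrow> 0"
    proof (rule Lim_null_comparison[OF always_eventually z], rule allI)
      fix n
      have "(LINT s|lborel. \<bar>f (x n - s) + g (x n - s) - (f (u - s) + g (u - s))\<bar>) \<le>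
        (LINT s|lborel. \<bar>f (x n - s) - f (u - s)\<bar> + \<bar>g (x n - s) - g (u - s)\<bar>)"
        by (intro integral_mono integrable_abs Bochner_Integration.integrable_add Bochner_Integration.integrable_diff
          i add(1,2)) linarith
      also have "\<dots> = (LINT s|lborel. \<bar>f (x n - s) - f (u - s)\<bar>) + (LINT s|lborel. \<bar>g (x n - s) - g (u - s)\<bar>)"
        by (intro Bochner_Integration.integral_add integrable_abs Bochner_Integration.integrable_diff i add(1,2))
      finally show "norm (LINT s|lborel. \<bar>f (x n - s) + g (x n - s) - (f (u - s) + g (u - s))\<bar>) \<le>
         (LINT s|lborel. \<bar>f (x n - s) - f (u - s)\<bar>) + (LINT s|lborel. \<bar>g (x n - s) - g (u - s)\<bar>)"
        by (simp add: integral_nonneg_AE)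
    qed
  qed
next
  case (lim f S)
  show ?case
  proof (rule L1_translation_continuous_approx[OF lim(4)])
    fix e :: real assume "0 < e"
    have "(\<lambda>i. LINT s|lborel. \<bar>f s - S i s\<bar>) \<longlonglongrightarrow> (LINT s|(lborel :: 'a measure). (0::real))"
    proof (rule integral_dominated_convergence[where w="\<lambda>s. 3 * \<bar>f s\<bar>"])
      show "AE s in lborel. (\<lambda>i. \<bar>f s - S i s\<bar>) \<longlonglongrightarrow> 0"
        using lim(2) by (intro AE_I2 tendsto_rabs_zero) (auto intro!: tendsto_eq_intros)
      \<comment> \<open>The approximants satisfy |S i| \<le> 2 |f|, hence the factor 3.\<close>
      show "AE s in lborel. norm \<bar>f s - S i s\<bar> \<le> 3 * \<bar>f s\<bar>" for i
      proof (rule AE_I2)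
        fix s show "norm \<bar>f s - S i s\<bar> \<le> 3 * \<bar>f s\<bar>" using lim(3)[of s i] by simp
      qed
    qed (use lim(1,4) in auto)
    then have "(\<lambda>i. LINT s|lborel. \<bar>f s - S i s\<bar>) \<longlonglongrightarrow> 0" by simp
    from order_tendstoD(2)[OF this \<open>0 < e\<close>] obtain i where "(LINT s|lborel. \<bar>f s - S i s\<bar>) < e"
      by (auto simp: eventually_sequentially)
    with lim(5) show "\<exists>h. L1_translation_continuous h \<and> (LINT s|lborel. \<bar>f s - h s\<bar>) < e" by blast
  qed
qed

lemma lborel_integral_translate:
  fixes f :: "'a::euclidean_space \<Rightarrow> real"
  shows "(LINT u|lborel. f (u - s)) = (LINT u|lborel. f u)"
    and "integrable lborel (\<lambda>u. f (u - s)) \<longleftrightarrow> integrable lborel f"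
proof -
  show "(LINT u|lborel. f (u - s)) = (LINT u|lborel. f u)"
    using lborel_integrable_reflect(2)[where f="\<lambda>x. f (- x)" and u=s] lborel_integrable_reflect(2)[where f=f and u=0]
    unfolding minus_diff_eq diff_0 by (rule trans)
  show "integrable lborel (\<lambda>u. f (u - s)) \<longleftrightarrow> integrable lborel f"
    using lborel_integrable_reflect(1)[where f="\<lambda>x. f (- x)" and u=s] lborel_integrable_reflect(1)[where f=f and u=0]
    unfolding minus_diff_eq diff_0 by (rule trans)
qed

text \<open>The integral over B is a continuous superposition of translates; replacing u by a simple
  function \<open>\<sigma> i u\<close> makes it a finite sum. By Fubini the L1 error is at most the
  integral over B of the translation modulus \<open>k i\<close>, which tends to 0.\<close>

lemma L1_approx_by_translates:
  fixes g :: "'a::euclidean_space \<Rightarrow> real"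
  assumes g: "integrable lborel g" and B: "B \<in> sets borel" "emeasure lborel B < \<infinity>" and e: "0 < e"
  shows "\<exists>J w. finite J \<and>
    integrable lborel (\<lambda>s. (\<Sum>v\<in>J. w v * g (v - s)) - (LINT u|lborel. indicator B u * g (u - s))) \<and>
    (LINT s|lborel. \<bar>(\<Sum>v\<in>J. w v * g (v - s)) - (LINT u|lborel. indicator B u * g (u - s))\<bar>) < e"
proof -
  note [measurable] = B(1)
  have [measurable]: "g \<in> borel_measurable borel" using g by auto
  from borel_measurable_implies_sequence_metric[of "\<lambda>u::'a. u" lborel 0]
  obtain \<sigma> where \<sigma>: "\<And>i. simple_function lborel (\<sigma> i)" "\<And>u::'a. (\<lambda>i. \<sigma> i u) \<longlonglongrightarrow> u" by auto
  have \<sigma>m[measurable]: "\<sigma> i \<in> borel_measurable borel" for i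
    using \<sigma>(1)[of i] by (auto dest: borel_measurable_simple_function)
  define k where "k i u = (LINT s|lborel. \<bar>g (\<sigma> i u - s) - g (u - s)\<bar>)" for i u
  have k0: "(\<lambda>i. k i u) \<longlonglongrightarrow> 0" for u
    using L1_translation_continuous_integrable[OF g] \<sigma>(2) unfolding k_def L1_translation_continuous_def by blast
  have kb: "0 \<le> k i u" "k i u \<le> 2 * (LINT s|lborel. \<bar>g s\<bar>)" for i u
  proof -
    show "0 \<le> k i u" unfolding k_def by (rule integral_nonneg_AE) simp
    note i = lborel_integrable_reflect(1)[THEN iffD2, OF g]
    have "k i u \<le> (LINT s|lborel. \<bar>g (\<sigma> i u - s)\<bar> + \<bar>g (u - s)\<bar>)"
      unfolding k_def by (intro integral_mono integrable_abs Bochner_Integration.integrable_add Bochner_Integration.integrable_diff i) linarith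
    also have "\<dots> = (LINT s|lborel. \<bar>g (\<sigma> i u - s)\<bar>) + (LINT s|lborel. \<bar>g (u - s)\<bar>)"
      by (intro Bochner_Integration.integral_add integrable_abs i)
    also have "\<dots> = 2 * (LINT s|lborel. \<bar>g s\<bar>)"
      using lborel_integrable_reflect(2)[of "\<lambda>s. \<bar>g s\<bar>" u] lborel_integrable_reflect(2)[of "\<lambda>s. \<bar>g s\<bar>" "\<sigma> i u"] by simp
    finally show "k i u \<le> 2 * (LINT s|lborel. \<bar>g s\<bar>)" .
  qed
  have km[measurable]: "k i \<in> borel_measurable borel" for i unfolding k_def by measurable
  have Bi: "integrable lborel (indicat_real B)" using B by (intro integrable_real_indicator) auto
  have ki: "integrable lborel (\<lambda>u. indicator B u * k i u)" for i
    by (rule Bochner_Integration.integrable_bound[OF integrable_mult_right[OF Bi, of "2 * (LINT s|lborel. \<bar>g s\<bar>)"]])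
       (use kb in \<open>auto split: split_indicator\<close>)
  have "(\<lambda>i. LINT u|lborel. indicator B u * k i u) \<longlonglongrightarrow> (LINT u|(lborel :: 'a measure). (0::real))"
  proof (rule integral_dominated_convergence[OF _ _ integrable_mult_right[OF Bi, of "2 * (LINT s|lborel. \<bar>g s\<bar>)"]])
    show "AE u in lborel. (\<lambda>i. indicator B u * k i u) \<longlonglongrightarrow> 0"
      by (intro AE_I2 tendsto_mult_right_zero k0)
    show "AE u in lborel. norm (indicator B u * k i u) \<le> 2 * (LINT s|lborel. \<bar>g s\<bar>) * indicator B u" for i
      using kb by (intro AE_I2) (auto split: split_indicator)
  qed measurable
  then have "(\<lambda>i. LINT u|lborel. indicator B u * k i u) \<longlonglongrightarrow> 0" by simp
  from order_tendstoD(2)[OF this e] obtain i where i: "(LINT u|lborel. indicator B u * k i u) < e"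
    by (auto simp: eventually_sequentially)
  define J where "J = range (\<sigma> i)"
  have J: "finite J" using \<sigma>(1)[of i] by (simp add: J_def simple_function_def)
  define A where "A v = B \<inter> {u. \<sigma> i u = v}" for v
  have [measurable]: "A v \<in> sets borel" for v unfolding A_def by measurable
  have Ai: "integrable lborel (indicat_real (A v))" for v
  proof (rule integrable_real_indicator)
    have "emeasure lborel (A v) \<le> emeasure lborel B" by (rule emeasure_mono) (auto simp: A_def)
    then show "emeasure lborel (A v) < \<infinity>" using B(2) by simp
  qed simp
  have pt: "indicator B u * g (\<sigma> i u - s) = (\<Sum>v\<in>J. indicator (A v) u * g (v - s))" for u s
  proof -
    have "(\<Sum>v\<in>J. indicator (A v) u * g (v - s)) = (\<Sum>v\<in>J. if v = \<sigma> i u then indicator B u * g (v - s) else 0)"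
      by (rule sum.cong) (auto simp: A_def split: split_indicator)
    then show ?thesis using J by (simp add: J_def)
  qed
  have Gi: "integrable lborel (\<lambda>u. indicator B u * g (\<sigma> i u - s))" for s
    unfolding pt by (intro Bochner_Integration.integrable_sum integrable_mult_left Ai)
  have G: "(LINT u|lborel. indicator B u * g (\<sigma> i u - s)) = (\<Sum>v\<in>J. measure lborel (A v) * g (v - s))" for s
    unfolding pt by (subst Bochner_Integration.integral_sum) (auto intro!: integrable_mult_left Ai)
  have Ci: "integrable lborel (\<lambda>u. indicator B u * g (u - s))" for s
    using integrable_mult_indicator[of B lborel "\<lambda>u. g (u - s)"] lborel_integral_translate(2)[of g s] g by simp
  define H where "H = (\<lambda>(u, s). indicator B u * (g (\<sigma> i u - s) - g (u - s)))"
  have Hm[measurable]: "H \<in> borel_measurable (lborel \<Otimes>\<^sub>M lborel)" unfolding H_def by measurable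
  have Habs: "(LINT s|lborel. \<bar>H (u, s)\<bar>) = indicator B u * k i u" for u
    by (simp add: H_def k_def abs_mult)
  have Hi: "integrable (lborel \<Otimes>\<^sub>M lborel) H"
  proof (rule lborel_pair.Fubini_integrable[OF Hm])
    show "integrable lborel (\<lambda>u. LINT s|lborel. norm (H (u, s)))" using ki by (simp add: Habs)
    show "AE u in lborel. integrable lborel (\<lambda>s. H (u, s))"
      unfolding H_def by (auto intro!: AE_I2 integrable_mult_right Bochner_Integration.integrable_diff
          lborel_integrable_reflect(1)[THEN iffD2, OF g])
  qed
  have H_int: "(LINT u|lborel. H (u, s)) = (\<Sum>v\<in>J. measure lborel (A v) * g (v - s)) - (LINT u|lborel. indicator B u * g (u - s))" for s
    unfolding G[symmetric] H_def by (simp add: right_diff_distrib Gi Ci)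
  have "integrable lborel (\<lambda>s. LINT u|lborel. H (u, s))"
    using lborel_pair.integrable_snd[of "\<lambda>u s. H (u, s)"] Hi by simp
  moreover have "(LINT s|lborel. \<bar>LINT u|lborel. H (u, s)\<bar>) < e"
  proof -
    have "(LINT s|lborel. \<bar>LINT u|lborel. H (u, s)\<bar>) \<le> (LINT s|lborel. LINT u|lborel. \<bar>H (u, s)\<bar>)"
      using lborel_pair.integrable_snd[of "\<lambda>u s. H (u, s)"] lborel_pair.integrable_snd[of "\<lambda>u s. \<bar>H (u, s)\<bar>"] Hi
      by (intro integral_mono integral_abs_bound integrable_abs) (simp_all add: split_def)
    also have "\<dots> = (LINT u|lborel. LINT s|lborel. \<bar>H (u, s)\<bar>)"
      using lborel_pair.Fubini_integral[of "\<lambda>u s. \<bar>H (u, s)\<bar>"] Hi by (simp add: split_def)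
    also have "\<dots> < e" using i by (simp add: Habs)
    finally show ?thesis .
  qed
  ultimately show ?thesis
    using J unfolding H_int by (intro exI[of _ J] exI[of _ "\<lambda>v. measure lborel (A v)"] conjI)
qed

text \<open>Superpositions over growing balls tend pointwise to the constant. Each is approximated
  in L1 by a finite sum of translates up to 1 / (m + 1), and a subsequence of the errors tends to 0
  almost everywhere.\<close>

theorem translates_converge_to_integral:
  fixes g :: "'a::euclidean_space \<Rightarrow> real"
  assumes g: "integrable lborel g"
  shows "\<exists>J w. (\<forall>n. finite (J n)) \<and>
    (AE s in lborel. (\<lambda>n::nat. \<Sum>v\<in>J n. w n v * g (v - s)) \<longlonglongrightarrow> (LINT u|lborel. g u))"
proof -
  define C where "C m s = (LINT u|lborel. indicator (cball 0 (real m)) u * g (u - s))" for m and s :: 'a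
  have [measurable]: "g \<in> borel_measurable borel" using g by auto
  have [measurable]: "cball (0::'a) (real m) \<in> sets borel" for m by (intro borel_closed closed_cball)
  define Q where "Q m J w \<longleftrightarrow> finite J \<and> integrable lborel (\<lambda>s. (\<Sum>v\<in>J. w v * g (v - s)) - C m s) \<and>
    (LINT s|lborel. \<bar>(\<Sum>v\<in>J. w v * g (v - s)) - C m s\<bar>) < 1 / Suc m" for m J w
  have "\<exists>J w. Q m J w" for m
    unfolding C_def Q_def by (rule L1_approx_by_translates[OF g _ emeasure_bounded_finite[OF bounded_cball]]) auto
  then obtain J w where "\<And>m. Q m (J m) (w m)" by metis
  then have Jw: "finite (J m)" "integrable lborel (\<lambda>s. (\<Sum>v\<in>J m. w m v * g (v - s)) - C m s)"
    "(LINT s|lborel. \<bar>(\<Sum>v\<in>J m. w m v * g (v - s)) - C m s\<bar>) < 1 / Suc m" for m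
    unfolding Q_def by simp_all
  have "(\<lambda>m. LINT s|lborel. norm ((\<Sum>v\<in>J m. w m v * g (v - s)) - C m s)) \<longlonglongrightarrow> 0"
  proof (rule Lim_null_comparison[OF always_eventually LIMSEQ_Suc[OF lim_1_over_n]], rule allI)
    show "norm (LINT s|lborel. norm ((\<Sum>v\<in>J m. w m v * g (v - s)) - C m s)) \<le> 1 / real (Suc m)" for m
      using Jw(3)[of m] by (simp add: integral_nonneg_AE)
  qed
  from tendsto_L1_AE_subseq[OF Jw(2) this] obtain r where
    r: "strict_mono (r :: nat \<Rightarrow> nat)"
    "AE s in lborel. (\<lambda>n. (\<Sum>v\<in>J (r n). w (r n) v * g (v - s)) - C (r n) s) \<longlonglongrightarrow> 0" by blast
  have C: "(\<lambda>m. C m s) \<longlonglongrightarrow> (LINT u|lborel. g u)" for s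
  proof -
    have i: "integrable lborel (\<lambda>u. g (u - s))" using lborel_integral_translate(2)[of g s] g by simp
    have "(\<lambda>m. C m s) \<longlonglongrightarrow> (LINT u|lborel. g (u - s))"
      unfolding C_def
    proof (rule integral_dominated_convergence[OF _ _ integrable_norm[OF i]])
      show "AE u in lborel. (\<lambda>m. indicator (cball 0 (real m)) u * g (u - s)) \<longlonglongrightarrow> g (u - s)"
      proof (rule AE_I2, rule tendsto_eventually)
        fix u :: 'a
        obtain N :: nat where "norm u \<le> N" using real_arch_simple by blast
        then show "\<forall>\<^sub>F m in sequentially. indicator (cball 0 (real m)) u * g (u - s) = g (u - s)"
          by (auto simp: eventually_sequentially intro!: exI[of _ N])
      qed
    qed (auto split: split_indicator)
    then show ?thesis by (simp add: lborel_integral_translate)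
  qed
  have "AE s in lborel. (\<lambda>n. \<Sum>v\<in>J (r n). w (r n) v * g (v - s)) \<longlonglongrightarrow> (LINT u|lborel. g u)"
    using r(2)
  proof eventually_elim
    case (elim s)
    from tendsto_add[OF elim LIMSEQ_subseq_LIMSEQ[OF C[of s] r(1)]] show ?case by (simp add: comp_def)
  qed
  then show ?thesis using Jw(1) by (intro exI[of _ "\<lambda>n. J (r n)"] exI[of _ "\<lambda>n. w (r n)"]) auto
qed

section \<open>Trigonometric polynomials as test functions\<close>

inductive trig_poly :: "(real \<Rightarrow> complex) \<Rightarrow> bool" where
  zero: "trig_poly (\<lambda>_. 0)"
| add_term: "trig_poly f \<Longrightarrow> trig_poly (\<lambda>x. f x + p * iexp (\<xi> * x))"

lemma trig_poly_add: "trig_poly g \<Longrightarrow> trig_poly f \<Longrightarrow> trig_poly (\<lambda>x. f x + g x)"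
proof (induction rule: trig_poly.induct)
  case (add_term g p \<xi>)
  from trig_poly.add_term[OF add_term.IH[OF add_term.prems], of p \<xi>] show ?case by (simp add: add.assoc)
qed simp

lemma trig_poly_mult_term: "trig_poly f \<Longrightarrow> trig_poly (\<lambda>x. f x * (p * iexp (\<xi> * x)))"
proof (induction rule: trig_poly.induct)
  case zero
  show ?case by (simp add: trig_poly.zero)
next
  case (add_term f p' \<xi>')
  from trig_poly.add_term[OF add_term.IH, of "p' * p" "\<xi>' + \<xi>"] show ?case
    by (simp add: distrib_right distrib_left exp_add mult_ac)
qed

lemma trig_poly_mult: "trig_poly g \<Longrightarrow> trig_poly f \<Longrightarrow> trig_poly (\<lambda>x. f x * g x)"
proof (induction rule: trig_poly.induct)
  case zero
  show ?case by (simp add: trig_poly.zero)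
next
  case (add_term g p \<xi>)
  from trig_poly_add[OF trig_poly_mult_term[OF add_term.prems, of p \<xi>] add_term.IH[OF add_term.prems]] show ?case
    by (simp add: distrib_left)
qed

lemma trig_poly_const: "trig_poly (\<lambda>_. c)"
  using trig_poly.add_term[OF trig_poly.zero, of c 0] by simp

lemma trig_poly_sin: "trig_poly (\<lambda>x. complex_of_real (sin (\<delta> * x)))"
proof -
  have "complex_of_real (sin t) = - \<i> / 2 * iexp t + \<i> / 2 * iexp (- t)" for t
    by (simp add: complex_eq_iff exp_of_real Re_exp Im_exp)
  then have "(\<lambda>x. complex_of_real (sin (\<delta> * x))) = (\<lambda>x. (0 + - \<i> / 2 * iexp (\<delta> * x)) + \<i> / 2 * iexp ((- \<delta>) * x))"
    by (simp add: fun_eq_iff)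
  moreover have "trig_poly (\<lambda>x. (0 + - \<i> / 2 * iexp (\<delta> * x)) + \<i> / 2 * iexp ((- \<delta>) * x))"
    by (intro trig_poly.intros)
  ultimately show ?thesis by (simp only:)
qed

lemma trig_poly_real_polynomial_function:
  assumes "real_polynomial_function q" "trig_poly (\<lambda>x. complex_of_real (f x))"
  shows "trig_poly (\<lambda>x. complex_of_real (q (f x)))"
  using assms
proof (induction q rule: real_polynomial_function.induct)
  case (linear q)
  then obtain c where "q = (\<lambda>x. x * c)" using real_bounded_linear by blast
  then show ?case using trig_poly_mult[OF trig_poly_const[of "complex_of_real c"] linear(2)] by simp
next
  case (const c)
  show ?case by (rule trig_poly_const)
next
  case (add q1 q2)
  then show ?case using trig_poly_add[of "\<lambda>x. complex_of_real (q2 (f x))" "\<lambda>x. complex_of_real (q1 (f x))"] by simp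
next
  case (mult q1 q2)
  then show ?case using trig_poly_mult[of "\<lambda>x. complex_of_real (q2 (f x))" "\<lambda>x. complex_of_real (q1 (f x))"] by simp
qed

text \<open>The inductive form makes closure under products easy; this indexed form is the one
  against which exponents are tested.\<close>

lemma trig_poly_rep:
  assumes "trig_poly f"
  shows "\<exists>(n::nat) p \<xi>. f = (\<lambda>x. \<Sum>k<n. p k * iexp (\<xi> k * x))"
  using assms
proof (induction rule: trig_poly.induct)
  case zero
  show ?case by (intro exI[of _ 0]) simp
next
  case (add_term f p' \<xi>')
  then obtain n :: nat and p \<xi> where f: "f = (\<lambda>x. \<Sum>k<n. p k * iexp (\<xi> k * x))" by blast
  show ?case
    by (intro exI[of _ "Suc n"] exI[of _ "p(n := p')"] exI[of _ "\<xi>(n := \<xi>')"]) (simp add: f)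
qed

lemma tendsto_scaled_sin: "(\<lambda>n. real (Suc n) * sin (1 / real (Suc n) * x)) \<longlonglongrightarrow> x"
proof (rule LIM_zero_cancel, rule Lim_null_comparison[OF always_eventually], rule allI)
  fix n
  let ?t = "1 / real (Suc n) * x"
  have "norm (iexp ?t - (\<Sum>k\<le>1. (\<i> * ?t) ^ k / fact k)) \<le> \<bar>?t\<bar> ^ Suc 1 / fact (Suc 1)" by (rule iexp_approx1)
  then have "norm (iexp ?t - (1 + \<i> * ?t)) \<le> ?t\<^sup>2 / 2" by (simp add: power2_eq_square)
  with abs_Im_le_cmod[of "iexp ?t - (1 + \<i> * ?t)"] have "\<bar>sin ?t - ?t\<bar> \<le> ?t\<^sup>2 / 2" by (simp add: Im_exp)
  then have "real (Suc n) * \<bar>sin ?t - ?t\<bar> \<le> real (Suc n) * (?t\<^sup>2 / 2)" by (rule mult_left_mono) simp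
  also have "\<dots> = x\<^sup>2 / 2 * (1 / real (Suc n))" by (simp add: power2_eq_square del: of_nat_Suc)
  also have "real (Suc n) * \<bar>sin ?t - ?t\<bar> = norm (real (Suc n) * sin ?t - x)"
  proof -
    have e: "real (Suc n) * sin ?t - x = real (Suc n) * (sin ?t - ?t)"
      by (simp add: right_diff_distrib del: of_nat_Suc)
    show ?thesis unfolding e real_norm_def abs_mult by simp
  qed
  finally show "norm (real (Suc n) * sin ?t - x) \<le> x\<^sup>2 / 2 * (1 / real (Suc n))" .
next
  have "(\<lambda>n. x\<^sup>2 / 2 * (1 / real (Suc n))) \<longlonglongrightarrow> x\<^sup>2 / 2 * 0" by (intro tendsto_intros LIMSEQ_Suc lim_1_over_n)
  then show "(\<lambda>n. x\<^sup>2 / 2 * (1 / real (Suc n))) \<longlonglongrightarrow> 0" by simp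
qed

text \<open>Composing Weierstrass polynomials with the bounded function \<open>n sin (x / n)\<close>, which tends to \<open>x\<close>,
  keeps the trigonometric polynomials uniformly bounded on the whole line.\<close>
lemma continuous_limit_of_trig_polys:
  fixes h :: "real \<Rightarrow> real"
  assumes h: "continuous_on UNIV h" "\<And>x. 0 \<le> h x" "\<And>x. h x \<le> B"
  shows "\<exists>R. (\<forall>n. trig_poly (\<lambda>x. complex_of_real (R n x))) \<and> (\<forall>n x. 0 \<le> R n x \<and> R n x \<le> B + 2) \<and>
    (\<forall>x. (\<lambda>n::nat. R n x) \<longlonglongrightarrow> h x)"
proof -
  define d where "d n = 1 / real (Suc n)" for n
  have d: "0 < d n" "d n \<le> 1" for n by (auto simp: d_def)
  \<comment> \<open>Approximating \<open>h + d n\<close> within \<open>d n\<close> puts the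
    polynomial between h and h + 2 \<open>d n\<close>: nonnegativity survives, and the upper bound
    grows by at most 2.\<close>
  have "\<exists>q. real_polynomial_function q \<and> (\<forall>x\<in>{- real (Suc n)..real (Suc n)}. \<bar>(h x + d n) - q x\<bar> < d n)" for n
  proof -
    have "continuous_on {- real (Suc n)..real (Suc n)} (\<lambda>x. h x + d n)"
      by (intro continuous_intros continuous_on_subset[OF h(1)]) simp
    from compact_Icc this d(1)[of n] obtain q where "real_polynomial_function q"
      "\<And>x. x \<in> {- real (Suc n)..real (Suc n)} \<Longrightarrow> \<bar>(h x + d n) - q x\<bar> < d n"
      by (rule Stone_Weierstrass_real_polynomial_function) (rule that)
    then show ?thesis by (intro exI[of _ q]) simp
  qed
  then obtain q where q0: "\<And>n. real_polynomial_function (q n) \<and>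
    (\<forall>x\<in>{- real (Suc n)..real (Suc n)}. \<bar>(h x + d n) - q n x\<bar> < d n)" by metis
  then have q: "real_polynomial_function (q n)"
    "\<bar>x\<bar> \<le> real (Suc n) \<Longrightarrow> \<bar>(h x + d n) - q n x\<bar> < d n" for n x
    by (auto simp: abs_le_iff)
  define y where "y n x = real (Suc n) * sin (1 / real (Suc n) * x)" for n x
  have y: "\<bar>y n x\<bar> \<le> real (Suc n)" for n x
    unfolding y_def abs_mult by (simp add: mult_left_le del: of_nat_Suc)
  have qy: "h (y n x) \<le> q n (y n x)" "q n (y n x) \<le> h (y n x) + 2 * d n" for n x
    using q(2)[OF y, of n x] by linarith+
  have "trig_poly (\<lambda>x. complex_of_real (q n (y n x)))" for n
  proof (rule trig_poly_real_polynomial_function[OF q(1)])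
    show "trig_poly (\<lambda>x. complex_of_real (y n x))"
      using trig_poly_mult[OF trig_poly_sin[of "1 / real (Suc n)"] trig_poly_const[of "complex_of_real (real (Suc n))"]]
      by (simp add: y_def)
  qed
  moreover have "0 \<le> q n (y n x) \<and> q n (y n x) \<le> B + 2" for n x
    using qy[of n x] h(2,3)[of "y n x"] d[of n] by linarith
  moreover have "(\<lambda>n. q n (y n x)) \<longlonglongrightarrow> h x" for x
  proof -
    have "isCont h x" using h(1) by (simp add: continuous_on_eq_continuous_at)
    then have hy: "(\<lambda>n. h (y n x)) \<longlonglongrightarrow> h x"
      by (rule isCont_tendsto_compose) (unfold y_def, rule tendsto_scaled_sin)
    have "(\<lambda>n. h (y n x) + 2 * d n) \<longlonglongrightarrow> h x + 2 * 0"
      unfolding d_def by (intro tendsto_intros hy LIMSEQ_Suc lim_1_over_n)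
    then have up: "(\<lambda>n. h (y n x) + 2 * d n) \<longlonglongrightarrow> h x" by simp
    show ?thesis
      by (rule tendsto_sandwich[OF _ _ hy up]) (simp_all add: qy)
  qed
  ultimately show ?thesis by (intro exI[of _ "\<lambda>n x. q n (y n x)"]) auto
qed

section \<open>Sums, differences and dilations of Levy measures\<close>

text \<open>The sigma-algebra is taken from the first measure; the rules below ask the second to
  have the same one.\<close>

definition plus_measure :: "'x measure \<Rightarrow> 'x measure \<Rightarrow> 'x measure" where
  "plus_measure M N = measure_of (space M) (sets M) (\<lambda>A. emeasure M A + emeasure N A)"

lemma sets_plus_measure [simp]: "sets (plus_measure M N) = sets M"
  and space_plus_measure [simp]: "space (plus_measure M N) = space M"
  by (simp_all add: plus_measure_def)

lemma emeasure_plus_measure: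
  assumes "sets N = sets M" "A \<in> sets M"
  shows "emeasure (plus_measure M N) A = emeasure M A + emeasure N A"
  unfolding plus_measure_def
proof (rule emeasure_measure_of_sigma)
  show "positive (sets M) (\<lambda>A. emeasure M A + emeasure N A)" by (simp add: positive_def)
  show "countably_additive (sets M) (\<lambda>A. emeasure M A + emeasure N A)"
  proof (rule countably_additiveI)
    fix F :: "nat \<Rightarrow> 'a set" assume F: "range F \<subseteq> sets M" "disjoint_family F" "(\<Union>i. F i) \<in> sets M"
    then show "(\<Sum>i. emeasure M (F i) + emeasure N (F i)) = emeasure M (\<Union>i. F i) + emeasure N (\<Union>i. F i)"
      using assms(1) by (simp add: suminf_add[symmetric] suminf_emeasure)
  qed
qed (use assms in \<open>auto simp: sets.sigma_algebra_axioms\<close>)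

lemma nn_integral_plus_measure:
  fixes M N :: "'x measure"
  assumes sets: "sets N = sets M" and f: "f \<in> borel_measurable M"
  shows "(\<integral>\<^sup>+x. f x \<partial>plus_measure M N) = (\<integral>\<^sup>+x. f x \<partial>M) + (\<integral>\<^sup>+x. f x \<partial>N)"
proof -
  have mN: "g \<in> borel_measurable N \<longleftrightarrow> g \<in> borel_measurable M" for g :: "'x \<Rightarrow> ennreal"
    by (simp add: measurable_cong_sets[OF sets refl])
  have mP: "g \<in> borel_measurable (plus_measure M N) \<longleftrightarrow> g \<in> borel_measurable M" for g :: "'x \<Rightarrow> ennreal"
    by (simp add: measurable_cong_sets[OF sets_plus_measure refl])
  have sp: "space N = space M" using sets by (rule sets_eq_imp_space_eq)
  show ?thesis
    using f
  proof (induction rule: borel_measurable_induct)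
    case (cong f g)
    have "integral\<^sup>N K f = integral\<^sup>N K g" if "space K = space M" for K
      using cong(3) that by (intro nn_integral_cong) simp
    then show ?case using cong(4) sp by simp
  next
    case (set A)
    then show ?case using emeasure_plus_measure[OF sets, of A] sets by simp
  next
    case (mult u c)
    then show ?case by (simp add: nn_integral_cmult distrib_left mN mP)
  next
    case (add u v)
    then show ?case by (simp add: nn_integral_add add_ac mN mP)
  next
    case (seq U)
    have S: "integral\<^sup>N K (SUP i. U i) = (SUP i. integral\<^sup>N K (U i))" if "\<And>i. U i \<in> borel_measurable K" for K
    proof -
      have "(SUP i. U i) = (\<lambda>x. SUP i. U i x)" by (simp add: fun_eq_iff image_comp)
      then show ?thesis using nn_integral_monotone_convergence_SUP[OF seq(3) that] by simp
    qed
    have "(SUP i. integral\<^sup>N M (U i) + integral\<^sup>N N (U i)) = (SUP i. integral\<^sup>N M (U i)) + (SUP i. integral\<^sup>N N (U i))"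
      using seq(3) by (intro ennreal_SUP_add incseq_nn_integral)
    moreover have "U i \<in> borel_measurable N" "U i \<in> borel_measurable (plus_measure M N)" for i
      using seq(1) mN mP by simp_all
    note SK = S[OF this(1)] S[OF this(2)] S[OF seq(1)]
    ultimately show ?case unfolding seq(4) by (simp only: SK seq(5))
  qed
qed

lemma integral_plus_measure_real:
  fixes f :: "'x \<Rightarrow> real"
  assumes sets: "sets N = sets M" and M: "integrable M f" and N: "integrable N f"
  shows "integrable (plus_measure M N) f" "(LINT x|plus_measure M N. f x) = (LINT x|M. f x) + (LINT x|N. f x)"
proof -
  have [measurable]: "f \<in> borel_measurable M" using M by auto
  have m: "f \<in> borel_measurable (plus_measure M N)" by (simp add: measurable_cong_sets[OF sets_plus_measure refl])
  note P = nn_integral_plus_measure[OF sets]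
  show i: "integrable (plus_measure M N) f"
    using M N m unfolding integrable_iff_bounded by (simp add: P)
  have fin: "(\<integral>\<^sup>+x. ennreal (f x) \<partial>K) < \<infinity>" "(\<integral>\<^sup>+x. ennreal (- f x) \<partial>K) < \<infinity>" if "integrable K f" for K
    using that by (simp_all add: real_integrable_def less_top)
  show "(LINT x|plus_measure M N. f x) = (LINT x|M. f x) + (LINT x|N. f x)"
    unfolding real_lebesgue_integral_def[OF i] real_lebesgue_integral_def[OF M] real_lebesgue_integral_def[OF N]
    using fin[OF M] fin[OF N] by (simp add: P enn2real_plus)
qed

lemma integral_plus_measure:
  fixes f :: "'x \<Rightarrow> complex"
  assumes sets: "sets N = sets M" and M: "integrable M f" and N: "integrable N f"
  shows "integrable (plus_measure M N) f" "(CLINT x|plus_measure M N. f x) = (CLINT x|M. f x) + (CLINT x|N. f x)"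
proof -
  note R = integral_plus_measure_real[OF sets integrable_Re[OF M] integrable_Re[OF N]]
  note I = integral_plus_measure_real[OF sets integrable_Im[OF M] integrable_Im[OF N]]
  have f: "f = (\<lambda>x. complex_of_real (Re (f x)) + \<i> * complex_of_real (Im (f x)))" by (simp add: complex_eq fun_eq_iff)
  show i: "integrable (plus_measure M N) f"
    by (subst f) (intro Bochner_Integration.integrable_add integrable_mult_right integrable_of_real R(1) I(1))
  show "(CLINT x|plus_measure M N. f x) = (CLINT x|M. f x) + (CLINT x|N. f x)"
  proof (rule complex_eqI)
    show "Re (CLINT x|plus_measure M N. f x) = Re ((CLINT x|M. f x) + (CLINT x|N. f x))"
      using R(2) by (simp only: integral_Re[OF i] integral_Re[OF M] integral_Re[OF N] plus_complex.sel)
    show "Im (CLINT x|plus_measure M N. f x) = Im ((CLINT x|M. f x) + (CLINT x|N. f x))"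
      using I(2) by (simp only: integral_Im[OF i] integral_Im[OF M] integral_Im[OF N] plus_complex.sel)
  qed
qed

lemma lborel_nn_integral_reflect:
  fixes f :: "'a::euclidean_space \<Rightarrow> ennreal"
  assumes [measurable]: "f \<in> borel_measurable borel"
  shows "(\<integral>\<^sup>+s. f (u - s) \<partial>lborel) = (\<integral>\<^sup>+s. f s \<partial>lborel)"
proof -
  have eq: "(lborel :: 'a measure) = distr lborel borel (\<lambda>s. u - s)"
    by (subst lborel_affine[of "-1" u]) (auto simp: density_1 one_ennreal_def[symmetric])
  show ?thesis by (subst (2) eq) (simp add: nn_integral_distr)
qed

section \<open>Comparison, difference and dilation of jump measures\<close>

lemma levy_measure_sets: "levy_measure \<mu> \<Longrightarrow> sets \<mu> = sets borel"
  by (simp add: levy_measure_def)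

lemma levy_measure_emeasure_zero: "levy_measure \<mu> \<Longrightarrow> emeasure \<mu> {0} = 0"
  by (simp add: levy_measure_def)

lemma levy_measure_tail_finite:
  assumes \<mu>: "levy_measure \<mu>" and "0 < e"
  shows "emeasure \<mu> {x. e < \<bar>x\<bar>} < \<infinity>"
proof -
  have [measurable_cong]: "sets \<mu> = sets borel" using \<mu> by (rule levy_measure_sets)
  let ?c = "min 1 (e\<^sup>2)"
  have c: "0 < ?c" using assms(2) by simp
  have "ennreal ?c * emeasure \<mu> {x. e < \<bar>x\<bar>} = (\<integral>\<^sup>+x. ennreal ?c * indicator {x. e < \<bar>x\<bar>} x \<partial>\<mu>)"
    by (subst nn_integral_cmult_indicator) (auto simp: levy_measure_sets[OF \<mu>])
  also have "\<dots> \<le> (\<integral>\<^sup>+x. ennreal (min 1 (x\<^sup>2)) \<partial>\<mu>)"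
  proof (rule nn_integral_mono)
    fix x
    show "ennreal ?c * indicator {x. e < \<bar>x\<bar>} x \<le> ennreal (min 1 (x\<^sup>2))"
    proof (cases "e < \<bar>x\<bar>")
      case True
      then have "e\<^sup>2 \<le> x\<^sup>2" using assms(2) abs_le_square_iff[of e x] by simp
      then have "?c \<le> min 1 (x\<^sup>2)" by auto
      then show ?thesis using True by (simp add: ennreal_leI)
    qed simp
  qed
  also have "\<dots> < \<infinity>" using \<mu> by (simp add: levy_measure_def)
  finally show ?thesis using c by (auto simp: ennreal_mult_less_top)
qed

text \<open>The tails have finite mass and, together with the null set {0}, cover the line.\<close>

lemma levy_measure_sigma_finite:
  assumes \<mu>: "levy_measure \<mu>" shows "sigma_finite_measure \<mu>"
proof
  let ?A = "\<lambda>n::nat. {x::real. 1 / real (Suc n) < \<bar>x\<bar>}"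
  have "(\<Union>n. ?A n) \<union> {0} = UNIV"
  proof (intro equalityI subsetI)
    fix x :: real
    show "x \<in> (\<Union>n. ?A n) \<union> {0}"
    proof (cases "x = 0")
      case False
      then obtain n where "1 / real (Suc n) < \<bar>x\<bar>" using nat_approx_posE[of "\<bar>x\<bar>"] by auto
      then show ?thesis by blast
    qed simp
  qed simp
  moreover have "space \<mu> = UNIV" using sets_eq_imp_space_eq[OF levy_measure_sets[OF \<mu>]] by simp
  ultimately show "\<exists>A. countable A \<and> A \<subseteq> sets \<mu> \<and> \<Union>A = space \<mu> \<and> (\<forall>a\<in>A. emeasure \<mu> a \<noteq> \<infinity>)"
    using levy_measure_tail_finite[OF \<mu>] levy_measure_emeasure_zero[OF \<mu>]
    by (intro exI[of _ "insert {0} (range ?A)"]) (auto simp: levy_measure_sets[OF \<mu>] less_top)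
qed

text \<open>Tent functions decreasing to the indicator of a compact subset K of B tend to 0 at the
  point 0, which lies outside K, so the extra term disappears. Inner regularity passes from K to
  B.\<close>

lemma finite_measure_le_of_integral_le:
  fixes m1 m2 :: "real measure" and C :: real
  assumes "finite_measure m1" "finite_measure m2" and s1: "sets m1 = sets borel" and s2: "sets m2 = sets borel"
    and le: "\<And>(h :: real \<Rightarrow> real) B. continuous_on UNIV h \<Longrightarrow> (\<And>x. 0 \<le> h x) \<Longrightarrow> (\<And>x. h x \<le> B) \<Longrightarrow>
      (LINT x|m2. h x) \<le> (LINT x|m1. h x) + C * h 0"
    and B: "B \<in> sets borel" "0 \<notin> B"
  shows "emeasure m2 B \<le> emeasure m1 B"
proof -
  interpret m1: finite_measure m1 by fact
  interpret m2: finite_measure m2 by fact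
  note [measurable_cong] = s1 s2
  have K: "emeasure m2 K \<le> emeasure m1 B" if K: "K \<subseteq> B" "compact K" for K
  proof (cases "K = {}")
    case False
    have Kc: "closed K" using K(2) by (rule compact_imp_closed)
    have [measurable]: "K \<in> sets borel" using Kc by (rule borel_closed)
    define h where "h n x = max 0 (1 - real n * infdist x K)" for n x
    have hcont: "continuous_on UNIV (h n)" for n unfolding h_def by (intro continuous_intros)
    have [measurable]: "h n \<in> borel_measurable borel" for n by (rule borel_measurable_continuous_onI[OF hcont])
    have h01: "0 \<le> h n x" "h n x \<le> 1" for n x by (auto simp: h_def infdist_nonneg)
    have hlim: "(\<lambda>n. h n x) \<longlonglongrightarrow> indicator K x" for x
    proof (cases "x \<in> K")
      case True
      then show ?thesis by (simp add: h_def)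
    next
      case out: False
      then have pos: "0 < infdist x K" using Kc False by (metis in_closed_iff_infdist_zero infdist_nonneg less_eq_real_def)
      obtain N :: nat where N: "1 / infdist x K \<le> N" using real_arch_simple by blast
      have "h n x = 0" if "N \<le> n" for n
      proof -
        have "1 / infdist x K \<le> n" using N that by linarith
        then have "1 \<le> real n * infdist x K" using pos by (simp add: divide_le_eq)
        then show ?thesis by (simp add: h_def)
      qed
      then show ?thesis using out by (intro tendsto_eventually) (auto simp: eventually_sequentially)
    qed
    have lim: "(\<lambda>n. LINT x|m. h n x) \<longlonglongrightarrow> measure m K" if "finite_measure m" "sets m = sets borel" for m
    proof -
      interpret finite_measure m by fact
      note [measurable_cong] = that(2)
      have "(\<lambda>n. LINT x|m. h n x) \<longlonglongrightarrow> (LINT x|m. indicator K x)"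
        by (rule integral_dominated_convergence[where w="\<lambda>_. 1"]) (auto intro!: hlim simp: h01)
      moreover have "space m = UNIV" using sets_eq_imp_space_eq[OF that(2)] by simp
      ultimately show ?thesis by simp
    qed
    have "measure m2 K \<le> measure m1 K + C * indicator K 0"
    proof (rule LIMSEQ_le[OF lim[OF assms(2) s2]])
      show "(\<lambda>n. (LINT x|m1. h n x) + C * h n 0) \<longlonglongrightarrow> measure m1 K + C * indicator K 0"
        by (intro tendsto_intros lim assms(1) s1 hlim)
      show "\<exists>N. \<forall>n\<ge>N. (LINT x|m2. h n x) \<le> (LINT x|m1. h n x) + C * h n 0"
        using le[OF hcont h01] by blast
    qed
    also have "indicator K (0::real) = (0::real)" using K(1) B(2) by (metis indicator_simps(2) subsetD)
    also have "measure m1 K + C * 0 = measure m1 K" by simp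
    also have "\<dots> \<le> measure m1 B" using K(1) B(1) s1 by (intro m1.finite_measure_mono) auto
    finally show ?thesis by (simp add: m1.emeasure_eq_measure m2.emeasure_eq_measure)
  qed simp
  have "emeasure m2 B = (SUP K\<in>{K. K \<subseteq> B \<and> compact K}. emeasure m2 K)"
    by (rule inner_regular) (use s2 B(1) in auto)
  also have "\<dots> \<le> emeasure m1 B" using K by (intro SUP_least) auto
  finally show ?thesis .
qed

text \<open>A Radon-Nikodym density cannot exceed 1: on the part of a tail where it does, the masses
  are finite and ordered, so the integral of the excess is 0. The tails exhaust all x \<noteq>
  0.\<close>

lemma density_of_dominated_levy_measure:
  assumes \<mu>1: "levy_measure \<mu>1" and \<mu>2: "levy_measure \<mu>2"
    and le: "\<And>A. A \<in> sets borel \<Longrightarrow> emeasure \<mu>2 A \<le> emeasure \<mu>1 A"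
  shows "\<exists>f. f \<in> borel_measurable borel \<and> (\<forall>x. 0 \<le> f x \<and> f x \<le> (1::real)) \<and> density \<mu>1 (\<lambda>x. ennreal (f x)) = \<mu>2"
proof -
  interpret sigma_finite_measure \<mu>1 using \<mu>1 by (rule levy_measure_sigma_finite)
  note s1[measurable_cong] = levy_measure_sets[OF \<mu>1] and s2 = levy_measure_sets[OF \<mu>2]
  have s21: "sets \<mu>2 = sets \<mu>1" using s1 s2 by simp
  have "absolutely_continuous \<mu>1 \<mu>2"
    unfolding absolutely_continuous_def
  proof
    fix A assume A: "A \<in> null_sets \<mu>1"
    then have "A \<in> sets borel" "emeasure \<mu>1 A = 0" using s1 by (auto simp: null_sets_def)
    then have "emeasure \<mu>2 A = 0" using le[of A] by simp
    then show "A \<in> null_sets \<mu>2" using \<open>A \<in> sets borel\<close> s2 by (simp add: null_sets_def)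
  qed
  from Radon_Nikodym[OF this s21] obtain f0 where "f0 \<in> borel_measurable \<mu>1" and d0: "density \<mu>1 f0 = \<mu>2" by (elim bexE)
  then have f0: "f0 \<in> borel_measurable borel" "density \<mu>1 f0 = \<mu>2" using measurable_cong_sets[OF s1 refl] by blast+
  note [measurable] = f0(1)
  have "AE x in \<mu>1. f0 x \<le> 1"
  proof -
    have null: "AE x in \<mu>1. 1 / real (Suc n) < \<bar>x\<bar> \<longrightarrow> f0 x \<le> 1" for n
    proof -
      let ?B = "{x. 1 / real (Suc n) < \<bar>x\<bar> \<and> 1 < f0 x}"
      have B: "?B \<in> sets borel" by measurable
      have fin: "emeasure \<mu>1 ?B < \<infinity>"
      proof -
        have "emeasure \<mu>1 ?B \<le> emeasure \<mu>1 {x. 1 / real (Suc n) < \<bar>x\<bar>}"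
          by (rule emeasure_mono) (auto simp: s1)
        also have "\<dots> < \<infinity>" by (rule levy_measure_tail_finite[OF \<mu>1]) simp
        finally show ?thesis .
      qed
      have "emeasure \<mu>1 ?B + (\<integral>\<^sup>+x. (f0 x - 1) * indicator ?B x \<partial>\<mu>1) =
        (\<integral>\<^sup>+x. indicator ?B x + (f0 x - 1) * indicator ?B x \<partial>\<mu>1)"
        using B by (subst nn_integral_add) (auto simp: s1)
      also have "\<dots> = (\<integral>\<^sup>+x. f0 x * indicator ?B x \<partial>\<mu>1)"
        by (intro nn_integral_cong) (auto split: split_indicator simp: add_diff_inverse_ennreal less_imp_le)
      also have "\<dots> = emeasure \<mu>2 ?B" using B by (subst f0(2)[symmetric], subst emeasure_density) (auto simp: s1)
      also have "\<dots> \<le> emeasure \<mu>1 ?B" by (rule le[OF B])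
      finally have le0: "emeasure \<mu>1 ?B + (\<integral>\<^sup>+x. (f0 x - 1) * indicator ?B x \<partial>\<mu>1) \<le> emeasure \<mu>1 ?B + 0" by simp
      then have "(\<integral>\<^sup>+x. (f0 x - 1) * indicator ?B x \<partial>\<mu>1) \<le> 0"
        using fin by (subst (asm) ennreal_add_left_cancel_le) auto
      then have "(\<integral>\<^sup>+x. (f0 x - 1) * indicator ?B x \<partial>\<mu>1) = 0" by simp
      then have "AE x in \<mu>1. (f0 x - 1) * indicator ?B x = 0"
        using B by (subst (asm) nn_integral_0_iff_AE) auto
      then show ?thesis
      proof eventually_elim
        case (elim x)
        show ?case
        proof (intro impI, rule ccontr)
          assume "1 / real (Suc n) < \<bar>x\<bar>" "\<not> f0 x \<le> 1"
          then have "f0 x - 1 = 0" using elim by (simp add: not_le)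
          then have "f0 x \<le> 1" by (simp add: diff_eq_0_iff_ennreal)
          then show False using \<open>\<not> f0 x \<le> 1\<close> by simp
        qed
      qed
    qed
    have "AE x in \<mu>1. \<forall>n. 1 / real (Suc n) < \<bar>x\<bar> \<longrightarrow> f0 x \<le> 1"
      unfolding AE_all_countable using null by blast
    moreover have "AE x in \<mu>1. x \<noteq> 0"
      by (rule AE_I[of _ _ "{0}"]) (auto simp: s1 levy_measure_emeasure_zero[OF \<mu>1])
    ultimately show ?thesis
    proof eventually_elim
      case (elim x)
      then show ?case using nat_approx_posE[of "\<bar>x\<bar>"] by auto
    qed
  qed
  \<comment> \<open>Clipping at 1 changes the density only on a null set and makes the bound hold
    everywhere.\<close>
  define f where "f x = enn2real (min 1 (f0 x))" for x
  have "density \<mu>1 (\<lambda>x. ennreal (f x)) = density \<mu>1 f0"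
  proof (rule density_cong)
    show "AE x in \<mu>1. ennreal (f x) = f0 x"
      using \<open>AE x in \<mu>1. f0 x \<le> 1\<close>
    proof eventually_elim
      case (elim x)
      then have "f0 x < \<infinity>" by (auto intro: le_less_trans)
      with elim show ?case by (simp add: f_def min_absorb2)
    qed
  qed (auto simp: f_def)
  moreover have "0 \<le> f x \<and> f x \<le> 1" for x
    using enn2real_mono[of "min 1 (f0 x)" 1] by (simp add: f_def)
  moreover have "f \<in> borel_measurable borel" unfolding f_def by measurable
  ultimately show ?thesis using f0(2) by (intro exI[of _ f]) auto
qed

text \<open>The difference is the measure with density 1 - f with respect to \<mu>1, where f is the
  density of \<mu>2.\<close>

lemma levy_jump_diff:
  assumes \<mu>1: "levy_measure \<mu>1" and \<mu>2: "levy_measure \<mu>2"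
    and le: "\<And>A. A \<in> sets borel \<Longrightarrow> emeasure \<mu>2 A \<le> emeasure \<mu>1 A"
  shows "\<exists>\<mu>. levy_measure \<mu> \<and> (\<forall>\<theta>. levy_jump \<mu> \<theta> = levy_jump \<mu>1 \<theta> - levy_jump \<mu>2 \<theta>)"
proof -
  from density_of_dominated_levy_measure[OF assms] obtain f where
    f[measurable]: "f \<in> borel_measurable borel" and f01: "\<And>x. 0 \<le> f x \<and> f x \<le> (1::real)"
    and d: "density \<mu>1 (\<lambda>x. ennreal (f x)) = \<mu>2" by blast
  note s1[measurable_cong] = levy_measure_sets[OF \<mu>1]
  let ?\<mu> = "density \<mu>1 (\<lambda>x. ennreal (1 - f x))"
  let ?e = "\<lambda>\<theta> x. iexp (\<theta> * x) - 1 - \<i> * complex_of_real (\<theta> * tau1 x)"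
  have "levy_measure ?\<mu>"
    unfolding levy_measure_def
  proof (intro conjI)
    show "emeasure ?\<mu> {0} = 0"
    proof -
      have "emeasure ?\<mu> {0} = (\<integral>\<^sup>+x. ennreal (1 - f x) * indicator {0} x \<partial>\<mu>1)"
        by (rule emeasure_density) (auto simp: s1)
      also have "\<dots> \<le> (\<integral>\<^sup>+x. indicator {0} x \<partial>\<mu>1)"
        using f01 by (intro nn_integral_mono) (auto split: split_indicator simp: ennreal_le_1)
      also have "\<dots> = 0" using levy_measure_emeasure_zero[OF \<mu>1] by (simp add: s1)
      finally show ?thesis by simp
    qed
    have "(\<integral>\<^sup>+x. ennreal (min 1 (x\<^sup>2)) \<partial>?\<mu>) = (\<integral>\<^sup>+x. ennreal (1 - f x) * ennreal (min 1 (x\<^sup>2)) \<partial>\<mu>1)"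
      by (rule nn_integral_density) auto
    also have "\<dots> \<le> (\<integral>\<^sup>+x. 1 * ennreal (min 1 (x\<^sup>2)) \<partial>\<mu>1)"
      using f01 by (intro nn_integral_mono mult_right_mono) (auto simp: ennreal_le_1)
    also have "\<dots> < \<infinity>" using \<mu>1 by (simp add: levy_measure_def)
    finally show "(\<integral>\<^sup>+x. ennreal (min 1 (x\<^sup>2)) \<partial>?\<mu>) < \<infinity>" .
  qed (simp add: s1)
  moreover have "levy_jump ?\<mu> \<theta> = levy_jump \<mu>1 \<theta> - levy_jump \<mu>2 \<theta>" for \<theta>
  proof -
    have i: "complex_integrable \<mu>1 (?e \<theta>)" by (rule integrable_levy_integrand[OF \<mu>1])
    have "complex_integrable \<mu>1 (\<lambda>x. f x *\<^sub>R ?e \<theta> x)"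
    proof (rule Bochner_Integration.integrable_bound[OF i])
      show "AE x in \<mu>1. norm (f x *\<^sub>R ?e \<theta> x) \<le> norm (?e \<theta> x)"
      proof (rule AE_I2)
        fix x
        have "\<bar>f x\<bar> \<le> 1" using f01[of x] by simp
        then show "norm (f x *\<^sub>R ?e \<theta> x) \<le> norm (?e \<theta> x)" unfolding norm_scaleR by (rule mult_left_le_one_le[rotated 2]) simp_all
      qed
    qed measurable
    then have "(CLINT x|\<mu>1. (1 - f x) *\<^sub>R ?e \<theta> x) = (CLINT x|\<mu>1. ?e \<theta> x) - (CLINT x|\<mu>1. f x *\<^sub>R ?e \<theta> x)"
      unfolding scaleR_left_diff_distrib scaleR_one using i by (intro Bochner_Integration.integral_diff)
    moreover have "levy_jump ?\<mu> \<theta> = (CLINT x|\<mu>1. (1 - f x) *\<^sub>R ?e \<theta> x)"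
      unfolding levy_jump_def using f01 by (intro integral_density) auto
    moreover have "levy_jump \<mu>2 \<theta> = (CLINT x|\<mu>1. f x *\<^sub>R ?e \<theta> x)"
      unfolding levy_jump_def d[symmetric] using f01 by (intro integral_density) auto
    ultimately show ?thesis by (simp add: levy_jump_def)
  qed
  ultimately show ?thesis by blast
qed

lemma levy_measure_plus:
  assumes \<mu>: "levy_measure \<mu>" and \<nu>: "levy_measure \<nu>"
  shows "levy_measure (plus_measure \<mu> \<nu>)" "levy_jump (plus_measure \<mu> \<nu>) \<theta> = levy_jump \<mu> \<theta> + levy_jump \<nu> \<theta>"
proof -
  have s: "sets \<nu> = sets \<mu>" using levy_measure_sets[OF \<mu>] levy_measure_sets[OF \<nu>] by simp
  note [measurable_cong] = levy_measure_sets[OF \<mu>]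
  show "levy_measure (plus_measure \<mu> \<nu>)"
    using \<mu> \<nu> unfolding levy_measure_def by (simp add: emeasure_plus_measure[OF s] nn_integral_plus_measure[OF s])
  show "levy_jump (plus_measure \<mu> \<nu>) \<theta> = levy_jump \<mu> \<theta> + levy_jump \<nu> \<theta>"
    unfolding levy_jump_def
    by (intro integral_plus_measure(2)[OF s] integrable_levy_integrand \<mu> \<nu>)
qed

text \<open>Dilation exchanges the compensators \<open>tau1 x\<close> / q and
  \<open>tau1 (x / q)\<close>; their difference is integrable and contributes only the drift
  d.\<close>

lemma levy_measure_dilation:
  assumes \<mu>: "levy_measure \<mu>" and q: "1 < q"
  shows "levy_measure (distr \<mu> borel (\<lambda>x. x / q))"
    and "\<exists>d. \<forall>\<theta>. levy_jump \<mu> (\<theta> / q) = levy_jump (distr \<mu> borel (\<lambda>x. x / q)) \<theta> + \<i> * complex_of_real (d * \<theta>)"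
proof -
  note s[measurable_cong] = levy_measure_sets[OF \<mu>]
  have sp: "space \<mu> = UNIV" using sets_eq_imp_space_eq[OF s] by simp
  let ?\<nu> = "distr \<mu> borel (\<lambda>x. x / q)"
  show l: "levy_measure ?\<nu>"
    unfolding levy_measure_def
  proof (intro conjI)
    have "(\<lambda>x. x / q) -` {0} = {0}" using q by auto
    then show "emeasure ?\<nu> {0} = 0" using levy_measure_emeasure_zero[OF \<mu>] by (subst emeasure_distr) (auto simp: sp)
    have "(\<integral>\<^sup>+x. ennreal (min 1 (x\<^sup>2)) \<partial>?\<nu>) = (\<integral>\<^sup>+x. ennreal (min 1 ((x / q)\<^sup>2)) \<partial>\<mu>)"
      by (subst nn_integral_distr) auto
    also have "\<dots> \<le> (\<integral>\<^sup>+x. ennreal (min 1 (x\<^sup>2)) \<partial>\<mu>)"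
    proof (intro nn_integral_mono ennreal_leI min_one_square_mono)
      fix x show "\<bar>x / q\<bar> \<le> \<bar>x\<bar>" using q by (simp add: divide_le_eq mult_left_mono[of 1 q "\<bar>x\<bar>", simplified])
    qed
    also have "\<dots> < \<infinity>" using \<mu> by (simp add: levy_measure_def)
    finally show "(\<integral>\<^sup>+x. ennreal (min 1 (x\<^sup>2)) \<partial>?\<nu>) < \<infinity>" .
  qed simp
  define d where "d = (LINT x|\<mu>. tau1 (x * (1 / q)) - 1 / q * tau1 x)"
  have it: "integrable \<mu> (\<lambda>x. tau1 (x * (1 / q)) - 1 / q * tau1 x)"
  proof (rule levy_measure_integrableI[OF \<mu>, where B="(1 + \<bar>1 / q\<bar>) * (1 + (1 / q)\<^sup>2)"])
    show "norm (tau1 (x * (1 / q)) - 1 / q * tau1 x) \<le> (1 + \<bar>1 / q\<bar>) * (1 + (1 / q)\<^sup>2) * min 1 (x\<^sup>2)" for x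
      using tau1_scale_le[of x "1 / q"] by (simp only: real_norm_def)
  qed measurable
  have "levy_jump \<mu> (\<theta> / q) = levy_jump ?\<nu> \<theta> + \<i> * complex_of_real (d * \<theta>)" for \<theta>
  proof -
    let ?e = "\<lambda>x. iexp (\<theta> * x) - 1 - \<i> * complex_of_real (\<theta> * tau1 x)"
    have "integrable ?\<nu> ?e" by (rule integrable_levy_integrand[OF l])
    then have i: "integrable \<mu> (\<lambda>x. ?e (x / q))" by (subst (asm) integrable_distr_eq) auto
    have "levy_jump \<mu> (\<theta> / q) = (CLINT x|\<mu>. ?e (x / q) + \<i> * complex_of_real \<theta> * complex_of_real (tau1 (x * (1 / q)) - 1 / q * tau1 x))"
      unfolding levy_jump_def by (intro Bochner_Integration.integral_cong) (auto simp: algebra_simps)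
    also have "\<dots> = (CLINT x|\<mu>. ?e (x / q)) + \<i> * complex_of_real \<theta> * complex_of_real d"
      unfolding d_def
      by (subst Bochner_Integration.integral_add[OF i integrable_mult_right[OF integrable_of_real[OF it]]])
         (simp only: integral_mult_right_zero integral_complex_of_real)
    also have "(CLINT x|\<mu>. ?e (x / q)) = levy_jump ?\<nu> \<theta>"
      unfolding levy_jump_def by (subst integral_distr) auto
    finally show ?thesis by (simp add: mult_ac)
  qed
  then show "\<exists>d. \<forall>\<theta>. levy_jump \<mu> (\<theta> / q) = levy_jump ?\<nu> \<theta> + \<i> * complex_of_real (d * \<theta>)" by blast
qed

section \<open>Positivity of the jump measure of an exponent\<close>

text \<open>The quadratic bound serves integrability against a jump measure, the linear one
  integrability in s for a kernel in L1.\<close>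

lemma one_minus_cos_bounds:
  "0 \<le> 1 - cos y" "1 - cos y \<le> 2 * min 1 (y\<^sup>2)" "1 - cos y \<le> 2 * \<bar>y\<bar>" for y :: real
proof -
  have c: "- 1 \<le> cos y" "cos y \<le> 1" by simp_all
  show "0 \<le> 1 - cos y" using c by simp
  have "norm (iexp y - (\<Sum>k\<le>1. (\<i> * y) ^ k / fact k)) \<le> \<bar>y\<bar> ^ Suc 1 / fact (Suc 1)" by (rule iexp_approx1)
  then have "norm (iexp y - (1 + \<i> * y)) \<le> y\<^sup>2 / 2" by (simp add: power2_eq_square)
  with abs_Re_le_cmod[of "iexp y - (1 + \<i> * y)"] have "\<bar>cos y - 1\<bar> \<le> y\<^sup>2 / 2" by (simp add: Re_exp)
  then have q: "1 - cos y \<le> 2 * y\<^sup>2" using zero_le_power2[of y] by linarith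
  then show m: "1 - cos y \<le> 2 * min 1 (y\<^sup>2)" using c by (auto simp: min_def)
  show "1 - cos y \<le> 2 * \<bar>y\<bar>"
  proof (cases "\<bar>y\<bar> \<le> 1")
    case True
    then have "y\<^sup>2 \<le> \<bar>y\<bar>" by (metis abs_ge_zero mult_left_le power2_abs power2_eq_square)
    then show ?thesis using q by simp
  next
    case False
    then show ?thesis using c by linarith
  qed
qed

lemma one_minus_cos_mult_le: "1 - cos (a * x) \<le> 2 * (1 + a\<^sup>2) * min 1 (x\<^sup>2)" for a x :: real
  using one_minus_cos_bounds(2)[of "a * x"] min_one_square_scale[of x a, unfolded mult.commute[of x a]] by linarith

lemma integrable_one_minus_cos:
  fixes f :: "real \<Rightarrow> 'b::{banach, second_countable_topology}"
  assumes "levy_measure \<mu>" and [measurable]: "f \<in> borel_measurable borel" and "\<And>x. norm (f x) \<le> B"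
  shows "integrable \<mu> (\<lambda>x. (1 - cos (a * x)) *\<^sub>R f x)"
proof (rule levy_measure_integrableI[OF assms(1), where B="2 * (1 + a\<^sup>2) * B"])
  fix x
  have "norm ((1 - cos (a * x)) *\<^sub>R f x) \<le> (2 * (1 + a\<^sup>2) * min 1 (x\<^sup>2)) * B"
    unfolding norm_scaleR using one_minus_cos_mult_le[of a x] one_minus_cos_bounds(1)[of "a * x"] assms(3)[of x]
    by (intro mult_mono) auto
  then show "norm ((1 - cos (a * x)) *\<^sub>R f x) \<le> 2 * (1 + a\<^sup>2) * B * min 1 (x\<^sup>2)" by (simp only: mult_ac)
qed measurable

lemma iexp_add: "iexp (a + b) = iexp a * iexp b"
  by (simp add: distrib_left exp_add)

text \<open>The constant and the compensator are affine in the argument, so they cancel in a second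
  difference with step a.\<close>

lemma levy_jump_second_difference:
  assumes \<mu>: "levy_measure \<mu>"
  shows "2 * levy_jump \<mu> b - levy_jump \<mu> (a + b) - levy_jump \<mu> (b - a) =
    (CLINT x|\<mu>. (1 - cos (a * x)) *\<^sub>R (2 * iexp (b * x)))"
proof -
  let ?e = "\<lambda>\<theta> x. iexp (\<theta> * x) - 1 - \<i> * complex_of_real (\<theta> * tau1 x)"
  note i = integrable_levy_integrand[OF \<mu>]
  have pt: "(1 - cos (a * x)) *\<^sub>R (2 * iexp (b * x)) = 2 * ?e b x - ?e (a + b) x - ?e (b - a) x" for x
  proof -
    have "iexp ((a + b) * x) + iexp ((b - a) * x) = iexp (b * x) * (iexp (a * x) + iexp (- (a * x)))"
      by (simp add: distrib_left exp_add[symmetric] algebra_simps)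
    also have "iexp (a * x) + iexp (- (a * x)) = complex_of_real (2 * cos (a * x))"
      by (simp add: complex_eq_iff Re_exp Im_exp)
    finally show ?thesis by (simp add: scaleR_conv_of_real algebra_simps)
  qed
  have "(CLINT x|\<mu>. 2 * f0 x - f1 x - f2 x) = 2 * (CLINT x|\<mu>. f0 x) - (CLINT x|\<mu>. f1 x) - (CLINT x|\<mu>. f2 x)"
    if "complex_integrable \<mu> f0" "complex_integrable \<mu> f1" "complex_integrable \<mu> f2" for f0 f1 f2
    using that by simp
  from this[OF i i i] show ?thesis unfolding pt levy_jump_def by (rule sym)
qed

text \<open>The exponentials left by the second differences at the points \<xi> k G recombine to the
  value of r at G x.\<close>

lemma levy_jump_trig_sum:
  fixes n :: nat
  assumes \<mu>: "levy_measure \<mu>" and R: "\<And>v. (\<Sum>k<n. p k * iexp (\<xi> k * v)) = complex_of_real (r v)"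
  shows "(\<Sum>k<n. p k * (2 * levy_jump \<mu> (\<xi> k * G) - levy_jump \<mu> (a + \<xi> k * G) - levy_jump \<mu> (\<xi> k * G - a))) =
    complex_of_real (2 * (LINT x|\<mu>. (1 - cos (a * x)) * r (G * x)))"
proof -
  have i: "complex_integrable \<mu> (\<lambda>x. p k * ((1 - cos (a * x)) *\<^sub>R (2 * iexp (\<xi> k * G * x))))" for k
    by (intro integrable_mult_right integrable_one_minus_cos[OF \<mu>, where B=2]) (auto simp: norm_mult)
  have "(\<Sum>k<n. p k * (2 * levy_jump \<mu> (\<xi> k * G) - levy_jump \<mu> (a + \<xi> k * G) - levy_jump \<mu> (\<xi> k * G - a))) =
    (\<Sum>k<n. CLINT x|\<mu>. p k * ((1 - cos (a * x)) *\<^sub>R (2 * iexp (\<xi> k * G * x))))"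
    unfolding levy_jump_second_difference[OF \<mu>] by (intro sum.cong refl) (simp only: integral_mult_right_zero)
  also have "\<dots> = (CLINT x|\<mu>. \<Sum>k<n. p k * ((1 - cos (a * x)) *\<^sub>R (2 * iexp (\<xi> k * G * x))))"
    by (rule Bochner_Integration.integral_sum[symmetric]) (rule i)
  also have "\<dots> = (CLINT x|\<mu>. complex_of_real (2 * ((1 - cos (a * x)) * r (G * x))))"
  proof (rule Bochner_Integration.integral_cong[OF refl])
    fix x
    have "(\<Sum>k<n. p k * ((1 - cos (a * x)) *\<^sub>R (2 * iexp (\<xi> k * G * x)))) =
      complex_of_real (2 * (1 - cos (a * x))) * (\<Sum>k<n. p k * iexp (\<xi> k * (G * x)))"
    proof -
      have gen: "q * (c *\<^sub>R (2 * e)) = complex_of_real (2 * c) * (q * e)" for q e :: complex and c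
        by (simp add: scaleR_conv_of_real mult_ac)
      show ?thesis unfolding sum_distrib_left gen mult.assoc[of "\<xi> _" G x] ..
    qed
    then show "(\<Sum>k<n. p k * ((1 - cos (a * x)) *\<^sub>R (2 * iexp (\<xi> k * G * x)))) =
      complex_of_real (2 * ((1 - cos (a * x)) * r (G * x)))"
      unfolding R by simp
  qed
  also have "\<dots> = complex_of_real (2 * (LINT x|\<mu>. (1 - cos (a * x)) * r (G * x)))"
    by (simp only: integral_complex_of_real integral_mult_right_zero)
  finally show ?thesis .
qed

text \<open>The signed jump measure is kept as a pair, since both parts may have infinite mass near
  0.\<close>

definition levy_difference :: "real \<Rightarrow> real \<Rightarrow> real measure \<Rightarrow> real measure \<Rightarrow> real \<Rightarrow> complex" where
  "levy_difference a \<beta> \<mu>1 \<mu>2 \<theta> = \<i> * complex_of_real (a * \<theta>) - complex_of_real (\<beta> * \<theta>\<^sup>2 / 2)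
     + levy_jump \<mu>1 \<theta> - levy_jump \<mu>2 \<theta>"

text \<open>Second differences remove the drift and reduce the Gaussian part to \<beta> a^2. This is
  multiplied by the sum of the coefficients p k, that is, by r 0.\<close>

lemma levy_difference_trig_sum:
  fixes n :: nat
  assumes \<mu>1: "levy_measure \<mu>1" and \<mu>2: "levy_measure \<mu>2"
    and R: "\<And>v. (\<Sum>k<n. p k * iexp (\<xi> k * v)) = complex_of_real (r v)"
    and \<phi>: "\<And>\<theta>. \<phi> \<theta> = levy_difference c \<beta> \<mu>1 \<mu>2 \<theta>"
  shows "(\<Sum>k<n. p k * (2 * \<phi> (\<xi> k * G) - \<phi> (a + \<xi> k * G) - \<phi> (\<xi> k * G - a))) =
    complex_of_real (\<beta> * a\<^sup>2 * r 0 + 2 * (LINT x|\<mu>1. (1 - cos (a * x)) * r (G * x))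
      - 2 * (LINT x|\<mu>2. (1 - cos (a * x)) * r (G * x)))"
proof -
  have P: "2 * (\<i> * complex_of_real (c * b) - complex_of_real (\<beta> * b\<^sup>2 / 2)) - (\<i> * complex_of_real (c * (a + b)) - complex_of_real (\<beta> * (a + b)\<^sup>2 / 2))
      - (\<i> * complex_of_real (c * (b - a)) - complex_of_real (\<beta> * (b - a)\<^sup>2 / 2)) = complex_of_real (\<beta> * a\<^sup>2)" for b
    by (simp add: complex_eq_iff power2_eq_square field_simps)
  have split: "2 * \<phi> b - \<phi> (a + b) - \<phi> (b - a) = complex_of_real (\<beta> * a\<^sup>2)
     + (2 * levy_jump \<mu>1 b - levy_jump \<mu>1 (a + b) - levy_jump \<mu>1 (b - a))
     - (2 * levy_jump \<mu>2 b - levy_jump \<mu>2 (a + b) - levy_jump \<mu>2 (b - a))" for b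
  proof -
    have alg: "2 * (P0 + j0 - k0) - (P1 + j1 - k1) - (P2 + j2 - k2) = Q + (2 * j0 - j1 - j2) - (2 * k0 - k1 - k2)"
      if "2 * P0 - P1 - P2 = Q" for P0 P1 P2 j0 j1 j2 k0 k1 k2 Q :: complex
      unfolding that[symmetric] by (simp add: algebra_simps)
    show ?thesis unfolding \<phi> levy_difference_def by (rule alg[OF P])
  qed
  have p: "(\<Sum>k<n. p k) = complex_of_real (r 0)" using R[of 0] by simp
  have "(\<Sum>k<n. p k * (2 * \<phi> (\<xi> k * G) - \<phi> (a + \<xi> k * G) - \<phi> (\<xi> k * G - a))) =
    (\<Sum>k<n. p k) * complex_of_real (\<beta> * a\<^sup>2)
    + (\<Sum>k<n. p k * (2 * levy_jump \<mu>1 (\<xi> k * G) - levy_jump \<mu>1 (a + \<xi> k * G) - levy_jump \<mu>1 (\<xi> k * G - a)))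
    - (\<Sum>k<n. p k * (2 * levy_jump \<mu>2 (\<xi> k * G) - levy_jump \<mu>2 (a + \<xi> k * G) - levy_jump \<mu>2 (\<xi> k * G - a)))"
    unfolding split by (simp only: distrib_left right_diff_distrib[of "p _" "_ + _"] sum.distrib sum_subtractf sum_distrib_right)
  then show ?thesis
    unfolding levy_jump_trig_sum[OF \<mu>1 R] levy_jump_trig_sum[OF \<mu>2 R] p by (simp add: mult_ac)
qed

lemma tendsto_scaled_exp:
  fixes w :: complex
  shows "(\<lambda>n. of_nat (Suc n) * (exp (w / of_nat (Suc n)) - 1)) \<longlonglongrightarrow> w"
proof (rule LIM_zero_cancel, rule Lim_null_comparison[OF always_eventually], rule allI)
  fix n
  let ?N = "of_nat (Suc n) :: complex"
  let ?t = "w / ?N"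
  have "norm (exp t - 1 - t) \<le> exp \<bar>Re t\<bar> * (norm t)\<^sup>2" for t :: complex
    using Taylor_exp[of t 1] by (simp add: power2_eq_square diff_diff_eq)
  then have "norm (exp ?t - 1 - ?t) \<le> exp \<bar>Re ?t\<bar> * (norm ?t)\<^sup>2" .
  also have "\<dots> \<le> exp (norm w) * (norm ?t)\<^sup>2"
  proof (rule mult_right_mono)
    have "\<bar>Re ?t\<bar> \<le> norm ?t" by (rule abs_Re_le_cmod)
    also have "norm ?t = norm w / real (Suc n)" unfolding norm_divide norm_of_nat ..
    also have "\<dots> \<le> norm w" using divide_left_mono[of 1 "real (Suc n)" "norm w"] by simp
    finally show "exp \<bar>Re ?t\<bar> \<le> exp (norm w)" by simp
  qed simp
  also have "(norm ?t)\<^sup>2 = (norm w)\<^sup>2 / (real (Suc n))\<^sup>2" unfolding norm_divide norm_of_nat power_divide ..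
  finally have "real (Suc n) * norm (exp ?t - 1 - ?t) \<le> real (Suc n) * (exp (norm w) * ((norm w)\<^sup>2 / (real (Suc n))\<^sup>2))"
    by (rule mult_left_mono) simp
  also have "\<dots> = exp (norm w) * (norm w)\<^sup>2 * (1 / real (Suc n))" by (simp add: power2_eq_square del: of_nat_Suc)
  also have "real (Suc n) * norm (exp ?t - 1 - ?t) = norm (?N * (exp ?t - 1) - w)"
  proof -
    have "?N * (exp ?t - 1) - w = ?N * (exp ?t - 1 - ?t)" by (simp add: right_diff_distrib del: of_nat_Suc)
    then show ?thesis by (simp only: norm_mult norm_of_nat)
  qed
  finally show "norm (?N * (exp ?t - 1) - w) \<le> exp (norm w) * (norm w)\<^sup>2 * (1 / real (Suc n))" .
next
  have "(\<lambda>n. exp (norm w) * (norm w)\<^sup>2 * (1 / real (Suc n))) \<longlonglongrightarrow> exp (norm w) * (norm w)\<^sup>2 * 0"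
    by (intro tendsto_intros LIMSEQ_Suc lim_1_over_n)
  then show "(\<lambda>n. exp (norm w) * (norm w)\<^sup>2 * (1 / real (Suc n))) \<longlonglongrightarrow> 0" by simp
qed

text \<open>The easy half of Schoenberg's theorem (an exponent is conditionally positive definite), tested
  on the nonnegative trigonometric polynomials \<open>(2 - 2 cos (z Y)) r(W)\<close> in two linear forms, which vanish at 0.\<close>
lemma id_exponent_conditionally_positive:
  fixes n :: nat and y w :: "'i \<Rightarrow> real"
  assumes id: "id_exponent J \<Psi>" and R: "\<And>v. (\<Sum>k<n. p k * iexp (\<xi> k * v)) = complex_of_real (r v)"
    and r: "\<And>v. 0 \<le> r v"
  shows "0 \<le> Re (\<Sum>k<n. p k * (2 * \<Psi> (\<lambda>j. \<xi> k * w j) - \<Psi> (\<lambda>j. z * y j + \<xi> k * w j) - \<Psi> (\<lambda>j. \<xi> k * w j - z * y j)))"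
proof -
  let ?E0 = "\<lambda>t k. exp (complex_of_real t * \<Psi> (\<lambda>j. \<xi> k * w j))"
  let ?Ep = "\<lambda>t k. exp (complex_of_real t * \<Psi> (\<lambda>j. z * y j + \<xi> k * w j))"
  let ?Em = "\<lambda>t k. exp (complex_of_real t * \<Psi> (\<lambda>j. \<xi> k * w j - z * y j))"
  \<comment> \<open>The subtracted ones cancel, as 2 - 1 - 1 = 0, so this is an expectation under
    the law with exponent t \<Psi>. They are written for the sake of the limit t -> 0.\<close>
  have pos: "0 \<le> Re (\<Sum>k<n. p k * (2 * (?E0 t k - 1) - (?Ep t k - 1) - (?Em t k - 1)))" if "0 < t" for t
  proof -
    from id that obtain \<nu> where \<nu>: "prob_on J \<nu>" "\<And>\<theta>. charf J \<nu> \<theta> = exp (complex_of_real t * \<Psi> \<theta>)"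
      unfolding id_exponent_def by metis
    define Y where "Y x = (\<Sum>j\<in>J. y j * x j)" for x
    define W where "W x = (\<Sum>j\<in>J. w j * x j)" for x
    have lin: "(\<Sum>j\<in>J. (a * y j + b * w j) * x j) = a * Y x + b * W x" for a b x
      by (simp add: Y_def W_def sum_distrib_left sum.distrib[symmetric] algebra_simps)
    have c: "exp (complex_of_real t * \<Psi> (\<lambda>j. a * y j + b * w j)) = (CLINT x|\<nu>. iexp (a * Y x + b * W x))" for a b
      unfolding \<nu>(2)[symmetric] charf_def lin ..
    have i: "complex_integrable \<nu> (\<lambda>x. iexp (a * Y x + b * W x))" for a b
      using integrable_iexp_prob_on[OF \<nu>(1), of "\<lambda>j. a * y j + b * w j"] unfolding lin .
    have E: "?E0 t k = (CLINT x|\<nu>. iexp (0 * Y x + \<xi> k * W x))" "?Ep t k = (CLINT x|\<nu>. iexp (z * Y x + \<xi> k * W x))"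
      "?Em t k = (CLINT x|\<nu>. iexp ((- z) * Y x + \<xi> k * W x))" for k
      unfolding c[symmetric] by (simp_all add: algebra_simps)
    have "(\<Sum>k<n. p k * (2 * (?E0 t k - 1) - (?Ep t k - 1) - (?Em t k - 1))) =
      (\<Sum>k<n. CLINT x|\<nu>. p k * (2 * iexp (0 * Y x + \<xi> k * W x) - iexp (z * Y x + \<xi> k * W x) - iexp ((- z) * Y x + \<xi> k * W x)))"
    proof (rule sum.cong[OF refl])
      fix k
      have "(CLINT x|\<nu>. p k * (2 * iexp (0 * Y x + \<xi> k * W x) - iexp (z * Y x + \<xi> k * W x) - iexp ((- z) * Y x + \<xi> k * W x))) =
        p k * (2 * ?E0 t k - ?Ep t k - ?Em t k)"
        unfolding E using i[of 0 "\<xi> k"] i[of z "\<xi> k"] i[of "- z" "\<xi> k"] by simp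
      then show "p k * (2 * (?E0 t k - 1) - (?Ep t k - 1) - (?Em t k - 1)) =
        (CLINT x|\<nu>. p k * (2 * iexp (0 * Y x + \<xi> k * W x) - iexp (z * Y x + \<xi> k * W x) - iexp ((- z) * Y x + \<xi> k * W x)))"
        by (simp add: algebra_simps)
    qed
    also have "\<dots> = (CLINT x|\<nu>. \<Sum>k<n. p k * (2 * iexp (0 * Y x + \<xi> k * W x) - iexp (z * Y x + \<xi> k * W x) - iexp ((- z) * Y x + \<xi> k * W x)))"
      by (rule Bochner_Integration.integral_sum[symmetric])
         (intro integrable_mult_right Bochner_Integration.integrable_diff i)
    also have "\<dots> = (CLINT x|\<nu>. complex_of_real ((2 - 2 * cos (z * Y x)) * r (W x)))"
    proof (rule Bochner_Integration.integral_cong[OF refl])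
      fix x
      have cs: "iexp (z * Y x) + iexp ((- z) * Y x) = complex_of_real (2 * cos (z * Y x))"
        by (simp add: complex_eq_iff Re_exp Im_exp)
      have "(\<Sum>k<n. p k * (2 * iexp (0 * Y x + \<xi> k * W x) - iexp (z * Y x + \<xi> k * W x) - iexp ((- z) * Y x + \<xi> k * W x))) =
        (2 - (iexp (z * Y x) + iexp ((- z) * Y x))) * (\<Sum>k<n. p k * iexp (\<xi> k * W x))"
      proof -
        have gen: "q * (2 * (1 * e) - u * e - v * e) = (2 - (u + v)) * (q * e)" for q e u v :: complex
          by (simp add: algebra_simps)
        have z0: "iexp (0 * Y x) = 1" by simp
        show ?thesis unfolding sum_distrib_left iexp_add z0 gen ..
      qed
      then show "(\<Sum>k<n. p k * (2 * iexp (0 * Y x + \<xi> k * W x) - iexp (z * Y x + \<xi> k * W x) - iexp ((- z) * Y x + \<xi> k * W x))) =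
        complex_of_real ((2 - 2 * cos (z * Y x)) * r (W x))"
        unfolding cs R by simp
    qed
    also have "\<dots> = complex_of_real (LINT x|\<nu>. (2 - 2 * cos (z * Y x)) * r (W x))" by (rule integral_complex_of_real)
    finally have "Re (\<Sum>k<n. p k * (2 * (?E0 t k - 1) - (?Ep t k - 1) - (?Em t k - 1))) =
      (LINT x|\<nu>. (2 - 2 * cos (z * Y x)) * r (W x))" by simp
    also have "\<dots> \<ge> 0" by (intro integral_nonneg_AE AE_I2 mult_nonneg_nonneg r) simp
    finally show ?thesis .
  qed
  \<comment> \<open>With t = 1 / (m + 1), the factor m + 1 recovers \<Psi> as the limit of (exp (t
    \<Psi>) - 1) / t.\<close>
  let ?N = "\<lambda>m. complex_of_nat (Suc m)"
  let ?D = "\<lambda>m. \<Sum>k<n. p k * (2 * (?N m * (?E0 (1 / Suc m) k - 1)) - ?N m * (?Ep (1 / Suc m) k - 1) - ?N m * (?Em (1 / Suc m) k - 1))"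
  have e: "(\<lambda>m. ?N m * (exp (complex_of_real (1 / Suc m) * v) - 1)) \<longlonglongrightarrow> v" for v
    using tendsto_scaled_exp[of v] by (simp del: of_nat_Suc)
  have "(\<lambda>m. Re (?D m)) \<longlonglongrightarrow>
    Re (\<Sum>k<n. p k * (2 * \<Psi> (\<lambda>j. \<xi> k * w j) - \<Psi> (\<lambda>j. z * y j + \<xi> k * w j) - \<Psi> (\<lambda>j. \<xi> k * w j - z * y j)))"
    by (intro tendsto_intros e)
  moreover have "0 \<le> Re (?D m)" for m
  proof -
    have "?D m = of_real (real (Suc m)) * (\<Sum>k<n. p k * (2 * (?E0 (1 / Suc m) k - 1) - (?Ep (1 / Suc m) k - 1) - (?Em (1 / Suc m) k - 1)))"
      unfolding sum_distrib_left by (rule sum.cong[OF refl]) (simp add: algebra_simps del: of_nat_Suc)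
    moreover have "0 \<le> real (Suc m) * Re (\<Sum>k<n. p k * (2 * (?E0 (1 / Suc m) k - 1) - (?Ep (1 / Suc m) k - 1) - (?Em (1 / Suc m) k - 1)))"
      by (intro mult_nonneg_nonneg pos) auto
    ultimately show ?thesis by (simp only: Re_complex_of_real times_complex.sel Im_complex_of_real mult_zero_left diff_zero)
  qed
  ultimately show ?thesis by (intro LIMSEQ_le_const) auto
qed

section \<open>The product of Lebesgue and jump measure, weighted by 1 - cos\<close>

definition kernel_integrable :: "('a::euclidean_space \<Rightarrow> real) \<Rightarrow> real measure \<Rightarrow> bool" where
  "kernel_integrable g \<mu> \<longleftrightarrow> levy_measure \<mu> \<and> (\<integral>\<^sup>+s. \<integral>\<^sup>+x. ennreal (min 1 ((x * g s)\<^sup>2)) \<partial>\<mu> \<partial>lborel) < \<infinity>"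

text \<open>The argument \<open>- fst p\<close> makes \<open>g (- s)\<close> the kernel of the field at \<open>u = 0\<close>.\<close>
definition levy_kernel :: "('a::euclidean_space \<Rightarrow> real) \<Rightarrow> real \<Rightarrow> real measure \<Rightarrow> ('a \<times> real) measure" where
  "levy_kernel g z \<mu> = density (lborel \<Otimes>\<^sub>M \<mu>) (\<lambda>p. ennreal (1 - cos (z * g (- fst p) * snd p)))"

lemma sets_levy_kernel:
  assumes "levy_measure \<mu>"
  shows "sets (levy_kernel g z \<mu>) = sets (borel \<Otimes>\<^sub>M borel)"
proof -
  note [measurable_cong] = levy_measure_sets[OF assms]
  show ?thesis unfolding levy_kernel_def sets_density by (rule sets_pair_measure_cong) (simp_all add: levy_measure_sets[OF assms])
qed

text \<open>The weight is at most a multiple of min 1 ((x g(-s))^2), and reflection in s turns its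
  integral into the one in \<open>kernel_integrable\<close>.\<close>

lemma finite_measure_levy_kernel:
  fixes g :: "'a::euclidean_space \<Rightarrow> real"
  assumes [measurable]: "g \<in> borel_measurable borel" and \<mu>: "kernel_integrable g \<mu>"
  shows "finite_measure (levy_kernel g z \<mu>)"
proof
  have l: "levy_measure \<mu>" using \<mu> by (simp add: kernel_integrable_def)
  note [measurable_cong] = levy_measure_sets[OF l]
  interpret sigma_finite_measure \<mu> by (rule levy_measure_sigma_finite[OF l])
  let ?F = "\<lambda>s. \<integral>\<^sup>+x. ennreal (min 1 ((x * g s)\<^sup>2)) \<partial>\<mu>"
  have [measurable]: "?F \<in> borel_measurable borel" by measurable
  have "emeasure (levy_kernel g z \<mu>) (space (levy_kernel g z \<mu>)) =
    (\<integral>\<^sup>+p. ennreal (1 - cos (z * g (- fst p) * snd p)) \<partial>(lborel \<Otimes>\<^sub>M \<mu>))"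
    unfolding levy_kernel_def by (subst emeasure_density) (auto simp: space_pair_measure intro!: nn_integral_cong)
  also have "\<dots> \<le> (\<integral>\<^sup>+p. ennreal (2 * (1 + z\<^sup>2)) * ennreal (min 1 ((snd p * g (- fst p))\<^sup>2)) \<partial>(lborel \<Otimes>\<^sub>M \<mu>))"
  proof (rule nn_integral_mono)
    fix p :: "'a \<times> real"
    have "1 - cos (z * g (- fst p) * snd p) \<le> 2 * (1 + z\<^sup>2) * min 1 ((snd p * g (- fst p))\<^sup>2)"
      using one_minus_cos_mult_le[of z "g (- fst p) * snd p"] by (simp add: mult_ac)
    then show "ennreal (1 - cos (z * g (- fst p) * snd p)) \<le> ennreal (2 * (1 + z\<^sup>2)) * ennreal (min 1 ((snd p * g (- fst p))\<^sup>2))"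
      by (subst ennreal_mult[symmetric]) (auto intro: ennreal_leI)
  qed
  also have "\<dots> = ennreal (2 * (1 + z\<^sup>2)) * (\<integral>\<^sup>+p. ennreal (min 1 ((snd p * g (- fst p))\<^sup>2)) \<partial>(lborel \<Otimes>\<^sub>M \<mu>))"
    by (rule nn_integral_cmult) measurable
  also have "(\<integral>\<^sup>+p. ennreal (min 1 ((snd p * g (- fst p))\<^sup>2)) \<partial>(lborel \<Otimes>\<^sub>M \<mu>)) = (\<integral>\<^sup>+s. ?F (- s) \<partial>lborel)"
    by (subst nn_integral_fst[symmetric]) auto
  also have "\<dots> = (\<integral>\<^sup>+s. ?F s \<partial>lborel)"
    using lborel_nn_integral_reflect[of ?F 0] by simp
  also have "ennreal (2 * (1 + z\<^sup>2)) * (\<integral>\<^sup>+s. ?F s \<partial>lborel) < \<infinity>"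
    using \<mu> by (simp add: kernel_integrable_def ennreal_mult_less_top)
  finally show "emeasure (levy_kernel g z \<mu>) (space (levy_kernel g z \<mu>)) \<noteq> \<infinity>" by simp
qed

lemma levy_kernel_integral:
  fixes g :: "'a::euclidean_space \<Rightarrow> real"
  assumes g[measurable]: "g \<in> borel_measurable borel" and \<mu>: "kernel_integrable g \<mu>"
    and f[measurable]: "f \<in> borel_measurable (borel \<Otimes>\<^sub>M borel)" and B: "\<And>p. \<bar>f p\<bar> \<le> B"
  shows "integrable lborel (\<lambda>s. LINT x|\<mu>. (1 - cos (z * g (- s) * x)) * f (s, x))"
    and "(LINT p|levy_kernel g z \<mu>. f p) = (LINT s|lborel. LINT x|\<mu>. (1 - cos (z * g (- s) * x)) * f (s, x))"
proof -
  have l: "levy_measure \<mu>" using \<mu> by (simp add: kernel_integrable_def)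
  note [measurable_cong] = levy_measure_sets[OF l]
  interpret sigma_finite_measure \<mu> by (rule levy_measure_sigma_finite[OF l])
  interpret pair_sigma_finite lborel \<mu> ..
  interpret K: finite_measure "levy_kernel g z \<mu>" by (rule finite_measure_levy_kernel[OF g \<mu>])
  have fm: "f \<in> borel_measurable (lborel \<Otimes>\<^sub>M \<mu>)" by measurable
  have "integrable (levy_kernel g z \<mu>) f"
  proof (rule K.integrable_const_bound[where B=B])
    show "f \<in> borel_measurable (levy_kernel g z \<mu>)" unfolding levy_kernel_def using fm by simp
  qed (use B in auto)
  then have i: "integrable (lborel \<Otimes>\<^sub>M \<mu>) (\<lambda>p. (1 - cos (z * g (- fst p) * snd p)) * f p)"
    unfolding levy_kernel_def by (subst (asm) integrable_density) auto
  show "integrable lborel (\<lambda>s. LINT x|\<mu>. (1 - cos (z * g (- s) * x)) * f (s, x))"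
    using integrable_fst'[OF i] by simp
  have "(LINT p|levy_kernel g z \<mu>. f p) = (LINT p|(lborel \<Otimes>\<^sub>M \<mu>). (1 - cos (z * g (- fst p) * snd p)) * f p)"
    unfolding levy_kernel_def by (subst integral_density) auto
  also have "\<dots> = (LINT s|lborel. LINT x|\<mu>. (1 - cos (z * g (- s) * x)) * f (s, x))"
    using integral_fst'[OF i] by simp
  finally show "(LINT p|levy_kernel g z \<mu>. f p) = (LINT s|lborel. LINT x|\<mu>. (1 - cos (z * g (- s) * x)) * f (s, x))" .
qed

lemma AE_levy_kernel_fst:
  fixes g :: "'a::euclidean_space \<Rightarrow> real"
  assumes [measurable]: "g \<in> borel_measurable borel" and l: "levy_measure \<mu>" and P: "AE s in lborel. P s"
  shows "AE p in levy_kernel g z \<mu>. P (fst p)"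
proof -
  note [measurable_cong] = levy_measure_sets[OF l]
  interpret sigma_finite_measure \<mu> by (rule levy_measure_sigma_finite[OF l])
  from P obtain N where N: "{s\<in>space lborel. \<not> P s} \<subseteq> N" "emeasure lborel N = 0" "N \<in> sets lborel"
    by (auto elim: AE_E)
  have "AE p in lborel \<Otimes>\<^sub>M \<mu>. P (fst p)"
  proof (rule AE_I)
    show "{p \<in> space (lborel \<Otimes>\<^sub>M \<mu>). \<not> P (fst p)} \<subseteq> N \<times> space \<mu>"
      using N(1) by (auto simp: space_pair_measure)
    show "emeasure (lborel \<Otimes>\<^sub>M \<mu>) (N \<times> space \<mu>) = 0"
      using N by (subst emeasure_pair_measure_Times) auto
    show "N \<times> space \<mu> \<in> sets (lborel \<Otimes>\<^sub>M \<mu>)" using N(3) by (intro pair_measureI) auto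
  qed
  then show ?thesis unfolding levy_kernel_def by (subst AE_density) auto
qed

text \<open>The total weight, over all positions s, of a jump of size x at frequency z: the density
  left after projecting \<open>levy_kernel\<close> to the jump variable.\<close>

definition kernel_weight :: "('a::euclidean_space \<Rightarrow> real) \<Rightarrow> real \<Rightarrow> real \<Rightarrow> ennreal" where
  "kernel_weight g z x = (\<integral>\<^sup>+s. ennreal (1 - cos (z * g (- s) * x)) \<partial>lborel)"

lemma measurable_kernel_weight:
  assumes [measurable]: "g \<in> borel_measurable borel"
  shows "kernel_weight g z \<in> borel_measurable borel"
  unfolding kernel_weight_def by measurable

lemma emeasure_levy_kernel_strip:
  fixes g :: "'a::euclidean_space \<Rightarrow> real"
  assumes [measurable]: "g \<in> borel_measurable borel" and l: "levy_measure \<mu>" and B[measurable]: "B \<in> sets borel"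
  shows "emeasure (levy_kernel g z \<mu>) (UNIV \<times> B) = (\<integral>\<^sup>+x. kernel_weight g z x * indicator B x \<partial>\<mu>)"
proof -
  note s[measurable_cong] = levy_measure_sets[OF l]
  interpret sigma_finite_measure \<mu> by (rule levy_measure_sigma_finite[OF l])
  interpret pair_sigma_finite lborel \<mu> ..
  have "UNIV \<times> B \<in> sets (lborel \<Otimes>\<^sub>M \<mu>)" by (rule pair_measureI) (simp_all add: s)
  then have "emeasure (levy_kernel g z \<mu>) (UNIV \<times> B) =
    (\<integral>\<^sup>+p. ennreal (1 - cos (z * g (- fst p) * snd p)) * indicator (UNIV \<times> B) p \<partial>(lborel \<Otimes>\<^sub>M \<mu>))"
    unfolding levy_kernel_def by (intro emeasure_density) auto
  also have "\<dots> = (\<integral>\<^sup>+p. ennreal (1 - cos (z * g (- fst p) * snd p)) * indicator B (snd p) \<partial>(lborel \<Otimes>\<^sub>M \<mu>))"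
    by (intro nn_integral_cong) (auto simp: indicator_def)
  also have "\<dots> = (\<integral>\<^sup>+x. \<integral>\<^sup>+s. ennreal (1 - cos (z * g (- s) * x)) * indicator B x \<partial>lborel \<partial>\<mu>)"
    by (subst nn_integral_snd[symmetric]) auto
  also have "\<dots> = (\<integral>\<^sup>+x. kernel_weight g z x * indicator B x \<partial>\<mu>)"
    unfolding kernel_weight_def by (intro nn_integral_cong nn_integral_multc) measurable
  finally show ?thesis .
qed

text \<open>The linear bound on 1 - cos, against a kernel in L1.\<close>

lemma kernel_weight_finite:
  fixes g :: "'a::euclidean_space \<Rightarrow> real"
  assumes g: "integrable lborel g" shows "kernel_weight g z x < \<infinity>"
proof -
  have "integrable lborel (\<lambda>s. g (0 - s))" using g by (rule lborel_integrable_reflect(1)[THEN iffD2])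
  then have i: "integrable lborel (\<lambda>s. 2 * \<bar>z * g (- s) * x\<bar>)" by simp
  have "kernel_weight g z x \<le> (\<integral>\<^sup>+s. ennreal (2 * \<bar>z * g (- s) * x\<bar>) \<partial>lborel)"
    unfolding kernel_weight_def by (intro nn_integral_mono ennreal_leI one_minus_cos_bounds)
  also have "\<dots> < \<infinity>" using integrableD(2)[OF i] by (simp add: less_top nn_integral_eq_integral[OF i])
  finally show ?thesis .
qed

text \<open>Infinite descent: n = 2 k is even, and m, k satisfy the same equation with m < n, unless
  m is already 0.\<close>

lemma square_eq_twice_square_imp_zero:
  fixes m n :: nat
  shows "n\<^sup>2 = 2 * m\<^sup>2 \<Longrightarrow> m = 0"
proof (induction n arbitrary: m rule: less_induct)
  case (less n)
  have "even (n\<^sup>2)" using less.prems by simp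
  then obtain k where k: "n = 2 * k" by auto
  then have mk: "m\<^sup>2 = 2 * k\<^sup>2" using less.prems by (simp add: power2_eq_square)
  show ?case
  proof (cases "m < n")
    case True
    from less.IH[OF this mk] show ?thesis using mk by simp
  next
    case False
    then have "n\<^sup>2 \<le> m\<^sup>2" by (intro power_mono) simp_all
    then show ?thesis using less.prems by simp
  qed
qed

text \<open>A single frequency \<open>z\<close> gives no information where \<open>z * g (- s) * x\<close> is a multiple of \<open>2 * pi\<close>;
  two incommensurable frequencies leave no blind spot.\<close>
lemma cos_sqrt2_eq_1_imp_zero:
  fixes y :: real
  assumes "cos y = 1" "cos (sqrt 2 * y) = 1" shows "y = 0"
proof -
  from assms obtain m n :: int where m: "y = real_of_int m * 2 * pi" and n: "sqrt 2 * y = real_of_int n * 2 * pi"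
    using cos_one_2pi_int by metis
  have "sqrt 2 * real_of_int m = real_of_int n" using n unfolding m by simp
  then have "(sqrt 2 * real_of_int m)\<^sup>2 = (real_of_int n)\<^sup>2" by simp
  then have "real_of_int (2 * m\<^sup>2) = real_of_int (n\<^sup>2)" by (simp add: power_mult_distrib)
  then have "2 * m\<^sup>2 = n\<^sup>2" by (simp only: of_int_eq_iff)
  then have "int ((nat \<bar>n\<bar>)\<^sup>2) = int (2 * (nat \<bar>m\<bar>)\<^sup>2)" by simp
  then have "(nat \<bar>n\<bar>)\<^sup>2 = 2 * (nat \<bar>m\<bar>)\<^sup>2" by (simp only: of_nat_eq_iff)
  then have "nat \<bar>m\<bar> = 0" by (rule square_eq_twice_square_imp_zero)
  then show ?thesis using m by simp
qed

text \<open>If both weights vanish at x, then g (-s) x = 0 for almost all s by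
  \<open>cos_sqrt2_eq_1_imp_zero\<close>, and the integral of g would be 0.\<close>

lemma kernel_weight_pos:
  fixes g :: "'a::euclidean_space \<Rightarrow> real"
  assumes g: "integrable lborel g" and I: "(LINT u|lborel. g u) \<noteq> 0" and x: "x \<noteq> 0"
  shows "kernel_weight g 1 x + kernel_weight g (sqrt 2) x \<noteq> 0"
proof
  have [measurable]: "g \<in> borel_measurable borel" using g by auto
  assume "kernel_weight g 1 x + kernel_weight g (sqrt 2) x = 0"
  then have z: "kernel_weight g 1 x = 0" "kernel_weight g (sqrt 2) x = 0" by simp_all
  have AE: "AE s in lborel. cos (z * g (- s) * x) = 1" if "kernel_weight g z x = 0" for z
  proof -
    from that have "AE s in lborel. ennreal (1 - cos (z * g (- s) * x)) = 0"
      unfolding kernel_weight_def by (subst (asm) nn_integral_0_iff_AE) auto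
    then show ?thesis
    proof eventually_elim
      case (elim s)
      then have "1 - cos (z * g (- s) * x) \<le> 0" by (simp only: ennreal_eq_0_iff)
      then show ?case using one_minus_cos_bounds(1)[of "z * g (- s) * x"] by linarith
    qed
  qed
  from AE[OF z(1)] AE[OF z(2)] have "AE s in lborel. g (0 - s) = 0"
  proof eventually_elim
    case (elim s)
    have "g (- s) * x = 0" by (rule cos_sqrt2_eq_1_imp_zero) (use elim in \<open>simp_all add: mult.assoc\<close>)
    then show ?case using x by simp
  qed
  then have "(LINT s|lborel. g (0 - s)) = 0" by (rule integral_eq_zero_AE)
  then show False using I unfolding lborel_integrable_reflect(2) by simp
qed

section \<open>Testing the exponent of the field\<close>

context levy_triplet
begin

context
  fixes g :: "'a::euclidean_space \<Rightarrow> real" and \<phi> :: "real \<Rightarrow> complex" and c \<beta> \<kappa> :: real and \<mu>1 \<mu>2 :: "real measure"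
  assumes g: "integrable lborel g"
    and translates: "\<And>u. Phi0_integrable (\<lambda>s. g (u - s))"
    and \<phi>b: "Phi0_bounded \<phi>" and \<phi>: "\<And>\<theta>. \<phi> \<theta> = levy_difference c \<beta> \<mu>1 \<mu>2 \<theta>"
    and \<beta>: "\<beta> = 0 \<or> integrable lborel (\<lambda>s. (g s)\<^sup>2)"
    and k1: "kernel_integrable g \<mu>1" and k2: "kernel_integrable g \<mu>2"
    and \<kappa>: "0 < \<kappa>"
    and id: "\<And>J. finite J \<Longrightarrow> id_exponent J (field_exponent \<kappa> J (\<lambda>u s. g (u - s)) \<phi>)"
begin

lemma g_measurable [measurable]: "g \<in> borel_measurable borel" using g by auto

text \<open>Conditional positivity, with X_0 inside the cosine and the linear form with kernel
  \<open>G\<close> inside r. For each s, \<open>levy_difference_trig_sum\<close> with a = z g(-s)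
  evaluates the integrand; integration over s yields the two kernel measures.\<close>

lemma kernel_inequality_trig:
  fixes n :: nat
  assumes R: "\<And>v. (\<Sum>k<n. p k * iexp (\<xi> k * v)) = complex_of_real (r v)"
    and r: "\<And>v. 0 \<le> r v" "\<And>v. r v \<le> B" and J: "finite J"
  shows "(LINT p|levy_kernel g z \<mu>2. r ((\<Sum>j\<in>J. w j * g (j - fst p)) * snd p)) \<le>
    (LINT p|levy_kernel g z \<mu>1. r ((\<Sum>j\<in>J. w j * g (j - fst p)) * snd p)) + \<beta> * z\<^sup>2 / 2 * (LINT s|lborel. (g (- s))\<^sup>2) * r 0"
proof -
  have "r = (\<lambda>v. Re (\<Sum>k<n. p k * iexp (\<xi> k * v)))" unfolding R by simp
  also have "\<dots> \<in> borel_measurable borel" by measurable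
  finally have [measurable]: "r \<in> borel_measurable borel" .
  have l1: "levy_measure \<mu>1" and l2: "levy_measure \<mu>2" using k1 k2 by (auto simp: kernel_integrable_def)
  define G where "G s = (\<Sum>j\<in>J. w j * g (j - s))" for s
  have [measurable]: "G \<in> borel_measurable borel" unfolding G_def by measurable
  \<comment> \<open>The index 0 is added because the test involves X_0; \<open>y\<close> selects it,
    and \<open>w'\<close> extends the coefficients by 0.\<close>
  define J' where "J' = insert 0 J"
  have J': "finite J'" using J by (simp add: J'_def)
  define y where "y j = (if j = 0 then 1 else 0 :: real)" for j :: 'a
  define w' where "w' j = (if j \<in> J then w j else 0)" for j
  let ?\<Psi> = "field_exponent \<kappa> J' (\<lambda>u s. g (u - s)) \<phi>"
  have comb: "(\<Sum>j\<in>J'. (a * y j + b * w' j) * g (j - s)) = a * g (- s) + b * G s" for a b s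
  proof -
    have "(\<Sum>j\<in>J'. (a * y j + b * w' j) * g (j - s)) = a * (\<Sum>j\<in>J'. y j * g (j - s)) + b * (\<Sum>j\<in>J'. w' j * g (j - s))"
      by (simp add: sum_distrib_left sum.distrib[symmetric] algebra_simps)
    also have "(\<Sum>j\<in>J'. y j * g (j - s)) = (\<Sum>j\<in>J'. if j = 0 then g (j - s) else 0)"
      by (rule sum.cong) (auto simp: y_def)
    also have "\<dots> = g (- s)" using J' by (simp add: J'_def)
    also have "(\<Sum>j\<in>J'. w' j * g (j - s)) = G s"
      unfolding G_def w'_def using J' by (intro sum.mono_neutral_cong_right) (auto simp: J'_def)
    finally show ?thesis .
  qed
  have \<Psi>: "?\<Psi> (\<lambda>j. a * y j + b * w' j) = complex_of_real \<kappa> * (CLINT s|lborel. \<phi> (a * g (- s) + b * G s))" for a b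
    unfolding field_exponent_def comb ..
  have int: "complex_integrable lborel (\<lambda>s. \<phi> (a * g (- s) + b * G s))" for a b
    using integrable_field[where f="\<lambda>u s. g (u - s)" and \<theta>="\<lambda>j. a * y j + b * w' j", OF J' translates \<phi>b] unfolding comb .
  have \<Psi>3: "?\<Psi> (\<lambda>j. \<xi> k * w' j) = complex_of_real \<kappa> * (CLINT s|lborel. \<phi> (\<xi> k * G s))"
    "?\<Psi> (\<lambda>j. z * y j + \<xi> k * w' j) = complex_of_real \<kappa> * (CLINT s|lborel. \<phi> (z * g (- s) + \<xi> k * G s))"
    "?\<Psi> (\<lambda>j. \<xi> k * w' j - z * y j) = complex_of_real \<kappa> * (CLINT s|lborel. \<phi> (\<xi> k * G s - z * g (- s)))" for k
    using \<Psi>[of 0 "\<xi> k"] \<Psi>[of z "\<xi> k"] \<Psi>[of "- z" "\<xi> k"] by simp_all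
  have i3: "complex_integrable lborel (\<lambda>s. \<phi> (\<xi> k * G s))" "complex_integrable lborel (\<lambda>s. \<phi> (z * g (- s) + \<xi> k * G s))"
    "complex_integrable lborel (\<lambda>s. \<phi> (\<xi> k * G s - z * g (- s)))" for k
    using int[of 0 "\<xi> k"] int[of z "\<xi> k"] int[of "- z" "\<xi> k"] by simp_all
  let ?I = "\<lambda>\<mu> s. LINT x|\<mu>. (1 - cos (z * g (- s) * x)) * r (G s * x)"
  let ?q = "\<lambda>s. \<beta> * (z * g (- s))\<^sup>2 * r 0"
  let ?T = "\<lambda>k s. p k * (2 * \<phi> (\<xi> k * G s) - \<phi> (z * g (- s) + \<xi> k * G s) - \<phi> (\<xi> k * G s - z * g (- s)))"
  have K: "integrable lborel (?I \<mu>)" "(LINT p|levy_kernel g z \<mu>. r (G (fst p) * snd p)) = (LINT s|lborel. ?I \<mu> s)"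
    if "kernel_integrable g \<mu>" for \<mu>
    using levy_kernel_integral[OF g_measurable that, of "\<lambda>p. r (G (fst p) * snd p)" B z] r by (simp_all add: abs_le_iff)
  have qi: "integrable lborel ?q"
  proof (cases "\<beta> = 0")
    case False
    then have "integrable lborel (\<lambda>s. (g s)\<^sup>2)" using \<beta> by simp
    then have "integrable lborel (\<lambda>s. (g (0 - s))\<^sup>2)" by (rule lborel_integrable_reflect(1)[THEN iffD2])
    then have "integrable lborel (\<lambda>s. \<beta> * z\<^sup>2 * r 0 * (g (- s))\<^sup>2)" by simp
    then show ?thesis by (simp add: power_mult_distrib mult_ac)
  qed simp
  have "(\<Sum>k<n. p k * (2 * ?\<Psi> (\<lambda>j. \<xi> k * w' j) - ?\<Psi> (\<lambda>j. z * y j + \<xi> k * w' j) - ?\<Psi> (\<lambda>j. \<xi> k * w' j - z * y j))) =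
    (\<Sum>k<n. complex_of_real \<kappa> * (CLINT s|lborel. ?T k s))"
  proof (rule sum.cong[OF refl])
    fix k
    have T: "(CLINT s|lborel. ?T k s) = p k * (2 * (CLINT s|lborel. \<phi> (\<xi> k * G s)) - (CLINT s|lborel. \<phi> (z * g (- s) + \<xi> k * G s))
        - (CLINT s|lborel. \<phi> (\<xi> k * G s - z * g (- s))))"
      using i3[of k] by simp
    have gen: "q * (2 * (r * A) - r * B - r * C) = r * (q * (2 * A - B - C))" for q r A B C :: complex
      by (simp add: algebra_simps)
    show "p k * (2 * ?\<Psi> (\<lambda>j. \<xi> k * w' j) - ?\<Psi> (\<lambda>j. z * y j + \<xi> k * w' j) - ?\<Psi> (\<lambda>j. \<xi> k * w' j - z * y j)) =
      complex_of_real \<kappa> * (CLINT s|lborel. ?T k s)"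
      unfolding \<Psi>3 gen T ..
  qed
  also have "\<dots> = complex_of_real \<kappa> * (CLINT s|lborel. \<Sum>k<n. ?T k s)"
    unfolding sum_distrib_left[symmetric]
    by (subst Bochner_Integration.integral_sum)
       (intro integrable_mult_right Bochner_Integration.integrable_diff i3 refl)+
  also have "(CLINT s|lborel. \<Sum>k<n. ?T k s) = (CLINT s|lborel. complex_of_real (?q s + 2 * ?I \<mu>1 s - 2 * ?I \<mu>2 s))"
    by (rule Bochner_Integration.integral_cong[OF refl])
       (rule levy_difference_trig_sum[OF l1 l2 R \<phi>])
  also have "\<dots> = complex_of_real (LINT s|lborel. ?q s + 2 * ?I \<mu>1 s - 2 * ?I \<mu>2 s)"
    by (rule integral_complex_of_real)
  also have "(LINT s|lborel. ?q s + 2 * ?I \<mu>1 s - 2 * ?I \<mu>2 s) =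
    (LINT s|lborel. ?q s) + 2 * (LINT s|lborel. ?I \<mu>1 s) - 2 * (LINT s|lborel. ?I \<mu>2 s)"
    using qi K(1)[OF k1] K(1)[OF k2] by simp
  finally have "0 \<le> \<kappa> * ((LINT s|lborel. ?q s) + 2 * (LINT s|lborel. ?I \<mu>1 s) - 2 * (LINT s|lborel. ?I \<mu>2 s))"
    using id_exponent_conditionally_positive[OF id[OF J'] R r(1), where z=z and y=y and w=w'] by simp
  then have "0 \<le> (LINT s|lborel. ?q s) + 2 * (LINT s|lborel. ?I \<mu>1 s) - 2 * (LINT s|lborel. ?I \<mu>2 s)"
    using \<kappa> by (simp add: zero_le_mult_iff)
  moreover have "(LINT s|lborel. ?q s) = \<beta> * z\<^sup>2 * (LINT s|lborel. (g (- s))\<^sup>2) * r 0"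
    by (simp add: power_mult_distrib mult.assoc[symmetric])
  ultimately show ?thesis
    unfolding G_def[symmetric] K(2)[OF k1] K(2)[OF k2] by (simp add: field_simps)
qed

text \<open>Bounded convergence on the finite measures \<open>levy_kernel\<close>, from
  trigonometric polynomials to h.\<close>

lemma kernel_inequality_finite:
  assumes h: "continuous_on UNIV h" "\<And>x. 0 \<le> h x" "\<And>x. h x \<le> B" and J: "finite J"
  shows "(LINT p|levy_kernel g z \<mu>2. h ((\<Sum>j\<in>J. w j * g (j - fst p)) * snd p)) \<le>
    (LINT p|levy_kernel g z \<mu>1. h ((\<Sum>j\<in>J. w j * g (j - fst p)) * snd p)) + \<beta> * z\<^sup>2 / 2 * (LINT s|lborel. (g (- s))\<^sup>2) * h 0"
proof -
  obtain R where R: "\<And>n. trig_poly (\<lambda>x. complex_of_real (R n x))" "\<And>n x. 0 \<le> R n x \<and> R n x \<le> B + 2"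
    "\<And>x. (\<lambda>n::nat. R n x) \<longlonglongrightarrow> h x"
    using continuous_limit_of_trig_polys[OF h] by blast
  let ?v = "\<lambda>p. (\<Sum>j\<in>J. w j * g (j - fst p)) * snd p"
  have lim: "(\<lambda>n. LINT p|levy_kernel g z \<mu>. R n (?v p)) \<longlonglongrightarrow> (LINT p|levy_kernel g z \<mu>. h (?v p))"
    if k: "kernel_integrable g \<mu>" for \<mu>
  proof -
    have l: "levy_measure \<mu>" using k by (simp add: kernel_integrable_def)
    interpret finite_measure "levy_kernel g z \<mu>" by (rule finite_measure_levy_kernel[OF g_measurable k])
    note [measurable_cong] = sets_levy_kernel[OF l, of g z]
    have Rm[measurable]: "R n \<in> borel_measurable borel" for n
    proof -
      obtain N :: nat and p \<xi> where "(\<lambda>x. complex_of_real (R n x)) = (\<lambda>x. \<Sum>k<N. p k * iexp (\<xi> k * x))"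
        using trig_poly_rep[OF R(1)[of n]] by blast
      then have "R n = (\<lambda>x. Re (\<Sum>k<N. p k * iexp (\<xi> k * x)))" by (metis Re_complex_of_real)
      also have "\<dots> \<in> borel_measurable borel" by measurable
      finally show ?thesis .
    qed
    have [measurable]: "h \<in> borel_measurable borel" by (rule borel_measurable_continuous_onI[OF h(1)])
    show ?thesis
    proof (rule integral_dominated_convergence[where w="\<lambda>_. B + 2"])
      show "AE p in levy_kernel g z \<mu>. norm (R n (?v p)) \<le> B + 2" for n
        using R(2) by (intro AE_I2) (simp add: abs_of_nonneg)
    qed (auto intro!: AE_I2 R(3))
  qed
  show ?thesis
  proof (rule LIMSEQ_le[OF lim[OF k2] tendsto_add[OF lim[OF k1] tendsto_mult[OF tendsto_const R(3)[of 0]]]])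
    have "(LINT p|levy_kernel g z \<mu>2. R n (?v p)) \<le>
      (LINT p|levy_kernel g z \<mu>1. R n (?v p)) + \<beta> * z\<^sup>2 / 2 * (LINT s|lborel. (g (- s))\<^sup>2) * R n 0" for n
    proof -
      obtain N :: nat and p \<xi> where rep: "(\<lambda>x. complex_of_real (R n x)) = (\<lambda>x. \<Sum>k<N. p k * iexp (\<xi> k * x))"
        using trig_poly_rep[OF R(1)[of n]] by blast
      show ?thesis
        by (rule kernel_inequality_trig[where p=p and \<xi>=\<xi> and n=N and B="B + 2"])
           (use fun_cong[OF rep] R(2) J in auto)
    qed
    then show "\<exists>N. \<forall>n\<ge>N. (LINT p|levy_kernel g z \<mu>2. R n (?v p)) \<le>
      (LINT p|levy_kernel g z \<mu>1. R n (?v p)) + \<beta> * z\<^sup>2 / 2 * (LINT s|lborel. (g (- s))\<^sup>2) * R n 0" by blast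
  qed
qed

text \<open>Bounded convergence in the choice of the linear form: in the limit the argument of h
  depends on the jump size alone.\<close>

lemma kernel_inequality:
  assumes h: "continuous_on UNIV h" "\<And>x. 0 \<le> h x" "\<And>x. h x \<le> B"
  shows "(LINT p|levy_kernel g z \<mu>2. h ((LINT u|lborel. g u) * snd p)) \<le>
    (LINT p|levy_kernel g z \<mu>1. h ((LINT u|lborel. g u) * snd p)) + \<beta> * z\<^sup>2 / 2 * (LINT s|lborel. (g (- s))\<^sup>2) * h 0"
proof -
  obtain J w where J: "\<And>n. finite (J n)"
    and AE: "AE s in lborel. (\<lambda>n::nat. \<Sum>v\<in>J n. w n v * g (v - s)) \<longlonglongrightarrow> (LINT u|lborel. g u)"
    using translates_converge_to_integral[OF g] by blast
  have hc: "isCont h x" for x using h(1) by (simp add: continuous_on_eq_continuous_at)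
  have [measurable]: "h \<in> borel_measurable borel" by (rule borel_measurable_continuous_onI[OF h(1)])
  have lim: "(\<lambda>n. LINT p|levy_kernel g z \<mu>. h ((\<Sum>j\<in>J n. w n j * g (j - fst p)) * snd p)) \<longlonglongrightarrow>
      (LINT p|levy_kernel g z \<mu>. h ((LINT u|lborel. g u) * snd p))" if k: "kernel_integrable g \<mu>" for \<mu>
  proof -
    have l: "levy_measure \<mu>" using k by (simp add: kernel_integrable_def)
    interpret finite_measure "levy_kernel g z \<mu>" by (rule finite_measure_levy_kernel[OF g_measurable k])
    note [measurable_cong] = sets_levy_kernel[OF l, of g z]
    show ?thesis
    proof (rule integral_dominated_convergence[where w="\<lambda>_. B"])
      show "AE p in levy_kernel g z \<mu>. norm (h ((\<Sum>j\<in>J n. w n j * g (j - fst p)) * snd p)) \<le> B" for n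
        using h by (intro AE_I2) (simp add: abs_of_nonneg)
      show "AE p in levy_kernel g z \<mu>. (\<lambda>n. h ((\<Sum>j\<in>J n. w n j * g (j - fst p)) * snd p)) \<longlonglongrightarrow> h ((LINT u|lborel. g u) * snd p)"
        using AE_levy_kernel_fst[OF g_measurable l AE]
      proof eventually_elim
        case (elim p)
        show ?case by (intro isCont_tendsto_compose[OF hc] tendsto_mult elim tendsto_const)
      qed
    qed auto
  qed
  show ?thesis
    by (rule LIMSEQ_le[OF lim[OF k2] tendsto_add[OF lim[OF k1] tendsto_const]])
       (use kernel_inequality_finite[OF h J] in blast)
qed

text \<open>Projected to the jump variable, the kernel inequality orders the two measures weighted
  by \<open>kernel_weight\<close>, for each frequency. The weights for 1 and \<open>sqrt 2\<close>
  add up to a finite function that is positive off 0, and integrating its inverse removes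
  it.\<close>

lemma jump_measures_ordered:
  assumes I: "(LINT u|lborel. g u) \<noteq> 0" and A: "A \<in> sets borel"
  shows "emeasure \<mu>2 A \<le> emeasure \<mu>1 A"
proof -
  let ?c = "LINT u|lborel. g u"
  have l1: "levy_measure \<mu>1" and l2: "levy_measure \<mu>2" using k1 k2 by (auto simp: kernel_integrable_def)
  have le0: "(\<integral>\<^sup>+x. kernel_weight g z x * indicator B x \<partial>\<mu>2) \<le> (\<integral>\<^sup>+x. kernel_weight g z x * indicator B x \<partial>\<mu>1)"
    if B[measurable]: "B \<in> sets borel" and B0: "0 \<notin> B" for z B
  proof -
    let ?m = "\<lambda>\<mu>. distr (levy_kernel g z \<mu>) borel (\<lambda>p. ?c * snd p)"
    \<comment> \<open>B is rescaled so that its preimage under the multiplication of the jump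
      variable by \<open>?c\<close> is the strip over B.\<close>
    let ?B = "(\<lambda>y. y / ?c) -` B"
    have B': "?B \<in> sets borel" using measurable_sets[of "\<lambda>y. y / ?c" borel borel B] by simp
    have meas: "(\<lambda>p. ?c * snd p) \<in> borel_measurable (levy_kernel g z \<mu>)" if "levy_measure \<mu>" for \<mu>
    proof -
      note [measurable_cong] = sets_levy_kernel[OF that, of g z]
      show ?thesis by measurable
    qed
    have fin: "finite_measure (?m \<mu>)" if "kernel_integrable g \<mu>" for \<mu>
      using finite_measure_levy_kernel[OF g_measurable that, of z] meas[of \<mu>] that
      by (intro finite_measure.finite_measure_distr) (auto simp: kernel_integrable_def)
    have "emeasure (?m \<mu>2) ?B \<le> emeasure (?m \<mu>1) ?B"
    proof (rule finite_measure_le_of_integral_le[OF fin[OF k1] fin[OF k2], where C="\<beta> * z\<^sup>2 / 2 * (LINT s|lborel. (g (- s))\<^sup>2)"])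
      fix h :: "real \<Rightarrow> real" and K assume h: "continuous_on UNIV h" "\<And>x. 0 \<le> h x" "\<And>x. h x \<le> K"
      have hm: "h \<in> borel_measurable borel" by (rule borel_measurable_continuous_onI[OF h(1)])
      show "(LINT x|?m \<mu>2. h x) \<le> (LINT x|?m \<mu>1. h x) + \<beta> * z\<^sup>2 / 2 * (LINT s|lborel. (g (- s))\<^sup>2) * h 0"
        unfolding integral_distr[OF meas[OF l2] hm] integral_distr[OF meas[OF l1] hm]
        by (rule kernel_inequality[OF h])
    qed (use B' B0 in simp_all)
    moreover have "emeasure (?m \<mu>) ?B = (\<integral>\<^sup>+x. kernel_weight g z x * indicator B x \<partial>\<mu>)" if l: "levy_measure \<mu>" for \<mu>
    proof -
      have "emeasure (?m \<mu>) ?B = emeasure (levy_kernel g z \<mu>) ((\<lambda>p. ?c * snd p) -` ?B \<inter> space (levy_kernel g z \<mu>))"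
        by (rule emeasure_distr[OF meas[OF l] B'])
      also have "(\<lambda>p. ?c * snd p) -` ?B \<inter> space (levy_kernel g z \<mu>) = UNIV \<times> B"
      proof -
        have "space (levy_kernel g z \<mu>) = UNIV"
          using sets_eq_imp_space_eq[OF sets_levy_kernel[OF l, of g z]] by (simp add: space_pair_measure)
        then show ?thesis using I by auto
      qed
      also have "emeasure (levy_kernel g z \<mu>) (UNIV \<times> B) = (\<integral>\<^sup>+x. kernel_weight g z x * indicator B x \<partial>\<mu>)"
        by (rule emeasure_levy_kernel_strip[OF g_measurable l B])
      finally show ?thesis .
    qed
    ultimately show ?thesis using l1 l2 by simp
  qed
  let ?H = "\<lambda>x. kernel_weight g 1 x + kernel_weight g (sqrt 2) x"
  have wm[measurable]: "kernel_weight g z \<in> borel_measurable borel" for z by (rule measurable_kernel_weight[OF g_measurable])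
  have Hfin: "?H x < \<infinity>" for x using kernel_weight_finite[OF g] by simp
  have Hpos: "0 < ?H x" if "x \<noteq> 0" for x using kernel_weight_pos[OF g I that] by (simp add: zero_less_iff_neq_zero)
  have H0: "?H 0 = 0" by (simp add: kernel_weight_def)
  note s1 = levy_measure_sets[OF l1] and s2 = levy_measure_sets[OF l2]
  note [measurable_cong] = s1 s2
  have emd: "emeasure (density \<mu> ?H) B = (\<integral>\<^sup>+x. kernel_weight g 1 x * indicator B x \<partial>\<mu>) + (\<integral>\<^sup>+x. kernel_weight g (sqrt 2) x * indicator B x \<partial>\<mu>)"
    if s: "sets \<mu> = sets borel" and B[measurable]: "B \<in> sets borel" for \<mu> B
  proof -
    note [measurable_cong] = s
    have "emeasure (density \<mu> ?H) B = (\<integral>\<^sup>+x. ?H x * indicator B x \<partial>\<mu>)"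
      by (rule emeasure_density) (use s B in auto)
    also have "\<dots> = (\<integral>\<^sup>+x. kernel_weight g 1 x * indicator B x + kernel_weight g (sqrt 2) x * indicator B x \<partial>\<mu>)"
      by (simp only: distrib_right)
    also have "\<dots> = (\<integral>\<^sup>+x. kernel_weight g 1 x * indicator B x \<partial>\<mu>) + (\<integral>\<^sup>+x. kernel_weight g (sqrt 2) x * indicator B x \<partial>\<mu>)"
      by (rule nn_integral_add) measurable
    finally show ?thesis .
  qed
  have "density \<mu>2 ?H \<le> density \<mu>1 ?H"
  proof (rule le_measure[THEN iffD2])
    show "sets (density \<mu>2 ?H) = sets (density \<mu>1 ?H)" using s1 s2 by simp
    show "\<forall>B\<in>sets (density \<mu>2 ?H). emeasure (density \<mu>2 ?H) B \<le> emeasure (density \<mu>1 ?H) B"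
    proof
      fix B assume "B \<in> sets (density \<mu>2 ?H)"
      then have B[measurable]: "B \<in> sets borel" using s2 by simp
      have "(\<integral>\<^sup>+x. kernel_weight g z x * indicator B x \<partial>\<mu>) = (\<integral>\<^sup>+x. kernel_weight g z x * indicator (B - {0}) x \<partial>\<mu>)" for z \<mu>
        by (intro nn_integral_cong) (auto simp: kernel_weight_def split: split_indicator)
      moreover have "B - {0} \<in> sets borel" by measurable
      ultimately show "emeasure (density \<mu>2 ?H) B \<le> emeasure (density \<mu>1 ?H) B"
        unfolding emd[OF s1 B] emd[OF s2 B] using le0[of "B - {0}"] by (simp add: add_mono)
    qed
  qed
  then have nle: "nn_integral (density \<mu>2 ?H) k \<le> nn_integral (density \<mu>1 ?H) k" for k
    using s1 s2 by (intro nn_integral_mono_measure) simp_all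
  let ?A = "A - {0}"
  have A'[measurable]: "?A \<in> sets borel" using A by measurable
  have inv: "(\<integral>\<^sup>+x. inverse (?H x) * indicator ?A x \<partial>density \<mu> ?H) = emeasure \<mu> ?A" if s: "sets \<mu> = sets borel" for \<mu>
  proof -
    note [measurable_cong] = s
    have "(\<integral>\<^sup>+x. inverse (?H x) * indicator ?A x \<partial>density \<mu> ?H) = (\<integral>\<^sup>+x. ?H x * (inverse (?H x) * indicator ?A x) \<partial>\<mu>)"
      by (rule nn_integral_density) measurable
    also have "\<dots> = (\<integral>\<^sup>+x. indicator ?A x \<partial>\<mu>)"
    proof (rule nn_integral_cong)
      fix x
      show "?H x * (inverse (?H x) * indicator ?A x) = indicator ?A x"
      proof (cases "x = 0")
        case False
        have "?H x * inverse (?H x) = 1" using ennreal_divide_self[of "?H x"] Hpos[OF False] Hfin[of x] by (simp only: divide_ennreal_def infinity_ennreal_def)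
        then show ?thesis by (simp add: mult.assoc[symmetric])
      qed simp
    qed
    also have "\<dots> = emeasure \<mu> ?A" using A' s by simp
    finally show ?thesis .
  qed
  have "emeasure \<mu>2 A \<le> emeasure \<mu>2 (?A \<union> {0})" by (rule emeasure_mono) (use A s2 in auto)
  also have "\<dots> \<le> emeasure \<mu>2 ?A + emeasure \<mu>2 {0}" by (rule emeasure_subadditive) (use A' s2 in auto)
  also have "\<dots> = emeasure \<mu>2 ?A" using levy_measure_emeasure_zero[OF l2] by simp
  also have "\<dots> \<le> emeasure \<mu>1 ?A" using nle[of "\<lambda>x. inverse (?H x) * indicator ?A x"] unfolding inv[OF s1] inv[OF s2] .
  also have "\<dots> \<le> emeasure \<mu>1 A" by (rule emeasure_mono) (use A s1 in auto)
  finally show ?thesis .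
qed

lemma id_exponent1_of_field:
  assumes I: "(LINT u|lborel. g u) \<noteq> 0" and \<beta>0: "0 \<le> \<beta>"
  shows "id_exponent1 \<phi>"
proof -
  have l1: "levy_measure \<mu>1" and l2: "levy_measure \<mu>2" using k1 k2 by (auto simp: kernel_integrable_def)
  obtain \<mu> where \<mu>: "levy_measure \<mu>" "\<And>\<theta>. levy_jump \<mu> \<theta> = levy_jump \<mu>1 \<theta> - levy_jump \<mu>2 \<theta>"
    using levy_jump_diff[OF l1 l2 jump_measures_ordered[OF I]] by blast
  have "\<phi> = (\<lambda>\<theta>. \<i> * complex_of_real (c * \<theta>) - complex_of_real (\<beta> * \<theta>\<^sup>2 / 2) + levy_jump \<mu> \<theta>)"
    by (rule ext) (simp add: \<phi> levy_difference_def \<mu>(2))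
  then show ?thesis using id_exponent1_levy_khintchine[OF \<mu>(1) \<beta>0, of c] by simp
qed

end

end

section \<open>Descent through the dilation differences\<close>

text \<open>This class of exponents, unlike that of the infinitely divisible ones, is closed under dilation differences.\<close>
definition signed_levy_exponent :: "('a::euclidean_space \<Rightarrow> real) \<Rightarrow> (real \<Rightarrow> complex) \<Rightarrow> bool" where
  "signed_levy_exponent g \<phi> \<longleftrightarrow> (\<exists>c \<beta> \<mu>1 \<mu>2. 0 \<le> \<beta> \<and> (\<beta> = 0 \<or> integrable lborel (\<lambda>s. (g s)\<^sup>2)) \<and>
     kernel_integrable g \<mu>1 \<and> kernel_integrable g \<mu>2 \<and> (\<forall>\<theta>. \<phi> \<theta> = levy_difference c \<beta> \<mu>1 \<mu>2 \<theta>))"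

lemma kernel_integrable_plus:
  fixes g :: "'a::euclidean_space \<Rightarrow> real"
  assumes [measurable]: "g \<in> borel_measurable borel" and \<mu>: "kernel_integrable g \<mu>" and \<nu>: "kernel_integrable g \<nu>"
  shows "kernel_integrable g (plus_measure \<mu> \<nu>)"
proof -
  have l: "levy_measure \<mu>" "levy_measure \<nu>" using \<mu> \<nu> by (auto simp: kernel_integrable_def)
  note [measurable_cong] = levy_measure_sets[OF l(1)] levy_measure_sets[OF l(2)]
  have s: "sets \<nu> = sets \<mu>" using l[THEN levy_measure_sets] by simp
  interpret A: sigma_finite_measure \<mu> by (rule levy_measure_sigma_finite[OF l(1)])
  interpret B: sigma_finite_measure \<nu> by (rule levy_measure_sigma_finite[OF l(2)])
  have "(\<integral>\<^sup>+s. \<integral>\<^sup>+x. ennreal (min 1 ((x * g s)\<^sup>2)) \<partial>plus_measure \<mu> \<nu> \<partial>lborel) =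
    (\<integral>\<^sup>+s. (\<integral>\<^sup>+x. ennreal (min 1 ((x * g s)\<^sup>2)) \<partial>\<mu>) + (\<integral>\<^sup>+x. ennreal (min 1 ((x * g s)\<^sup>2)) \<partial>\<nu>) \<partial>lborel)"
    by (intro nn_integral_cong nn_integral_plus_measure[OF s]) measurable
  also have "\<dots> = (\<integral>\<^sup>+s. \<integral>\<^sup>+x. ennreal (min 1 ((x * g s)\<^sup>2)) \<partial>\<mu> \<partial>lborel) + (\<integral>\<^sup>+s. \<integral>\<^sup>+x. ennreal (min 1 ((x * g s)\<^sup>2)) \<partial>\<nu> \<partial>lborel)"
    by (rule nn_integral_add) measurable
  also have "\<dots> < \<infinity>" using \<mu> \<nu> by (simp add: kernel_integrable_def)
  finally show ?thesis unfolding kernel_integrable_def using levy_measure_plus(1)[OF l] by simp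
qed

lemma kernel_integrable_dilation:
  fixes g :: "'a::euclidean_space \<Rightarrow> real"
  assumes \<mu>: "kernel_integrable g \<mu>" and q: "1 < q"
  shows "kernel_integrable g (distr \<mu> borel (\<lambda>x. x / q))"
proof -
  have l: "levy_measure \<mu>" using \<mu> by (simp add: kernel_integrable_def)
  note [measurable_cong] = levy_measure_sets[OF l]
  have "(\<integral>\<^sup>+s. \<integral>\<^sup>+x. ennreal (min 1 ((x * g s)\<^sup>2)) \<partial>distr \<mu> borel (\<lambda>x. x / q) \<partial>lborel) =
    (\<integral>\<^sup>+s. \<integral>\<^sup>+x. ennreal (min 1 ((x / q * g s)\<^sup>2)) \<partial>\<mu> \<partial>lborel)"
    by (intro nn_integral_cong nn_integral_distr) measurable
  also have "\<dots> \<le> (\<integral>\<^sup>+s. \<integral>\<^sup>+x. ennreal (min 1 ((x * g s)\<^sup>2)) \<partial>\<mu> \<partial>lborel)"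
  proof (intro nn_integral_mono ennreal_leI min_one_square_mono)
    fix s x
    have "\<bar>x / q\<bar> \<le> \<bar>x\<bar>" using q by (simp add: divide_le_eq mult_left_mono[of 1 q "\<bar>x\<bar>", simplified])
    then show "\<bar>x / q * g s\<bar> \<le> \<bar>x * g s\<bar>" unfolding abs_mult by (rule mult_right_mono) simp
  qed
  also have "\<dots> < \<infinity>" using \<mu> by (simp add: kernel_integrable_def)
  finally show ?thesis unfolding kernel_integrable_def using levy_measure_dilation(1)[OF l q] by simp
qed

text \<open>With D for the dilation by 1 / q, \<mu>1 - \<mu>2 - D (\<mu>1 - \<mu>2) = (\<mu>1 + D
  \<mu>2) - (\<mu>2 + D \<mu>1). The Gaussian coefficient is multiplied by 1 - 1 / q^2 and stays
  nonnegative.\<close>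

lemma signed_levy_exponent_dilation_diff:
  fixes g :: "'a::euclidean_space \<Rightarrow> real"
  assumes g: "g \<in> borel_measurable borel" and \<phi>: "signed_levy_exponent g \<phi>" and q: "1 < q"
  shows "signed_levy_exponent g (\<lambda>r. \<phi> r - \<phi> (r / q))"
proof -
  from \<phi> obtain c \<beta> \<mu>1 \<mu>2 where \<beta>: "0 \<le> \<beta>" "\<beta> = 0 \<or> integrable lborel (\<lambda>s. (g s)\<^sup>2)"
    and k1: "kernel_integrable g \<mu>1" and k2: "kernel_integrable g \<mu>2"
    and \<phi>: "\<And>\<theta>. \<phi> \<theta> = levy_difference c \<beta> \<mu>1 \<mu>2 \<theta>"
    unfolding signed_levy_exponent_def by blast
  have l1: "levy_measure \<mu>1" and l2: "levy_measure \<mu>2" using k1 k2 by (auto simp: kernel_integrable_def)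
  let ?D1 = "distr \<mu>1 borel (\<lambda>x. x / q)" and ?D2 = "distr \<mu>2 borel (\<lambda>x. x / q)"
  obtain d1 where d1: "\<And>\<theta>. levy_jump \<mu>1 (\<theta> / q) = levy_jump ?D1 \<theta> + \<i> * complex_of_real (d1 * \<theta>)"
    using levy_measure_dilation(2)[OF l1 q] by blast
  obtain d2 where d2: "\<And>\<theta>. levy_jump \<mu>2 (\<theta> / q) = levy_jump ?D2 \<theta> + \<i> * complex_of_real (d2 * \<theta>)"
    using levy_measure_dilation(2)[OF l2 q] by blast
  have P: "\<i> * complex_of_real (c * \<theta>) - complex_of_real (\<beta> * \<theta>\<^sup>2 / 2) - (\<i> * complex_of_real (c * (\<theta> / q)) - complex_of_real (\<beta> * (\<theta> / q)\<^sup>2 / 2))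
      - \<i> * complex_of_real (d1 * \<theta>) + \<i> * complex_of_real (d2 * \<theta>) =
    \<i> * complex_of_real ((c - c / q - d1 + d2) * \<theta>) - complex_of_real (\<beta> * (1 - 1 / q\<^sup>2) * \<theta>\<^sup>2 / 2)" for \<theta>
    by (simp add: complex_eq_iff power_divide algebra_simps diff_divide_distrib)
  have "\<phi> \<theta> - \<phi> (\<theta> / q) = levy_difference (c - c / q - d1 + d2) (\<beta> * (1 - 1 / q\<^sup>2)) (plus_measure \<mu>1 ?D2) (plus_measure \<mu>2 ?D1) \<theta>" for \<theta>
  proof -
    have alg: "(P0 + j1 - j2) - (P1 + (k1 + e1) - (k2 + e2)) = Q + (j1 + k2) - (j2 + k1)"
      if "P0 - P1 - e1 + e2 = Q" for P0 P1 j1 j2 k1 k2 e1 e2 Q :: complex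
      unfolding that[symmetric] by (simp add: algebra_simps)
    show ?thesis
      unfolding \<phi> levy_difference_def d1 d2
        levy_measure_plus(2)[OF l1 levy_measure_dilation(1)[OF l2 q]]
        levy_measure_plus(2)[OF l2 levy_measure_dilation(1)[OF l1 q]]
      by (rule alg[OF P])
  qed
  moreover have "kernel_integrable g (plus_measure \<mu>1 ?D2)" "kernel_integrable g (plus_measure \<mu>2 ?D1)"
    by (intro kernel_integrable_plus[OF g] kernel_integrable_dilation k1 k2 q)+
  moreover have "1 \<le> q\<^sup>2" using q by (simp add: one_le_power)
  then have "0 \<le> \<beta> * (1 - 1 / q\<^sup>2)" using \<beta>(1) q by (intro mult_nonneg_nonneg) (simp_all add: field_simps)
  moreover have "\<beta> * (1 - 1 / q\<^sup>2) = 0 \<or> integrable lborel (\<lambda>s. (g s)\<^sup>2)" using \<beta>(2) by auto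
  ultimately show ?thesis unfolding signed_levy_exponent_def by blast
qed

lemma levy_measure_null: "levy_measure (null_measure borel)" "levy_jump (null_measure borel) \<theta> = 0"
proof -
  show "levy_measure (null_measure borel)" by (simp add: levy_measure_def)
  have "AE x in null_measure borel. iexp (\<theta> * x) - 1 - \<i> * complex_of_real (\<theta> * tau1 x) = 0"
    by (rule AE_I[of _ _ UNIV]) simp_all
  then show "levy_jump (null_measure borel) \<theta> = 0" unfolding levy_jump_def by (rule integral_eq_zero_AE)
qed

context levy_triplet
begin

text \<open>Each summand of \<Phi> is integrable along g by itself: the jump term gives kernel
  integrability of \<rho>, and the Gaussian term makes g square integrable unless b = 0.\<close>

lemma signed_levy_exponent_lk:
  fixes g :: "'a::euclidean_space \<Rightarrow> real"
  assumes [measurable]: "g \<in> borel_measurable borel" and fin: "(\<integral>\<^sup>+s. \<Phi> \<bar>g s\<bar> \<partial>lborel) < \<infinity>"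
  shows "signed_levy_exponent g (lk_exponent \<gamma> b \<rho>)"
  unfolding signed_levy_exponent_def
proof (intro exI conjI allI)
  show "(0::real) \<le> b\<^sup>2" by simp
  show "kernel_integrable g \<rho>"
    unfolding kernel_integrable_def
  proof (intro conjI levy)
    have "(\<integral>\<^sup>+s. \<integral>\<^sup>+x. ennreal (min 1 ((x * g s)\<^sup>2)) \<partial>\<rho> \<partial>lborel) \<le> (\<integral>\<^sup>+s. \<Phi> \<bar>g s\<bar> \<partial>lborel)"
      unfolding Phi0_eq by (intro nn_integral_mono) (simp add: power_mult_distrib add_increasing)
    then show "(\<integral>\<^sup>+s. \<integral>\<^sup>+x. ennreal (min 1 ((x * g s)\<^sup>2)) \<partial>\<rho> \<partial>lborel) < \<infinity>" using fin by (rule le_less_trans)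
  qed
  show "kernel_integrable g (null_measure borel)"
    unfolding kernel_integrable_def by (simp add: levy_measure_null)
  show "b\<^sup>2 = 0 \<or> integrable lborel (\<lambda>s. (g s)\<^sup>2)"
  proof (cases "b = 0")
    case False
    have "(\<integral>\<^sup>+s. ennreal (norm (b\<^sup>2 * (g s)\<^sup>2)) \<partial>lborel) \<le> (\<integral>\<^sup>+s. \<Phi> \<bar>g s\<bar> \<partial>lborel)"
      unfolding Phi0_eq by (intro nn_integral_mono) (simp add: add_increasing add_increasing2)
    then have "(\<integral>\<^sup>+s. ennreal (norm (b\<^sup>2 * (g s)\<^sup>2)) \<partial>lborel) < \<infinity>" using fin by (rule le_less_trans)
    then have "integrable lborel (\<lambda>s. b\<^sup>2 * (g s)\<^sup>2)" by (intro integrableI_bounded) auto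
    then show ?thesis using False by simp
  qed simp
  show "lk_exponent \<gamma> b \<rho> \<theta> = levy_difference \<gamma> (b\<^sup>2) \<rho> (null_measure borel) \<theta>" for \<theta>
    by (simp add: lk_exponent_eq levy_difference_def levy_measure_null)
qed

text \<open>The positivity argument is applied to the dilation differences at each level. They
  belong to the signed class before anything is known about their infinite divisibility.\<close>

lemma urbanik_exponent1_of_field:
  fixes g :: "'a::euclidean_space \<Rightarrow> real"
  assumes g: "integrable lborel g" and I: "(LINT u|lborel. g u) \<noteq> 0"
    and tr: "\<And>u. Phi0_integrable (\<lambda>s. g (u - s))" and \<kappa>: "0 < \<kappa>"
    and "signed_levy_exponent g \<phi>" "Phi0_bounded \<phi>"
    and "\<And>J. finite J \<Longrightarrow> urbanik_exponent m J (field_exponent \<kappa> J (\<lambda>u s. g (u - s)) \<phi>)"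
  shows "urbanik_exponent m {()} (\<lambda>\<theta>. \<phi> (\<theta> ()))"
proof -
  have gm: "g \<in> borel_measurable borel" using g by auto
  have core: "id_exponent1 \<phi>" if sl: "signed_levy_exponent g \<phi>" and \<phi>b: "Phi0_bounded \<phi>"
    and id: "\<And>J. finite J \<Longrightarrow> id_exponent J (field_exponent \<kappa> J (\<lambda>u s. g (u - s)) \<phi>)" for \<phi>
  proof -
    from sl obtain c \<beta> \<mu>1 \<mu>2 where \<beta>: "0 \<le> \<beta>" "\<beta> = 0 \<or> integrable lborel (\<lambda>s. (g s)\<^sup>2)"
      and k: "kernel_integrable g \<mu>1" "kernel_integrable g \<mu>2"
      and \<phi>: "\<And>\<theta>. \<phi> \<theta> = levy_difference c \<beta> \<mu>1 \<mu>2 \<theta>"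
      unfolding signed_levy_exponent_def by blast
    show ?thesis by (rule id_exponent1_of_field[OF g tr \<phi>b \<phi> \<beta>(2) k \<kappa> id I \<beta>(1)])
  qed
  have eq: "dilation_diff q (\<lambda>\<theta>. \<phi> (\<theta> ())) = (\<lambda>\<theta>. \<phi> (\<theta> ()) - \<phi> (\<theta> () / q))" for q and \<phi> :: "real \<Rightarrow> complex"
    by (simp add: dilation_diff_def fun_eq_iff)
  have dd: "dilation_diff q (field_exponent \<kappa> J (\<lambda>u s. g (u - s)) \<phi>) = field_exponent \<kappa> J (\<lambda>u s. g (u - s)) (\<lambda>r. \<phi> r - \<phi> (r / q))"
    if "finite J" "Phi0_bounded \<phi>" for q J \<phi>
    by (rule dilation_diff_field_exponent[where f="\<lambda>u s. g (u - s)" and q=q, OF that(1) tr that(2)])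
  note sl = signed_levy_exponent_dilation_diff[OF gm]
  show ?thesis
    using assms(5-)
  proof (induction m arbitrary: \<phi>)
    case (0 \<phi>)
    show ?case
      unfolding urbanik_exponent.simps
    proof (intro allI impI)
      fix q :: real assume q: "1 < q"
      have "id_exponent1 (\<lambda>r. \<phi> r - \<phi> (r / q))"
      proof (rule core[OF sl[OF 0(1) q] Phi0_bounded_dilation_diff[OF 0(2) q]])
        fix J :: "'a set" assume J: "finite J"
        show "id_exponent J (field_exponent \<kappa> J (\<lambda>u s. g (u - s)) (\<lambda>r. \<phi> r - \<phi> (r / q)))"
          unfolding dd[OF J 0(2), symmetric] using 0(3)[OF J] q by simp
      qed
      then show "id_exponent {()} (dilation_diff q (\<lambda>\<theta>. \<phi> (\<theta> ())))" unfolding eq .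
    qed
  next
    case (Suc m \<phi>)
    show ?case
      unfolding urbanik_exponent.simps
    proof (intro allI impI)
      fix q :: real assume q: "1 < q"
      have *: "id_exponent J (field_exponent \<kappa> J (\<lambda>u s. g (u - s)) (\<lambda>r. \<phi> r - \<phi> (r / q)))"
        "urbanik_exponent m J (field_exponent \<kappa> J (\<lambda>u s. g (u - s)) (\<lambda>r. \<phi> r - \<phi> (r / q)))"
        if J: "finite J" for J :: "'a set"
        unfolding dd[OF J Suc.prems(2), symmetric] using Suc.prems(3)[OF J] q by simp_all
      have "id_exponent1 (\<lambda>r. \<phi> r - \<phi> (r / q))"
        by (rule core[OF sl[OF Suc.prems(1) q] Phi0_bounded_dilation_diff[OF Suc.prems(2) q] *(1)])
      moreover have "urbanik_exponent m {()} (\<lambda>\<theta>. \<phi> (\<theta> ()) - \<phi> (\<theta> () / q))"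
        by (rule Suc.IH[OF sl[OF Suc.prems(1) q] Phi0_bounded_dilation_diff[OF Suc.prems(2) q] *(2)])
      ultimately show "id_exponent {()} (dilation_diff q (\<lambda>\<theta>. \<phi> (\<theta> ()))) \<and> urbanik_exponent m {()} (dilation_diff q (\<lambda>\<theta>. \<phi> (\<theta> ())))"
        unfolding eq by simp
    qed
  qed
qed

end

section \<open>Recovering the exponent from one set, and the equivalence\<close>

context levy_basis
begin

lemma field_exponent_indicator:
  fixes A :: "'a set"
  assumes A: "A \<in> bdd_borel" and \<phi>: "\<phi> 0 = 0"
  shows "field_exponent \<kappa> {A} indicator \<phi> = (\<lambda>\<theta>. complex_of_real (\<kappa> * measure lborel A) * \<phi> (\<theta> A))"
proof
  fix \<theta> :: "'a set \<Rightarrow> real"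
  have [measurable]: "A \<in> sets borel" using A by (rule bdd_borel_sets)
  have "(CLINT s|lborel. \<phi> (\<Sum>B\<in>{A}. \<theta> B * indicator B s)) = (CLINT s|lborel. indicator A s *\<^sub>R \<phi> (\<theta> A))"
    by (intro Bochner_Integration.integral_cong refl) (simp add: \<phi> indicator_def del: sum_mult_indicator)
  also have "\<dots> = measure lborel A *\<^sub>R \<phi> (\<theta> A)"
    using bdd_borel_emeasure_finite[OF A] by (subst integral_scaleR_left) (auto intro: integrable_real_indicator)
  finally show "field_exponent \<kappa> {A} indicator \<phi> \<theta> = complex_of_real (\<kappa> * measure lborel A) * \<phi> (\<theta> A)"
    unfolding field_exponent_def by (simp add: scaleR_conv_of_real mult.assoc)
qed

text \<open>On one set of positive volume the field exponent is a positive multiple of \<phi>, which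
  can be scaled away at every level.\<close>

lemma urbanik_exponent1_of_indicator:
  fixes A :: "'a set"
  assumes A: "A \<in> bdd_borel" "0 < measure lborel A" and "Phi0_bounded \<phi>"
    and "urbanik_exponent m {A} (field_exponent \<kappa> {A} indicator \<phi>)"
  shows "urbanik_exponent m {()} (\<lambda>\<theta>. \<phi> (\<theta> ()))"
proof -
  have core: "id_exponent1 \<phi>" if "Phi0_bounded \<phi>" "id_exponent {A} (field_exponent \<kappa> {A} indicator \<phi>)" for \<phi>
  proof -
    let ?k = "\<kappa> * measure lborel A"
    have k: "0 < ?k" using A(2) kappa_pos by simp
    have eq: "complex_of_real (1 / ?k) * (complex_of_real ?k * z) = z" for z
      using k by (simp only: mult.assoc[symmetric] of_real_mult[symmetric]) auto
    from id_exponent_scale[OF that(2), of "1 / ?k"] k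
    have "id_exponent {A} (\<lambda>\<theta>. \<phi> (\<theta> A))"
      unfolding field_exponent_indicator[where \<phi>=\<phi>, OF A(1) Phi0_bounded_0[OF that(1)]] eq by simp
    from id_exponent_linear_image[OF this, of "{()}" "\<lambda>_. 1"] show ?thesis by simp
  qed
  have eq: "dilation_diff q (\<lambda>\<theta>. \<phi> (\<theta> ())) = (\<lambda>\<theta>. \<phi> (\<theta> ()) - \<phi> (\<theta> () / q))" for q and \<phi> :: "real \<Rightarrow> complex"
    by (simp add: dilation_diff_def fun_eq_iff)
  have dd: "dilation_diff q (field_exponent \<kappa> {A} indicator \<phi>) = field_exponent \<kappa> {A} indicator (\<lambda>r. \<phi> r - \<phi> (r / q))"
    if "Phi0_bounded \<phi>" for \<phi> q
    using that A(1) by (intro dilation_diff_field_exponent) (auto intro: Phi0_integrable_indicator)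
  show ?thesis
    using assms(3-)
  proof (induction m arbitrary: \<phi>)
    case (0 \<phi>)
    then show ?case by (auto simp: eq dd intro!: core[of "\<lambda>r. \<phi> r - \<phi> (r / _)"] Phi0_bounded_dilation_diff)
  next
    case (Suc m \<phi>)
    show ?case
      unfolding urbanik_exponent.simps eq
    proof (intro allI impI conjI)
      fix q :: real assume q: "1 < q"
      have *: "id_exponent {A} (field_exponent \<kappa> {A} indicator (\<lambda>r. \<phi> r - \<phi> (r / q)))"
        "urbanik_exponent m {A} (field_exponent \<kappa> {A} indicator (\<lambda>r. \<phi> r - \<phi> (r / q)))"
        using Suc.prems(2) q by (simp_all add: dd[OF Suc.prems(1)])
      note b = Phi0_bounded_dilation_diff[OF Suc.prems(1) q]
      show "id_exponent {()} (\<lambda>\<theta>. \<phi> (\<theta> ()) - \<phi> (\<theta> () / q))" by (rule core[OF b *(1)])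
      show "urbanik_exponent m {()} (\<lambda>\<theta>. \<phi> (\<theta> ()) - \<phi> (\<theta> () / q))" by (rule Suc.IH[OF b *(2)])
    qed
  qed
qed

end

theorem theorem4p12:
  fixes M :: "'w measure"
    and L :: "'a::euclidean_space set \<Rightarrow> 'w \<Rightarrow> real"
    and \<gamma> b \<kappa> :: real and \<rho> :: "real measure"
    and g :: "'a \<Rightarrow> real"
    and X :: "'a \<Rightarrow> 'w \<Rightarrow> real"
  assumes "hom_levy_basis M L \<gamma> b \<rho> \<kappa>"
    and "integrable lborel g"
    and "in_L_Phi0 \<gamma> b \<rho> \<kappa> g"
    and "\<forall>\<xi>. fourier_transform g \<xi> \<noteq> 0"
    and "\<forall>u. stoch_integral M L (\<lambda>s. g (u - s)) (X u)"
  shows "law_in_urbanik m M UNIV X \<longleftrightarrow> law_in_urbanik m M bdd_borel L"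
proof -
  interpret prob_space M using assms(1) by (simp add: hom_levy_basis_def)
  interpret levy_basis \<gamma> b \<rho> M L \<kappa>
    using assms(1) by unfold_locales (simp_all add: hom_levy_basis_def)
  have gm[measurable]: "g \<in> borel_measurable borel" using assms(2) by auto
  have fin: "(\<integral>\<^sup>+s. \<Phi> \<bar>g s\<bar> \<partial>lborel) < \<infinity>"
    using assms(3) kappa_pos unfolding in_L_Phi0_def by (auto simp: ennreal_mult_less_top)
  \<comment> \<open>Lebesgue measure is invariant under s |-> u - s, so every kernel of the field
    inherits the integrability of g.\<close>
  have tr: "Phi0_integrable (\<lambda>s. g (u - s))" for u
    using fin lborel_nn_integral_reflect[of "\<lambda>s. \<Phi> \<bar>g s\<bar>" u] unfolding Phi0_integrable_def by simp
  have "fourier_transform g 0 = complex_of_real (LINT s|lborel. g s)"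
    by (simp add: fourier_transform_def)
  then have I: "(LINT s|lborel. g s) \<noteq> 0" using assms(4) by (metis of_real_0)
  have X: "stoch_integral M L (\<lambda>s. g (u - s)) (X u)" for u using assms(5) by simp
  have lawX: "law_in_urbanik m M UNIV X \<longleftrightarrow>
    (\<forall>J. finite J \<longrightarrow> J \<subseteq> UNIV \<longrightarrow> urbanik_exponent m J (field_exponent \<kappa> J (\<lambda>u s. g (u - s)) \<psi>))"
    by (rule law_in_urbanik_iff) (use charf_fidi_stoch_integral[where f="\<lambda>u s. g (u - s)" and X=X] X tr in auto)
  have lawL: "law_in_urbanik m M bdd_borel L \<longleftrightarrow>
    (\<forall>J :: 'a set set. finite J \<longrightarrow> J \<subseteq> bdd_borel \<longrightarrow> urbanik_exponent m J (field_exponent \<kappa> J indicator \<psi>))"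
    by (rule law_in_urbanik_iff) (use charf_fidi_L Phi0_integrable_indicator in auto)
  note \<psi>b = Phi0_bounded_lk_exponent
  show ?thesis
  proof
    assume "law_in_urbanik m M UNIV X"
    then have "urbanik_exponent m J (field_exponent \<kappa> J (\<lambda>u s. g (u - s)) \<psi>)" if "finite J" for J :: "'a set"
      using that unfolding lawX by simp
    then have "urbanik_exponent m {()} (\<lambda>\<theta>. \<psi> (\<theta> ()))"
      by (rule urbanik_exponent1_of_field[OF assms(2) I tr kappa_pos signed_levy_exponent_lk[OF gm fin] \<psi>b])
    then show "law_in_urbanik m M bdd_borel L"
      unfolding lawL using kappa_pos Phi0_integrable_indicator
      by (auto intro!: urbanik_exponent_field[OF _ _ _ \<psi>b])
  next
    assume L: "law_in_urbanik m M bdd_borel L"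
    \<comment> \<open>The unit cube, as a bounded Borel set of positive volume.\<close>
    let ?A = "cbox 0 One :: 'a set"
    have A: "?A \<in> bdd_borel" "0 < measure lborel ?A" by (simp_all add: bdd_borel_def)
    then have "urbanik_exponent m {?A} (field_exponent \<kappa> {?A} indicator \<psi>)" using L unfolding lawL by simp
    then have "urbanik_exponent m {()} (\<lambda>\<theta>. \<psi> (\<theta> ()))"
      by (rule urbanik_exponent1_of_indicator[OF A \<psi>b])
    then show "law_in_urbanik m M UNIV X"
      unfolding lawX using kappa_pos tr by (auto intro!: urbanik_exponent_field[OF _ _ _ \<psi>b])
  qed
qed

end
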